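(* Let $X$ be a $d$-dimensional Brownian motion with initial value $X_0$ and let $f\in H^1(\mathbb{R}^d)$. Suppose that $X_0$ has a bounded Lebesgue density or that $d=1$. Let $\widehat{\Gamma}^*=\mathbb{E}[\Gamma_T(f)\mid\mathcal{G}_n]$. Then $$\lim_{n\to\infty}\Big(\Delta_n^{-1}\big\|\Gamma_T(f)-\widehat{\Gamma}^*\big\|_{L^2(\mathbb{P})}\Big)=\mathbb{E}\Big[\frac{1}{12}\int_0^T|\nabla f(X_t)|^2\,dt\Big]^{1/2}.$$
   Context: Fix $T>0$. A Brownian motion $X$ with initial value $X_0$ means $X_t=X_0+W_t$, $0\le t\le T$, with $W$ a standard $d$-dimensional Brownian motion and $X_0$ independent of $W$. For $n\in\mathbb{N}$ put $\Delta_n=T/n$, $t_k=k\Delta_n$, and let $\mathcal{G}_n=\sigma(X_{t_k}:0\le k\le n)$ be the sigma field generated by the discrete observations. For a real-valued function $f$, $\Gamma_T(f)=\int_0^T f(X_r)\,dr$. The estimator $\widehat{\Gamma}^*=\mathbb{E}[\Gamma_T(f)\mid\mathcal{G}_n]$ attains the minimal $L^2(\mathbb{P})$-error $\inf_{\widehat\Gamma}\|\Gamma_T(f)-\widehat\Gamma\|_{L^2(\mathbb{P})}$ over all square-integrable $\mathcal{G}_n$-measurable estimators $\widehat\Gamma$. $H^1(\mathbb{R}^d)=\{f:\|f\|_{L^2}+\|f\|_{H^1}<\infty\}$ with $\|f\|_{H^1}^2=\int_{\mathbb{R}^d}|\mathcal{F}f(u)|^2|u|^{2}\,du$, $\mathcal{F}f(u)=\int_{\mathbb{R}^d}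 f(x)e^{i\langle u,x\rangle}dx$ (extended to $L^2$). $\nabla f$ is the weak gradient. *)

theory Defs
  imports "HOL-Probability.Probability"
begin

text \<open>
  The dimension is \<open>DIM('a)\<close>. The law \<open>N(0, (t - s) I)\<close> of an increment is given by its
  density, a product of one-dimensional normal densities (parametrised by standard deviation)
  over the orthonormal basis. Paths are continuous for every \<open>\<omega>\<close>, not just almost surely, so
  that path integrals are measurable without assuming \<open>M\<close> to be complete.
\<close>

definition standard_brownian_motion ::
    "'w measure \<Rightarrow> real \<Rightarrow> (real \<Rightarrow> 'w \<Rightarrow> 'a::euclidean_space) \<Rightarrow> bool" where
  "standard_brownian_motion M T W \<longleftrightarrow>
     (\<forall>t\<in>{0..T}. W t \<in> borel_measurable M) \<and>
     (\<forall>\<omega>\<in>space M. W 0 \<omega> = 0) \<and>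
     (\<forall>\<omega>\<in>space M. continuous_on {0..T} (\<lambda>t. W t \<omega>)) \<and>
     (\<forall>s t. 0 \<le> s \<and> s < t \<and> t \<le> T \<longrightarrow>
        distributed M lborel (\<lambda>\<omega>. W t \<omega> - W s \<omega>)
          (\<lambda>x. ennreal (\<Prod>b\<in>Basis. normal_density 0 (sqrt (t - s)) (x \<bullet> b)))) \<and>
     (\<forall>(m::nat) (\<tau>::nat \<Rightarrow> real).
        (\<forall>i\<le>m. \<tau> i \<in> {0..T}) \<and> (\<forall>i<m. \<tau> i \<le> \<tau> (Suc i)) \<longrightarrow>
        prob_space.indep_vars M (\<lambda>_. borel) (\<lambda>i \<omega>. W (\<tau> (Suc i)) \<omega> - W (\<tau> i) \<omega>) {..<m})"

definition brownian_motion ::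
    "'w measure \<Rightarrow> real \<Rightarrow> (real \<Rightarrow> 'w \<Rightarrow> 'a::euclidean_space) \<Rightarrow> bool" where
  "brownian_motion M T X \<longleftrightarrow>
     X 0 \<in> borel_measurable M \<and>
     (\<exists>W. standard_brownian_motion M T W \<and>
        prob_space.indep_set M
          (sets (vimage_algebra (space M) (X 0) borel))
          (sets (vimage_algebra (space M) (\<lambda>\<omega>. \<lambda>t\<in>{0..T}. W t \<omega>)
            (\<Pi>\<^sub>M t\<in>{0..T}. borel))) \<and>
        (\<forall>t\<in>{0..T}. \<forall>\<omega>\<in>space M. X t \<omega> = X 0 \<omega> + W t \<omega>))"

definition has_bounded_density :: "'w measure \<Rightarrow> ('w \<Rightarrow> 'a::euclidean_space) \<Rightarrow> bool" where
  "has_bounded_density M Y \<longleftrightarrow>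
     (\<exists>p C. distributed M lborel Y p \<and> (AE x in lborel. p x \<le> ennreal C))"

definition occupation_time ::
    "real \<Rightarrow> (real \<Rightarrow> 'w \<Rightarrow> 'a) \<Rightarrow> ('a \<Rightarrow> real) \<Rightarrow> 'w \<Rightarrow> real" where
  "occupation_time T X f \<omega> = (LINT r:{0..T}|lborel. f (X r \<omega>))"

definition observation_algebra ::
    "'w measure \<Rightarrow> real \<Rightarrow> nat \<Rightarrow> (real \<Rightarrow> 'w \<Rightarrow> 'a::euclidean_space) \<Rightarrow> 'w measure" where
  "observation_algebra M T n X =
     sigma (space M)
       (\<Union>k\<le>n. {X (real k * (T / real n)) -` A \<inter> space M | A. A \<in> sets borel})"

definition L2_norm :: "'w measure \<Rightarrow> ('w \<Rightarrow> real) \<Rightarrow> real" where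
  "L2_norm M Y = sqrt (LINT \<omega>|M. (Y \<omega>)\<^sup>2)"

text \<open>Elements of \<open>L\<^sup>2\<close> are represented by Borel functions.\<close>

definition square_integrable :: "('a::euclidean_space \<Rightarrow> real) \<Rightarrow> bool" where
  "square_integrable f \<longleftrightarrow> f \<in> borel_measurable borel \<and> integrable lborel (\<lambda>x. (f x)\<^sup>2)"

definition fourier :: "('a::euclidean_space \<Rightarrow> real) \<Rightarrow> 'a \<Rightarrow> complex" where
  "fourier f u = (LINT x|lborel. complex_of_real (f x) * exp (\<i> * complex_of_real (u \<bullet> x)))"

text \<open>
  \<open>fourier_L2 f g\<close>: a version of the Fourier transform of \<open>f\<close> is \<open>g\<close>, for the continuous
  extension of \<^const>\<open>fourier\<close> from \<open>L\<^sup>1 \<inter> L\<^sup>2\<close> to \<open>L\<^sup>2\<close>.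
\<close>

definition fourier_L2 :: "('a::euclidean_space \<Rightarrow> real) \<Rightarrow> ('a \<Rightarrow> complex) \<Rightarrow> bool" where
  "fourier_L2 f g \<longleftrightarrow>
     g \<in> borel_measurable borel \<and>
     (\<exists>h::nat \<Rightarrow> 'a \<Rightarrow> real.
        (\<forall>n. integrable lborel (h n) \<and> square_integrable (h n)) \<and>
        (\<lambda>n. \<integral>\<^sup>+x. ennreal ((h n x - f x)\<^sup>2) \<partial>lborel) \<longlonglongrightarrow> 0 \<and>
        (\<lambda>n. \<integral>\<^sup>+u. ennreal ((cmod (fourier (h n) u - g u))\<^sup>2) \<partial>lborel) \<longlonglongrightarrow> 0)"

definition sobolev_H1 :: "('a::euclidean_space \<Rightarrow> real) set" where
  "sobolev_H1 =
     {f. square_integrable f \<and>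
         (\<exists>g. fourier_L2 f g \<and>
              (\<integral>\<^sup>+u. ennreal ((cmod (g u))\<^sup>2 * (norm u)\<^sup>2) \<partial>lborel) < \<infinity>)}"

primrec k_times_C :: "nat \<Rightarrow> ('a::euclidean_space \<Rightarrow> real) \<Rightarrow> bool" where
  "k_times_C 0 \<phi> \<longleftrightarrow> continuous_on UNIV \<phi>"
| "k_times_C (Suc k) \<phi> \<longleftrightarrow>
     (\<forall>x. \<phi> differentiable (at x)) \<and>
     (\<forall>b\<in>Basis. k_times_C k (\<lambda>x. frechet_derivative \<phi> (at x) b))"

definition test_function :: "('a::euclidean_space \<Rightarrow> real) \<Rightarrow> bool" where
  "test_function \<phi> \<longleftrightarrow> (\<forall>k. k_times_C k \<phi>) \<and> compact (closure {x. \<phi> x \<noteq> 0})"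

definition is_weak_gradient :: "('a::euclidean_space \<Rightarrow> real) \<Rightarrow> ('a \<Rightarrow> 'a) \<Rightarrow> bool" where
  "is_weak_gradient f g \<longleftrightarrow>
     g \<in> borel_measurable borel \<and>
     (\<forall>K. compact K \<longrightarrow> set_integrable lborel K g) \<and>
     (\<forall>\<phi>. test_function \<phi> \<longrightarrow> (\<forall>b\<in>Basis.
        (LINT x|lborel. f x * frechet_derivative \<phi> (at x) b) =
        - (LINT x|lborel. (g x \<bullet> b) * \<phi> x)))"

text \<open>For \<open>f\<close> in \<open>H\<^sup>1\<close> a weak gradient exists and is unique up to null sets.\<close>

definition weak_gradient :: "('a::euclidean_space \<Rightarrow> real) \<Rightarrow> 'a \<Rightarrow> 'a" where
  "weak_gradient f = (SOME g. is_weak_gradient f g)"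

end

theory Submission imports Defs begin

text \<open>
  Write \<open>\<Delta> = T/n\<close> and \<open>t\<^sub>k = k\<Delta>\<close>. On an observation interval with \<open>k \<ge> 1\<close> the function is expanded
  to first order,
  \<open>f(X\<^sub>r) = f(X\<^sub>t\<^sub>k) + \<nabla>f(X\<^sub>t\<^sub>k) \<bullet> (X\<^sub>r - X\<^sub>t\<^sub>k) + remainder\<close>. Up to quantities that are functions of the
  observations, the linear term is \<open>\<nabla>f(X\<^sub>t\<^sub>k)\<close> applied to
  \<open>X\<^sub>r - X\<^sub>t\<^sub>k - 1/2 (X\<^sub>t\<^sub>k\<^sub>+\<^sub>1 - X\<^sub>t\<^sub>k)\<close>. Its time integral over the interval changes sign in law when the
  increments inside the interval are reversed while the observations are kept, so its
  conditional expectation given the observations vanishes. These integrals are orthogonal for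
  different \<open>k\<close>, and the \<open>k\<close>-th one has second moment \<open>\<Delta>\<^sup>3/12 E|\<nabla>f(X\<^sub>t\<^sub>k)|\<^sup>2\<close>. Hence the squared norm
  of their sum is \<open>\<Delta>\<^sup>2\<close> times a Riemann sum for \<open>1/12 E \<integral>|\<nabla>f(X\<^sub>t)|\<^sup>2 dt\<close>, which gives the limit
  (\<open>bridge_integral_cond_zero\<close>, \<open>bridge_integral_orthogonal\<close>, \<open>bridge_integral_properties\<close>,
  \<open>riemann_sum\<close>).

  Everything else is \<open>o(\<Delta>)\<close> in \<open>L\<^sup>2\<close>. Conditional expectation is an \<open>L\<^sup>2\<close>-contraction, so a
  perturbation \<open>R\<close> of the occupation time moves the \<open>L\<^sup>2\<close>-error by at most \<open>2\<parallel>R\<parallel>\<close>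
  (\<open>cond_exp_error_near\<close>). The Taylor remainder is made orthogonal over different intervals by
  subtracting its conditional mean given \<open>X\<^sub>t\<^sub>k\<close>, which is a function of the observations. Its
  second moment is controlled by two facts. First, the law of \<open>X\<^sub>t\<close> has density at most \<open>C t\<^sup>-\<^sup>1\<^sup>/\<^sup>2\<close>,
  either because \<open>d = 1\<close> or because the initial density is bounded (\<open>density_bound\<close>); this replaces
  \<open>L\<^sup>2(P)\<close> by \<open>L\<^sup>2\<close> of Lebesgue measure at the price of an integrable singularity at time \<open>0\<close>.
  Secondly, the mean of \<open>\<parallel>f(\<cdot> + y) - f - \<nabla>f \<bullet> y\<parallel>\<^sup>2\<close> over a centred Gaussian \<open>y\<close> with covariance
  \<open>\<sigma>\<^sup>2 I\<close> is \<open>o(\<sigma>\<^sup>2)\<close> (\<open>sobolev_weak_gradient\<close>). On the first interval \<open>\<nabla>f(X\<^sub>0)\<close> need not be square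
  integrable; there \<open>f(X\<^sub>r)\<close> is compared with \<open>f(X\<^sub>\<Delta>)\<close>.

  On the analytic side, the difference quotients of \<open>f\<close> converge in \<open>L\<^sup>2\<close> because their Fourier
  multipliers do, and the limit is a weak gradient; du Bois-Reymond's lemma identifies it with
  the chosen one up to a null set. The Gaussian bound comes from the multiplier
  \<open>e\<^sup>i\<^sup>s - 1 - i s\<close>, \<open>s = - u \<bullet> y\<close>, of the Taylor defect and dominated convergence. An inequality in
  Plancherel's theorem, up to a constant, is enough for both.
\<close>

section \<open>Square masses, completeness and translations\<close>

text \<open>An extended nonnegative squared \<open>L\<^sup>2\<close>-norm: completeness arguments and Fubini then need no
  integrability side conditions.\<close>

definition sq_mass :: "'b measure \<Rightarrow> ('b \<Rightarrow> 'c::real_normed_vector) \<Rightarrow> ennreal" where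
  "sq_mass N f = (\<integral>\<^sup>+x. ennreal ((norm (f x))\<^sup>2) \<partial>N)"

lemma sq_mass_real: "sq_mass N (f :: _ \<Rightarrow> real) = (\<integral>\<^sup>+x. ennreal ((f x)\<^sup>2) \<partial>N)"
  by (simp add: sq_mass_def)

lemma norm_add_square_le: "(norm (a + b))\<^sup>2 \<le> 2 * (norm a)\<^sup>2 + 2 * (norm (b::'c::real_normed_vector))\<^sup>2"
proof -
  have "(norm (a + b))\<^sup>2 \<le> (norm a + norm b)\<^sup>2"
    by (intro power_mono norm_triangle_ineq) auto
  also have "\<dots> \<le> 2 * (norm a)\<^sup>2 + 2 * (norm b)\<^sup>2"
    using zero_le_power2[of "norm a - norm b"] by (simp add: power2_eq_square algebra_simps)
  finally show ?thesis .
qed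

lemma sq_mass_add_le:
  fixes f g :: "'b \<Rightarrow> 'c::euclidean_space"
  assumes [measurable]: "f \<in> borel_measurable N" "g \<in> borel_measurable N"
  shows "sq_mass N (\<lambda>x. f x + g x) \<le> 2 * sq_mass N f + 2 * sq_mass N g"
proof -
  have "sq_mass N (\<lambda>x. f x + g x)
      \<le> (\<integral>\<^sup>+x. 2 * ennreal ((norm (f x))\<^sup>2) + 2 * ennreal ((norm (g x))\<^sup>2) \<partial>N)"
    unfolding sq_mass_def
    by (intro nn_integral_mono, simp flip: ennreal_mult'' ennreal_plus
        add: norm_add_square_le ennreal_mult''[symmetric] flip: ennreal_numeral)
  also have "\<dots> = 2 * sq_mass N f + 2 * sq_mass N g"
    by (simp add: sq_mass_def nn_integral_add nn_integral_cmult)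
  finally show ?thesis .
qed

lemma sq_mass_diff_commute: "sq_mass N (\<lambda>x. f x - g x) = sq_mass N (\<lambda>x. g x - f x)"
  by (simp add: sq_mass_def norm_minus_commute)

lemma sq_mass_triangle:
  fixes f g h :: "'b \<Rightarrow> 'c::euclidean_space"
  assumes "f \<in> borel_measurable N" "g \<in> borel_measurable N" "h \<in> borel_measurable N"
  shows "sq_mass N (\<lambda>x. f x - h x)
    \<le> 2 * sq_mass N (\<lambda>x. f x - g x) + 2 * sq_mass N (\<lambda>x. g x - h x)"
  using sq_mass_add_le[of "\<lambda>x. f x - g x" N "\<lambda>x. g x - h x"] assms by simp

lemma nn_integral_translate:
  fixes h :: "'a::euclidean_space \<Rightarrow> ennreal"
  assumes [measurable]: "h \<in> borel_measurable borel"
  shows "(\<integral>\<^sup>+x. h (x + z) \<partial>lborel) = (\<integral>\<^sup>+x. h x \<partial>lborel)"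
proof -
  have "(\<integral>\<^sup>+x. h x \<partial>lborel) = (\<integral>\<^sup>+x. h x \<partial>distr lborel borel ((+) z))"
    by (simp add: lborel_distr_plus)
  also have "\<dots> = (\<integral>\<^sup>+x. h (z + x) \<partial>lborel)"
    by (subst nn_integral_distr) auto
  finally show ?thesis by (simp add: add.commute)
qed

lemma integral_translate:
  fixes h :: "'a::euclidean_space \<Rightarrow> 'b::{banach, second_countable_topology}"
  assumes [measurable]: "h \<in> borel_measurable borel"
  shows "(\<integral>x. h (x + z) \<partial>lborel) = (\<integral>x. h x \<partial>lborel)"
proof -
  have "(\<integral>x. h x \<partial>lborel) = (\<integral>x. h x \<partial>distr lborel borel ((+) z))"
    by (simp add: lborel_distr_plus)
  also have "\<dots> = (\<integral>x. h (z + x) \<partial>lborel)"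
    by (subst integral_distr) auto
  finally show ?thesis by (simp add: add.commute)
qed

lemma integrable_translate:
  fixes h :: "'a::euclidean_space \<Rightarrow> 'b::{banach, second_countable_topology}"
  assumes "integrable lborel h"
  shows "integrable lborel (\<lambda>x. h (x + z))"
proof -
  have [measurable]: "h \<in> borel_measurable borel" using assms by auto
  have "integrable (distr lborel borel ((+) z)) h"
    using assms by (simp add: lborel_distr_plus)
  then have "integrable lborel (\<lambda>x. h (z + x))"
    by (subst (asm) integrable_distr_eq) auto
  then show ?thesis by (simp add: add.commute)
qed

lemma sq_mass_translate:
  fixes f :: "'a::euclidean_space \<Rightarrow> 'b::euclidean_space"
  assumes [measurable]: "f \<in> borel_measurable borel"
  shows "sq_mass lborel (\<lambda>x. f (x + z)) = sq_mass lborel f"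
  unfolding sq_mass_def
  using nn_integral_translate[of "\<lambda>x. ennreal ((norm (f x))\<^sup>2)"] by simp

lemma ennreal_tendsto_0I:
  fixes F :: "'b \<Rightarrow> ennreal"
  assumes "\<And>e::real. e > 0 \<Longrightarrow> eventually (\<lambda>n. F n \<le> ennreal e) A"
  shows "(F \<longlongrightarrow> 0) A"
proof (rule order_tendstoI)
  fix a :: ennreal assume "0 < a"
  obtain e where e: "0 < e" "ennreal e < a"
  proof (cases a)
    case (real r)
    then show thesis using \<open>0 < a\<close> that[of "r/2"] by (simp add: ennreal_less_iff)
  next
    case top
    then show thesis using that[of 1] by simp
  qed
  show "eventually (\<lambda>n. F n < a) A"
    using assms[OF e(1)] by eventually_elim (use e(2) in \<open>auto intro: le_less_trans\<close>)
qed auto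

lemma ennreal_tendsto_0D:
  fixes F :: "'b \<Rightarrow> ennreal"
  assumes "(F \<longlongrightarrow> 0) A" "(e::real) > 0"
  shows "eventually (\<lambda>n. F n \<le> ennreal e) A"
  using order_tendstoD(2)[OF assms(1), of "ennreal e"] assms(2)
  by (auto elim: eventually_mono)

lemma ennreal_tendsto_0_bound:
  fixes F G :: "'b \<Rightarrow> ennreal"
  assumes "(G \<longlongrightarrow> 0) A" "eventually (\<lambda>n. F n \<le> G n) A"
  shows "(F \<longlongrightarrow> 0) A"
  by (rule tendsto_sandwich[OF _ assms(2) tendsto_const assms(1)]) auto

lemma ennreal_tendsto_0_cmult:
  fixes F :: "'b \<Rightarrow> ennreal"
  assumes "(F \<longlongrightarrow> 0) A" "c < \<infinity>"
  shows "((\<lambda>n. c * F n) \<longlongrightarrow> 0) A"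
  using ennreal_tendsto_cmult[of c F 0 A, OF _ assms(1)] assms(2) by auto

lemma ennreal_tendsto_0_add:
  fixes F G :: "'b \<Rightarrow> ennreal"
  assumes "(F \<longlongrightarrow> 0) A" "(G \<longlongrightarrow> 0) A"
  shows "((\<lambda>n. F n + G n) \<longlongrightarrow> 0) A"
  using tendsto_add[OF assms] by simp

text \<open>The Riesz--Fischer theorem: a rapidly convergent subsequence converges almost everywhere,
  and Fatou's lemma turns this into convergence of the whole sequence in square mean.\<close>

lemma L2_complete:
  fixes q :: "nat \<Rightarrow> 'b \<Rightarrow> real"
  assumes [measurable]: "\<And>n. q n \<in> borel_measurable N"
    and cauchy: "\<And>e::real. e > 0 \<Longrightarrow> \<exists>n0. \<forall>m\<ge>n0. \<forall>n\<ge>n0. sq_mass N (\<lambda>x. q m x - q n x) \<le> ennreal e"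
  obtains G where "G \<in> borel_measurable N" "(\<lambda>n. sq_mass N (\<lambda>x. q n x - G x)) \<longlonglongrightarrow> 0"
proof -
  have "\<exists>n0. \<forall>m\<ge>n0. \<forall>n\<ge>n0. sq_mass N (\<lambda>x. q m x - q n x) \<le> ennreal ((1/4)^k)" for k
    by (rule cauchy) simp
  then obtain r0 where r0: "\<And>k m n. m \<ge> r0 k \<Longrightarrow> n \<ge> r0 k \<Longrightarrow>
      sq_mass N (\<lambda>x. q m x - q n x) \<le> ennreal ((1/4)^k)"
    by metis
  \<comment> \<open>A monotone subsequence whose consecutive square distances are at most \<open>4\<^sup>-\<^sup>k\<close>.\<close>
  define r where "r k = (\<Sum>i\<le>k. r0 i) + k" for k
  have r_ge: "r k \<ge> r0 k" "r k \<ge> k" "r (Suc k) \<ge> r k" for k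
    unfolding r_def by (auto intro: trans_le_add1 member_le_sum)
  define d where "d k x = q (r (Suc k)) x - q (r k) x" for k x
  have [measurable]: "d k \<in> borel_measurable N" for k unfolding d_def by simp
  have d: "sq_mass N (d k) \<le> ennreal ((1/4)^k)" for k
    unfolding d_def using r_ge[of k] r_ge[of "Suc k"] by (intro r0) linarith+
  \<comment> \<open>The weights \<open>2\<^sup>k\<close> leave a convergent series and still give summability of the increments, since \<open>2|d| \<le> 2\<^sup>-\<^sup>k + 2\<^sup>k d\<^sup>2\<close>.\<close>
  have "(\<integral>\<^sup>+x. (\<Sum>k. ennreal (2^k * (d k x)\<^sup>2)) \<partial>N) = (\<Sum>k. \<integral>\<^sup>+x. ennreal (2^k * (d k x)\<^sup>2) \<partial>N)"
    by (rule nn_integral_suminf) simp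
  also have "\<dots> = (\<Sum>k. ennreal (2^k) * sq_mass N (d k))"
    by (simp add: sq_mass_real ennreal_mult nn_integral_cmult)
  also have "\<dots> \<le> (\<Sum>k. ennreal ((1/2)^k))"
  proof (intro suminf_le)
    fix k
    have "ennreal (2^k) * sq_mass N (d k) \<le> ennreal (2^k) * ennreal ((1/4)^k)"
      by (intro mult_left_mono d) auto
    also have "\<dots> = ennreal ((1/2)^k)"
      by (simp add: ennreal_mult[symmetric] power_mult_distrib[symmetric])
    finally show "ennreal (2^k) * sq_mass N (d k) \<le> ennreal ((1/2)^k)" .
  qed auto
  also have "\<dots> < \<infinity>"
    by (subst suminf_ennreal2) (auto simp: ennreal_less_top)
  finally have fin: "(\<integral>\<^sup>+x. (\<Sum>k. ennreal (2^k * (d k x)\<^sup>2)) \<partial>N) < \<infinity>" .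
  have "AE x in N. (\<Sum>k. ennreal (2^k * (d k x)\<^sup>2)) \<noteq> \<infinity>"
    using fin by (intro nn_integral_PInf_AE) auto
  then have conv: "AE x in N. convergent (\<lambda>k. q (r k) x)"
  proof eventually_elim
    case (elim x)
    have s2: "summable (\<lambda>k. 2^k * (d k x)\<^sup>2)"
      by (rule summable_suminf_not_top) (simp, use elim in \<open>simp only: infinity_ennreal_def not_False_eq_True\<close>)
    have "summable (\<lambda>k. (1/2)^k + 2^k * (d k x)\<^sup>2)"
      by (intro summable_add s2) auto
    then have "summable (\<lambda>k. d k x)"
    proof (rule summable_comparison_test'[where N=0])
      fix k :: nat
      have pq: "(2::real)^k * (1/2)^k = 1" by (simp add: power_mult_distrib[symmetric])
      have "0 \<le> (1 - 2^k * \<bar>d k x\<bar>)\<^sup>2 * (1/2)^k" by simp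
      also have "\<dots> = (1/2)^k - 2 * \<bar>d k x\<bar> * (2^k * (1/2)^k) + 2^k * \<bar>d k x\<bar>\<^sup>2 * (2^k * (1/2)^k)"
        by (simp only: power2_eq_square) (simp only: algebra_simps mult_1)
      also have "\<dots> = (1/2)^k - 2 * \<bar>d k x\<bar> + 2^k * (d k x)\<^sup>2"
        unfolding pq by simp
      finally have "2 * \<bar>d k x\<bar> \<le> (1/2)^k + 2^k * (d k x)\<^sup>2" by linarith
      then show "norm (d k x) \<le> (1/2)^k + 2^k * (d k x)\<^sup>2"
        unfolding real_norm_def by linarith
    qed
    then have "convergent (\<lambda>n. \<Sum>k<n. d k x)" by (simp add: summable_iff_convergent)
    moreover have "(\<Sum>k<n. d k x) = q (r n) x - q (r 0) x" for n
      unfolding d_def by (rule sum_lessThan_telescope)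
    ultimately have "convergent (\<lambda>n. q (r n) x - q (r 0) x)" by simp
    then show ?case by (simp add: convergent_diff_const_right_iff)
  qed
  define G where "G x = lim (\<lambda>k. q (r k) x)" for x
  have Gm[measurable]: "G \<in> borel_measurable N" unfolding G_def by simp
  have lim: "(\<lambda>n. sq_mass N (\<lambda>x. q n x - G x)) \<longlonglongrightarrow> 0"
  proof (rule ennreal_tendsto_0I)
    fix e :: real assume "e > 0"
    then obtain n0 where n0: "\<And>m n. m \<ge> n0 \<Longrightarrow> n \<ge> n0 \<Longrightarrow> sq_mass N (\<lambda>x. q n x - q m x) \<le> ennreal e"
      using cauchy by meson
    have "sq_mass N (\<lambda>x. q n x - G x) \<le> ennreal e" if "n \<ge> n0" for n
    proof -
      have "sq_mass N (\<lambda>x. q n x - G x) =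
          (\<integral>\<^sup>+x. liminf (\<lambda>k. ennreal ((q n x - q (r k) x)\<^sup>2)) \<partial>N)"
        unfolding sq_mass_real
      proof (rule nn_integral_cong_AE)
        show "AE x in N. ennreal ((q n x - G x)\<^sup>2) = liminf (\<lambda>k. ennreal ((q n x - q (r k) x)\<^sup>2))"
          using conv
        proof eventually_elim
          case (elim x)
          then have "(\<lambda>k. q (r k) x) \<longlonglongrightarrow> G x" by (simp add: G_def convergent_LIMSEQ_iff)
          then have "(\<lambda>k. ennreal ((q n x - q (r k) x)\<^sup>2)) \<longlonglongrightarrow> ennreal ((q n x - G x)\<^sup>2)"
            by (intro tendsto_intros) auto
          then show ?case by (rule lim_imp_Liminf[OF sequentially_bot, symmetric])
        qed
      qed
      also have "\<dots> \<le> liminf (\<lambda>k. \<integral>\<^sup>+x. ennreal ((q n x - q (r k) x)\<^sup>2) \<partial>N)"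
        by (rule nn_integral_liminf) simp
      also have "\<dots> = liminf (\<lambda>k. sq_mass N (\<lambda>x. q n x - q (r k) x))"
        by (simp add: sq_mass_real)
      also have "\<dots> \<le> ennreal e"
      proof (rule Liminf_le)
        show "\<forall>\<^sub>F k in sequentially. sq_mass N (\<lambda>x. q n x - q (r k) x) \<le> ennreal e"
          using eventually_ge_at_top[of n0]
        proof eventually_elim
          case (elim k)
          show ?case using n0[of "r k" n] r_ge(2)[of k] that elim by linarith
        qed
      qed simp
      finally show ?thesis .
    qed
    then show "\<forall>\<^sub>F n in sequentially. sq_mass N (\<lambda>x. q n x - G x) \<le> ennreal e"
      by (auto simp: eventually_sequentially)
  qed
  show thesis using that[OF Gm lim] .
qed

text \<open>The positive part of \<open>1\<^sub>U(x) - 1\<^sub>U(x + z)\<close> lives on \<open>U\<close>, where dominated convergence applies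
  because \<open>U\<close> is open. The negative part has the same integral by translation invariance.\<close>

lemma L1_translation_continuous_open:
  fixes U :: "'a::euclidean_space set"
  assumes "open U" "emeasure lborel U < \<infinity>" and z: "z \<longlonglongrightarrow> 0"
  shows "(\<lambda>n. \<integral>\<^sup>+x. ennreal \<bar>indicator U (x + z n) - indicator U x :: real\<bar> \<partial>lborel) \<longlonglongrightarrow> 0"
proof -
  have [measurable]: "U \<in> sets borel" using assms(1) by auto
  let ?p = "\<lambda>n x. max 0 (indicator U x - indicator U (x + z n)) :: real"
  have int: "integrable lborel (\<lambda>x. indicator U x :: real)"
    using assms by (intro integrable_real_indicator) auto
  have intz: "integrable lborel (\<lambda>x. indicator U (x + z n) :: real)" for n
    using integrable_translate[OF int] .
  have intp: "integrable lborel (?p n)" for n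
    by (intro integrable_max) (use int intz in auto)
  have eq: "(\<integral>\<^sup>+x. ennreal \<bar>indicator U (x + z n) - indicator U x :: real\<bar> \<partial>lborel)
     = ennreal (2 * (\<integral>x. ?p n x \<partial>lborel))" for n
  proof -
    have "(\<integral>\<^sup>+x. ennreal \<bar>indicator U (x + z n) - indicator U x :: real\<bar> \<partial>lborel)
      = ennreal (\<integral>x. \<bar>indicator U (x + z n) - indicator U x :: real\<bar> \<partial>lborel)"
      using int intz by (intro nn_integral_eq_integral) auto
    also have "(\<integral>x. \<bar>indicator U (x + z n) - indicator U x :: real\<bar> \<partial>lborel)
       = (\<integral>x. 2 * ?p n x + indicator U (x + z n) - indicator U x \<partial>lborel)"
      by (intro Bochner_Integration.integral_cong) (auto simp: indicator_def)
    also have "\<dots> = 2 * (\<integral>x. ?p n x \<partial>lborel) + (\<integral>x. indicator U (x + z n) \<partial>lborel) - (\<integral>x. indicator U x \<partial>lborel)"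
      using int intz intp by (subst Bochner_Integration.integral_diff Bochner_Integration.integral_add; simp)+
    also have "\<dots> = 2 * (\<integral>x. ?p n x \<partial>lborel)"
      using integral_translate[of "\<lambda>x. indicator U x :: real" "z n"] by simp
    finally show ?thesis .
  qed
  have "(\<lambda>n. \<integral>x. ?p n x \<partial>lborel) \<longlonglongrightarrow> (\<integral>x. 0 \<partial>(lborel :: 'a measure))"
  proof (rule integral_dominated_convergence[where w="\<lambda>x. indicator U x :: real"])
    show "AE x in lborel. (\<lambda>n. ?p n x) \<longlonglongrightarrow> 0"
    proof (rule AE_I2)
      fix x :: 'a
      show "(\<lambda>n. ?p n x) \<longlonglongrightarrow> 0"
      proof (cases "x \<in> U")
        case True
        have "(\<lambda>n. x + z n) \<longlonglongrightarrow> x + 0" by (intro tendsto_intros z)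
        then have "eventually (\<lambda>n. x + z n \<in> U) sequentially"
          using topological_tendstoD[OF _ assms(1)] True by simp
        then have "eventually (\<lambda>n. ?p n x = 0) sequentially"
          by eventually_elim (auto simp: indicator_def)
        then show ?thesis by (rule tendsto_eventually)
      qed (auto simp: indicator_def)
    qed
  qed (use int in \<open>auto simp: indicator_def\<close>)
  then have "(\<lambda>n. ennreal (2 * (\<integral>x. ?p n x \<partial>lborel))) \<longlonglongrightarrow> ennreal (2 * 0)"
    by (intro tendsto_intros) simp_all
  then show ?thesis by (simp add: eq)
qed

text \<open>Translation of a function is uniformly stable under \<open>L\<^sup>1\<close>-perturbations; this is what carries
  continuity of translations from a dense class to all integrable functions.\<close>

lemma L1_translation_perturb:
  fixes h s :: "'a::euclidean_space \<Rightarrow> 'b::{banach, second_countable_topology}"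
  assumes [measurable]: "h \<in> borel_measurable borel" "s \<in> borel_measurable borel"
  shows "(\<integral>\<^sup>+x. ennreal (norm (h (x + z) - h x)) \<partial>lborel)
    \<le> (\<integral>\<^sup>+x. ennreal (norm (s (x + z) - s x)) \<partial>lborel) + 2 * (\<integral>\<^sup>+x. ennreal (norm (h x - s x)) \<partial>lborel)"
proof -
  have "(\<integral>\<^sup>+x. ennreal (norm (h (x + z) - h x)) \<partial>lborel)
    \<le> (\<integral>\<^sup>+x. ennreal (norm (s (x + z) - s x)) + (ennreal (norm (h (x + z) - s (x + z))) + ennreal (norm (h x - s x))) \<partial>lborel)"
  proof (rule nn_integral_mono)
    fix x
    have "h (x + z) - h x = (s (x + z) - s x) + ((h (x + z) - s (x + z)) + (s x - h x))" by simp
    then have "norm (h (x + z) - h x) \<le> norm (s (x + z) - s x) + (norm (h (x + z) - s (x + z)) + norm (h x - s x))"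
      by (smt (verit) norm_triangle_ineq norm_minus_commute)
    then show "ennreal (norm (h (x + z) - h x)) \<le> ennreal (norm (s (x + z) - s x))
        + (ennreal (norm (h (x + z) - s (x + z))) + ennreal (norm (h x - s x)))"
      by (simp flip: ennreal_plus)
  qed
  also have "\<dots> = (\<integral>\<^sup>+x. ennreal (norm (s (x + z) - s x)) \<partial>lborel) + 2 * (\<integral>\<^sup>+x. ennreal (norm (h x - s x)) \<partial>lborel)"
    using nn_integral_translate[of "\<lambda>x. ennreal (norm (h x - s x))" z]
    by (simp add: nn_integral_add mult_2)
  finally show ?thesis .
qed

text \<open>Outer regularity reduces indicators of Borel sets to open sets, and the induction principle
  for integrable functions does the rest.\<close>

lemma L1_translation_continuous:
  fixes h :: "'a::euclidean_space \<Rightarrow> real"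
  assumes "integrable lborel h" and z: "z \<longlonglongrightarrow> 0"
  shows "(\<lambda>n. \<integral>\<^sup>+x. ennreal (norm (h (x + z n) - h x)) \<partial>lborel) \<longlonglongrightarrow> 0"
  using assms(1)
proof (induction rule: integrable_induct)
  case (base A c)
  have A[measurable]: "A \<in> sets borel" using base by simp
  have "(\<lambda>n. \<integral>\<^sup>+x. ennreal (norm (indicator A (x + z n) - indicator A x :: real)) \<partial>lborel) \<longlonglongrightarrow> 0"
  proof (rule ennreal_tendsto_0I)
    fix e :: real assume e: "e > 0"
    obtain U where U: "open U" "A \<subseteq> U" "emeasure lborel (U - A) < ennreal (e/4)"
      by (rule outer_regular_lborel[OF A, of "e/4"]) (use e in simp)
    have [measurable]: "U \<in> sets borel" using U by auto
    have "emeasure lborel U \<le> emeasure lborel A + emeasure lborel (U - A)"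
      using emeasure_subadditive[of A lborel "U - A"] U(2) by (simp add: Un_absorb1)
    also have "\<dots> < \<infinity>" using base(2) U(3) by (auto simp: less_top[symmetric] ennreal_less_top intro: less_trans)
    finally have Uf: "emeasure lborel U < \<infinity>" .
    have "\<forall>\<^sub>F n in sequentially. (\<integral>\<^sup>+x. ennreal \<bar>indicator U (x + z n) - indicator U x :: real\<bar> \<partial>lborel) \<le> ennreal (e/2)"
      by (rule ennreal_tendsto_0D[OF L1_translation_continuous_open[OF U(1) Uf z]]) (use e in auto)
    then show "\<forall>\<^sub>F n in sequentially. (\<integral>\<^sup>+x. ennreal (norm (indicator A (x + z n) - indicator A x :: real)) \<partial>lborel) \<le> ennreal e"
    proof eventually_elim
      case (elim n)
      have "(\<integral>\<^sup>+x. ennreal (norm (indicator A x - indicator U x :: real)) \<partial>lborel) = (\<integral>\<^sup>+x. indicator (U - A) x \<partial>lborel)"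
        using U(2) by (intro nn_integral_cong) (auto simp: indicator_def)
      also have "\<dots> \<le> ennreal (e/4)" using U(3) by simp
      finally have 1: "(\<integral>\<^sup>+x. ennreal (norm (indicator A x - indicator U x :: real)) \<partial>lborel) \<le> ennreal (e/4)" .
      have "(\<integral>\<^sup>+x. ennreal (norm (indicator A (x + z n) - indicator A x :: real)) \<partial>lborel)
        \<le> (\<integral>\<^sup>+x. ennreal (norm (indicator U (x + z n) - indicator U x :: real)) \<partial>lborel)
          + 2 * (\<integral>\<^sup>+x. ennreal (norm (indicator A x - indicator U x :: real)) \<partial>lborel)"
        by (rule L1_translation_perturb) simp_all
      also have "\<dots> \<le> ennreal (e/2) + 2 * ennreal (e/4)"
        using elim 1 by (intro add_mono mult_left_mono) auto
      also have "\<dots> = ennreal e"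
        using e by (simp add: mult_2 flip: ennreal_plus)
      finally show ?case by simp
    qed
  qed
  then have "(\<lambda>n. ennreal (norm c) * (\<integral>\<^sup>+x. ennreal (norm (indicator A (x + z n) - indicator A x :: real)) \<partial>lborel)) \<longlonglongrightarrow> 0"
    by (rule ennreal_tendsto_0_cmult) simp
  then show ?case
    by (simp add: nn_integral_cmult[symmetric] ennreal_mult[symmetric] abs_mult[symmetric] algebra_simps)
next
  case (add f g)
  have [measurable]: "f \<in> borel_measurable borel" "g \<in> borel_measurable borel" using add by auto
  show ?case
  proof (rule ennreal_tendsto_0_bound[OF ennreal_tendsto_0_add[OF add.IH(1,2)]], rule always_eventually, rule allI)
    fix n
    show "(\<integral>\<^sup>+x. ennreal (norm (f (x + z n) + g (x + z n) - (f x + g x))) \<partial>lborel)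
      \<le> (\<integral>\<^sup>+x. ennreal (norm (f (x + z n) - f x)) \<partial>lborel) + (\<integral>\<^sup>+x. ennreal (norm (g (x + z n) - g x)) \<partial>lborel)"
      by (subst nn_integral_add[symmetric]) (auto intro!: nn_integral_mono ennreal_leI simp: simp flip: ennreal_plus)
  qed
next
  case (lim f s)
  have [measurable]: "f \<in> borel_measurable borel" "\<And>i. s i \<in> borel_measurable borel"
    using lim.hyps by auto
  have "(\<lambda>i. \<integral>\<^sup>+x. ennreal (norm (f x - s i x)) \<partial>lborel) \<longlonglongrightarrow> (\<integral>\<^sup>+x. 0 \<partial>(lborel :: 'a measure))"
  proof (rule nn_integral_dominated_convergence[where w="\<lambda>x. ennreal (3 * norm (f x))"])
    show "(\<integral>\<^sup>+x. ennreal (3 * norm (f x)) \<partial>lborel) < \<infinity>"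
      using lim.hyps(4) by (simp add: integrable_iff_bounded ennreal_mult nn_integral_cmult ennreal_mult_less_top)
    show "AE x in lborel. ennreal (norm (f x - s i x)) \<le> ennreal (3 * norm (f x))" for i
    proof (intro AE_I2 ennreal_leI)
      fix x
      have "norm (f x - s i x) \<le> norm (f x) + norm (s i x)" by (rule norm_triangle_ineq4)
      moreover have "norm (s i x) \<le> 2 * norm (f x)" by (rule lim.hyps(3)) simp
      ultimately show "norm (f x - s i x) \<le> 3 * norm (f x)" by linarith
    qed
    have "(\<lambda>i. norm (f x - s i x)) \<longlonglongrightarrow> 0" for x
      using tendsto_norm[OF tendsto_diff[OF tendsto_const[of "f x"] lim.hyps(2)[of x]]] by simp
    then show "AE x in lborel. (\<lambda>i. ennreal (norm (f x - s i x))) \<longlonglongrightarrow> 0"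
      by (intro AE_I2) (subst ennreal_0[symmetric], intro tendsto_ennrealI)
  qed auto
  then have L: "(\<lambda>i. \<integral>\<^sup>+x. ennreal (norm (f x - s i x)) \<partial>lborel) \<longlonglongrightarrow> 0" by simp
  show ?case
  proof (rule ennreal_tendsto_0I)
    fix e :: real assume e: "e > 0"
    have "\<forall>\<^sub>F i in sequentially. (\<integral>\<^sup>+x. ennreal (norm (f x - s i x)) \<partial>lborel) \<le> ennreal (e/4)"
      by (rule ennreal_tendsto_0D[OF L]) (use e in auto)
    then obtain i where i: "(\<integral>\<^sup>+x. ennreal (norm (f x - s i x)) \<partial>lborel) \<le> ennreal (e/4)"
      by (meson eventually_happens' sequentially_bot)
    have "\<forall>\<^sub>F n in sequentially. (\<integral>\<^sup>+x. ennreal (norm (s i (x + z n) - s i x)) \<partial>lborel) \<le> ennreal (e/2)"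
      by (rule ennreal_tendsto_0D[OF lim.IH]) (use e in auto)
    then show "\<forall>\<^sub>F n in sequentially. (\<integral>\<^sup>+x. ennreal (norm (f (x + z n) - f x)) \<partial>lborel) \<le> ennreal e"
    proof eventually_elim
      case (elim n)
      have "(\<integral>\<^sup>+x. ennreal (norm (f (x + z n) - f x)) \<partial>lborel)
        \<le> (\<integral>\<^sup>+x. ennreal (norm (s i (x + z n) - s i x)) \<partial>lborel) + 2 * (\<integral>\<^sup>+x. ennreal (norm (f x - s i x)) \<partial>lborel)"
        by (rule L1_translation_perturb) simp_all
      also have "\<dots> \<le> ennreal (e/2) + 2 * ennreal (e/4)"
        using elim i by (intro add_mono mult_left_mono) auto
      also have "\<dots> = ennreal e"
        using e by (simp add: mult_2 flip: ennreal_plus)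
      finally show ?case by simp
    qed
  qed
qed

lemma square_integrable_iff_sq_mass:
  "square_integrable h \<longleftrightarrow> h \<in> borel_measurable borel \<and> sq_mass lborel h < \<infinity>"
  unfolding square_integrable_def sq_mass_real
  by (auto simp: integrable_iff_bounded)

text \<open>Reduction to \<open>L\<^sup>1\<close>: the function \<open>h|h|\<close> is integrable and \<open>(a - b)\<^sup>2 \<le> 2 |a|a| - b|b||\<close>.\<close>

lemma L2_translation_continuous:
  fixes h :: "'a::euclidean_space \<Rightarrow> real"
  assumes "square_integrable h" and z: "z \<longlonglongrightarrow> 0"
  shows "(\<lambda>n. sq_mass lborel (\<lambda>x. h (x + z n) - h x)) \<longlonglongrightarrow> 0"
proof -
  have [measurable]: "h \<in> borel_measurable borel" using assms by (simp add: square_integrable_def)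
  \<comment> \<open>The sign keeps \<open>h|h|\<close> injective in \<open>h\<close>; the square alone would not control \<open>h\<close>.\<close>
  let ?k = "\<lambda>x. h x * \<bar>h x\<bar>"
  have "integrable lborel ?k"
    using assms(1) unfolding square_integrable_def
    by (elim conjE Bochner_Integration.integrable_bound) (auto simp: abs_mult power2_eq_square)
  then have "(\<lambda>n. 2 * (\<integral>\<^sup>+x. ennreal (norm (?k (x + z n) - ?k x)) \<partial>lborel)) \<longlonglongrightarrow> 0"
    by (intro ennreal_tendsto_0_cmult L1_translation_continuous z) auto
  then show ?thesis
  proof (rule ennreal_tendsto_0_bound, intro always_eventually allI)
    fix n
    have nn: "(a - b)\<^sup>2 \<le> \<bar>a * a - b * b\<bar>" if "0 \<le> a" "0 \<le> b" for a b :: real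
    proof -
      have "(a - b)\<^sup>2 = \<bar>a - b\<bar> * \<bar>a - b\<bar>" by (simp add: power2_eq_square)
      also have "\<dots> \<le> \<bar>a - b\<bar> * (a + b)" using that by (intro mult_left_mono) auto
      also have "\<dots> = \<bar>(a - b) * (a + b)\<bar>" using that by (simp add: abs_mult)
      also have "(a - b) * (a + b) = a * a - b * b" by (simp add: algebra_simps)
      finally show ?thesis .
    qed
    have opp: "(a - b)\<^sup>2 \<le> 2 * (a * a + b * b)" for a b :: real
      using zero_le_power2[of "a + b"] by (simp add: power2_eq_square algebra_simps)
    have ineq: "(a - b)\<^sup>2 \<le> 2 * \<bar>a * \<bar>a\<bar> - b * \<bar>b\<bar>\<bar>" for a b :: real
    proof -
      \<comment> \<open>Equal signs: \<open>|a - b| \<le> |a + b|\<close>. Opposite signs: the right-hand side is \<open>2(a\<^sup>2 + b\<^sup>2)\<close>.\<close>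
      consider "0 \<le> a" "0 \<le> b" | "a \<le> 0" "b \<le> 0" | "0 \<le> a" "b < 0" | "a < 0" "0 \<le> b" by linarith
      then show ?thesis
      proof cases
        case 1
        then have "(a - b)\<^sup>2 \<le> \<bar>a * a - b * b\<bar>" by (rule nn)
        moreover have "a * \<bar>a\<bar> - b * \<bar>b\<bar> = a * a - b * b" using 1 by simp
        ultimately show ?thesis by (simp only:) (rule order_trans, assumption, simp)
      next
        case 2
        then have "(a - b)\<^sup>2 \<le> \<bar>a * a - b * b\<bar>" using nn[of "- a" "- b"] by (simp add: power2_commute)
        moreover have "\<bar>a * \<bar>a\<bar> - b * \<bar>b\<bar>\<bar> = \<bar>a * a - b * b\<bar>" using 2 by (simp add: abs_minus_commute)
        ultimately show ?thesis by (simp only:) (rule order_trans, assumption, simp)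
      next
        case 3
        then have "a * \<bar>a\<bar> - b * \<bar>b\<bar> = a * a + b * b" by simp
        then show ?thesis using opp[of a b] by (simp only:) (smt (verit) zero_le_square)
      next
        case 4
        then have "a * \<bar>a\<bar> - b * \<bar>b\<bar> = - (a * a + b * b)" by simp
        then show ?thesis using opp[of a b] by (simp only:) (smt (verit) zero_le_square)
      qed
    qed
    have "sq_mass lborel (\<lambda>x. h (x + z n) - h x) \<le> (\<integral>\<^sup>+x. 2 * ennreal (norm (?k (x + z n) - ?k x)) \<partial>lborel)"
      unfolding sq_mass_real
      by (intro nn_integral_mono) (use ineq in \<open>auto simp: ennreal_mult'[symmetric] simp flip: ennreal_numeral intro!: ennreal_leI\<close>)
    then show "sq_mass lborel (\<lambda>x. h (x + z n) - h x) \<le> 2 * (\<integral>\<^sup>+x. ennreal (norm (?k (x + z n) - ?k x)) \<partial>lborel)"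
      by (simp add: nn_integral_cmult)
  qed
qed

section \<open>Gaussian densities and their moments\<close>

text \<open>The centred Gaussian density with covariance \<open>\<sigma>\<^sup>2\<close> times the identity, as a product over the
  orthonormal basis; all moments then factor into one-dimensional ones.\<close>

definition gauss :: "real \<Rightarrow> 'a::euclidean_space \<Rightarrow> real" where
  "gauss \<sigma> x = (\<Prod>b\<in>Basis. normal_density 0 \<sigma> (x \<bullet> b))"

lemma lborel_prod_Basis:
  fixes F :: "'a::euclidean_space \<Rightarrow> real \<Rightarrow> 'c::{real_normed_field, banach, second_countable_topology}"
  assumes F: "\<And>b. b \<in> Basis \<Longrightarrow> integrable lborel (F b)"
  shows integral_lborel_prod_Basis:
      "(\<integral>x. (\<Prod>b\<in>Basis. F b (x \<bullet> b)) \<partial>lborel) = (\<Prod>b\<in>Basis. \<integral>t. F b t \<partial>lborel)"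
    and integrable_lborel_prod_Basis:
      "integrable lborel (\<lambda>x. \<Prod>b\<in>Basis. F b (x \<bullet> b))"
proof -
  interpret product_sigma_finite "\<lambda>_::'a. lborel :: real measure" ..
  have [measurable]: "F b \<in> borel_measurable borel" if "b \<in> Basis" for b
    using F[OF that] by auto
  have m: "(\<lambda>x. \<Prod>b\<in>Basis. F b (x \<bullet> b)) \<in> borel_measurable borel"
    by measurable
  have t: "(\<lambda>f. \<Sum>b\<in>Basis. f b *\<^sub>R b) \<in> (\<Pi>\<^sub>M b\<in>Basis. lborel) \<rightarrow>\<^sub>M (borel :: 'a measure)"
    by measurable
  have e: "(\<Prod>b\<in>Basis. F b ((\<Sum>b\<in>Basis. f b *\<^sub>R b) \<bullet> b)) = (\<Prod>b\<in>Basis. F b (f b))" for f :: "'a \<Rightarrow> real"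
    by (intro prod.cong refl) simp
  show "(\<integral>x. (\<Prod>b\<in>Basis. F b (x \<bullet> b)) \<partial>lborel) = (\<Prod>b\<in>Basis. \<integral>t. F b t \<partial>lborel)"
    by (subst lborel_eq[where 'a='a], subst integral_distr[OF t m], subst e)
      (rule product_integral_prod[OF finite_Basis F])
  show "integrable lborel (\<lambda>x. \<Prod>b\<in>Basis. F b (x \<bullet> b))"
    by (subst lborel_eq[where 'a='a], subst integrable_distr_eq[OF t m], subst e)
      (rule product_integrable_prod[OF finite_Basis F])
qed

lemma gauss_nonneg: "0 \<le> gauss \<sigma> x"
  by (simp add: gauss_def prod_nonneg)

lemma gauss_measurable[measurable]: "gauss \<sigma> \<in> borel_measurable borel"
  unfolding gauss_def[abs_def] by measurable

lemma gauss_le: "gauss \<sigma> (x::'a::euclidean_space) \<le> (1 / sqrt (2 * pi * \<sigma>\<^sup>2)) ^ DIM('a)"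
proof -
  have "gauss \<sigma> x \<le> (\<Prod>b\<in>(Basis :: 'a set). 1 / sqrt (2 * pi * \<sigma>\<^sup>2))"
    unfolding gauss_def
  proof (rule prod_mono)
    fix b :: 'a
    have "1 / sqrt (2 * pi * \<sigma>\<^sup>2) * exp (- (x \<bullet> b)\<^sup>2 / (2 * \<sigma>\<^sup>2)) \<le> 1 / sqrt (2 * pi * \<sigma>\<^sup>2) * 1"
      by (intro mult_left_mono) auto
    then show "0 \<le> normal_density 0 \<sigma> (x \<bullet> b) \<and> normal_density 0 \<sigma> (x \<bullet> b) \<le> 1 / sqrt (2 * pi * \<sigma>\<^sup>2)"
      by (simp add: normal_density_def)
  qed
  then show ?thesis by simp
qed

lemma norm_square_Basis: "(norm (y::'a::euclidean_space))\<^sup>2 = (\<Sum>b\<in>Basis. (y \<bullet> b)\<^sup>2)"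
  by (subst power2_norm_eq_inner, subst euclidean_inner) (simp only: power2_eq_square)

lemma gauss_exp:
  "gauss \<sigma> (x::'a::euclidean_space) = (1 / sqrt (2 * pi * \<sigma>\<^sup>2)) ^ DIM('a) * exp (- (norm x)\<^sup>2 / (2 * \<sigma>\<^sup>2))"
proof -
  have "gauss \<sigma> x = (\<Prod>b\<in>(Basis :: 'a set). 1 / sqrt (2 * pi * \<sigma>\<^sup>2)) * (\<Prod>b\<in>Basis. exp (- (x \<bullet> b)\<^sup>2 / (2 * \<sigma>\<^sup>2)))"
    unfolding gauss_def normal_density_def prod.distrib[symmetric] by simp
  also have "(\<Prod>b\<in>Basis. exp (- (x \<bullet> b)\<^sup>2 / (2 * \<sigma>\<^sup>2))) = exp (- (norm x)\<^sup>2 / (2 * \<sigma>\<^sup>2))"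
    by (simp add: norm_square_Basis exp_sum[symmetric] sum_negf sum_divide_distrib)
  finally show ?thesis by simp
qed

lemma gauss_monomial:
  fixes p :: "'a::euclidean_space \<Rightarrow> nat"
  assumes "0 < \<sigma>"
  shows "(\<integral>y. gauss \<sigma> y * (\<Prod>b\<in>Basis. (y \<bullet> b) ^ p b) \<partial>lborel)
      = (\<Prod>b\<in>Basis. \<integral>t. normal_density 0 \<sigma> t * t ^ p b \<partial>lborel)" (is ?A)
    and "integrable lborel (\<lambda>y. gauss \<sigma> y * (\<Prod>b\<in>Basis. (y \<bullet> b) ^ p b))" (is ?B)
proof -
  have i: "integrable lborel (\<lambda>t. normal_density 0 \<sigma> t * t ^ p b)" for b
    using integrable_normal_moment[OF assms, of 0 "p b"] by simp
  show ?A ?B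
    using lborel_prod_Basis[OF i] by (simp_all add: gauss_def prod.distrib)
qed

lemma normal_moments:
  assumes "0 < \<sigma>"
  shows "(\<integral>t. normal_density 0 \<sigma> t \<partial>lborel) = 1" "(\<integral>t. normal_density 0 \<sigma> t * t \<partial>lborel) = 0"
    "(\<integral>t. normal_density 0 \<sigma> t * t^2 \<partial>lborel) = \<sigma>\<^sup>2" "(\<integral>t. normal_density 0 \<sigma> t * t^4 \<partial>lborel) = 3 * \<sigma>^4"
  using assms integral_normal_moment_even[OF assms, of 0 1] integral_normal_moment_even[OF assms, of 0 2]
    integral_normal_moment_nz_1[OF assms, of 0]
  by (simp_all add: power_divide fact_numeral)

lemma gauss_integral:
  assumes "0 < \<sigma>"
  shows "integrable lborel (gauss \<sigma> :: 'a::euclidean_space \<Rightarrow> real)"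
    "(\<integral>y. gauss \<sigma> y \<partial>(lborel :: 'a measure)) = 1"
  using gauss_monomial[OF assms, of "\<lambda>_::'a. 0"] normal_moments[OF assms] by (simp_all)

lemma gauss_nn_integral:
  assumes "0 < \<sigma>"
  shows "(\<integral>\<^sup>+y. ennreal (gauss \<sigma> y) \<partial>(lborel :: 'a::euclidean_space measure)) = 1"
  using gauss_integral[OF assms, where 'a='a] by (simp add: nn_integral_eq_integral gauss_nonneg)

lemma gauss_monomial1:
  fixes b :: "'a::euclidean_space"
  assumes "0 < \<sigma>" "b \<in> Basis" "k > 0"
  shows "(\<integral>y. gauss \<sigma> y * (y \<bullet> b) ^ k \<partial>lborel) = (\<integral>t. normal_density 0 \<sigma> t * t ^ k \<partial>lborel)"
    and "integrable lborel (\<lambda>y. gauss \<sigma> y * (y \<bullet> b) ^ k)"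
proof -
  let ?p = "\<lambda>c. if c = b then k else 0"
  have e: "(\<Prod>c\<in>Basis. (y \<bullet> c) ^ ?p c) = (y \<bullet> b) ^ k" for y
    using assms(2) by (simp add: if_distrib[of "\<lambda>n. _ ^ n"] prod.delta cong: if_cong)
  have "(\<Prod>c\<in>Basis. \<integral>t. normal_density 0 \<sigma> t * t ^ ?p c \<partial>lborel)
      = (\<Prod>c\<in>Basis. if c = b then (\<integral>t. normal_density 0 \<sigma> t * t ^ k \<partial>lborel) else 1)"
    by (intro prod.cong refl) (simp add: normal_moments[OF assms(1)])
  also have "\<dots> = (\<integral>t. normal_density 0 \<sigma> t * t ^ k \<partial>lborel)"
    using assms(2) by (simp add: prod.delta)
  finally show "(\<integral>y. gauss \<sigma> y * (y \<bullet> b) ^ k \<partial>lborel) = (\<integral>t. normal_density 0 \<sigma> t * t ^ k \<partial>lborel)"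
    using gauss_monomial(1)[OF assms(1), of ?p] by (simp only: e)
  show "integrable lborel (\<lambda>y. gauss \<sigma> y * (y \<bullet> b) ^ k)"
    using gauss_monomial(2)[OF assms(1), of ?p] by (simp only: e)
qed

lemma gauss_monomial11:
  fixes b :: "'a::euclidean_space"
  assumes "0 < \<sigma>" "b \<in> Basis" "c \<in> Basis" "b \<noteq> c"
  shows "(\<integral>y. gauss \<sigma> y * ((y \<bullet> b) * (y \<bullet> c)) \<partial>lborel) = 0"
    and "integrable lborel (\<lambda>y. gauss \<sigma> y * ((y \<bullet> b) * (y \<bullet> c)))"
proof -
  let ?p = "\<lambda>d. if d = b then 1 else if d = c then 1 else 0 :: nat"
  have e: "(\<Prod>d\<in>Basis. (y \<bullet> d) ^ ?p d) = (y \<bullet> b) * (y \<bullet> c)" for y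
  proof -
    have "(\<Prod>d\<in>Basis. (y \<bullet> d) ^ ?p d) = (\<Prod>d\<in>Basis. (if d = b then y \<bullet> b else 1) * (if d = c then y \<bullet> c else 1))"
      using assms(4) by (intro prod.cong refl) auto
    also have "\<dots> = (y \<bullet> b) * (y \<bullet> c)"
      using assms by (simp add: prod.distrib prod.delta)
    finally show ?thesis .
  qed
  have "(\<Prod>d\<in>Basis. \<integral>t. normal_density 0 \<sigma> t * t ^ ?p d \<partial>lborel) = 0"
    using assms(2) by (intro prod_zero) (auto intro!: bexI[of _ b] simp: normal_moments[OF assms(1)])
  then show "(\<integral>y. gauss \<sigma> y * ((y \<bullet> b) * (y \<bullet> c)) \<partial>lborel) = 0"
    using gauss_monomial(1)[OF assms(1), of ?p] by (simp only: e)
  show "integrable lborel (\<lambda>y. gauss \<sigma> y * ((y \<bullet> b) * (y \<bullet> c)))"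
    using gauss_monomial(2)[OF assms(1), of ?p] by (simp only: e)
qed

lemma gauss_first_moment:
  fixes v :: "'a::euclidean_space"
  assumes "0 < \<sigma>"
  shows "(\<integral>y. gauss \<sigma> y * (v \<bullet> y) \<partial>lborel) = 0"
    and "integrable lborel (\<lambda>y. gauss \<sigma> y * (v \<bullet> y))"
proof -
  have e: "gauss \<sigma> y * (v \<bullet> y) = (\<Sum>b\<in>Basis. (v \<bullet> b) * (gauss \<sigma> y * (y \<bullet> b) ^ 1))" for y
    by (subst euclidean_inner) (simp add: sum_distrib_left algebra_simps)
  show "integrable lborel (\<lambda>y. gauss \<sigma> y * (v \<bullet> y))"
    unfolding e using gauss_monomial1(2)[OF assms, of _ 1]
    by (intro Bochner_Integration.integrable_sum integrable_mult_right) auto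
  show "(\<integral>y. gauss \<sigma> y * (v \<bullet> y) \<partial>lborel) = 0"
    unfolding e using gauss_monomial1[OF assms, of _ 1]
    by (subst Bochner_Integration.integral_sum) (auto simp: normal_moments[OF assms])
qed

lemma gauss_second_moment:
  fixes v :: "'a::euclidean_space"
  assumes "0 < \<sigma>"
  shows "(\<integral>y. gauss \<sigma> y * (v \<bullet> y)\<^sup>2 \<partial>lborel) = \<sigma>\<^sup>2 * (norm v)\<^sup>2"
    and "integrable lborel (\<lambda>y. gauss \<sigma> y * (v \<bullet> y)\<^sup>2)"
proof -
  have e: "gauss \<sigma> y * (v \<bullet> y)\<^sup>2 = (\<Sum>b\<in>Basis. \<Sum>c\<in>Basis. (v \<bullet> b) * (v \<bullet> c) * (gauss \<sigma> y * ((y \<bullet> b) * (y \<bullet> c))))" for y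
    by (subst euclidean_inner) (simp add: sum_distrib_left sum_distrib_right power2_eq_square algebra_simps sum_product)
  have i: "integrable lborel (\<lambda>y. gauss \<sigma> y * ((y \<bullet> b) * (y \<bullet> c)))" if "b \<in> Basis" "c \<in> Basis" for b c :: 'a
    using gauss_monomial11(2)[OF assms that] gauss_monomial1(2)[OF assms that(1), of 2]
    by (cases "b = c") (simp_all add: power2_eq_square)
  have m: "(\<integral>y. gauss \<sigma> y * ((y \<bullet> b) * (y \<bullet> c)) \<partial>lborel) = (if b = c then \<sigma>\<^sup>2 else 0)" if "b \<in> Basis" "c \<in> Basis" for b c :: 'a
    using gauss_monomial11(1)[OF assms that] gauss_monomial1(1)[OF assms that(1), of 2]
    by (cases "b = c") (simp_all add: power2_eq_square[of "_ \<bullet> _"] normal_moments[OF assms])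
  show "integrable lborel (\<lambda>y. gauss \<sigma> y * (v \<bullet> y)\<^sup>2)"
    unfolding e using i
    by (intro Bochner_Integration.integrable_sum integrable_mult_right) auto
  have "(\<integral>y. gauss \<sigma> y * (v \<bullet> y)\<^sup>2 \<partial>lborel) = (\<Sum>b\<in>Basis. \<Sum>c\<in>Basis. (v \<bullet> b) * (v \<bullet> c) * (if b = c then \<sigma>\<^sup>2 else 0))"
    unfolding e using i
    by (simp add: Bochner_Integration.integral_sum Bochner_Integration.integrable_sum m cong: sum.cong)
  also have "\<dots> = \<sigma>\<^sup>2 * (norm v)\<^sup>2"
    by (simp add: if_distrib[of "\<lambda>x. _ * x"] sum.delta' power2_norm_eq_inner euclidean_inner[of v v] sum_distrib_left
        algebra_simps cong: if_cong)
  finally show "(\<integral>y. gauss \<sigma> y * (v \<bullet> y)\<^sup>2 \<partial>lborel) = \<sigma>\<^sup>2 * (norm v)\<^sup>2" .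
qed

lemma gauss_norm_second_moment:
  assumes "0 < (\<sigma>::real)"
  shows "(\<integral>\<^sup>+y. ennreal (gauss \<sigma> y * (norm y)\<^sup>2) \<partial>(lborel :: 'a::euclidean_space measure))
    = ennreal (real DIM('a) * \<sigma>\<^sup>2)"
proof -
  have e: "gauss \<sigma> y * (norm y)\<^sup>2 = (\<Sum>b\<in>Basis. gauss \<sigma> y * (y \<bullet> b) ^ 2)" for y :: 'a
    by (simp add: norm_square_Basis sum_distrib_left)
  have "has_bochner_integral lborel (\<lambda>y::'a. gauss \<sigma> y * (norm y)\<^sup>2) (\<Sum>b\<in>(Basis :: 'a set). \<sigma>\<^sup>2)"
    unfolding e using gauss_monomial1[OF assms, of _ 2]
    by (intro has_bochner_integral_sum) (auto simp: has_bochner_integral_iff normal_moments[OF assms])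
  then show ?thesis
    by (simp add: nn_integral_eq_integral has_bochner_integral_iff gauss_nonneg)
qed

lemma gauss_norm_fourth_moment:
  assumes "0 < (\<sigma>::real)"
  shows "(\<integral>\<^sup>+y. ennreal (gauss \<sigma> y * (norm y)^4) \<partial>(lborel :: 'a::euclidean_space measure))
    \<le> ennreal (3 * (real DIM('a))\<^sup>2 * \<sigma>^4)"
proof -
  have le: "gauss \<sigma> y * (norm y)^4 \<le> (\<Sum>b\<in>Basis. real DIM('a) * (gauss \<sigma> y * (y \<bullet> b) ^ 4))" for y :: 'a
  proof -
    have "(norm y)^4 = (\<Sum>b\<in>Basis. 1 * (y \<bullet> b)\<^sup>2)\<^sup>2"
      by (simp flip: norm_square_Basis)
    also have "\<dots> \<le> (\<Sum>b\<in>(Basis :: 'a set). 1\<^sup>2) * (\<Sum>b\<in>Basis. ((y \<bullet> b)\<^sup>2)\<^sup>2)"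
      by (rule Cauchy_Schwarz_ineq_sum)
    also have "\<dots> = real DIM('a) * (\<Sum>b\<in>Basis. (y \<bullet> b)^4)" by simp
    finally have "gauss \<sigma> y * (norm y)^4 \<le> gauss \<sigma> y * (real DIM('a) * (\<Sum>b\<in>Basis. (y \<bullet> b)^4))"
      by (intro mult_left_mono) (auto simp: gauss_nonneg)
    then show ?thesis by (simp add: sum_distrib_left algebra_simps)
  qed
  have "has_bochner_integral lborel (\<lambda>y::'a. \<Sum>b\<in>Basis. real DIM('a) * (gauss \<sigma> y * (y \<bullet> b) ^ 4))
      (\<Sum>b\<in>(Basis :: 'a set). real DIM('a) * (3 * \<sigma>^4))"
    using gauss_monomial1[OF assms, of _ 4]
    by (intro has_bochner_integral_sum has_bochner_integral_mult_right) (auto simp: has_bochner_integral_iff normal_moments[OF assms])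
  then have "(\<integral>\<^sup>+y. ennreal (\<Sum>b\<in>Basis. real DIM('a) * (gauss \<sigma> y * (y \<bullet> b) ^ 4)) \<partial>(lborel :: 'a measure)) = ennreal (\<Sum>b\<in>(Basis :: 'a set). real DIM('a) * (3 * \<sigma>^4))"
    by (subst nn_integral_eq_integral) (auto simp: has_bochner_integral_iff gauss_nonneg intro!: sum_nonneg)
  also have "(\<Sum>b\<in>(Basis :: 'a set). real DIM('a) * (3 * \<sigma>^4)) = 3 * (real DIM('a))\<^sup>2 * \<sigma>^4"
    by (simp add: power2_eq_square)
  finally show ?thesis
    using nn_integral_mono[of lborel "\<lambda>y::'a. ennreal (gauss \<sigma> y * (norm y)^4)" "\<lambda>y. ennreal (\<Sum>b\<in>Basis. real DIM('a) * (gauss \<sigma> y * (y \<bullet> b) ^ 4))"]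
    by (simp add: le ennreal_leI del: sum_constant)
qed

lemma normal_char:
  assumes "0 < \<sigma>"
  shows "(\<integral>t. complex_of_real (normal_density 0 \<sigma> t) * exp (\<i> * complex_of_real (z * t)) \<partial>lborel)
     = complex_of_real (exp (- (\<sigma> * z)\<^sup>2 / 2))" (is ?A)
    and "integrable lborel (\<lambda>t. complex_of_real (normal_density 0 \<sigma> t) * exp (\<i> * complex_of_real (z * t)))" (is ?B)
proof -
  show ?B
  proof (rule Bochner_Integration.integrable_bound)
    show "integrable lborel (\<lambda>t. normal_density 0 \<sigma> t)"
      using integrable_normal_moment[OF assms, of 0 0] by simp
  qed (auto simp: norm_mult)
  have "(\<integral>t. complex_of_real (normal_density 0 \<sigma> t) * exp (\<i> * complex_of_real (z * t)) \<partial>lborel)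
    = \<bar>\<sigma>\<bar> *\<^sub>R (\<integral>t. complex_of_real (normal_density 0 \<sigma> (0 + \<sigma> * t)) * exp (\<i> * complex_of_real (z * (0 + \<sigma> * t))) \<partial>lborel)"
    using assms by (intro lborel_integral_real_affine) auto
  also have "\<dots> = (\<integral>t. std_normal_density t *\<^sub>R iexp (\<sigma> * z * t) \<partial>lborel)"
  proof -
    have "\<sigma> * normal_density 0 \<sigma> (\<sigma> * t) = std_normal_density t" for t
      using assms by (simp add: normal_density_def power_mult_distrib real_sqrt_mult)
    note n = this[symmetric]
    show ?thesis using assms
      by (subst integral_scaleR_right[symmetric]) (simp add: n scaleR_conv_of_real algebra_simps)
  qed
  also have "\<dots> = char std_normal_distribution (\<sigma> * z)"
    unfolding char_def by (subst integral_density) (auto simp: mult.commute)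
  also have "\<dots> = complex_of_real (exp (- (\<sigma> * z)\<^sup>2 / 2))"
    by (simp add: char_std_normal_distribution)
  finally show ?A .
qed

text \<open>Gaussian weights are self-dual under the Fourier transform; this evaluates the smoothed
  energy of a Fourier transform in closed form.\<close>

lemma gauss_char:
  fixes z :: "'a::euclidean_space"
  assumes "0 < \<sigma>"
  shows "(\<integral>u. complex_of_real (gauss \<sigma> u) * exp (\<i> * complex_of_real (u \<bullet> z)) \<partial>lborel)
     = complex_of_real (exp (- \<sigma>\<^sup>2 * (norm z)\<^sup>2 / 2))"
proof -
  have "(\<integral>u. complex_of_real (gauss \<sigma> u) * exp (\<i> * complex_of_real (u \<bullet> z)) \<partial>lborel)
    = (\<integral>u. (\<Prod>b\<in>Basis. complex_of_real (normal_density 0 \<sigma> (u \<bullet> b)) * exp (\<i> * complex_of_real ((z \<bullet> b) * (u \<bullet> b)))) \<partial>lborel)"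
    by (subst euclidean_inner) (simp add: gauss_def prod.distrib exp_sum sum_distrib_left mult.commute)
  also have "\<dots> = (\<Prod>b\<in>Basis. complex_of_real (exp (- (\<sigma> * (z \<bullet> b))\<^sup>2 / 2)))"
    by (subst integral_lborel_prod_Basis[OF normal_char(2)[OF assms]]) (simp only: normal_char(1)[OF assms])
  also have "\<dots> = complex_of_real (exp (- \<sigma>\<^sup>2 * (norm z)\<^sup>2 / 2))"
    by (simp add: norm_square_Basis exp_sum[symmetric] sum_distrib_left sum_negf sum_divide_distrib power_mult_distrib
        flip: of_real_prod)
  finally show ?thesis .
qed

lemma gauss_scale:
  fixes \<phi> :: "'a::euclidean_space \<Rightarrow> real"
  assumes "0 < \<sigma>" and [measurable]: "\<phi> \<in> borel_measurable borel"
  shows "(\<integral>y. gauss \<sigma> y * \<phi> y \<partial>lborel) = (\<integral>y. gauss 1 y * \<phi> (\<sigma> *\<^sub>R y) \<partial>lborel)"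
proof -
  have n: "\<sigma> ^ DIM('a) * gauss \<sigma> (\<sigma> *\<^sub>R y) = gauss 1 y" for y :: 'a
    using assms(1) by (simp add: gauss_exp power_mult_distrib power_divide real_sqrt_mult)
  have "(\<integral>y. gauss \<sigma> y * \<phi> y \<partial>lborel) =
      (\<integral>y. gauss \<sigma> y * \<phi> y \<partial>density (distr lborel borel (\<lambda>x. 0 + \<sigma> *\<^sub>R x)) (\<lambda>_. ennreal (\<bar>\<sigma>\<bar> ^ DIM('a))))"
    using assms(1) by (subst lborel_affine[of \<sigma> 0]) auto
  also have "\<dots> = (\<integral>y. \<sigma> ^ DIM('a) * (gauss \<sigma> (\<sigma> *\<^sub>R y) * \<phi> (\<sigma> *\<^sub>R y)) \<partial>lborel)"
    using assms(1) by (subst integral_density) (auto simp: integral_distr)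
  also have "\<dots> = (\<integral>y. gauss 1 y * \<phi> (\<sigma> *\<^sub>R y) \<partial>lborel)"
    by (simp add: n[symmetric] mult.assoc)
  finally show ?thesis .
qed

section \<open>The Plancherel inequality\<close>

lemma fourier_measurable[measurable]:
  fixes h :: "'a::euclidean_space \<Rightarrow> real"
  assumes [measurable]: "h \<in> borel_measurable borel"
  shows "fourier h \<in> borel_measurable borel"
proof -
  have "(\<lambda>u. LINT x|lborel. complex_of_real (h x) * exp (\<i> * complex_of_real (u \<bullet> x))) \<in> borel_measurable borel"
    by (rule sigma_finite_measure.borel_measurable_lebesgue_integral[OF sigma_finite_lborel]) measurable
  then show ?thesis by (simp add: fourier_def[abs_def])
qed

lemma fourier_integrable:
  fixes h :: "'a::euclidean_space \<Rightarrow> real"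
  assumes "integrable lborel h"
  shows "integrable lborel (\<lambda>x. complex_of_real (h x) * exp (\<i> * complex_of_real (u \<bullet> x)))"
proof -
  have [measurable]: "h \<in> borel_measurable borel" using assms by auto
  show ?thesis
    by (rule Bochner_Integration.integrable_bound[OF assms]) (auto simp: norm_mult)
qed

lemma cmod_fourier_le:
  fixes h :: "'a::euclidean_space \<Rightarrow> real"
  assumes "integrable lborel h"
  shows "cmod (fourier h u) \<le> (\<integral>x. \<bar>h x\<bar> \<partial>lborel)"
proof -
  have "cmod (fourier h u) \<le> (\<integral>x. norm (complex_of_real (h x) * exp (\<i> * complex_of_real (u \<bullet> x))) \<partial>lborel)"
    unfolding fourier_def by (rule integral_norm_bound)
  then show ?thesis by (simp add: norm_mult)
qed

lemma fourier_translate: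
  fixes h :: "'a::euclidean_space \<Rightarrow> real"
  assumes "integrable lborel h"
  shows "fourier (\<lambda>x. h (x + z)) u = exp (- (\<i> * complex_of_real (u \<bullet> z))) * fourier h u"
proof -
  have [measurable]: "h \<in> borel_measurable borel" using assms by auto
  have "exp (- (\<i> * complex_of_real (u \<bullet> z))) * fourier h u
      = (\<integral>x. exp (- (\<i> * complex_of_real (u \<bullet> z))) * (complex_of_real (h x) * exp (\<i> * complex_of_real (u \<bullet> x))) \<partial>lborel)"
    unfolding fourier_def by simp
  also have "\<dots> = (\<integral>x. exp (- (\<i> * complex_of_real (u \<bullet> z))) * (complex_of_real (h (x + z)) * exp (\<i> * complex_of_real (u \<bullet> (x + z)))) \<partial>lborel)"
    by (rule integral_translate[symmetric]) measurable
  also have "\<dots> = fourier (\<lambda>x. h (x + z)) u"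
    unfolding fourier_def
  proof (rule Bochner_Integration.integral_cong[OF refl])
    fix x
    have "exp (- (\<i> * complex_of_real (u \<bullet> z))) * exp (\<i> * complex_of_real (u \<bullet> (x + z))) = exp (\<i> * complex_of_real (u \<bullet> x))"
      by (simp add: exp_add[symmetric] inner_add_right algebra_simps)
    then show "exp (- (\<i> * complex_of_real (u \<bullet> z))) * (complex_of_real (h (x + z)) * exp (\<i> * complex_of_real (u \<bullet> (x + z))))
        = complex_of_real (h (x + z)) * exp (\<i> * complex_of_real (u \<bullet> x))"
      by (metis (no_types, lifting) mult.left_commute)
  qed
  finally show ?thesis by simp
qed

lemma fourier_lincomb:
  fixes h k :: "'a::euclidean_space \<Rightarrow> real"
  assumes "integrable lborel h" "integrable lborel k"
  shows "fourier (\<lambda>x. a * h x + b * k x) u = complex_of_real a * fourier h u + complex_of_real b * fourier k u"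
proof -
  have "fourier (\<lambda>x. a * h x + b * k x) u
    = (\<integral>x. complex_of_real a * (complex_of_real (h x) * exp (\<i> * complex_of_real (u \<bullet> x)))
          + complex_of_real b * (complex_of_real (k x) * exp (\<i> * complex_of_real (u \<bullet> x))) \<partial>lborel)"
    unfolding fourier_def by (intro Bochner_Integration.integral_cong) (auto simp: algebra_simps)
  also have "\<dots> = complex_of_real a * fourier h u + complex_of_real b * fourier k u"
    using fourier_integrable[OF assms(1), of u] fourier_integrable[OF assms(2), of u]
    by (subst Bochner_Integration.integral_add) (auto simp: fourier_def)
  finally show ?thesis .
qed

lemma integrable_product:
  fixes G :: "'a::euclidean_space \<Rightarrow> real" and h :: "'b::euclidean_space \<Rightarrow> real"
    and F :: "'a \<times> 'b \<Rightarrow> 'c::{banach, second_countable_topology}"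
  assumes G: "integrable lborel G" and h: "integrable lborel h"
    and F[measurable]: "F \<in> borel_measurable (lborel \<Otimes>\<^sub>M lborel)"
    and le: "\<And>x y. norm (F (x, y)) \<le> G x * h y"
  shows "integrable (lborel \<Otimes>\<^sub>M lborel) F"
proof -
  have [measurable]: "G \<in> borel_measurable borel" "h \<in> borel_measurable borel" using G h by auto
  have "integrable (lborel \<Otimes>\<^sub>M lborel) (\<lambda>(x, y). G x * h y)"
  proof (rule lborel_pair.Fubini_integrable)
    show "integrable lborel (\<lambda>x. \<integral>y. norm (case (x, y) of (x, y) \<Rightarrow> G x * h y) \<partial>lborel)"
      using integrable_norm[OF G] by (simp add: abs_mult)
  qed (use h in auto)
  then show ?thesis
    by (rule Bochner_Integration.integrable_bound) (use le in \<open>auto intro!: AE_I2 intro: order_trans[OF _ abs_ge_self]\<close>)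
qed

lemma Fubini_dominated:
  fixes G :: "'a::euclidean_space \<Rightarrow> real" and h :: "'b::euclidean_space \<Rightarrow> real"
    and F :: "'a \<Rightarrow> 'b \<Rightarrow> 'c::{banach, second_countable_topology}"
  assumes "integrable lborel G" "integrable lborel h"
    and "case_prod F \<in> borel_measurable (lborel \<Otimes>\<^sub>M lborel)"
    and le: "\<And>x y. norm (F x y) \<le> G x * h y"
  shows "(\<integral>x. (\<integral>y. F x y \<partial>lborel) \<partial>lborel) = (\<integral>y. (\<integral>x. F x y \<partial>lborel) \<partial>lborel)"
proof -
  show ?thesis
    by (rule lborel_pair.Fubini_integral[symmetric], rule integrable_product[OF assms(1-3)]) (simp add: le)
qed

text \<open>Expanding the square of the Fourier transform and integrating against a Gaussian weight
  first makes every exchange of integrals absolutely convergent.\<close>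

lemma smoothed_energy:
  fixes h :: "'a::euclidean_space \<Rightarrow> real"
  assumes h: "integrable lborel h" and \<sigma>: "0 < \<sigma>"
  shows "(\<integral>u. gauss \<sigma> u * (cmod (fourier h u))\<^sup>2 \<partial>lborel)
    = (\<integral>x. (\<integral>y. h x * h y * exp (- \<sigma>\<^sup>2 * (norm (x - y))\<^sup>2 / 2) \<partial>lborel) \<partial>lborel)"
proof -
  have [measurable]: "h \<in> borel_measurable borel" using h by auto
  let ?e = "\<lambda>u x::'a. exp (\<i> * complex_of_real (u \<bullet> x))"
  let ?G = "\<lambda>u. complex_of_real (gauss \<sigma> u)"
  let ?H = "\<lambda>x. complex_of_real (h x)"
  have [measurable]: "(\<lambda>u. cnj (fourier h u)) \<in> borel_measurable borel"
    by (intro borel_measurable_continuous_on[OF _ fourier_measurable] continuous_intros) simp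
  have cF: "cnj (fourier h u) = (\<integral>y. ?H y * ?e u (- y) \<partial>lborel)" for u
    unfolding fourier_def by (rule trans[OF Bochner_Integration.integral_cnj[symmetric]]) (simp add: exp_cnj)
  have "complex_of_real (\<integral>u. gauss \<sigma> u * (cmod (fourier h u))\<^sup>2 \<partial>lborel)
      = (\<integral>u. ?G u * (fourier h u * cnj (fourier h u)) \<partial>lborel)"
    unfolding complex_norm_square[symmetric] by (subst integral_complex_of_real[symmetric]) simp
  also have "\<dots> = (\<integral>u. (\<integral>x. ?G u * cnj (fourier h u) * (?H x * ?e u x) \<partial>lborel) \<partial>lborel)"
    by (subst integral_mult_right_zero, simp add: fourier_def[symmetric] algebra_simps)
  also have "\<dots> = (\<integral>x. (\<integral>u. ?G u * cnj (fourier h u) * (?H x * ?e u x) \<partial>lborel) \<partial>lborel)"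
  proof (rule Fubini_dominated)
    show "integrable lborel (\<lambda>u::'a. (\<integral>x. \<bar>h x\<bar> \<partial>lborel) * gauss \<sigma> u)"
      using gauss_integral[OF \<sigma>, where 'a='a] by simp
    show "integrable lborel (\<lambda>x. \<bar>h x\<bar>)" using h by simp
    show "cmod (?G u * cnj (fourier h u) * (?H x * ?e u x)) \<le> (\<integral>x. \<bar>h x\<bar> \<partial>lborel) * gauss \<sigma> u * \<bar>h x\<bar>" for u x
      using cmod_fourier_le[OF h, of u]
      by (auto simp: norm_mult gauss_nonneg mult.commute intro!: mult_right_mono mult_left_mono)
  qed measurable
  also have "\<dots> = (\<integral>x. (\<integral>y. complex_of_real (h x * h y * exp (- \<sigma>\<^sup>2 * (norm (x - y))\<^sup>2 / 2)) \<partial>lborel) \<partial>lborel)"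
  proof (rule Bochner_Integration.integral_cong[OF refl])
    fix x
    have "(\<integral>u. ?G u * cnj (fourier h u) * (?H x * ?e u x) \<partial>lborel)
      = (\<integral>u. (\<integral>y. ?G u * (?H x * ?e u x) * (?H y * ?e u (- y)) \<partial>lborel) \<partial>lborel)"
      by (subst integral_mult_right_zero) (simp add: cF algebra_simps)
    also have "\<dots> = (\<integral>y. (\<integral>u. ?G u * (?H x * ?e u x) * (?H y * ?e u (- y)) \<partial>lborel) \<partial>lborel)"
    proof (rule Fubini_dominated)
      show "integrable lborel (\<lambda>u::'a. \<bar>h x\<bar> * gauss \<sigma> u)"
        using gauss_integral[OF \<sigma>, where 'a='a] by simp
      show "integrable lborel (\<lambda>x. \<bar>h x\<bar>)" using h by simp
      show "cmod (?G u * (?H x * ?e u x) * (?H y * ?e u (- y))) \<le> \<bar>h x\<bar> * gauss \<sigma> u * \<bar>h y\<bar>" for u y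
        by (auto simp: norm_mult gauss_nonneg)
    qed measurable
    also have "\<dots> = (\<integral>y. complex_of_real (h x * h y * exp (- \<sigma>\<^sup>2 * (norm (x - y))\<^sup>2 / 2)) \<partial>lborel)"
    proof (rule Bochner_Integration.integral_cong[OF refl])
      fix y
      have "(\<integral>u. ?G u * (?H x * ?e u x) * (?H y * ?e u (- y)) \<partial>lborel)
         = (\<integral>u. (?H x * ?H y) * (?G u * ?e u (x - y)) \<partial>lborel)"
        by (intro Bochner_Integration.integral_cong refl) (simp add: exp_add[symmetric] inner_diff_right algebra_simps exp_diff exp_minus field_simps)
      also have "\<dots> = ?H x * ?H y * complex_of_real (exp (- \<sigma>\<^sup>2 * (norm (x - y))\<^sup>2 / 2))"
        by (subst integral_mult_right_zero) (simp only: gauss_char[OF \<sigma>])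
      finally show "(\<integral>u. ?G u * (?H x * ?e u x) * (?H y * ?e u (- y)) \<partial>lborel)
         = complex_of_real (h x * h y * exp (- \<sigma>\<^sup>2 * (norm (x - y))\<^sup>2 / 2))" by simp
    qed
    finally show "(\<integral>u. ?G u * cnj (fourier h u) * (?H x * ?e u x) \<partial>lborel)
      = (\<integral>y. complex_of_real (h x * h y * exp (- \<sigma>\<^sup>2 * (norm (x - y))\<^sup>2 / 2)) \<partial>lborel)" .
  qed
  also have "\<dots> = complex_of_real (\<integral>x. (\<integral>y. h x * h y * exp (- \<sigma>\<^sup>2 * (norm (x - y))\<^sup>2 / 2) \<partial>lborel) \<partial>lborel)"
    by (simp only: integral_complex_of_real)
  finally show ?thesis by (simp only: of_real_eq_iff)
qed

text \<open>The last identity shows that continuity of translations in \<open>L\<^sup>2\<close> is the same as continuity of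
  the autocorrelation at \<open>0\<close>.\<close>

lemma autocorrelation:
  fixes h :: "'a::euclidean_space \<Rightarrow> real"
  assumes h: "square_integrable h"
  shows "integrable lborel (\<lambda>x. h x * h (x + w))"
    and "\<bar>\<integral>x. h x * h (x + w) \<partial>lborel\<bar> \<le> (\<integral>x. (h x)\<^sup>2 \<partial>lborel)"
    and "sq_mass lborel (\<lambda>x. h (x + w) - h x) = ennreal (2 * (\<integral>x. (h x)\<^sup>2 \<partial>lborel) - 2 * (\<integral>x. h x * h (x + w) \<partial>lborel))"
proof -
  have [measurable]: "h \<in> borel_measurable borel" and h2: "integrable lborel (\<lambda>x. (h x)\<^sup>2)"
    using h by (auto simp: square_integrable_def)
  have h2w: "integrable lborel (\<lambda>x. (h (x + w))\<^sup>2)" using integrable_translate[OF h2] .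
  have e: "(\<integral>x. (h (x + w))\<^sup>2 \<partial>lborel) = (\<integral>x. (h x)\<^sup>2 \<partial>lborel)"
    by (rule integral_translate) measurable
  have le: "\<bar>h x * h (x + w)\<bar> \<le> ((h x)\<^sup>2 + (h (x + w))\<^sup>2) / 2" for x
    using zero_le_power2[of "\<bar>h x\<bar> - \<bar>h (x + w)\<bar>"] by (simp add: power2_diff abs_mult)
  have isum: "integrable lborel (\<lambda>x. ((h x)\<^sup>2 + (h (x + w))\<^sup>2) / 2)" using h2 h2w by simp
  show i: "integrable lborel (\<lambda>x. h x * h (x + w))"
    by (rule Bochner_Integration.integrable_bound[OF isum]) (use le in \<open>auto intro!: AE_I2 intro: order_trans[OF _ abs_ge_self]\<close>)
  have "\<bar>\<integral>x. h x * h (x + w) \<partial>lborel\<bar> \<le> (\<integral>x. \<bar>h x * h (x + w)\<bar> \<partial>lborel)"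
    using integral_norm_bound[of lborel "\<lambda>x. h x * h (x + w)"] by simp
  also have "\<dots> \<le> (\<integral>x. ((h x)\<^sup>2 + (h (x + w))\<^sup>2) / 2 \<partial>lborel)"
    using i isum le by (intro integral_mono) auto
  also have "\<dots> = (\<integral>x. (h x)\<^sup>2 \<partial>lborel)" using h2 h2w e by simp
  finally show "\<bar>\<integral>x. h x * h (x + w) \<partial>lborel\<bar> \<le> (\<integral>x. (h x)\<^sup>2 \<partial>lborel)" .
  have q: "(h (x + w) - h x)\<^sup>2 = (h (x + w))\<^sup>2 + (h x)\<^sup>2 - 2 * (h x * h (x + w))" for x
    by (simp add: power2_diff algebra_simps)
  have "sq_mass lborel (\<lambda>x. h (x + w) - h x) = ennreal (\<integral>x. (h (x + w) - h x)\<^sup>2 \<partial>lborel)"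
    unfolding sq_mass_real
  proof (intro nn_integral_eq_integral)
    show "integrable lborel (\<lambda>x. (h (x + w) - h x)\<^sup>2)" unfolding q using i h2 h2w by simp
  qed simp
  also have "(\<integral>x. (h (x + w) - h x)\<^sup>2 \<partial>lborel) = 2 * (\<integral>x. (h x)\<^sup>2 \<partial>lborel) - 2 * (\<integral>x. h x * h (x + w) \<partial>lborel)"
    unfolding q using i h2 h2w by (simp add: e)
  finally show "sq_mass lborel (\<lambda>x. h (x + w) - h x) = ennreal (2 * (\<integral>x. (h x)\<^sup>2 \<partial>lborel) - 2 * (\<integral>x. h x * h (x + w) \<partial>lborel))" .
qed

lemma autocorrelation_continuous:
  fixes h :: "'a::euclidean_space \<Rightarrow> real"
  assumes h: "square_integrable h" and w: "w \<longlonglongrightarrow> 0"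
  shows "(\<lambda>n. \<integral>x. h x * h (x + w n) \<partial>lborel) \<longlonglongrightarrow> (\<integral>x. (h x)\<^sup>2 \<partial>lborel)"
proof -
  let ?a = "\<lambda>n. \<integral>x. h x * h (x + w n) \<partial>lborel" and ?A = "\<integral>x. (h x)\<^sup>2 \<partial>lborel"
  have nn: "0 \<le> 2 * ?A - 2 * ?a n" for n using autocorrelation(2)[OF h, of "w n"] by linarith
  have "(\<lambda>n. ennreal (2 * ?A - 2 * ?a n)) \<longlonglongrightarrow> ennreal 0"
    using L2_translation_continuous[OF h w] by (simp add: autocorrelation(3)[OF h])
  then have "(\<lambda>n. 2 * ?A - 2 * ?a n) \<longlonglongrightarrow> 0"
    by (subst (asm) tendsto_ennreal_iff) (use nn in auto)
  then have "(\<lambda>n. ?A - (2 * ?A - 2 * ?a n) / 2) \<longlonglongrightarrow> ?A - 0 / 2"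
    by (intro tendsto_intros) auto
  then show ?thesis by (simp add: field_simps)
qed

text \<open>The energy of the Fourier transform, damped at scale \<open>\<sigma>\<close>, is the autocorrelation averaged at
  scale \<open>1/\<sigma>\<close>; Plancherel's theorem is the limit of large \<open>\<sigma>\<close>.\<close>

lemma smoothed_energy_autocorrelation:
  fixes h :: "'a::euclidean_space \<Rightarrow> real"
  assumes h: "integrable lborel h" and h2: "square_integrable h" and \<sigma>: "0 < \<sigma>"
  shows "(2 * pi) ^ DIM('a) * (\<integral>w. gauss 1 w * (\<integral>x. h x * h (x + (1 / \<sigma>) *\<^sub>R w) \<partial>lborel) \<partial>lborel)
    = (sqrt (2 * pi) * \<sigma>) ^ DIM('a) * (\<integral>u. gauss \<sigma> u * (cmod (fourier h u))\<^sup>2 \<partial>lborel)"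
proof -
  have [measurable]: "h \<in> borel_measurable borel" using h by auto
  define a where "a w = (\<integral>x. h x * h (x + w) \<partial>lborel)" for w
  have [measurable]: "a \<in> borel_measurable borel"
    unfolding a_def[abs_def]
    by (rule sigma_finite_measure.borel_measurable_lebesgue_integral[OF sigma_finite_lborel]) measurable
  let ?E = "\<lambda>w::'a. exp (- \<sigma>\<^sup>2 * (norm w)\<^sup>2 / 2)"
  have E: "(\<sigma> / sqrt (2 * pi)) ^ DIM('a) * ?E w = gauss (1 / \<sigma>) w" for w
    using \<sigma> by (simp add: gauss_exp power_divide real_sqrt_divide real_sqrt_mult field_simps)
  have iE: "integrable lborel ?E"
  proof -
    have "?E = (\<lambda>w. (sqrt (2 * pi) / \<sigma>) ^ DIM('a) * gauss (1 / \<sigma>) w)"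
      unfolding E[symmetric] using \<sigma> by (auto simp: fun_eq_iff power_divide)
    then show ?thesis using gauss_integral[of "1 / \<sigma>", where 'a='a] \<sigma> by simp
  qed
  have "(\<integral>u. gauss \<sigma> u * (cmod (fourier h u))\<^sup>2 \<partial>lborel) = (\<integral>x. (\<integral>y. h x * h y * ?E (x - y) \<partial>lborel) \<partial>lborel)"
    by (rule smoothed_energy[OF h \<sigma>])
  also have "\<dots> = (\<integral>x. (\<integral>w. h x * h (x + w) * ?E w \<partial>lborel) \<partial>lborel)"
  proof (rule Bochner_Integration.integral_cong[OF refl])
    fix x
    show "(\<integral>y. h x * h y * ?E (x - y) \<partial>lborel) = (\<integral>w. h x * h (x + w) * ?E w \<partial>lborel)"
      using integral_translate[of "\<lambda>y. h x * h y * ?E (x - y)" x]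
      by (simp add: add.commute norm_minus_commute)
  qed
  also have "\<dots> = (\<integral>w. (\<integral>x. h x * h (x + w) * ?E w \<partial>lborel) \<partial>lborel)"
  proof -
      have "integrable (lborel \<Otimes>\<^sub>M lborel) (\<lambda>(w, x). h x * h (x + w) * ?E w)"
    proof (rule lborel_pair.Fubini_integrable)
      have "(\<integral>x. norm (h x * h (x + w) * ?E w) \<partial>lborel) \<le> (\<integral>x. (h x)\<^sup>2 \<partial>lborel) * ?E w" for w
      proof -
        have "square_integrable (\<lambda>x. \<bar>h x\<bar>)" using h2 by (simp add: square_integrable_def)
        from autocorrelation(2)[OF this, of w] show ?thesis by (simp add: abs_mult)
      qed
      then show "integrable lborel (\<lambda>w. \<integral>x. norm (case (w, x) of (w, x) \<Rightarrow> h x * h (x + w) * ?E w) \<partial>lborel)"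
        by (intro Bochner_Integration.integrable_bound[OF integrable_mult_right[OF iE, of "\<integral>x. (h x)\<^sup>2 \<partial>lborel"]])
          (auto intro!: AE_I2 intro: order_trans[OF _ abs_ge_self])
      show "AE w in lborel. integrable lborel (\<lambda>x. case (w, x) of (w, x) \<Rightarrow> h x * h (x + w) * ?E w)"
        using autocorrelation(1)[OF h2] by simp
    qed measurable
    then show ?thesis by (rule lborel_pair.Fubini_integral)
  qed
  also have "\<dots> = (\<integral>w. (sqrt (2 * pi) / \<sigma>) ^ DIM('a) * (gauss (1 / \<sigma>) w * a w) \<partial>lborel)"
    unfolding a_def E[symmetric] using \<sigma> by (intro Bochner_Integration.integral_cong refl) (simp add: power_divide)
  also have "\<dots> = (sqrt (2 * pi) / \<sigma>) ^ DIM('a) * (\<integral>w. gauss 1 w * a ((1 / \<sigma>) *\<^sub>R w) \<partial>lborel)"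
    using \<sigma> gauss_scale[of "1 / \<sigma>" a] by simp
  finally have "(sqrt (2 * pi) * \<sigma>) ^ DIM('a) * (\<integral>u. gauss \<sigma> u * (cmod (fourier h u))\<^sup>2 \<partial>lborel)
    = ((sqrt (2 * pi) * \<sigma>) ^ DIM('a) * (sqrt (2 * pi) / \<sigma>) ^ DIM('a)) * (\<integral>w. gauss 1 w * a ((1 / \<sigma>) *\<^sub>R w) \<partial>lborel)"
    by (simp only: mult.assoc)
  also have "(sqrt (2 * pi) * \<sigma>) ^ DIM('a) * (sqrt (2 * pi) / \<sigma>) ^ DIM('a) = (2 * pi) ^ DIM('a)"
    by (subst power_mult_distrib[symmetric]) (use \<sigma> in simp)
  finally show ?thesis by (simp add: a_def)
qed

text \<open>Let \<open>\<sigma>\<close> tend to infinity in the previous identity: the normalised weight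
  \<open>(\<surd>(2\<pi>) \<sigma>)\<^sup>d gauss \<sigma> u\<close> is at most \<open>1\<close>, and the averaged autocorrelation tends to the mass of \<open>h\<close>.\<close>

lemma Plancherel_le:
  fixes h :: "'a::euclidean_space \<Rightarrow> real"
  assumes h: "integrable lborel h" and h2: "square_integrable h"
  shows "ennreal ((2 * pi) ^ DIM('a)) * sq_mass lborel h \<le> sq_mass lborel (fourier h)"
proof (cases "sq_mass lborel (fourier h)")
  case (real B)
  have [measurable]: "h \<in> borel_measurable borel" using h by auto
  define a where "a w = (\<integral>x. h x * h (x + w) \<partial>lborel)" for w
  have [measurable]: "a \<in> borel_measurable borel"
    unfolding a_def[abs_def]
    by (rule sigma_finite_measure.borel_measurable_lebesgue_integral[OF sigma_finite_lborel]) measurable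
  let ?A = "\<integral>x. (h x)\<^sup>2 \<partial>lborel"
  let ?s = "\<lambda>n. real (Suc n)"
  have le: "(2 * pi) ^ DIM('a) * (\<integral>w. gauss 1 w * a ((1 / ?s n) *\<^sub>R w) \<partial>lborel) \<le> B" for n
  proof -
    have "ennreal ((sqrt (2 * pi) * ?s n) ^ DIM('a) * (\<integral>u. gauss (?s n) u * (cmod (fourier h u))\<^sup>2 \<partial>lborel))
      \<le> ennreal ((sqrt (2 * pi) * ?s n) ^ DIM('a)) * (\<integral>\<^sup>+u. ennreal (gauss (?s n) u * (cmod (fourier h u))\<^sup>2) \<partial>lborel)"
    proof -
      have "integrable lborel (\<lambda>u. gauss (?s n) u * (cmod (fourier h u))\<^sup>2)"
      proof (rule Bochner_Integration.integrable_bound)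
        show "integrable lborel (\<lambda>u::'a. gauss (?s n) u * (\<integral>x. \<bar>h x\<bar> \<partial>lborel)\<^sup>2)"
          using gauss_integral[of "?s n", where 'a='a] by simp
        show "AE u in lborel. norm (gauss (?s n) u * (cmod (fourier h u))\<^sup>2) \<le> norm (gauss (?s n) u * (\<integral>x. \<bar>h x\<bar> \<partial>lborel)\<^sup>2)"
          using cmod_fourier_le[OF h] by (intro AE_I2) (auto simp: abs_mult gauss_nonneg intro!: mult_left_mono power_mono)
      qed measurable
      from nn_integral_eq_integral[OF this] show ?thesis
        by (subst ennreal_mult') (auto simp: gauss_nonneg simp del: of_nat_Suc)
    qed
    also have "\<dots> = (\<integral>\<^sup>+u. ennreal ((sqrt (2 * pi) * ?s n) ^ DIM('a) * (gauss (?s n) u * (cmod (fourier h u))\<^sup>2)) \<partial>lborel)"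
      by (subst nn_integral_cmult[symmetric]) (auto simp: ennreal_mult' gauss_nonneg)
    also have "\<dots> \<le> (\<integral>\<^sup>+u. ennreal ((cmod (fourier h u))\<^sup>2) \<partial>lborel)"
    proof (intro nn_integral_mono ennreal_leI)
      fix u :: 'a
      have "(sqrt (2 * pi) * ?s n) ^ DIM('a) * gauss (?s n) u \<le> (sqrt (2 * pi) * ?s n) ^ DIM('a) * (1 / sqrt (2 * pi * (?s n)\<^sup>2)) ^ DIM('a)"
        by (intro mult_left_mono gauss_le) auto
      also have "\<dots> = 1" by (simp add: real_sqrt_mult power_mult_distrib[symmetric] del: of_nat_Suc)
      finally have "(sqrt (2 * pi) * ?s n) ^ DIM('a) * gauss (?s n) u * (cmod (fourier h u))\<^sup>2 \<le> 1 * (cmod (fourier h u))\<^sup>2"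
        by (rule mult_right_mono) auto
      then show "(sqrt (2 * pi) * ?s n) ^ DIM('a) * (gauss (?s n) u * (cmod (fourier h u))\<^sup>2) \<le> (cmod (fourier h u))\<^sup>2"
        by (simp add: mult.assoc)
    qed
    also have "\<dots> = ennreal B" using real by (simp add: sq_mass_def)
    finally have "(sqrt (2 * pi) * ?s n) ^ DIM('a) * (\<integral>u. gauss (?s n) u * (cmod (fourier h u))\<^sup>2 \<partial>lborel) \<le> B"
      using real(1) by (simp only: ennreal_le_iff)
    moreover have "0 < ?s n" by simp
    ultimately show ?thesis
      unfolding a_def by (simp only: smoothed_energy_autocorrelation[OF h h2])
  qed
  have "(\<lambda>n. \<integral>w. gauss 1 w * a ((1 / ?s n) *\<^sub>R w) \<partial>lborel) \<longlonglongrightarrow> (\<integral>w. gauss 1 w * ?A \<partial>(lborel :: 'a measure))"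
  proof (rule integral_dominated_convergence[where w="\<lambda>w. gauss 1 w * ?A"])
    show "integrable lborel (\<lambda>w::'a. gauss 1 w * ?A)"
      using gauss_integral[of 1, where 'a='a] by simp
    show "AE w in lborel. norm (gauss 1 w * a ((1 / ?s n) *\<^sub>R w)) \<le> gauss 1 w * ?A" for n
      using autocorrelation(2)[OF h2] by (intro AE_I2) (auto simp: abs_mult gauss_nonneg a_def intro!: mult_left_mono)
    show "AE w in lborel. (\<lambda>n. gauss 1 w * a ((1 / ?s n) *\<^sub>R w)) \<longlonglongrightarrow> gauss 1 w * ?A"
    proof (intro AE_I2 tendsto_intros)
      fix w :: 'a
      have "(\<lambda>n. (1 / ?s n) *\<^sub>R w) \<longlonglongrightarrow> 0 *\<^sub>R w"
        by (intro tendsto_intros lim_1_over_n[THEN LIMSEQ_Suc, unfolded])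
      then show "(\<lambda>n. a ((1 / ?s n) *\<^sub>R w)) \<longlonglongrightarrow> ?A"
        unfolding a_def by (intro autocorrelation_continuous[OF h2]) simp
    qed
  qed measurable
  moreover have "(\<integral>w. gauss 1 w * ?A \<partial>(lborel :: 'a measure)) = ?A"
    using gauss_integral[of 1, where 'a='a] by simp
  ultimately have "(\<lambda>n. \<integral>w. gauss 1 w * a ((1 / ?s n) *\<^sub>R w) \<partial>lborel) \<longlonglongrightarrow> ?A" by (simp only:)
  then have "(\<lambda>n. (2 * pi) ^ DIM('a) * (\<integral>w. gauss 1 w * a ((1 / ?s n) *\<^sub>R w) \<partial>lborel)) \<longlonglongrightarrow> (2 * pi) ^ DIM('a) * ?A"
    by (rule tendsto_mult_left)
  then have "(2 * pi) ^ DIM('a) * ?A \<le> B"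
    by (rule LIMSEQ_le_const2) (use le in auto)
  moreover have "sq_mass lborel h = ennreal ?A"
    using h2 by (simp add: sq_mass_real square_integrable_def nn_integral_eq_integral)
  ultimately show ?thesis
    using real by (simp add: ennreal_mult'[symmetric] ennreal_leI)
qed simp

section \<open>The Fourier transform on square-integrable functions\<close>

lemma fourier_L2_iff:
  "fourier_L2 f g \<longleftrightarrow> g \<in> borel_measurable borel \<and>
     (\<exists>h::nat \<Rightarrow> 'a::euclidean_space \<Rightarrow> real.
        (\<forall>n. integrable lborel (h n) \<and> square_integrable (h n)) \<and>
        (\<lambda>n. sq_mass lborel (\<lambda>x. h n x - f x)) \<longlonglongrightarrow> 0 \<and>
        (\<lambda>n. sq_mass lborel (\<lambda>u. fourier (h n) u - g u)) \<longlonglongrightarrow> 0)"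
  unfolding fourier_L2_def sq_mass_def by simp

lemma sq_mass_scaleR:
  assumes [measurable]: "f \<in> borel_measurable N"
  shows "sq_mass N (\<lambda>x. c *\<^sub>R f x) = ennreal (c\<^sup>2) * sq_mass N (f :: _ \<Rightarrow> 'c::euclidean_space)"
  unfolding sq_mass_def
  by (subst nn_integral_cmult[symmetric]) (auto simp: power_mult_distrib ennreal_mult)

lemma fourier_L2_measurable: "fourier_L2 f g \<Longrightarrow> g \<in> borel_measurable borel"
  by (simp add: fourier_L2_def)

text \<open>The approximating functions satisfy Plancherel's inequality. The factor \<open>4\<close> comes from applying
  \<open>|a + b|\<^sup>2 \<le> 2|a|\<^sup>2 + 2|b|\<^sup>2\<close> once on each side, which is harmless for all later uses.\<close>

lemma fourier_L2_Plancherel_le: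
  fixes f :: "'a::euclidean_space \<Rightarrow> real"
  assumes F: "fourier_L2 f g" and [measurable]: "f \<in> borel_measurable borel"
  shows "ennreal ((2 * pi) ^ DIM('a)) * sq_mass lborel f \<le> 4 * sq_mass lborel g"
proof -
  let ?K = "ennreal ((2 * pi) ^ DIM('a))"
  obtain h where h: "\<And>n. integrable lborel (h n)" "\<And>n. square_integrable (h n)"
    and 1: "(\<lambda>n. sq_mass lborel (\<lambda>x. h n x - f x)) \<longlonglongrightarrow> 0"
    and 2: "(\<lambda>n. sq_mass lborel (\<lambda>u. fourier (h n) u - g u)) \<longlonglongrightarrow> 0"
    using F unfolding fourier_L2_iff by blast
  have [measurable]: "g \<in> borel_measurable borel" "h n \<in> borel_measurable borel" for n
    using fourier_L2_measurable[OF F] h(2)[of n] by (auto simp: square_integrable_def)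
  have le: "?K * sq_mass lborel f \<le> (2 * ?K) * sq_mass lborel (\<lambda>x. h n x - f x) + (4 * sq_mass lborel (\<lambda>u. fourier (h n) u - g u)) + 4 * sq_mass lborel g" for n
  proof -
    have "sq_mass lborel f \<le> 2 * sq_mass lborel (\<lambda>x. f x - h n x) + 2 * sq_mass lborel (h n)"
      using sq_mass_add_le[of "\<lambda>x. f x - h n x" lborel "h n"] by simp
    then have "?K * sq_mass lborel f \<le> ?K * (2 * sq_mass lborel (\<lambda>x. h n x - f x) + 2 * sq_mass lborel (h n))"
      by (intro mult_left_mono) (auto simp: sq_mass_diff_commute)
    also have "\<dots> = (2 * ?K) * sq_mass lborel (\<lambda>x. h n x - f x) + 2 * (?K * sq_mass lborel (h n))"
      by (simp add: distrib_left mult_ac)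
    also have "\<dots> \<le> (2 * ?K) * sq_mass lborel (\<lambda>x. h n x - f x) + 2 * (2 * sq_mass lborel (\<lambda>u. fourier (h n) u - g u) + 2 * sq_mass lborel g)"
    proof (intro add_left_mono mult_left_mono)
      have "sq_mass lborel (fourier (h n)) \<le> 2 * sq_mass lborel (\<lambda>u. fourier (h n) u - g u) + 2 * sq_mass lborel g"
        using sq_mass_add_le[of "\<lambda>u. fourier (h n) u - g u" lborel g] by simp
      then show "?K * sq_mass lborel (h n) \<le> 2 * sq_mass lborel (\<lambda>u. fourier (h n) u - g u) + 2 * sq_mass lborel g"
        by (rule order_trans[OF Plancherel_le[OF h]])
    qed simp
    finally show ?thesis by (simp add: distrib_left mult.assoc[symmetric] add.assoc)
  qed
  have "(\<lambda>n. (2 * ?K) * sq_mass lborel (\<lambda>x. h n x - f x) + 4 * sq_mass lborel (\<lambda>u. fourier (h n) u - g u)) \<longlonglongrightarrow> 0"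
    by (intro ennreal_tendsto_0_add ennreal_tendsto_0_cmult 1 2) (auto simp: ennreal_mult_less_top)
  then have "(\<lambda>n. (2 * ?K) * sq_mass lborel (\<lambda>x. h n x - f x) + 4 * sq_mass lborel (\<lambda>u. fourier (h n) u - g u) + 4 * sq_mass lborel g) \<longlonglongrightarrow> 0 + 4 * sq_mass lborel g"
    by (intro tendsto_add tendsto_const)
  then have "?K * sq_mass lborel f \<le> 0 + 4 * sq_mass lborel g"
    by (rule LIMSEQ_le_const) (use le in auto)
  then show ?thesis by simp
qed

lemma square_integrable_lincomb:
  assumes "square_integrable h" "square_integrable k"
  shows "square_integrable (\<lambda>x. a * h x + b * k x)"
proof -
  have [measurable]: "h \<in> borel_measurable borel" "k \<in> borel_measurable borel"
    using assms by (auto simp: square_integrable_def)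
  have "sq_mass lborel (\<lambda>x. a * h x + b * k x) \<le> 2 * sq_mass lborel (\<lambda>x. a *\<^sub>R h x) + 2 * sq_mass lborel (\<lambda>x. b *\<^sub>R k x)"
    using sq_mass_add_le[of "\<lambda>x. a *\<^sub>R h x" lborel "\<lambda>x. b *\<^sub>R k x"] by simp
  also have "\<dots> < \<infinity>"
    using assms unfolding square_integrable_iff_sq_mass
    by (subst (1 2) sq_mass_scaleR) (auto simp: ennreal_mult_less_top)
  finally show ?thesis by (simp add: square_integrable_iff_sq_mass)
qed

lemma square_integrable_translate:
  "square_integrable h \<Longrightarrow> square_integrable (\<lambda>x. h (x + z))"
  using sq_mass_translate[of h z] measurable_compose[of "\<lambda>x. x + z" borel borel h borel]
  by (simp add: square_integrable_iff_sq_mass)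

lemma fourier_L2_translate:
  fixes f :: "'a::euclidean_space \<Rightarrow> real"
  assumes F: "fourier_L2 f g" and [measurable]: "f \<in> borel_measurable borel"
  shows "fourier_L2 (\<lambda>x. f (x + z)) (\<lambda>u. exp (- (\<i> * complex_of_real (u \<bullet> z))) * g u)"
proof -
  obtain h where h: "\<And>n. integrable lborel (h n)" "\<And>n. square_integrable (h n)"
    and 1: "(\<lambda>n. sq_mass lborel (\<lambda>x. h n x - f x)) \<longlonglongrightarrow> 0"
    and 2: "(\<lambda>n. sq_mass lborel (\<lambda>u. fourier (h n) u - g u)) \<longlonglongrightarrow> 0"
    using F unfolding fourier_L2_iff by blast
  have [measurable]: "g \<in> borel_measurable borel" "h n \<in> borel_measurable borel" for n
    using fourier_L2_measurable[OF F] h(2)[of n] by (auto simp: square_integrable_def)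
  have e1: "sq_mass lborel (\<lambda>x. h n (x + z) - f (x + z)) = sq_mass lborel (\<lambda>x. h n x - f x)" for n
    by (rule sq_mass_translate[of "\<lambda>x. h n x - f x"]) measurable
  have e2: "sq_mass lborel (\<lambda>u. fourier (\<lambda>x. h n (x + z)) u - exp (- (\<i> * complex_of_real (u \<bullet> z))) * g u)
      = sq_mass lborel (\<lambda>u. fourier (h n) u - g u)" for n
    unfolding sq_mass_def fourier_translate[OF h(1)] right_diff_distrib[symmetric] by (simp add: norm_mult)
  show ?thesis
    unfolding fourier_L2_iff
    by (intro conjI exI[of _ "\<lambda>n x. h n (x + z)"])
      (use 1 2 h in \<open>auto simp: e1 e2 intro: integrable_translate square_integrable_translate\<close>)
qed

lemma fourier_L2_lincomb:
  fixes f f' :: "'a::euclidean_space \<Rightarrow> real"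
  assumes F: "fourier_L2 f g" "fourier_L2 f' g'" and [measurable]: "f \<in> borel_measurable borel" "f' \<in> borel_measurable borel"
  shows "fourier_L2 (\<lambda>x. a * f x + b * f' x) (\<lambda>u. complex_of_real a * g u + complex_of_real b * g' u)"
proof -
  obtain h where h: "\<And>n. integrable lborel (h n)" "\<And>n. square_integrable (h n)"
    and 1: "(\<lambda>n. sq_mass lborel (\<lambda>x. h n x - f x)) \<longlonglongrightarrow> 0"
    and 2: "(\<lambda>n. sq_mass lborel (\<lambda>u. fourier (h n) u - g u)) \<longlonglongrightarrow> 0"
    using F(1) unfolding fourier_L2_iff by blast
  obtain h' where h': "\<And>n. integrable lborel (h' n)" "\<And>n. square_integrable (h' n)"
    and k1: "(\<lambda>n. sq_mass lborel (\<lambda>x. h' n x - f' x)) \<longlonglongrightarrow> 0"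
    and k2: "(\<lambda>n. sq_mass lborel (\<lambda>u. fourier (h' n) u - g' u)) \<longlonglongrightarrow> 0"
    using F(2) unfolding fourier_L2_iff by blast
  have [measurable]: "g \<in> borel_measurable borel" "h n \<in> borel_measurable borel"
    "g' \<in> borel_measurable borel" "h' n \<in> borel_measurable borel" for n
    using fourier_L2_measurable[OF F(1)] h(2)[of n] fourier_L2_measurable[OF F(2)] h'(2)[of n] by (auto simp: square_integrable_def)
  show ?thesis
    unfolding fourier_L2_iff
  proof (intro conjI exI[of _ "\<lambda>n x. a * h n x + b * h' n x"] allI)
    show "(\<lambda>u. complex_of_real a * g u + complex_of_real b * g' u) \<in> borel_measurable borel" by measurable
    show "integrable lborel (\<lambda>x. a * h n x + b * h' n x)" for n using h(1) h'(1) by auto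
    show "square_integrable (\<lambda>x. a * h n x + b * h' n x)" for n using h(2) h'(2) by (rule square_integrable_lincomb)
    show "(\<lambda>n. sq_mass lborel (\<lambda>x. a * h n x + b * h' n x - (a * f x + b * f' x))) \<longlonglongrightarrow> 0"
    proof (rule ennreal_tendsto_0_bound)
      show "(\<lambda>n. (2 * ennreal (a\<^sup>2)) * sq_mass lborel (\<lambda>x. h n x - f x) + (2 * ennreal (b\<^sup>2)) * sq_mass lborel (\<lambda>x. h' n x - f' x)) \<longlonglongrightarrow> 0"
        by (intro ennreal_tendsto_0_add ennreal_tendsto_0_cmult 1 k1) (auto simp: ennreal_mult_less_top)
      have "sq_mass lborel (\<lambda>x. a *\<^sub>R (h n x - f x) + b *\<^sub>R (h' n x - f' x))
        \<le> 2 * sq_mass lborel (\<lambda>x. a *\<^sub>R (h n x - f x)) + 2 * sq_mass lborel (\<lambda>x. b *\<^sub>R (h' n x - f' x))" for n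
        by (rule sq_mass_add_le) measurable
      then show "\<forall>\<^sub>F n in sequentially. sq_mass lborel (\<lambda>x. a * h n x + b * h' n x - (a * f x + b * f' x))
        \<le> (2 * ennreal (a\<^sup>2)) * sq_mass lborel (\<lambda>x. h n x - f x) + (2 * ennreal (b\<^sup>2)) * sq_mass lborel (\<lambda>x. h' n x - f' x)"
        by (subst (asm) (1 2) sq_mass_scaleR) (auto simp: algebra_simps)
    qed
    show "(\<lambda>n. sq_mass lborel (\<lambda>u. fourier (\<lambda>x. a * h n x + b * h' n x) u - (complex_of_real a * g u + complex_of_real b * g' u))) \<longlonglongrightarrow> 0"
    proof (rule ennreal_tendsto_0_bound)
      show "(\<lambda>n. (2 * ennreal (a\<^sup>2)) * sq_mass lborel (\<lambda>u. fourier (h n) u - g u) + (2 * ennreal (b\<^sup>2)) * sq_mass lborel (\<lambda>u. fourier (h' n) u - g' u)) \<longlonglongrightarrow> 0"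
        by (intro ennreal_tendsto_0_add ennreal_tendsto_0_cmult 2 k2) (auto simp: ennreal_mult_less_top)
      have "sq_mass lborel (\<lambda>u. a *\<^sub>R (fourier (h n) u - g u) + b *\<^sub>R (fourier (h' n) u - g' u))
        \<le> 2 * sq_mass lborel (\<lambda>u. a *\<^sub>R (fourier (h n) u - g u)) + 2 * sq_mass lborel (\<lambda>u. b *\<^sub>R (fourier (h' n) u - g' u))" for n
        by (rule sq_mass_add_le) measurable
      then show "\<forall>\<^sub>F n in sequentially. sq_mass lborel (\<lambda>u. fourier (\<lambda>x. a * h n x + b * h' n x) u - (complex_of_real a * g u + complex_of_real b * g' u))
        \<le> (2 * ennreal (a\<^sup>2)) * sq_mass lborel (\<lambda>u. fourier (h n) u - g u) + (2 * ennreal (b\<^sup>2)) * sq_mass lborel (\<lambda>u. fourier (h' n) u - g' u)"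
        unfolding fourier_lincomb[OF h(1) h'(1)]
        by (subst (asm) (1 2) sq_mass_scaleR) (auto simp: algebra_simps scaleR_conv_of_real)
    qed
  qed
qed

lemma fourier_L2_zero: "fourier_L2 (\<lambda>_::'a::euclidean_space. 0) (\<lambda>_. 0)"
  unfolding fourier_L2_iff
  by (intro conjI exI[of _ "\<lambda>_ _. 0"]) (auto simp: square_integrable_def fourier_def sq_mass_def)

lemma fourier_L2_sum:
  fixes f :: "'i \<Rightarrow> 'a::euclidean_space \<Rightarrow> real"
  assumes "finite I" and "\<And>i. i \<in> I \<Longrightarrow> fourier_L2 (f i) (g i)" and "\<And>i. i \<in> I \<Longrightarrow> f i \<in> borel_measurable borel"
  shows "fourier_L2 (\<lambda>x. \<Sum>i\<in>I. c i * f i x) (\<lambda>u. \<Sum>i\<in>I. complex_of_real (c i) * g i u)"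
  using assms
proof (induction I rule: finite_induct)
  case empty
  show ?case using fourier_L2_zero by simp
next
  case (insert i I)
  have "fourier_L2 (\<lambda>x. c i * f i x + 1 * (\<Sum>i\<in>I. c i * f i x)) (\<lambda>u. complex_of_real (c i) * g i u + complex_of_real 1 * (\<Sum>i\<in>I. complex_of_real (c i) * g i u))"
    using insert by (intro fourier_L2_lincomb borel_measurable_sum) auto
  then show ?case using insert by simp
qed

text \<open>The graph of the extended Fourier transform is closed, by a diagonal choice among the
  approximating sequences.\<close>

lemma fourier_L2_limit:
  fixes q :: "nat \<Rightarrow> 'a::euclidean_space \<Rightarrow> real"
  assumes F: "\<And>k. fourier_L2 (q k) (m k)" and [measurable]: "\<And>k. q k \<in> borel_measurable borel"
    and [measurable]: "G \<in> borel_measurable borel" "\<gamma> \<in> borel_measurable borel"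
    and lq: "(\<lambda>k. sq_mass lborel (\<lambda>x. q k x - G x)) \<longlonglongrightarrow> 0"
    and lm: "(\<lambda>k. sq_mass lborel (\<lambda>u. m k u - \<gamma> u)) \<longlonglongrightarrow> 0"
  shows "fourier_L2 G \<gamma>"
proof -
  have mm[measurable]: "m k \<in> borel_measurable borel" for k by (rule fourier_L2_measurable[OF F])
  have "\<exists>h. integrable lborel h \<and> square_integrable h \<and> sq_mass lborel (\<lambda>x. h x - q k x) \<le> ennreal (1 / Suc k)
      \<and> sq_mass lborel (\<lambda>u. fourier h u - m k u) \<le> ennreal (1 / Suc k)" for k
  proof -
    obtain h where h: "\<And>n. integrable lborel (h n)" "\<And>n. square_integrable (h n)"
      and 1: "(\<lambda>n. sq_mass lborel (\<lambda>x. h n x - q k x)) \<longlonglongrightarrow> 0"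
      and 2: "(\<lambda>n. sq_mass lborel (\<lambda>u. fourier (h n) u - m k u)) \<longlonglongrightarrow> 0"
      using F unfolding fourier_L2_iff by blast
    have "\<forall>\<^sub>F n in sequentially. sq_mass lborel (\<lambda>x. h n x - q k x) \<le> ennreal (1 / Suc k) \<and> sq_mass lborel (\<lambda>u. fourier (h n) u - m k u) \<le> ennreal (1 / Suc k)"
      by (intro eventually_conj ennreal_tendsto_0D 1 2) auto
    from eventually_happens'[OF sequentially_bot this] obtain n where "sq_mass lborel (\<lambda>x. h n x - q k x) \<le> ennreal (1 / Suc k) \<and> sq_mass lborel (\<lambda>u. fourier (h n) u - m k u) \<le> ennreal (1 / Suc k)"
      by blast
    then show ?thesis using h by blast
  qed
  then obtain h where h: "\<And>k. integrable lborel (h k)" "\<And>k. square_integrable (h k)"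
      and 1: "\<And>k. sq_mass lborel (\<lambda>x. h k x - q k x) \<le> ennreal (1 / Suc k)"
      and 2: "\<And>k. sq_mass lborel (\<lambda>u. fourier (h k) u - m k u) \<le> ennreal (1 / Suc k)"
    by metis
  have [measurable]: "h k \<in> borel_measurable borel" for k using h(2)[of k] by (simp add: square_integrable_def)
  have z: "(\<lambda>k. ennreal (1 / Suc k)) \<longlonglongrightarrow> 0"
    using tendsto_ennrealI[OF LIMSEQ_Suc[OF lim_1_over_n[where 'a=real]]] by simp
  show ?thesis
    unfolding fourier_L2_iff
  proof (intro conjI exI[of _ h] allI h)
    show "(\<lambda>k. sq_mass lborel (\<lambda>x. h k x - G x)) \<longlonglongrightarrow> 0"
    proof (rule ennreal_tendsto_0_bound)
      show "(\<lambda>k. 2 * ennreal (1 / Suc k) + 2 * sq_mass lborel (\<lambda>x. q k x - G x)) \<longlonglongrightarrow> 0"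
        by (intro ennreal_tendsto_0_add ennreal_tendsto_0_cmult lq z) auto
      show "\<forall>\<^sub>F k in sequentially. sq_mass lborel (\<lambda>x. h k x - G x) \<le> 2 * ennreal (1 / Suc k) + 2 * sq_mass lborel (\<lambda>x. q k x - G x)"
      proof (intro always_eventually allI)
        fix k
        show "sq_mass lborel (\<lambda>x. h k x - G x) \<le> 2 * ennreal (1 / Suc k) + 2 * sq_mass lborel (\<lambda>x. q k x - G x)"
          by (rule order_trans[OF sq_mass_triangle[of _ _ "q k"]]; (intro add_right_mono mult_left_mono 1)?) auto
      qed
    qed
    show "(\<lambda>k. sq_mass lborel (\<lambda>x. fourier (h k) x - \<gamma> x)) \<longlonglongrightarrow> 0"
    proof (rule ennreal_tendsto_0_bound)
      show "(\<lambda>k. 2 * ennreal (1 / Suc k) + 2 * sq_mass lborel (\<lambda>x. m k x - \<gamma> x)) \<longlonglongrightarrow> 0"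
        by (intro ennreal_tendsto_0_add ennreal_tendsto_0_cmult lm z) auto
      show "\<forall>\<^sub>F k in sequentially. sq_mass lborel (\<lambda>x. fourier (h k) x - \<gamma> x) \<le> 2 * ennreal (1 / Suc k) + 2 * sq_mass lborel (\<lambda>x. m k x - \<gamma> x)"
      proof (intro always_eventually allI)
        fix k
        show "sq_mass lborel (\<lambda>x. fourier (h k) x - \<gamma> x) \<le> 2 * ennreal (1 / Suc k) + 2 * sq_mass lborel (\<lambda>x. m k x - \<gamma> x)"
          by (rule order_trans[OF sq_mass_triangle[of _ _ "m k"]]; (intro add_right_mono mult_left_mono 2)?) auto
      qed
    qed
  qed measurable
qed

lemma cmod_exp_i_minus_1: "cmod (exp (\<i> * complex_of_real t) - 1) \<le> \<bar>t\<bar>"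
  using iexp_approx1[of t 0] by simp

lemma cmod_exp_i_linear: "cmod (exp (\<i> * complex_of_real t) - 1 - \<i> * complex_of_real t) \<le> t\<^sup>2 / 2"
  using iexp_approx1[of t 1] by (simp add: algebra_simps power2_eq_square)

lemma cmod_exp_i_linear_le: "cmod (exp (\<i> * complex_of_real t) - 1 - \<i> * complex_of_real t) \<le> 2 * \<bar>t\<bar>"
  using norm_triangle_ineq4[of "exp (\<i> * complex_of_real t) - 1" "\<i> * complex_of_real t"] cmod_exp_i_minus_1[of t]
  by (simp add: norm_mult)

text \<open>Difference quotients have the multipliers \<open>n (e\<^sup>-\<^sup>i\<^sup>u\<^sup>\<bullet>\<^sup>b\<^sup>/\<^sup>n - 1)\<close>, which converge to \<open>- i u \<bullet> b\<close> and are
  dominated by \<open>|u|\<close>. So the transforms converge in \<open>L\<^sup>2\<close>, and by Plancherel's inequality the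
  quotients themselves are a Cauchy sequence.\<close>

lemma L2_directional_derivative:
  fixes f :: "'a::euclidean_space \<Rightarrow> real"
  assumes F: "fourier_L2 f g" and [measurable]: "f \<in> borel_measurable borel"
    and fin: "(\<integral>\<^sup>+u. ennreal ((cmod (g u))\<^sup>2 * (norm u)\<^sup>2) \<partial>lborel) < \<infinity>" and b: "norm b \<le> 1"
  obtains G where "square_integrable G"
    "fourier_L2 G (\<lambda>u. - (\<i> * complex_of_real (u \<bullet> b)) * g u)"
    "(\<lambda>n. sq_mass lborel (\<lambda>x. Suc n * (f (x + (1 / Suc n) *\<^sub>R b) - f x) - G x)) \<longlonglongrightarrow> 0"
proof -
  have [measurable]: "g \<in> borel_measurable borel" by (rule fourier_L2_measurable[OF F])
  define q where "q n x = Suc n * (f (x + (1 / Suc n) *\<^sub>R b) - f x)" for n x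
  define m where "m n u = Suc n * (exp (- (\<i> * complex_of_real (u \<bullet> ((1 / Suc n) *\<^sub>R b)))) - 1) * g u" for n u
  define \<gamma> where "\<gamma> u = - (\<i> * complex_of_real (u \<bullet> b)) * g u" for u
  have [measurable]: "q n \<in> borel_measurable borel" "m n \<in> borel_measurable borel" "\<gamma> \<in> borel_measurable borel" for n
    unfolding q_def[abs_def] m_def[abs_def] \<gamma>_def[abs_def] by measurable
  have Fq: "fourier_L2 (q n) (m n)" for n
  proof -
    have "fourier_L2 (\<lambda>x. Suc n * f (x + (1 / Suc n) *\<^sub>R b) + (- Suc n) * f x)
      (\<lambda>u. complex_of_real (Suc n) * (exp (- (\<i> * complex_of_real (u \<bullet> ((1 / Suc n) *\<^sub>R b)))) * g u) + complex_of_real (- Suc n) * g u)"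
      by (intro fourier_L2_lincomb fourier_L2_translate F) auto
    then show ?thesis
      unfolding q_def[abs_def] m_def[abs_def] by (simp add: algebra_simps)
  qed
  have mb: "cmod (m n u - \<gamma> u) \<le> min (2 * norm u * cmod (g u)) ((norm u)\<^sup>2 / 2 * cmod (g u) / Suc n)" for n u
  proof -
    let ?t = "- (u \<bullet> b) / Suc n"
    have t: "\<bar>u \<bullet> b\<bar> \<le> norm u"
      using Cauchy_Schwarz_ineq2[of u b] b mult_left_mono[OF b, of "norm u"] by simp
    have "m n u - \<gamma> u = Suc n * (exp (\<i> * complex_of_real ?t) - 1 - \<i> * complex_of_real ?t) * g u"
      unfolding m_def \<gamma>_def by (simp add: field_simps del: of_nat_Suc)
    then have e: "cmod (m n u - \<gamma> u) = Suc n * cmod (exp (\<i> * complex_of_real ?t) - 1 - \<i> * complex_of_real ?t) * cmod (g u)"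
      by (simp add: norm_mult del: of_nat_Suc)
    have "Suc n * cmod (exp (\<i> * complex_of_real ?t) - 1 - \<i> * complex_of_real ?t) \<le> Suc n * (2 * \<bar>?t\<bar>)"
      by (intro mult_left_mono cmod_exp_i_linear_le) auto
    also have "\<dots> \<le> 2 * norm u" using t by simp
    finally have 1: "cmod (m n u - \<gamma> u) \<le> 2 * norm u * cmod (g u)"
      unfolding e by (intro mult_right_mono) auto
    have "Suc n * cmod (exp (\<i> * complex_of_real ?t) - 1 - \<i> * complex_of_real ?t) \<le> Suc n * (?t\<^sup>2 / 2)"
      by (intro mult_left_mono cmod_exp_i_linear) auto
    also have "\<dots> = (u \<bullet> b)\<^sup>2 / 2 / Suc n" by (simp add: field_simps power2_eq_square del: of_nat_Suc)
    also have "\<dots> \<le> (norm u)\<^sup>2 / 2 / Suc n"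
      using power_mono[OF t, of 2] by (intro divide_right_mono) auto
    finally have 2: "cmod (m n u - \<gamma> u) \<le> (norm u)\<^sup>2 / 2 / Suc n * cmod (g u)"
      unfolding e by (intro mult_right_mono) auto
    show ?thesis using 1 2 by (simp add: field_simps del: of_nat_Suc)
  qed
  have lm: "(\<lambda>n. sq_mass lborel (\<lambda>u. m n u - \<gamma> u)) \<longlonglongrightarrow> 0"
  proof -
    have "(\<lambda>n. \<integral>\<^sup>+u. ennreal ((cmod (m n u - \<gamma> u))\<^sup>2) \<partial>lborel) \<longlonglongrightarrow> (\<integral>\<^sup>+u. 0 \<partial>(lborel :: 'a measure))"
    proof (rule nn_integral_dominated_convergence[where w="\<lambda>u. 4 * ennreal ((cmod (g u))\<^sup>2 * (norm u)\<^sup>2)"])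
      show "AE u in lborel. ennreal ((cmod (m n u - \<gamma> u))\<^sup>2) \<le> 4 * ennreal ((cmod (g u))\<^sup>2 * (norm u)\<^sup>2)" for n
      proof (rule AE_I2)
        fix u
        have "(cmod (m n u - \<gamma> u))\<^sup>2 \<le> (2 * norm u * cmod (g u))\<^sup>2"
          using mb[of n u] by (intro power_mono) auto
        also have "\<dots> = 4 * ((cmod (g u))\<^sup>2 * (norm u)\<^sup>2)" by (simp add: power_mult_distrib)
        finally have "ennreal ((cmod (m n u - \<gamma> u))\<^sup>2) \<le> ennreal (4 * ((cmod (g u))\<^sup>2 * (norm u)\<^sup>2))" by (rule ennreal_leI)
        then show "ennreal ((cmod (m n u - \<gamma> u))\<^sup>2) \<le> 4 * ennreal ((cmod (g u))\<^sup>2 * (norm u)\<^sup>2)"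
          by (simp add: ennreal_mult')
      qed
      show "(\<integral>\<^sup>+u. 4 * ennreal ((cmod (g u))\<^sup>2 * (norm u)\<^sup>2) \<partial>lborel) < \<infinity>"
        using fin by (simp add: nn_integral_cmult ennreal_mult_less_top)
      show "AE u in lborel. (\<lambda>n. ennreal ((cmod (m n u - \<gamma> u))\<^sup>2)) \<longlonglongrightarrow> 0"
      proof (rule AE_I2)
        fix u
        have "(\<lambda>n. (norm u)\<^sup>2 / 2 * cmod (g u) * (1 / Suc n)) \<longlonglongrightarrow> (norm u)\<^sup>2 / 2 * cmod (g u) * 0"
          by (intro tendsto_mult_left LIMSEQ_Suc[OF lim_1_over_n])
        then have l: "(\<lambda>n. (norm u)\<^sup>2 / 2 * cmod (g u) * (1 / Suc n)) \<longlonglongrightarrow> 0" by (simp only: mult_zero_right)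
        have "(\<lambda>n. cmod (m n u - \<gamma> u)) \<longlonglongrightarrow> 0"
        proof (rule tendsto_sandwich[OF _ _ tendsto_const l]; intro always_eventually allI)
          fix n
          show "0 \<le> cmod (m n u - \<gamma> u)" by simp
          show "cmod (m n u - \<gamma> u) \<le> (norm u)\<^sup>2 / 2 * cmod (g u) * (1 / Suc n)"
            using mb[of n u] by simp
        qed
        then have "(\<lambda>n. ennreal ((cmod (m n u - \<gamma> u))\<^sup>2)) \<longlonglongrightarrow> ennreal (0\<^sup>2)"
          by (intro tendsto_ennrealI tendsto_power)
        then show "(\<lambda>n. ennreal ((cmod (m n u - \<gamma> u))\<^sup>2)) \<longlonglongrightarrow> 0" by simp
      qed
    qed measurable
    then show ?thesis by (simp add: sq_mass_def)
  qed
  let ?K = "(2 * pi) ^ DIM('a)"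
  have qm: "ennreal ?K * sq_mass lborel (\<lambda>x. q i x - q j x) \<le> 8 * sq_mass lborel (\<lambda>u. m i u - \<gamma> u) + 8 * sq_mass lborel (\<lambda>u. m j u - \<gamma> u)" for i j
  proof -
    have "fourier_L2 (\<lambda>x. 1 * q i x + (- 1) * q j x) (\<lambda>u. complex_of_real 1 * m i u + complex_of_real (- 1) * m j u)"
      by (intro fourier_L2_lincomb Fq) auto
    then have "ennreal ?K * sq_mass lborel (\<lambda>x. q i x - q j x) \<le> 4 * sq_mass lborel (\<lambda>u. m i u - m j u)"
      by (intro fourier_L2_Plancherel_le) auto
    also have "\<dots> \<le> 4 * (2 * sq_mass lborel (\<lambda>u. m i u - \<gamma> u) + 2 * sq_mass lborel (\<lambda>u. \<gamma> u - m j u))"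
      by (intro mult_left_mono sq_mass_triangle) auto
    finally show ?thesis
      by (simp add: distrib_left mult.assoc[symmetric] sq_mass_diff_commute[of _ \<gamma>])
  qed
  obtain G where Gm[measurable]: "G \<in> borel_measurable lborel" and lG: "(\<lambda>n. sq_mass lborel (\<lambda>x. q n x - G x)) \<longlonglongrightarrow> 0"
  proof (rule L2_complete[of q lborel])
    fix e :: real assume e: "e > 0"
    have "\<forall>\<^sub>F n in sequentially. sq_mass lborel (\<lambda>u. m n u - \<gamma> u) \<le> ennreal (?K * e / 16)"
      by (rule ennreal_tendsto_0D[OF lm]) (use e in auto)
    then obtain n0 where n0: "\<And>n. n \<ge> n0 \<Longrightarrow> sq_mass lborel (\<lambda>u. m n u - \<gamma> u) \<le> ennreal (?K * e / 16)"
      by (auto simp: eventually_sequentially)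
    have "sq_mass lborel (\<lambda>x. q i x - q j x) \<le> ennreal e" if "i \<ge> n0" "j \<ge> n0" for i j
    proof -
      have "ennreal ?K * sq_mass lborel (\<lambda>x. q i x - q j x) \<le> 8 * ennreal (?K * e / 16) + 8 * ennreal (?K * e / 16)"
        by (rule order_trans[OF qm]) (intro add_mono mult_left_mono n0 that; simp)
      also have "\<dots> = ennreal (16 * (?K * e / 16))"
      proof -
        have "8 * ennreal c + 8 * ennreal c = ennreal (16 * c)" if "0 \<le> c" for c
          using that by (simp add: distrib_right[symmetric] ennreal_mult')
        then show ?thesis using e by simp
      qed
      also have "\<dots> = ennreal ?K * ennreal e" using e by (subst ennreal_mult[symmetric]) auto
      finally show ?thesis
        by (subst (asm) ennreal_mult_le_mult_iff) auto
    qed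
    then show "\<exists>n0. \<forall>i\<ge>n0. \<forall>j\<ge>n0. sq_mass lborel (\<lambda>x. q i x - q j x) \<le> ennreal e" by blast
  qed auto
  have Gm'[measurable]: "G \<in> borel_measurable borel" using Gm by simp
  have FG: "fourier_L2 G \<gamma>"
    by (rule fourier_L2_limit[OF Fq _ _ _ lG lm]) auto
  have "ennreal ?K * sq_mass lborel G \<le> 4 * sq_mass lborel \<gamma>"
    by (rule fourier_L2_Plancherel_le[OF FG]) simp
  also have "4 * sq_mass lborel \<gamma> \<le> 4 * (\<integral>\<^sup>+u. ennreal ((cmod (g u))\<^sup>2 * (norm u)\<^sup>2) \<partial>lborel)"
    unfolding sq_mass_def
  proof (intro mult_left_mono nn_integral_mono ennreal_leI)
    fix u
    have t: "\<bar>u \<bullet> b\<bar> \<le> norm u"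
      using Cauchy_Schwarz_ineq2[of u b] b mult_left_mono[OF b, of "norm u"] by simp
    show "(norm (\<gamma> u))\<^sup>2 \<le> (cmod (g u))\<^sup>2 * (norm u)\<^sup>2"
      using mult_right_mono[OF power_mono[OF t, of 2], of "(cmod (g u))\<^sup>2"] by (simp add: \<gamma>_def norm_mult power_mult_distrib mult.commute)
  qed simp
  also have "\<dots> < \<infinity>" using fin by (simp add: ennreal_mult_less_top)
  finally have "ennreal ?K * sq_mass lborel G < \<infinity>" .
  then have "square_integrable G"
    by (auto simp: square_integrable_iff_sq_mass ennreal_mult_less_top)
  then show thesis
    using that[of G] FG lG by (simp add: q_def[abs_def] \<gamma>_def[abs_def])
qed

section \<open>Test functions and uniqueness of weak gradients\<close>

text \<open>The derivatives of \<open>e\<^sup>-\<^sup>1\<^sup>/\<^sup>t\<close> are linear combinations of these functions, so the family is closed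
  under differentiation and smoothness follows by induction on the order.\<close>

definition flat_exp :: "nat \<Rightarrow> real \<Rightarrow> real" where
  "flat_exp k t = (if t > 0 then exp (- 1 / t) / t ^ k else 0)"

text \<open>Decay of second order at \<open>0\<close> is what makes the derivative at \<open>0\<close> vanish. It follows from
  \<open>e\<^sup>s \<ge> (1 + s/m)\<^sup>m\<close> with \<open>s = 1/t\<close> and \<open>m = k + 2\<close>.\<close>

lemma flat_exp_square_bound: "\<bar>flat_exp k t\<bar> \<le> real (k + 2) ^ (k + 2) * t\<^sup>2"
proof (cases "t > 0")
  case True
  let ?n = "k + 2"
  define m where "m = real ?n"
  have m: "m > 0" "m = real ?n" by (auto simp: m_def)
  have "((1/t) / m) ^ ?n \<le> (1 + (1/t) / m) ^ ?n"
    using True m by (intro power_mono) auto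
  also have "\<dots> \<le> exp (1/t)"
    unfolding m(2) using True by (intro exp_ge_one_plus_x_over_n_power_n) (auto intro: order_trans[of _ 0])
  finally have "((1/t) / m) ^ ?n * exp (- 1/t) \<le> exp (1/t) * exp (- 1/t)"
    by (intro mult_right_mono) auto
  also have "\<dots> = 1" by (simp add: exp_minus)
  also have "((1/t) / m) ^ ?n = 1 / (m * t) ^ ?n" by (simp add: power_divide mult.commute)
  finally have "exp (- 1/t) / (m * t) ^ ?n \<le> 1" by simp
  moreover have "0 < (m * t) ^ ?n" using True m by simp
  ultimately have "exp (- 1/t) \<le> real ?n ^ ?n * t ^ ?n"
    by (simp only: divide_le_eq_1_pos) (simp only: power_mult_distrib m(2))
  then have "exp (- 1/t) / t ^ k \<le> real ?n ^ ?n * t ^ ?n / t ^ k"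
    using True by (intro divide_right_mono) auto
  also have "\<dots> = real ?n ^ ?n * t\<^sup>2" using True by (simp add: power_add power2_eq_square del: of_nat_add)
  finally show ?thesis using True by (simp add: flat_exp_def)
qed (simp add: flat_exp_def)

lemma flat_exp_deriv:
  "(flat_exp k has_real_derivative (flat_exp (k + 2) t - real k * flat_exp (k + 1) t)) (at t)"
proof -
  consider "t > 0" | "t < 0" | "t = 0" by linarith
  then show ?thesis
  proof cases
    case 1
    have "((\<lambda>t. exp (- 1 / t) / t ^ k) has_real_derivative (flat_exp (k + 2) t - real k * flat_exp (k + 1) t)) (at t)"
      using 1 by (auto intro!: derivative_eq_intros simp: flat_exp_def)
        (cases k; simp add: field_simps power2_eq_square)
    then show ?thesis
      by (rule DERIV_cong_ev[THEN iffD1, rotated -1])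
        (use 1 in \<open>auto simp: flat_exp_def eventually_nhds_metric dist_real_def intro!: exI[of _ t]\<close>)
  next
    case 2
    have "((\<lambda>t. 0) has_real_derivative (flat_exp (k + 2) t - real k * flat_exp (k + 1) t)) (at t)"
      using 2 by (simp add: flat_exp_def)
    then show ?thesis
      by (rule DERIV_cong_ev[THEN iffD1, rotated -1])
        (use 2 in \<open>auto simp: flat_exp_def eventually_nhds_metric dist_real_def intro!: exI[of _ "- t"]\<close>)
  next
    case 3
    define C where "C = real (k + 2) ^ (k + 2)"
    have "((\<lambda>h. (flat_exp k (0 + h) - flat_exp k 0) / h) \<longlongrightarrow> 0) (at 0)"
    proof (rule Lim_null_comparison)
      show "\<forall>\<^sub>F h in at 0. norm ((flat_exp k (0 + h) - flat_exp k 0) / h) \<le> C * \<bar>h\<bar>"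
      proof (rule eventually_at_filter[THEN iffD2], intro always_eventually allI impI)
        fix h :: real assume "h \<noteq> 0"
        have "norm ((flat_exp k (0 + h) - flat_exp k 0) / h) = \<bar>flat_exp k h\<bar> / \<bar>h\<bar>" by (simp add: flat_exp_def abs_divide)
        also have "\<dots> \<le> (C * h\<^sup>2) / \<bar>h\<bar>" unfolding C_def by (intro divide_right_mono flat_exp_square_bound) auto
        also have "C * h\<^sup>2 / \<bar>h\<bar> = C * \<bar>h\<bar>"
          using \<open>h \<noteq> 0\<close> by (simp add: power2_eq_square field_simps)
        finally show "norm ((flat_exp k (0 + h) - flat_exp k 0) / h) \<le> C * \<bar>h\<bar>" .
      qed
      have "((\<lambda>h. C * \<bar>h\<bar>) \<longlongrightarrow> C * \<bar>0\<bar>) (at 0)" by (intro tendsto_intros)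
      then show "((\<lambda>h. C * \<bar>h\<bar>) \<longlongrightarrow> 0) (at 0)" by (simp only: abs_zero mult_zero_right)
    qed
    then show ?thesis using 3 by (simp add: DERIV_def flat_exp_def)
  qed
qed

lemma k_times_C_SucI:
  assumes "\<And>x. (\<phi> has_derivative D x) (at x)" and "\<And>b. b \<in> Basis \<Longrightarrow> k_times_C k (\<lambda>x. D x b)"
  shows "k_times_C (Suc k) \<phi>"
proof -
  have "frechet_derivative \<phi> (at x) = D x" for x
    using frechet_derivative_at[OF assms(1)] by simp
  then show ?thesis using assms by (auto simp: differentiable_def)
qed

lemma k_times_C_SucD:
  assumes "k_times_C (Suc k) \<phi>"
  shows "(\<phi> has_derivative frechet_derivative \<phi> (at x)) (at x)"
    and "b \<in> Basis \<Longrightarrow> k_times_C k (\<lambda>x. frechet_derivative \<phi> (at x) b)"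
  using assms by (auto simp: frechet_derivative_works)

lemma k_times_C_down: "k_times_C (Suc k) \<phi> \<Longrightarrow> k_times_C k \<phi>"
proof (induction k arbitrary: \<phi>)
  case 0
  then have "\<forall>x. isCont \<phi> x" by (auto intro: differentiable_imp_continuous_within)
  then show ?case by (simp add: continuous_on_eq_continuous_at)
next
  case (Suc k)
  show ?case
    by (rule k_times_C_SucI[OF k_times_C_SucD(1)[OF Suc.prems]]) (rule Suc.IH[OF k_times_C_SucD(2)[OF Suc.prems]])
qed

lemma k_times_C_add: "k_times_C k f \<Longrightarrow> k_times_C k g \<Longrightarrow> k_times_C k (\<lambda>x. f x + g x)"
proof (induction k arbitrary: f g)
  case (Suc k)
  show ?case
    by (rule k_times_C_SucI[OF has_derivative_add[OF k_times_C_SucD(1)[OF Suc.prems(1)] k_times_C_SucD(1)[OF Suc.prems(2)]]])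
      (intro Suc.IH k_times_C_SucD(2) Suc.prems)
qed (auto intro: continuous_intros)

lemma k_times_C_mult: "k_times_C k f \<Longrightarrow> k_times_C k g \<Longrightarrow> k_times_C k (\<lambda>x. f x * g x)"
proof (induction k arbitrary: f g)
  case (Suc k)
  show ?case
    by (rule k_times_C_SucI[OF has_derivative_mult[OF k_times_C_SucD(1)[OF Suc.prems(1)] k_times_C_SucD(1)[OF Suc.prems(2)]]])
      (intro k_times_C_add Suc.IH k_times_C_down[OF Suc.prems(1)] k_times_C_down[OF Suc.prems(2)]
        k_times_C_SucD(2)[OF Suc.prems(1)] k_times_C_SucD(2)[OF Suc.prems(2)])
qed (auto intro: continuous_intros)

lemma k_times_C_const: "k_times_C k (\<lambda>_. c)"
proof (induction k arbitrary: c)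
  case (Suc k)
  show ?case by (rule k_times_C_SucI[OF has_derivative_const]) (rule Suc.IH)
qed simp

lemma k_times_C_prod: "finite I \<Longrightarrow> (\<And>i. i \<in> I \<Longrightarrow> k_times_C k (f i)) \<Longrightarrow> k_times_C k (\<lambda>x. \<Prod>i\<in>I. f i x)"
  by (induction I rule: finite_induct) (auto intro: k_times_C_const k_times_C_mult)

lemma k_times_C_flat_exp: "k_times_C k (\<lambda>x. flat_exp j (x \<bullet> c + d))"
proof (induction k arbitrary: j)
  case 0
  have "isCont (flat_exp j) t" for t using flat_exp_deriv by (rule DERIV_isCont)
  then have "continuous_on UNIV (flat_exp j)" by (simp add: continuous_on_eq_continuous_at)
  moreover have "continuous_on UNIV (\<lambda>x. x \<bullet> c + d)" by (intro continuous_intros)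
  ultimately show ?case using continuous_on_compose2[of UNIV "flat_exp j" UNIV "\<lambda>x. x \<bullet> c + d"] by simp
next
  case (Suc k)
  let ?e = "\<lambda>j x. flat_exp j (x \<bullet> c + d)"
  have "((\<lambda>x. ?e j x) has_derivative (\<lambda>h. (h \<bullet> c) * (?e (j + 2) x + (- real j) * ?e (j + 1) x))) (at x)" for x
  proof -
    have "((\<lambda>x. x \<bullet> c + d) has_derivative (\<lambda>h. h \<bullet> c)) (at x)"
      by (auto intro!: derivative_eq_intros)
    from DERIV_compose_FDERIV[OF flat_exp_deriv this] show ?thesis by (simp add: algebra_simps)
  qed
  then show ?case
    by (rule k_times_C_SucI) (intro k_times_C_mult k_times_C_add k_times_C_const Suc.IH)
qed

text \<open>A product of one-sided cutoffs \<open>e\<^sup>-\<^sup>1\<^sup>/\<^sup>n\<^sup>t\<close> in the distances \<open>t\<close> to the faces of a box; as \<open>n\<close> grows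
  it converges to the indicator of the open box.\<close>

definition box_bump :: "nat \<Rightarrow> 'a \<Rightarrow> 'a \<Rightarrow> 'a::euclidean_space \<Rightarrow> real" where
  "box_bump n a b x = (\<Prod>i\<in>Basis. flat_exp 0 (x \<bullet> (real n *\<^sub>R i) + - real n * (a \<bullet> i))
     * flat_exp 0 (x \<bullet> (- real n *\<^sub>R i) + real n * (b \<bullet> i)))"

lemma flat_exp_0_range: "0 \<le> flat_exp 0 t" "flat_exp 0 t \<le> 1"
  by (auto simp: flat_exp_def)

lemma box_bump_range: "0 \<le> box_bump n a b x" "box_bump n a b x \<le> 1"
  unfolding box_bump_def
  by (auto intro!: prod_nonneg prod_le_1 mult_nonneg_nonneg mult_le_one flat_exp_0_range)

lemma box_bump_outside: "x \<notin> box a b \<Longrightarrow> box_bump n a b x = 0"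
proof -
  assume "x \<notin> box a b"
  then obtain i where i: "i \<in> Basis" "x \<bullet> i \<le> a \<bullet> i \<or> b \<bullet> i \<le> x \<bullet> i"
    by (auto simp: mem_box not_less)
  then have "flat_exp 0 (x \<bullet> (real n *\<^sub>R i) + - real n * (a \<bullet> i)) * flat_exp 0 (x \<bullet> (- real n *\<^sub>R i) + real n * (b \<bullet> i)) = 0"
    using mult_left_mono[of "x \<bullet> i" "a \<bullet> i" "real n"] mult_left_mono[of "b \<bullet> i" "x \<bullet> i" "real n"]
    by (auto simp: flat_exp_def)
  then show ?thesis unfolding box_bump_def using i(1) by (intro prod_zero) auto
qed

lemma test_function_box_bump: "test_function (box_bump n a b)"
  unfolding test_function_def
proof (intro conjI allI)
  show "k_times_C k (box_bump n a b)" for k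
    unfolding box_bump_def[abs_def] by (intro k_times_C_prod k_times_C_mult k_times_C_flat_exp) auto
  have "{x. box_bump n a b x \<noteq> 0} \<subseteq> box a b" using box_bump_outside by blast
  then have "bounded {x. box_bump n a b x \<noteq> 0}" using bounded_box bounded_subset by blast
  then show "compact (closure {x. box_bump n a b x \<noteq> 0})" by (simp add: compact_closure)
qed

lemma flat_exp_0_limit:
  assumes "t > 0"
  shows "(\<lambda>n. flat_exp 0 (real n * t)) \<longlonglongrightarrow> 1"
proof -
  have "(\<lambda>n. exp (- (1 / t) * (1 / real n))) \<longlonglongrightarrow> exp (- (1 / t) * 0)"
    by (intro tendsto_exp tendsto_mult_left lim_1_over_n)
  then have l: "(\<lambda>n. exp (- (1 / t) * (1 / real n))) \<longlonglongrightarrow> 1" by (simp only: mult_zero_right exp_zero)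
  have "\<forall>\<^sub>F n in sequentially. exp (- (1 / t) * (1 / real n)) = flat_exp 0 (real n * t)"
    using eventually_gt_at_top[of 0]
  proof eventually_elim
    case (elim n)
    then show ?case using assms by (simp add: flat_exp_def mult.commute)
  qed
  from Lim_transform_eventually[OF l this] show ?thesis .
qed

lemma box_bump_limit: "(\<lambda>n. box_bump n a b x) \<longlonglongrightarrow> indicator (box a b) x"
proof (cases "x \<in> box a b")
  case True
  have "(\<lambda>n. box_bump n a b x) \<longlonglongrightarrow> (\<Prod>i\<in>(Basis::'a set). 1 * 1)"
    unfolding box_bump_def
  proof (intro tendsto_prod tendsto_mult)
    fix i :: 'a assume i: "i \<in> Basis"
    have "(\<lambda>n. flat_exp 0 (real n * (x \<bullet> i - a \<bullet> i))) \<longlonglongrightarrow> 1"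
      "(\<lambda>n. flat_exp 0 (real n * (b \<bullet> i - x \<bullet> i))) \<longlonglongrightarrow> 1"
      using True i by (auto intro!: flat_exp_0_limit simp: mem_box)
    then show "(\<lambda>n. flat_exp 0 (x \<bullet> (real n *\<^sub>R i) + - real n * (a \<bullet> i))) \<longlonglongrightarrow> 1"
      "(\<lambda>n. flat_exp 0 (x \<bullet> (- real n *\<^sub>R i) + real n * (b \<bullet> i))) \<longlonglongrightarrow> 1"
      by (simp_all add: algebra_simps)
  qed
  then show ?thesis using True by simp
qed (simp add: box_bump_outside)

lemma test_function_continuous: "test_function \<phi> \<Longrightarrow> continuous_on UNIV \<phi>"
  unfolding test_function_def by (metis k_times_C.simps(1))

lemma test_function_measurable: "test_function \<phi> \<Longrightarrow> \<phi> \<in> borel_measurable borel"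
  by (rule borel_measurable_continuous_onI[OF test_function_continuous])

lemma test_function_bounded_support:
  fixes \<phi> :: "'a::euclidean_space \<Rightarrow> real"
  assumes "test_function \<phi>"
  obtains R B where "0 < R" "0 \<le> B" "\<And>x. \<bar>\<phi> x\<bar> \<le> B * indicator (cball 0 R) x"
proof -
  let ?S = "closure {x. \<phi> x \<noteq> 0}"
  have S: "compact ?S" using assms by (simp add: test_function_def)
  then obtain R where R: "R > 0" "?S \<subseteq> cball 0 R"
    using compact_imp_bounded[of ?S] unfolding bounded_pos by (auto simp: subset_eq)
  have "compact (\<phi> ` cball 0 R)"
    using test_function_continuous[OF assms] by (intro compact_continuous_image) (auto intro: continuous_on_subset)
  then obtain B where B: "\<And>x. x \<in> cball 0 R \<Longrightarrow> \<bar>\<phi> x\<bar> \<le> B"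
    using compact_imp_bounded bounded_iff by (metis imageI real_norm_def)
  have "0 \<le> B" using B[of 0] R by auto
  moreover have "\<bar>\<phi> x\<bar> \<le> B * indicator (cball 0 R) x" for x
  proof (cases "x \<in> cball 0 R")
    case False
    have "\<phi> x = 0"
    proof (rule ccontr)
      assume "\<phi> x \<noteq> 0"
      then have "x \<in> ?S" by (intro closure_subset[THEN subsetD]) simp
      from subsetD[OF R(2) this] False show False by contradiction
    qed
    then show ?thesis using False by simp
  qed (use B in auto)
  ultimately show thesis using that R(1) by blast
qed

lemma integrable_mult_test_function:
  fixes H :: "'a::euclidean_space \<Rightarrow> real"
  assumes H: "\<And>K. compact K \<Longrightarrow> set_integrable lborel K H" and [measurable]: "H \<in> borel_measurable borel"
    and \<phi>: "test_function \<phi>"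
  shows "integrable lborel (\<lambda>x. H x * \<phi> x)"
proof -
  note [measurable] = test_function_measurable[OF \<phi>]
  obtain R B where RB: "0 \<le> B" "\<And>x. \<bar>\<phi> x\<bar> \<le> B * indicator (cball 0 R) x"
    using test_function_bounded_support[OF \<phi>] by metis
  have "integrable lborel (\<lambda>x. B * (indicator (cball 0 R) x *\<^sub>R H x))"
    using H[of "cball 0 R"] by (simp add: set_integrable_def)
  then show ?thesis
  proof (rule Bochner_Integration.integrable_bound)
    show "AE x in lborel. norm (H x * \<phi> x) \<le> norm (B * (indicator (cball 0 R) x *\<^sub>R H x))"
    proof (rule AE_I2)
      fix x
      have "\<bar>H x\<bar> * \<bar>\<phi> x\<bar> \<le> \<bar>H x\<bar> * (B * indicator (cball 0 R) x)"
        by (intro mult_left_mono RB) auto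
      then show "norm (H x * \<phi> x) \<le> norm (B * (indicator (cball 0 R) x *\<^sub>R H x))"
        using RB(1) by (simp add: abs_mult mult_ac)
    qed
  qed measurable
qed

text \<open>Smooth bumps approximate indicators of open boxes, so the integral of \<open>H\<close> over every box
  vanishes. Boxes form an intersection-stable generator of the Borel sets, hence the integral
  of \<open>H\<close> over every Borel subset of a box vanishes.\<close>

lemma du_Bois_Reymond:
  fixes H :: "'a::euclidean_space \<Rightarrow> real"
  assumes H: "\<And>K. compact K \<Longrightarrow> set_integrable lborel K H" and [measurable]: "H \<in> borel_measurable borel"
    and 0: "\<And>\<phi>. test_function \<phi> \<Longrightarrow> (\<integral>x. H x * \<phi> x \<partial>lborel) = 0"
  shows "AE x in lborel. H x = 0"
proof -
  have box0: "(\<integral>x. indicator (box a b) x * H x \<partial>lborel) = 0" for a b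
  proof -
    have i: "integrable lborel (\<lambda>x. indicator (cbox a b) x * H x)"
      using H[of "cbox a b"] by (simp add: set_integrable_def)
    have "(\<lambda>n. \<integral>x. H x * box_bump n a b x \<partial>lborel) \<longlonglongrightarrow> (\<integral>x. indicator (box a b) x * H x \<partial>lborel)"
    proof (rule integral_dominated_convergence[where w="\<lambda>x. \<bar>indicator (cbox a b) x * H x\<bar>"])
      show "integrable lborel (\<lambda>x. \<bar>indicator (cbox a b) x * H x\<bar>)" using i by simp
      show "(\<lambda>x. H x * box_bump n a b x) \<in> borel_measurable lborel" for n
        using test_function_measurable[OF test_function_box_bump, of n a b] by measurable
      show "AE x in lborel. (\<lambda>n. H x * box_bump n a b x) \<longlonglongrightarrow> indicator (box a b) x * H x"
        by (intro AE_I2) (subst mult.commute, intro tendsto_mult_left box_bump_limit)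
      show "AE x in lborel. norm (H x * box_bump n a b x) \<le> \<bar>indicator (cbox a b) x * H x\<bar>" for n
      proof (rule AE_I2)
        fix x
        show "norm (H x * box_bump n a b x) \<le> \<bar>indicator (cbox a b) x * H x\<bar>"
        proof (cases "x \<in> box a b")
          case True
          then have "x \<in> cbox a b" using box_subset_cbox by blast
          then show ?thesis using box_bump_range[of n a b x] by (simp add: abs_mult mult_left_le)
        qed (simp add: box_bump_outside)
      qed
    qed measurable
    moreover have "(\<integral>x. H x * box_bump n a b x \<partial>lborel) = 0" for n
      by (rule 0[OF test_function_box_bump])
    ultimately show ?thesis by (simp add: LIMSEQ_const_iff)
  qed
  have Q: "AE x in lborel. x \<in> box a b \<longrightarrow> H x = 0" for a b :: 'a
  proof -
    let ?h = "\<lambda>x. indicator (box a b) x * H x"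
    have i: "integrable lborel ?h"
    proof (rule Bochner_Integration.integrable_bound)
      show "integrable lborel (\<lambda>x. indicator (cbox a b) x * H x)"
        using H[of "cbox a b"] by (simp add: set_integrable_def)
      show "AE x in lborel. norm (?h x) \<le> norm (indicator (cbox a b) x * H x)"
        using box_subset_cbox[of a b] by (intro AE_I2) (auto simp: indicator_def)
    qed measurable
    have "(LINT x:A|lborel. ?h x) = 0" if A: "A \<in> sets borel" for A
    proof -
      have st: "Int_stable (range (\<lambda>(a, b). box a b :: 'a set))"
        by (auto simp: Int_stable_def box_Int_box)
      have pow: "range (\<lambda>(a, b). box a b :: 'a set) \<subseteq> Pow UNIV" by simp
      have "A \<in> sigma_sets UNIV (range (\<lambda>(a, b). box a b))"
        using A unfolding borel_eq_box by simp
      with st pow show ?thesis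
      proof (induction rule: sigma_sets_induct_disjoint)
        case (basic A)
        then obtain c d where A: "A = box c d" by auto
        obtain e k where ek: "box c d \<inter> box a b = box e k" using box_Int_box by blast
        have "(LINT x:A|lborel. ?h x) = (\<integral>x. indicator (box e k) x * H x \<partial>lborel)"
          unfolding set_lebesgue_integral_def A ek[symmetric]
          by (intro Bochner_Integration.integral_cong refl) (auto simp: indicator_def)
        then show ?case using box0 by simp
      next
        case (compl A)
        then have [measurable]: "A \<in> sets borel" unfolding borel_eq_box by simp
        have "(LINT x:UNIV - A|lborel. ?h x) = (\<integral>x. ?h x - indicator A x *\<^sub>R ?h x \<partial>lborel)"
          unfolding set_lebesgue_integral_def by (intro Bochner_Integration.integral_cong refl) (auto simp: indicator_def)
        also have "\<dots> = (\<integral>x. ?h x \<partial>lborel) - (LINT x:A|lborel. ?h x)"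
          unfolding set_lebesgue_integral_def
          using integrable_mult_indicator[of A lborel ?h] i by (intro Bochner_Integration.integral_diff) auto
        finally show ?case using compl box0 by simp
      next
        case (union A)
        then have [measurable]: "A i \<in> sets borel" for i unfolding borel_eq_box by auto
        have "(LINT x:(\<Union>i. A i)|lborel. ?h x) = (\<Sum>i. (LINT x:(A i)|lborel. ?h x))"
        proof (rule lebesgue_integral_countable_add)
          show "set_integrable lborel (\<Union>i. A i) ?h"
            unfolding set_integrable_def by (intro integrable_mult_indicator i) auto
        qed (use union(1) in \<open>auto simp: disjoint_family_on_def\<close>)
        then show ?case using union by simp
      qed (simp add: set_lebesgue_integral_def)
    qed
    then have "AE x in lborel. ?h x = 0" by (intro sigma_finite_measure.density_zero[OF sigma_finite_lborel i]) auto
    then show ?thesis by eventually_elim (auto simp: indicator_def split: if_splits)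
  qed
  have "AE x in lborel. \<forall>n::nat. x \<in> box (- real n *\<^sub>R One) (real n *\<^sub>R One) \<longrightarrow> H x = 0"
    unfolding AE_all_countable using Q by blast
  then show ?thesis
  proof eventually_elim
    case (elim x)
    have "x \<in> (\<Union>i::nat. box (- (real i *\<^sub>R One)) (real i *\<^sub>R One))"
      unfolding UN_box_eq_UNIV by simp
    then obtain n :: nat where "x \<in> box (- real n *\<^sub>R One) (real n *\<^sub>R One)"
      by auto
    then show ?case using elim by blast
  qed
qed

text \<open>Allows \<^const>\<open>weak_gradient\<close>, which is an arbitrary choice, to be replaced by the gradient
  constructed from the Fourier transform.\<close>

lemma weak_gradient_unique:
  fixes f :: "'a::euclidean_space \<Rightarrow> real"
  assumes "is_weak_gradient f g" "is_weak_gradient f g'"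
  shows "AE x in lborel. g x = g' x"
proof -
  have [measurable]: "g \<in> borel_measurable borel" "g' \<in> borel_measurable borel"
    using assms by (auto simp: is_weak_gradient_def)
  have loc: "set_integrable lborel K (\<lambda>x. g x \<bullet> b)" "set_integrable lborel K (\<lambda>x. g' x \<bullet> b)" if "compact K" for K b
    using assms that unfolding is_weak_gradient_def set_integrable_def
    by (auto simp: inner_scaleR_left[symmetric] simp del: inner_scaleR_left)
  have "AE x in lborel. \<forall>b\<in>Basis. g x \<bullet> b - g' x \<bullet> b = 0"
  proof (intro AE_finite_allI finite_Basis)
    fix b :: 'a assume b: "b \<in> Basis"
    show "AE x in lborel. g x \<bullet> b - g' x \<bullet> b = 0"
    proof (rule du_Bois_Reymond)
      show "set_integrable lborel K (\<lambda>x. g x \<bullet> b - g' x \<bullet> b)" if "compact K" for K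
        using loc[OF that] by (rule set_integral_diff)
      fix \<phi> :: "'a \<Rightarrow> real" assume \<phi>: "test_function \<phi>"
      have "(\<integral>x. (g x \<bullet> b - g' x \<bullet> b) * \<phi> x \<partial>lborel) = (\<integral>x. (g x \<bullet> b) * \<phi> x \<partial>lborel) - (\<integral>x. (g' x \<bullet> b) * \<phi> x \<partial>lborel)"
        unfolding left_diff_distrib using loc \<phi>
        by (intro Bochner_Integration.integral_diff integrable_mult_test_function) auto
      also have "\<dots> = 0"
      proof -
        have "(LINT x|lborel. f x * frechet_derivative \<phi> (at x) b) = - (LINT x|lborel. (g x \<bullet> b) * \<phi> x)"
          "(LINT x|lborel. f x * frechet_derivative \<phi> (at x) b) = - (LINT x|lborel. (g' x \<bullet> b) * \<phi> x)"
          using assms b \<phi> unfolding is_weak_gradient_def by auto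
        then show ?thesis by linarith
      qed
      finally show "(\<integral>x. (g x \<bullet> b - g' x \<bullet> b) * \<phi> x \<partial>lborel) = 0" .
    qed measurable
  qed
  then show ?thesis
    by eventually_elim (auto intro: euclidean_eqI)
qed

section \<open>Sobolev functions: weak gradient and Taylor defect\<close>

lemma L2_Cauchy_Schwarz:
  fixes f g :: "'b \<Rightarrow> real"
  assumes [measurable]: "f \<in> borel_measurable N" "g \<in> borel_measurable N"
    and f2: "integrable N (\<lambda>x. (f x)\<^sup>2)" and g2: "integrable N (\<lambda>x. (g x)\<^sup>2)"
  shows "integrable N (\<lambda>x. f x * g x)"
    and "\<bar>\<integral>x. f x * g x \<partial>N\<bar> \<le> sqrt (\<integral>x. (f x)\<^sup>2 \<partial>N) * sqrt (\<integral>x. (g x)\<^sup>2 \<partial>N)"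
proof -
  have le: "\<bar>f x * g x\<bar> \<le> (f x)\<^sup>2 + (g x)\<^sup>2" for x
    using zero_le_power2[of "\<bar>f x\<bar> - \<bar>g x\<bar>"] zero_le_power2[of "f x"] zero_le_power2[of "g x"]
    unfolding power2_diff power2_abs abs_mult by linarith
  show i: "integrable N (\<lambda>x. f x * g x)"
  proof (rule Bochner_Integration.integrable_bound[OF Bochner_Integration.integrable_add[OF f2 g2]])
    show "AE x in N. norm (f x * g x) \<le> norm ((f x)\<^sup>2 + (g x)\<^sup>2)"
    proof (rule AE_I2)
      fix x
      show "norm (f x * g x) \<le> norm ((f x)\<^sup>2 + (g x)\<^sup>2)"
        using le[of x] abs_ge_self[of "(f x)\<^sup>2 + (g x)\<^sup>2"] unfolding real_norm_def by linarith
    qed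
  qed measurable
  have nn: "0 \<le> (\<integral>x. \<bar>f x * g x\<bar> \<partial>N)" "0 \<le> (\<integral>x. (f x)\<^sup>2 \<partial>N)" "0 \<le> (\<integral>x. (g x)\<^sup>2 \<partial>N)" by simp_all
  have "(\<integral>\<^sup>+x. ennreal \<bar>f x\<bar> * ennreal \<bar>g x\<bar> \<partial>N)\<^sup>2 \<le> (\<integral>\<^sup>+x. (ennreal \<bar>f x\<bar>)\<^sup>2 \<partial>N) * (\<integral>\<^sup>+x. (ennreal \<bar>g x\<bar>)\<^sup>2 \<partial>N)"
    by (rule Cauchy_Schwarz_nn_integral) measurable
  moreover have "(\<integral>\<^sup>+x. ennreal \<bar>f x\<bar> * ennreal \<bar>g x\<bar> \<partial>N) = ennreal (\<integral>x. \<bar>f x * g x\<bar> \<partial>N)"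
    using nn_integral_eq_integral[OF integrable_abs[OF i]] by (simp add: abs_mult ennreal_mult)
  moreover have "(\<integral>\<^sup>+x. (ennreal \<bar>f x\<bar>)\<^sup>2 \<partial>N) = ennreal (\<integral>x. (f x)\<^sup>2 \<partial>N)"
    using nn_integral_eq_integral[OF f2] by (simp add: ennreal_power)
  moreover have "(\<integral>\<^sup>+x. (ennreal \<bar>g x\<bar>)\<^sup>2 \<partial>N) = ennreal (\<integral>x. (g x)\<^sup>2 \<partial>N)"
    using nn_integral_eq_integral[OF g2] by (simp add: ennreal_power)
  ultimately have "(\<integral>x. \<bar>f x * g x\<bar> \<partial>N)\<^sup>2 \<le> (\<integral>x. (f x)\<^sup>2 \<partial>N) * (\<integral>x. (g x)\<^sup>2 \<partial>N)"
    using nn by (simp add: ennreal_power ennreal_mult[symmetric])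
  then have "(\<integral>x. \<bar>f x * g x\<bar> \<partial>N) \<le> sqrt ((\<integral>x. (f x)\<^sup>2 \<partial>N) * (\<integral>x. (g x)\<^sup>2 \<partial>N))"
    by (rule real_le_rsqrt)
  moreover have "\<bar>\<integral>x. f x * g x \<partial>N\<bar> \<le> (\<integral>x. \<bar>f x * g x\<bar> \<partial>N)"
    using integral_norm_bound[of N "\<lambda>x. f x * g x"] by simp
  ultimately show "\<bar>\<integral>x. f x * g x \<partial>N\<bar> \<le> sqrt (\<integral>x. (f x)\<^sup>2 \<partial>N) * sqrt (\<integral>x. (g x)\<^sup>2 \<partial>N)"
    unfolding real_sqrt_mult[symmetric] by linarith
qed

lemma L2_tendsto_inner:
  fixes q :: "nat \<Rightarrow> 'a::euclidean_space \<Rightarrow> real"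
  assumes q: "\<And>n. square_integrable (q n)" and G: "square_integrable G" and \<phi>: "square_integrable \<phi>"
    and lim: "(\<lambda>n. sq_mass lborel (\<lambda>x. q n x - G x)) \<longlonglongrightarrow> 0"
  shows "(\<lambda>n. \<integral>x. q n x * \<phi> x \<partial>lborel) \<longlonglongrightarrow> (\<integral>x. G x * \<phi> x \<partial>lborel)"
proof -
  have m[measurable]: "q n \<in> borel_measurable borel" "G \<in> borel_measurable borel" "\<phi> \<in> borel_measurable borel" for n
    using q[of n] G \<phi> by (auto simp: square_integrable_def)
  have i: "integrable lborel (\<lambda>x. (q n x)\<^sup>2)" "integrable lborel (\<lambda>x. (G x)\<^sup>2)" "integrable lborel (\<lambda>x. (\<phi> x)\<^sup>2)" for n
    using q[of n] G \<phi> by (auto simp: square_integrable_def)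
  have d: "integrable lborel (\<lambda>x. (q n x - G x)\<^sup>2)" for n
    using square_integrable_lincomb[OF q[of n] G, of 1 "-1"] by (simp add: square_integrable_def)
  have "(\<lambda>n. ennreal (\<integral>x. (q n x - G x)\<^sup>2 \<partial>lborel)) \<longlonglongrightarrow> ennreal 0"
    using lim by (simp add: sq_mass_real nn_integral_eq_integral[OF d])
  then have l: "(\<lambda>n. \<integral>x. (q n x - G x)\<^sup>2 \<partial>lborel) \<longlonglongrightarrow> 0"
    by (subst (asm) tendsto_ennreal_iff) auto
  have "(\<lambda>n. sqrt (\<integral>x. (q n x - G x)\<^sup>2 \<partial>lborel) * sqrt (\<integral>x. (\<phi> x)\<^sup>2 \<partial>lborel)) \<longlonglongrightarrow> sqrt 0 * sqrt (\<integral>x. (\<phi> x)\<^sup>2 \<partial>lborel)"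
    by (intro tendsto_mult_right tendsto_real_sqrt l)
  then have l2: "(\<lambda>n. sqrt (\<integral>x. (q n x - G x)\<^sup>2 \<partial>lborel) * sqrt (\<integral>x. (\<phi> x)\<^sup>2 \<partial>lborel)) \<longlonglongrightarrow> 0" by simp
  have e: "(\<integral>x. q n x * \<phi> x \<partial>lborel) - (\<integral>x. G x * \<phi> x \<partial>lborel) = (\<integral>x. (q n x - G x) * \<phi> x \<partial>lborel)" for n
    unfolding left_diff_distrib using L2_Cauchy_Schwarz(1)[of _ lborel \<phi>] i
    by (subst Bochner_Integration.integral_diff) auto
  have "(\<lambda>n. (\<integral>x. q n x * \<phi> x \<partial>lborel) - (\<integral>x. G x * \<phi> x \<partial>lborel)) \<longlonglongrightarrow> 0"
  proof (rule Lim_null_comparison[OF _ l2], intro always_eventually allI)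
    fix n
    show "norm ((\<integral>x. q n x * \<phi> x \<partial>lborel) - (\<integral>x. G x * \<phi> x \<partial>lborel)) \<le> sqrt (\<integral>x. (q n x - G x)\<^sup>2 \<partial>lborel) * sqrt (\<integral>x. (\<phi> x)\<^sup>2 \<partial>lborel)"
      unfolding e real_norm_def using d i by (intro L2_Cauchy_Schwarz(2)) auto
  qed
  then show ?thesis by (rule LIM_zero_cancel)
qed

lemma test_function_square_integrable:
  fixes \<phi> :: "'a::euclidean_space \<Rightarrow> real"
  assumes "test_function \<phi>"
  shows "square_integrable \<phi>"
proof -
  note [measurable] = test_function_measurable[OF assms]
  obtain R B where RB: "0 \<le> B" "\<And>x. \<bar>\<phi> x\<bar> \<le> B * indicator (cball 0 R) x"
    using test_function_bounded_support[OF assms] by metis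
  have "integrable lborel (\<lambda>x::'a. B\<^sup>2 * indicator (cball 0 R) x)"
    by (intro integrable_mult_right integrable_real_indicator emeasure_lborel_cball_finite) auto
  then have "integrable lborel (\<lambda>x. (\<phi> x)\<^sup>2)"
  proof (rule Bochner_Integration.integrable_bound)
    show "AE x in lborel. norm ((\<phi> x)\<^sup>2) \<le> norm (B\<^sup>2 * indicator (cball 0 R) x)"
    proof (rule AE_I2)
      fix x
      have "\<bar>\<phi> x\<bar>\<^sup>2 \<le> (B * indicator (cball 0 R) x)\<^sup>2" by (intro power_mono RB) auto
      then show "norm ((\<phi> x)\<^sup>2) \<le> norm (B\<^sup>2 * indicator (cball 0 R) x)"
        by (auto simp: indicator_def split: if_splits)
    qed
  qed measurable
  then show ?thesis by (simp add: square_integrable_def)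
qed

text \<open>A translation moves the difference quotient from \<open>f\<close> to the test function, where it converges
  boundedly and with a common compact support.\<close>

lemma L2_derivative_weak:
  fixes f :: "'a::euclidean_space \<Rightarrow> real"
  assumes f: "square_integrable f" and G: "square_integrable G" and b: "b \<in> Basis"
    and lim: "(\<lambda>n. sq_mass lborel (\<lambda>x. Suc n * (f (x + (1 / Suc n) *\<^sub>R b) - f x) - G x)) \<longlonglongrightarrow> 0"
    and \<phi>: "test_function \<phi>"
  shows "(\<integral>x. f x * frechet_derivative \<phi> (at x) b \<partial>lborel) = - (\<integral>x. G x * \<phi> x \<partial>lborel)"
proof -
  have [measurable]: "f \<in> borel_measurable borel" using f by (simp add: square_integrable_def)
  note [measurable] = test_function_measurable[OF \<phi>]
  have \<phi>2: "square_integrable \<phi>" by (rule test_function_square_integrable[OF \<phi>])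
  have C1: "k_times_C (Suc 0) \<phi>" using \<phi> unfolding test_function_def by blast
  define D where "D x = frechet_derivative \<phi> (at x) b" for x
  have Dc: "continuous_on UNIV D" using k_times_C_SucD(2)[OF C1 b] by (simp add: D_def[abs_def])
  have deriv: "((\<lambda>s. \<phi> (x - s *\<^sub>R b)) has_real_derivative - D (x - s *\<^sub>R b)) (at s)" for x s
  proof -
    have "((\<lambda>s. x - s *\<^sub>R b) has_derivative (\<lambda>h. - h *\<^sub>R b)) (at s)"
      by (auto intro!: derivative_eq_intros)
    from has_derivative_compose[OF this k_times_C_SucD(1)[OF C1]]
    have "((\<lambda>s. \<phi> (x - s *\<^sub>R b)) has_derivative (\<lambda>h. frechet_derivative \<phi> (at (x - s *\<^sub>R b)) (- h *\<^sub>R b))) (at s)" .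
    moreover
    have "frechet_derivative \<phi> (at (x - s *\<^sub>R b)) (- h *\<^sub>R b) = - D (x - s *\<^sub>R b) * h" for h
      using linear_scale[OF has_derivative_linear[OF k_times_C_SucD(1)[OF C1]], of "x - s *\<^sub>R b" "- h" b]
      by (simp add: D_def)
    then have "(\<lambda>h. frechet_derivative \<phi> (at (x - s *\<^sub>R b)) (- h *\<^sub>R b)) = (*) (- D (x - s *\<^sub>R b))"
      by (rule ext)
    ultimately show ?thesis unfolding has_field_derivative_def by (simp only:)
  qed
  obtain R B where RB: "0 < R" "0 \<le> B" "\<And>x. \<bar>\<phi> x\<bar> \<le> B * indicator (cball 0 R) x"
    using test_function_bounded_support[OF \<phi>] by metis
  have \<phi>0: "\<phi> x = 0" if "norm x > R" for x using RB(3)[of x] that by (simp add: indicator_def)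
  \<comment> \<open>The backward difference quotient of the test function, adjoint to the forward quotient of \<open>f\<close>.\<close>
  define p where "p n x = Suc n * (\<phi> (x - (1 / Suc n) *\<^sub>R b) - \<phi> x)" for n x
  have [measurable]: "p n \<in> borel_measurable borel" for n unfolding p_def[abs_def] by measurable
  have p_lim: "(\<lambda>n. p n x) \<longlonglongrightarrow> - D x" for x
  proof -
    have "((\<lambda>h. (\<phi> (x - (0 + h) *\<^sub>R b) - \<phi> (x - 0 *\<^sub>R b)) / h) \<longlongrightarrow> - D (x - 0 *\<^sub>R b)) (at 0)"
      using deriv[of x 0] by (simp only: DERIV_def)
    moreover have "filterlim (\<lambda>n. 1 / real (Suc n)) (at 0) sequentially"
      unfolding filterlim_at using LIMSEQ_Suc[OF lim_1_over_n[where 'a=real]] by (auto intro!: always_eventually)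
    ultimately have "(\<lambda>n. (\<phi> (x - (0 + 1 / real (Suc n)) *\<^sub>R b) - \<phi> (x - 0 *\<^sub>R b)) / (1 / real (Suc n))) \<longlonglongrightarrow> - D (x - 0 *\<^sub>R b)"
      by (rule filterlim_compose)
    then show ?thesis by (simp add: p_def mult.commute del: of_nat_Suc)
  qed
  have nb: "norm b = 1" using b by simp
  have p0: "p n x = 0" if "norm x > R + 1" for n x
  proof -
    have "norm x \<le> norm (x - (1 / Suc n) *\<^sub>R b) + norm ((1 / Suc n) *\<^sub>R b)"
      using norm_triangle_ineq[of "x - (1 / Suc n) *\<^sub>R b" "(1 / Suc n) *\<^sub>R b"] by simp
    moreover have "norm ((1 / Suc n) *\<^sub>R b) \<le> 1" using nb by simp
    ultimately have "norm (x - (1 / Suc n) *\<^sub>R b) > R" using that by linarith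
    then show ?thesis using \<phi>0 that by (simp add: p_def)
  qed
  have "compact (D ` cball 0 (R + 2))"
    using Dc by (intro compact_continuous_image) (auto intro: continuous_on_subset)
  then obtain C where C: "\<And>x. x \<in> cball 0 (R + 2) \<Longrightarrow> \<bar>D x\<bar> \<le> C"
    using compact_imp_bounded bounded_iff by (metis imageI real_norm_def)
  have C0: "0 \<le> C" using C[of 0] RB(1) by auto
  have pb: "\<bar>p n x\<bar> \<le> C * indicator (cball 0 (R + 1)) x" for n x
  proof (cases "x \<in> cball 0 (R + 1)")
    case True
    obtain s where s: "0 < s" "s < 1 / Suc n" "\<phi> (x - (1 / Suc n) *\<^sub>R b) - \<phi> (x - 0 *\<^sub>R b) = (1 / Suc n - 0) * - D (x - s *\<^sub>R b)"
      using MVT2[of 0 "1 / Suc n" "\<lambda>s. \<phi> (x - s *\<^sub>R b)" "\<lambda>s. - D (x - s *\<^sub>R b)"] deriv by auto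
    have "s \<le> 1" using s(2) by (rule order_trans[OF less_imp_le]) simp
    then have "norm (x - s *\<^sub>R b) \<le> R + 2"
      using True norm_triangle_ineq4[of x "s *\<^sub>R b"] nb s(1) by (simp add: dist_norm)
    then have "\<bar>D (x - s *\<^sub>R b)\<bar> \<le> C" by (intro C) simp
    moreover have "p n x = - D (x - s *\<^sub>R b)" using s(3) by (simp add: p_def del: of_nat_Suc)
    ultimately show ?thesis using True by simp
  next
    case False
    then show ?thesis using p0[of x n] by (simp add: dist_norm)
  qed
  have "(\<lambda>n. \<integral>x. f x * p n x \<partial>lborel) \<longlonglongrightarrow> (\<integral>x. f x * - D x \<partial>lborel)"
  proof (rule integral_dominated_convergence[where w="\<lambda>x. \<bar>f x * (C * indicator (cball 0 (R + 1)) x)\<bar>"])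
    have [measurable]: "cball (0::'a) (R + 1) \<in> sets borel" by (simp add: borel_closed)
    have "integrable lborel (\<lambda>x. f x * (C * indicator (cball 0 (R + 1)) x))"
    proof (rule L2_Cauchy_Schwarz(1))
      have "integrable lborel (\<lambda>x::'a. C\<^sup>2 * indicator (cball 0 (R + 1)) x)"
        by (intro integrable_mult_right integrable_real_indicator emeasure_lborel_cball_finite) auto
      moreover have "(C * indicator (cball 0 (R + 1)) x)\<^sup>2 = C\<^sup>2 * indicator (cball 0 (R + 1)) x" for x :: 'a
        by (simp add: indicator_def)
      ultimately show "integrable lborel (\<lambda>x::'a. (C * indicator (cball 0 (R + 1)) x)\<^sup>2)" by simp
      show "integrable lborel (\<lambda>x. (f x)\<^sup>2)" using f by (simp add: square_integrable_def)
    qed measurable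
    then show "integrable lborel (\<lambda>x. \<bar>f x * (C * indicator (cball 0 (R + 1)) x)\<bar>)" by (rule integrable_abs)
    show "(\<lambda>x. f x * - D x) \<in> borel_measurable lborel"
      using borel_measurable_continuous_onI[OF Dc] by measurable
    show "AE x in lborel. (\<lambda>n. f x * p n x) \<longlonglongrightarrow> f x * - D x"
      by (intro AE_I2 tendsto_mult_left p_lim)
    show "AE x in lborel. norm (f x * p n x) \<le> \<bar>f x * (C * indicator (cball 0 (R + 1)) x)\<bar>" for n
    proof (rule AE_I2)
      fix x
      show "norm (f x * p n x) \<le> \<bar>f x * (C * indicator (cball 0 (R + 1)) x)\<bar>"
        using mult_left_mono[OF pb[of n x], of "\<bar>f x\<bar>"] C0 by (simp add: abs_mult)
    qed
  qed measurable
  moreover have "(\<integral>x. f x * p n x \<partial>lborel) = (\<integral>x. Suc n * (f (x + (1 / Suc n) *\<^sub>R b) - f x) * \<phi> x \<partial>lborel)" for n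
  proof -
    let ?s = "(1 / Suc n) *\<^sub>R b"
    have fs: "square_integrable (\<lambda>x. f (x + ?s))" "square_integrable (\<lambda>x. \<phi> (x - ?s))"
      using square_integrable_translate[OF f, of ?s] square_integrable_translate[OF \<phi>2, of "- ?s"] by auto
    have i: "integrable lborel (\<lambda>x. f x * \<phi> (x - ?s))" "integrable lborel (\<lambda>x. f x * \<phi> x)" "integrable lborel (\<lambda>x. f (x + ?s) * \<phi> x)"
      using fs f \<phi>2 by (auto intro!: L2_Cauchy_Schwarz(1) simp: square_integrable_def)
    have "(\<integral>x. f x * p n x \<partial>lborel) = (\<integral>x. Suc n * (f x * \<phi> (x - ?s) - f x * \<phi> x) \<partial>lborel)"
      unfolding p_def by (intro Bochner_Integration.integral_cong refl) (simp add: algebra_simps)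
    also have "\<dots> = Suc n * ((\<integral>x. f x * \<phi> (x - ?s) \<partial>lborel) - (\<integral>x. f x * \<phi> x \<partial>lborel))"
      using i by simp
    also have "(\<integral>x. f x * \<phi> (x - ?s) \<partial>lborel) = (\<integral>x. f (x + ?s) * \<phi> x \<partial>lborel)"
      using integral_translate[of "\<lambda>x. f x * \<phi> (x - ?s)" ?s] by simp
    also have "Suc n * ((\<integral>x. f (x + ?s) * \<phi> x \<partial>lborel) - (\<integral>x. f x * \<phi> x \<partial>lborel)) = (\<integral>x. Suc n * (f (x + ?s) * \<phi> x - f x * \<phi> x) \<partial>lborel)"
      using i by simp
    also have "\<dots> = (\<integral>x. Suc n * (f (x + ?s) - f x) * \<phi> x \<partial>lborel)"
      by (intro Bochner_Integration.integral_cong refl) (simp add: algebra_simps)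
    finally show ?thesis .
  qed
  moreover have "(\<lambda>n. \<integral>x. Suc n * (f (x + (1 / Suc n) *\<^sub>R b) - f x) * \<phi> x \<partial>lborel) \<longlonglongrightarrow> (\<integral>x. G x * \<phi> x \<partial>lborel)"
  proof (rule L2_tendsto_inner[OF _ G \<phi>2 lim])
    fix n
    show "square_integrable (\<lambda>x. Suc n * (f (x + (1 / Suc n) *\<^sub>R b) - f x))"
      using square_integrable_lincomb[OF square_integrable_translate[OF f] f, of "Suc n" "(1 / Suc n) *\<^sub>R b" "- Suc n"]
      by (simp add: algebra_simps)
  qed
  ultimately have "(\<integral>x. f x * - D x \<partial>lborel) = (\<integral>x. G x * \<phi> x \<partial>lborel)"
    by (simp add: LIMSEQ_unique)
  then show ?thesis by (simp add: D_def)
qed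

text \<open>The gradient collects the \<open>L\<^sup>2\<close>-limits of the difference quotients along the basis. Then
  \<open>f(\<cdot> + z) - f - G \<bullet> z\<close> has the multiplier \<open>e\<^sup>-\<^sup>i\<^sup>u\<^sup>\<bullet>\<^sup>z - 1 + i u \<bullet> z\<close>, and Plancherel's inequality bounds its
  mass.\<close>

lemma sobolev_gradient:
  fixes f :: "'a::euclidean_space \<Rightarrow> real"
  assumes "f \<in> sobolev_H1"
  obtains G g where "is_weak_gradient f G" "G \<in> borel_measurable borel" "sq_mass lborel G < \<infinity>"
    "g \<in> borel_measurable borel" "(\<integral>\<^sup>+u. ennreal ((cmod (g u))\<^sup>2 * (norm u)\<^sup>2) \<partial>lborel) < \<infinity>"
    "\<And>z. ennreal ((2 * pi) ^ DIM('a)) * sq_mass lborel (\<lambda>x. f (x + z) - f x - G x \<bullet> z)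
      \<le> 4 * (\<integral>\<^sup>+u. ennreal ((cmod (exp (\<i> * complex_of_real (- (u \<bullet> z))) - 1 - \<i> * complex_of_real (- (u \<bullet> z))))\<^sup>2 * (cmod (g u))\<^sup>2) \<partial>lborel)"
proof -
  obtain g where f: "square_integrable f" and F: "fourier_L2 f g" and fin: "(\<integral>\<^sup>+u. ennreal ((cmod (g u))\<^sup>2 * (norm u)\<^sup>2) \<partial>lborel) < \<infinity>"
    using assms by (auto simp: sobolev_H1_def)
  have [measurable]: "f \<in> borel_measurable borel" using f by (simp add: square_integrable_def)
  have gm[measurable]: "g \<in> borel_measurable borel" by (rule fourier_L2_measurable[OF F])
  have "\<exists>G. square_integrable G \<and> fourier_L2 G (\<lambda>u. - (\<i> * complex_of_real (u \<bullet> b)) * g u) \<and>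
    (\<lambda>n. sq_mass lborel (\<lambda>x. Suc n * (f (x + (1 / Suc n) *\<^sub>R b) - f x) - G x)) \<longlonglongrightarrow> 0" if "b \<in> Basis" for b
    by (rule L2_directional_derivative[OF F _ fin, of b]) (use that in auto)
  then have "\<forall>b\<in>Basis. \<exists>G. square_integrable G \<and> fourier_L2 G (\<lambda>u. - (\<i> * complex_of_real (u \<bullet> b)) * g u) \<and>
    (\<lambda>n. sq_mass lborel (\<lambda>x. Suc n * (f (x + (1 / Suc n) *\<^sub>R b) - f x) - G x)) \<longlonglongrightarrow> 0" by (rule ballI)
  from bchoice[OF this] obtain G where G0: "\<forall>b\<in>Basis. square_integrable (G b) \<and> fourier_L2 (G b) (\<lambda>u. - (\<i> * complex_of_real (u \<bullet> b)) * g u) \<and>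
    (\<lambda>n. sq_mass lborel (\<lambda>x. Suc n * (f (x + (1 / Suc n) *\<^sub>R b) - f x) - G b x)) \<longlonglongrightarrow> 0" ..
  have G: "square_integrable (G b)"
    "fourier_L2 (G b) (\<lambda>u. - (\<i> * complex_of_real (u \<bullet> b)) * g u)"
    "(\<lambda>n. sq_mass lborel (\<lambda>x. Suc n * (f (x + (1 / Suc n) *\<^sub>R b) - f x) - G b x)) \<longlonglongrightarrow> 0"
    if "b \<in> Basis" for b using bspec[OF G0 that] by (iprover elim: conjE)+
  have Gm: "G b \<in> borel_measurable borel" if "b \<in> Basis" for b using G(1)[OF that] by (simp add: square_integrable_def)
  define V where "V x = (\<Sum>b\<in>Basis. G b x *\<^sub>R b)" for x
  have Vm[measurable]: "V \<in> borel_measurable borel" unfolding V_def[abs_def] using Gm by measurable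
  have Vb: "V x \<bullet> b = G b x" if "b \<in> Basis" for x b using that by (simp add: V_def)
  have V2: "(norm (V x))\<^sup>2 = (\<Sum>b\<in>Basis. (G b x)\<^sup>2)" for x
    by (subst norm_square_Basis) (intro sum.cong refl, simp add: Vb)
  have Vsq: "sq_mass lborel V < \<infinity>"
  proof -
    have "integrable lborel (\<lambda>x. (norm (V x))\<^sup>2)"
      unfolding V2 using G(1) by (intro Bochner_Integration.integrable_sum) (auto simp: square_integrable_def)
    then show ?thesis by (simp add: sq_mass_def integrable_iff_bounded)
  qed
  have "is_weak_gradient f V"
    unfolding is_weak_gradient_def
  proof (intro conjI allI impI ballI Vm)
    fix K :: "'a set" assume K: "compact K"
    have [measurable]: "K \<in> sets borel" using K by (simp add: compact_imp_closed borel_closed)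
    have Gi: "integrable lborel (\<lambda>x. G b x * indicator K x)" if "b \<in> Basis" for b
    proof (rule L2_Cauchy_Schwarz(1))
      have "integrable lborel (indicator K :: 'a \<Rightarrow> real)"
        using emeasure_compact_finite[OF K] by (intro integrable_real_indicator) auto
      moreover have "(indicator K x)\<^sup>2 = (indicator K x :: real)" for x by (simp add: indicator_def)
      ultimately show "integrable lborel (\<lambda>x. (indicator K x :: real)\<^sup>2)" by simp
    qed (use G(1)[OF that] Gm[OF that] in \<open>auto simp: square_integrable_def\<close>)
    have "integrable lborel (\<lambda>x. \<Sum>b\<in>Basis. (G b x * indicator K x) *\<^sub>R b)"
      using Gi by (intro Bochner_Integration.integrable_sum integrable_scaleR_left) auto
    then show "set_integrable lborel K V"
      unfolding set_integrable_def V_def by (simp add: scaleR_sum_right mult.commute)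
  next
    fix \<phi> :: "'a \<Rightarrow> real" and b :: 'a assume "test_function \<phi>" and b: "b \<in> Basis"
    then show "(LINT x|lborel. f x * frechet_derivative \<phi> (at x) b) = - (LINT x|lborel. (V x \<bullet> b) * \<phi> x)"
      using L2_derivative_weak[OF f G(1)[OF b] b G(3)[OF b]] by (simp add: Vb[OF b])
  qed
  moreover have "ennreal ((2 * pi) ^ DIM('a)) * sq_mass lborel (\<lambda>x. f (x + z) - f x - V x \<bullet> z)
      \<le> 4 * (\<integral>\<^sup>+u. ennreal ((cmod (exp (\<i> * complex_of_real (- (u \<bullet> z))) - 1 - \<i> * complex_of_real (- (u \<bullet> z))))\<^sup>2 * (cmod (g u))\<^sup>2) \<partial>lborel)" for z
  proof -
    let ?q = "\<lambda>x. 1 * (1 * f (x + z) + (- 1) * f x) + (- 1) * (\<Sum>b\<in>Basis. (z \<bullet> b) * G b x)"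
    let ?m = "\<lambda>u. complex_of_real 1 * (complex_of_real 1 * (exp (- (\<i> * complex_of_real (u \<bullet> z))) * g u) + complex_of_real (- 1) * g u)
        + complex_of_real (- 1) * (\<Sum>b\<in>Basis. complex_of_real (z \<bullet> b) * (- (\<i> * complex_of_real (u \<bullet> b)) * g u))"
    have sm: "(\<lambda>x. \<Sum>b\<in>Basis. (z \<bullet> b) * G b x) \<in> borel_measurable borel"
      using Gm by (intro borel_measurable_sum) auto
    have "fourier_L2 ?q ?m"
      by (intro fourier_L2_lincomb fourier_L2_translate F fourier_L2_sum G(2) finite_Basis Gm sm) measurable
    then have "ennreal ((2 * pi) ^ DIM('a)) * sq_mass lborel ?q \<le> 4 * sq_mass lborel ?m"
      by (rule fourier_L2_Plancherel_le) (use sm in measurable)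
    moreover have "?q = (\<lambda>x. f (x + z) - f x - V x \<bullet> z)"
    proof -
      have "V x \<bullet> z = (\<Sum>b\<in>Basis. (z \<bullet> b) * G b x)" for x
        unfolding V_def inner_sum_left by (intro sum.cong refl) (simp add: inner_commute mult.commute)
      then show ?thesis by (simp add: fun_eq_iff)
    qed
    moreover have "sq_mass lborel ?m = (\<integral>\<^sup>+u. ennreal ((cmod (exp (\<i> * complex_of_real (- (u \<bullet> z))) - 1 - \<i> * complex_of_real (- (u \<bullet> z))))\<^sup>2 * (cmod (g u))\<^sup>2) \<partial>lborel)"
    proof -
      have "?m u = (exp (\<i> * complex_of_real (- (u \<bullet> z))) - 1 - \<i> * complex_of_real (- (u \<bullet> z))) * g u" for u
      proof -
        have "(\<Sum>b\<in>Basis. complex_of_real (z \<bullet> b) * (- (\<i> * complex_of_real (u \<bullet> b)) * g u))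
            = - \<i> * complex_of_real (\<Sum>b\<in>Basis. (u \<bullet> b) * (z \<bullet> b)) * g u"
          by (simp add: sum_distrib_left sum_distrib_right mult_ac sum_negf)
        also have "(\<Sum>b\<in>Basis. (u \<bullet> b) * (z \<bullet> b)) = u \<bullet> z" by (rule euclidean_inner[symmetric])
        finally show ?thesis by (simp add: algebra_simps)
      qed
      then show ?thesis by (simp only: sq_mass_def norm_mult power_mult_distrib)
    qed
    ultimately show ?thesis by (simp only:)
  qed
  ultimately show thesis using that[of V g] Vsq gm fin Vm by blast
qed

definition taylor_defect :: "('a::euclidean_space \<Rightarrow> real) \<Rightarrow> ('a \<Rightarrow> 'a) \<Rightarrow> 'a \<Rightarrow> ennreal" where
  "taylor_defect f G y = sq_mass lborel (\<lambda>x. f (x + y) - f x - G x \<bullet> y)"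

text \<open>The multiplier is bounded both by \<open>2|u||y|\<close> and by \<open>|u|\<^sup>2|y|\<^sup>2/2\<close>. Averaging over the Gaussian gives
  \<open>\<sigma>\<^sup>2\<close> times an integrand dominated by a multiple of \<open>|u|\<^sup>2|g(u)|\<^sup>2\<close> that tends to \<open>0\<close> with \<open>\<sigma>\<close>. The bound \<open>\<theta>\<close> is a
  function of an upper bound \<open>\<delta>\<close> of \<open>\<sigma>\<^sup>2\<close>, so that one value serves a whole observation
  interval.\<close>

lemma sobolev_weak_gradient:
  fixes f :: "'a::euclidean_space \<Rightarrow> real"
  assumes "f \<in> sobolev_H1"
  shows "weak_gradient f \<in> borel_measurable borel" "sq_mass lborel (weak_gradient f) < \<infinity>"
    and "\<exists>\<theta>. (\<theta> \<longlongrightarrow> (0::real)) (at_right 0) \<and> (\<forall>\<sigma> \<delta>. 0 < \<sigma> \<longrightarrow> \<sigma>\<^sup>2 \<le> \<delta> \<longrightarrow>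
      (\<integral>\<^sup>+y. ennreal (gauss \<sigma> y) * taylor_defect f (weak_gradient f) y \<partial>lborel) \<le> ennreal (\<sigma>\<^sup>2 * \<theta> \<delta>))"
proof -
  obtain G g where G: "is_weak_gradient f G" "G \<in> borel_measurable borel" "sq_mass lborel G < \<infinity>"
    and gm[measurable]: "g \<in> borel_measurable borel" and fin: "(\<integral>\<^sup>+u. ennreal ((cmod (g u))\<^sup>2 * (norm u)\<^sup>2) \<partial>lborel) < \<infinity>"
    and R: "\<And>z. ennreal ((2 * pi) ^ DIM('a)) * sq_mass lborel (\<lambda>x. f (x + z) - f x - G x \<bullet> z)
      \<le> 4 * (\<integral>\<^sup>+u. ennreal ((cmod (exp (\<i> * complex_of_real (- (u \<bullet> z))) - 1 - \<i> * complex_of_real (- (u \<bullet> z))))\<^sup>2 * (cmod (g u))\<^sup>2) \<partial>lborel)"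
    by (rule sobolev_gradient[OF assms], rule that)
  have w: "is_weak_gradient f (weak_gradient f)"
    unfolding weak_gradient_def by (rule someI[of "is_weak_gradient f", OF G(1)])
  have ae: "AE x in lborel. weak_gradient f x = G x" by (rule weak_gradient_unique[OF w G(1)])
  show "weak_gradient f \<in> borel_measurable borel" using w by (simp add: is_weak_gradient_def)
  show "sq_mass lborel (weak_gradient f) < \<infinity>"
  proof -
    have "sq_mass lborel (weak_gradient f) = sq_mass lborel G"
      unfolding sq_mass_def by (rule nn_integral_cong_AE) (use ae in \<open>eventually_elim, simp\<close>)
    then show ?thesis using G(3) by simp
  qed
  have td: "taylor_defect f (weak_gradient f) y = taylor_defect f G y" for y
    unfolding taylor_defect_def sq_mass_def
    by (rule nn_integral_cong_AE) (use ae in \<open>eventually_elim, simp\<close>)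
  let ?K = "(2 * pi) ^ DIM('a)" and ?d = "real DIM('a)"
  let ?c = "\<lambda>u y. cmod (exp (\<i> * complex_of_real (- (u \<bullet> y))) - 1 - \<i> * complex_of_real (- (u \<bullet> y)))"
  \<comment> \<open>The two bounds on the multiplier, averaged with \<open>E|y|\<^sup>2 = d \<sigma>\<^sup>2\<close> and \<open>E|y|\<^sup>4 \<le> 3 d\<^sup>2 \<sigma>\<^sup>4\<close>; a factor \<open>\<sigma>\<^sup>2\<close> is taken out.\<close>
  define w where "w \<delta> u = (cmod (g u))\<^sup>2 * min (4 * ?d * (norm u)\<^sup>2) (3 / 4 * ?d\<^sup>2 * \<delta> * (norm u)^4)" for \<delta> u
  have wm[measurable]: "w \<delta> \<in> borel_measurable borel" for \<delta> unfolding w_def[abs_def] by measurable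
  have wb: "w \<delta> u \<le> 4 * ?d * ((cmod (g u))\<^sup>2 * (norm u)\<^sup>2)" for \<delta> u
    unfolding w_def by (subst mult.left_commute) (intro mult_left_mono, auto)
  have w0: "0 \<le> w \<delta> u" if "0 \<le> \<delta>" for \<delta> u unfolding w_def using that by auto
  have dom: "integrable lborel (\<lambda>u. 4 * ?d * ((cmod (g u))\<^sup>2 * (norm u)\<^sup>2))"
    using fin by (intro integrable_mult_right) (auto simp: integrable_iff_bounded)
  have wi: "integrable lborel (w \<delta>)" if "0 \<le> \<delta>" for \<delta>
  proof (rule Bochner_Integration.integrable_bound[OF dom])
    show "AE u in lborel. norm (w \<delta> u) \<le> norm (4 * ?d * ((cmod (g u))\<^sup>2 * (norm u)\<^sup>2))"
      using wb w0[OF that] by (intro AE_I2) (simp add: abs_of_nonneg)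
  qed measurable
  define \<theta> where "\<theta> \<delta> = 4 / ?K * (\<integral>u. w \<delta> u \<partial>lborel)" for \<delta>
  have lim: "(\<theta> \<longlongrightarrow> 0) (at_right 0)"
  proof (rule tendsto_at_right_sequentially[of 0 1])
    fix S :: "nat \<Rightarrow> real" assume S: "\<And>n. 0 < S n" "S \<longlonglongrightarrow> 0"
    have "(\<lambda>n. \<integral>u. w (S n) u \<partial>lborel) \<longlonglongrightarrow> (\<integral>u. 0 \<partial>(lborel :: 'a measure))"
    proof (rule integral_dominated_convergence[OF _ _ dom])
      show "AE u in lborel. (\<lambda>n. w (S n) u) \<longlonglongrightarrow> 0"
      proof (rule AE_I2)
        fix u
        have "(\<lambda>n. w (S n) u) \<longlonglongrightarrow> (cmod (g u))\<^sup>2 * min (4 * ?d * (norm u)\<^sup>2) (3 / 4 * ?d\<^sup>2 * 0 * (norm u)^4)"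
          unfolding w_def by (intro tendsto_intros S)
        then show "(\<lambda>n. w (S n) u) \<longlonglongrightarrow> 0" by simp
      qed
      show "AE u in lborel. norm (w (S n) u) \<le> 4 * ?d * ((cmod (g u))\<^sup>2 * (norm u)\<^sup>2)" for n
        using wb w0[OF less_imp_le[OF S(1)]] by (intro AE_I2) (simp add: abs_of_nonneg)
    qed measurable
    from tendsto_mult_left[OF this, of "4 / ?K"] show "(\<lambda>n. \<theta> (S n)) \<longlonglongrightarrow> 0" by (simp add: \<theta>_def)
  qed simp
  have bound: "(\<integral>\<^sup>+y. ennreal (gauss \<sigma> y) * taylor_defect f G y \<partial>lborel) \<le> ennreal (\<sigma>\<^sup>2 * \<theta> \<delta>)"
    if \<sigma>: "0 < \<sigma>" "\<sigma>\<^sup>2 \<le> \<delta>" for \<sigma> \<delta>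
  proof -
    have \<delta>: "0 \<le> \<delta>" using \<sigma>(2) zero_le_power2[of \<sigma>] by linarith
    have K: "?K > 0" by simp
    have "taylor_defect f G y \<le> ennreal (4 / ?K) * (\<integral>\<^sup>+u. ennreal ((?c u y)\<^sup>2 * (cmod (g u))\<^sup>2) \<partial>lborel)" for y
    proof -
      have "ennreal (1 / ?K) * (ennreal ?K * taylor_defect f G y) \<le> ennreal (1 / ?K) * (4 * (\<integral>\<^sup>+u. ennreal ((?c u y)\<^sup>2 * (cmod (g u))\<^sup>2) \<partial>lborel))"
        unfolding taylor_defect_def by (intro mult_left_mono R) simp
      moreover have "ennreal (1 / ?K) * (ennreal ?K * A) = A" for A
        using K by (subst mult.assoc[symmetric], subst ennreal_mult[symmetric]) auto
      moreover have "ennreal (1 / ?K) * (4 * A) = ennreal (4 / ?K) * A" for A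
        by (subst mult.assoc[symmetric]) (simp add: ennreal_mult'[symmetric] ennreal_mult''[symmetric] flip: ennreal_numeral)
      ultimately show ?thesis by (simp only:)
    qed
    then have "(\<integral>\<^sup>+y. ennreal (gauss \<sigma> y) * taylor_defect f G y \<partial>lborel)
      \<le> (\<integral>\<^sup>+y. ennreal (gauss \<sigma> y) * (ennreal (4 / ?K) * (\<integral>\<^sup>+u. ennreal ((?c u y)\<^sup>2 * (cmod (g u))\<^sup>2) \<partial>lborel)) \<partial>lborel)"
      by (intro nn_integral_mono mult_left_mono) auto
    also have "\<dots> = ennreal (4 / ?K) * (\<integral>\<^sup>+y. (\<integral>\<^sup>+u. ennreal (gauss \<sigma> y) * ennreal ((?c u y)\<^sup>2 * (cmod (g u))\<^sup>2) \<partial>lborel) \<partial>lborel)"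
      by (subst nn_integral_cmult[symmetric], measurable, subst nn_integral_cmult, measurable, simp add: mult_ac)
    also have "(\<integral>\<^sup>+y. (\<integral>\<^sup>+u. ennreal (gauss \<sigma> y) * ennreal ((?c u y)\<^sup>2 * (cmod (g u))\<^sup>2) \<partial>lborel) \<partial>lborel)
       = (\<integral>\<^sup>+u. (\<integral>\<^sup>+y. ennreal (gauss \<sigma> y) * ennreal ((?c u y)\<^sup>2 * (cmod (g u))\<^sup>2) \<partial>lborel) \<partial>lborel)"
      by (rule lborel_pair.Fubini') measurable
    also have "\<dots> \<le> (\<integral>\<^sup>+u. ennreal (\<sigma>\<^sup>2 * w \<delta> u) \<partial>lborel)"
    proof (rule nn_integral_mono)
      fix u :: 'a
      have ub: "\<bar>- (u \<bullet> y)\<bar> \<le> norm u * norm y" for y using Cauchy_Schwarz_ineq2[of u y] by simp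
      have c1: "(?c u y)\<^sup>2 \<le> 4 * (norm u)\<^sup>2 * (norm y)\<^sup>2" for y
      proof -
        have "?c u y \<le> 2 * (norm u * norm y)"
          using cmod_exp_i_linear_le[of "- (u \<bullet> y)"] ub[of y] by linarith
        from power_mono[OF this, of 2] show ?thesis by (simp add: power_mult_distrib)
      qed
      have c2: "(?c u y)\<^sup>2 \<le> (norm u)^4 / 4 * (norm y)^4" for y
      proof -
        have "?c u y \<le> (norm u * norm y)\<^sup>2 / 2"
          using cmod_exp_i_linear[of "- (u \<bullet> y)"] power_mono[OF ub[of y], of 2] by simp
        from power_mono[OF this, of 2] show ?thesis by (simp add: power_mult_distrib power_divide)
      qed
      have "(\<integral>\<^sup>+y. ennreal (gauss \<sigma> y) * ennreal ((?c u y)\<^sup>2 * (cmod (g u))\<^sup>2) \<partial>lborel)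
         \<le> (\<integral>\<^sup>+y. ennreal (4 * (norm u)\<^sup>2 * (cmod (g u))\<^sup>2) * ennreal (gauss \<sigma> y * (norm y)\<^sup>2) \<partial>(lborel :: 'a measure))"
      proof (rule nn_integral_mono)
        fix y
        have "gauss \<sigma> y * ((?c u y)\<^sup>2 * (cmod (g u))\<^sup>2) \<le> gauss \<sigma> y * ((4 * (norm u)\<^sup>2 * (norm y)\<^sup>2) * (cmod (g u))\<^sup>2)"
          by (intro mult_left_mono mult_right_mono c1 gauss_nonneg) auto
        then show "ennreal (gauss \<sigma> y) * ennreal ((?c u y)\<^sup>2 * (cmod (g u))\<^sup>2) \<le> ennreal (4 * (norm u)\<^sup>2 * (cmod (g u))\<^sup>2) * ennreal (gauss \<sigma> y * (norm y)\<^sup>2)"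
          by (simp add: ennreal_mult[symmetric] gauss_nonneg mult_ac)
      qed
      also have "\<dots> = ennreal (4 * (norm u)\<^sup>2 * (cmod (g u))\<^sup>2 * (?d * \<sigma>\<^sup>2))"
        by (subst nn_integral_cmult) (auto simp: gauss_norm_second_moment[OF \<sigma>(1)] ennreal_mult)
      finally have 1: "(\<integral>\<^sup>+y. ennreal (gauss \<sigma> y) * ennreal ((?c u y)\<^sup>2 * (cmod (g u))\<^sup>2) \<partial>lborel)
         \<le> ennreal (\<sigma>\<^sup>2 * ((cmod (g u))\<^sup>2 * (4 * ?d * (norm u)\<^sup>2)))" by (simp add: mult_ac)
      have "(\<integral>\<^sup>+y. ennreal (gauss \<sigma> y) * ennreal ((?c u y)\<^sup>2 * (cmod (g u))\<^sup>2) \<partial>lborel)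
         \<le> (\<integral>\<^sup>+y. ennreal ((norm u)^4 / 4 * (cmod (g u))\<^sup>2) * ennreal (gauss \<sigma> y * (norm y)^4) \<partial>(lborel :: 'a measure))"
      proof (rule nn_integral_mono)
        fix y
        have "gauss \<sigma> y * ((?c u y)\<^sup>2 * (cmod (g u))\<^sup>2) \<le> gauss \<sigma> y * (((norm u)^4 / 4 * (norm y)^4) * (cmod (g u))\<^sup>2)"
          by (intro mult_left_mono mult_right_mono c2 gauss_nonneg) auto
        then show "ennreal (gauss \<sigma> y) * ennreal ((?c u y)\<^sup>2 * (cmod (g u))\<^sup>2) \<le> ennreal ((norm u)^4 / 4 * (cmod (g u))\<^sup>2) * ennreal (gauss \<sigma> y * (norm y)^4)"
          by (simp add: ennreal_mult[symmetric] gauss_nonneg mult_ac)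
      qed
      also have "\<dots> = ennreal ((norm u)^4 / 4 * (cmod (g u))\<^sup>2) * (\<integral>\<^sup>+y. ennreal (gauss \<sigma> y * (norm y)^4) \<partial>(lborel :: 'a measure))"
        by (subst nn_integral_cmult) auto
      also have "\<dots> \<le> ennreal ((norm u)^4 / 4 * (cmod (g u))\<^sup>2) * ennreal (3 * ?d\<^sup>2 * \<sigma>^4)"
        by (intro mult_left_mono gauss_norm_fourth_moment[OF \<sigma>(1)]) simp
      also have "\<dots> = ennreal (\<sigma>\<^sup>2 * ((cmod (g u))\<^sup>2 * (3 / 4 * ?d\<^sup>2 * \<sigma>\<^sup>2 * (norm u)^4)))"
        by (subst ennreal_mult[symmetric], simp, simp, simp add: power4_eq_xxxx power2_eq_square mult_ac)
      also have "\<dots> \<le> ennreal (\<sigma>\<^sup>2 * ((cmod (g u))\<^sup>2 * (3 / 4 * ?d\<^sup>2 * \<delta> * (norm u)^4)))"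
        by (intro ennreal_leI mult_left_mono mult_right_mono \<sigma>(2)) auto
      finally have 2: "(\<integral>\<^sup>+y. ennreal (gauss \<sigma> y) * ennreal ((?c u y)\<^sup>2 * (cmod (g u))\<^sup>2) \<partial>lborel)
         \<le> ennreal (\<sigma>\<^sup>2 * ((cmod (g u))\<^sup>2 * (3 / 4 * ?d\<^sup>2 * \<delta> * (norm u)^4)))" .
      show "(\<integral>\<^sup>+y. ennreal (gauss \<sigma> y) * ennreal ((?c u y)\<^sup>2 * (cmod (g u))\<^sup>2) \<partial>lborel) \<le> ennreal (\<sigma>\<^sup>2 * w \<delta> u)"
        unfolding w_def using 1 2 by (cases "4 * ?d * (norm u)\<^sup>2 \<le> 3 / 4 * ?d\<^sup>2 * \<delta> * (norm u)^4") (simp_all only: min_def if_True if_False)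
    qed
    also have "\<dots> = ennreal (\<sigma>\<^sup>2 * (\<integral>u. w \<delta> u \<partial>lborel))"
      using wi[OF \<delta>] w0[OF \<delta>] by (subst nn_integral_eq_integral) auto
    finally have "(\<integral>\<^sup>+y. ennreal (gauss \<sigma> y) * taylor_defect f G y \<partial>lborel) \<le> ennreal (4 / ?K) * ennreal (\<sigma>\<^sup>2 * (\<integral>u. w \<delta> u \<partial>lborel))"
      by (simp add: mult_left_mono)
    also have "\<dots> = ennreal (\<sigma>\<^sup>2 * \<theta> \<delta>)"
      using w0[OF \<delta>] by (subst ennreal_mult[symmetric]) (auto simp: \<theta>_def mult_ac intro!: integral_nonneg_AE)
    finally show ?thesis .
  qed
  show "\<exists>\<theta>. (\<theta> \<longlongrightarrow> (0::real)) (at_right 0) \<and> (\<forall>\<sigma> \<delta>. 0 < \<sigma> \<longrightarrow> \<sigma>\<^sup>2 \<le> \<delta> \<longrightarrow>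
      (\<integral>\<^sup>+y. ennreal (gauss \<sigma> y) * taylor_defect f (weak_gradient f) y \<partial>lborel) \<le> ennreal (\<sigma>\<^sup>2 * \<theta> \<delta>))"
    unfolding td using lim bound by blast
qed

section \<open>Increments of Brownian motion\<close>

text \<open>Independence only involves products of probabilities, which do not see the order of the
  variables.\<close>

lemma (in prob_space) indep_vars_permute:
  assumes Y: "indep_vars (\<lambda>_. N) Y I" and I: "I \<noteq> {}" "finite I" and \<pi>: "bij_betw \<pi> I I"
  shows "indep_vars (\<lambda>_. N) (\<lambda>j. Y (\<pi> j)) I"
proof -
  have Ym: "Y i \<in> M \<rightarrow>\<^sub>M N" if "i \<in> I" for i using Y that by (auto simp: indep_vars_def)
  have \<pi>I: "\<pi> j \<in> I" if "j \<in> I" for j using \<pi> that by (auto simp: bij_betw_def)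
  let ?q = "the_inv_into I \<pi>"
  have q: "?q (\<pi> j) = j" if "j \<in> I" for j using \<pi> that by (auto simp: bij_betw_def the_inv_into_f_f)
  have qI: "?q i \<in> I" if "i \<in> I" for i using bij_betw_the_inv_into[OF \<pi>] that by (auto simp: bij_betw_def)
  show ?thesis
  proof (subst indep_vars_finite[where E="\<lambda>_. sets N", OF I])
    show "\<forall>A\<in>(\<Pi> i\<in>I. sets N). prob (\<Inter>j\<in>I. Y (\<pi> j) -` A j \<inter> space M) = (\<Prod>j\<in>I. prob (Y (\<pi> j) -` A j \<inter> space M))"
    proof
      fix A assume A: "A \<in> (\<Pi> i\<in>I. sets N)"
      have "(\<Inter>j\<in>I. Y (\<pi> j) -` A j \<inter> space M) = (\<Inter>j\<in>I. Y (\<pi> j) -` A (?q (\<pi> j)) \<inter> space M)"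
        by (intro INF_cong refl) (simp add: q)
      also have "\<dots> = (\<Inter>i\<in>\<pi> ` I. Y i -` A (?q i) \<inter> space M)" by simp
      also have "\<pi> ` I = I" using \<pi> by (simp add: bij_betw_def)
      also have "prob (\<Inter>i\<in>I. Y i -` A (?q i) \<inter> space M) = (\<Prod>i\<in>I. prob (Y i -` A (?q i) \<inter> space M))"
        using A qI by (intro indep_varsD_finite[OF Y I]) auto
      also have "\<dots> = (\<Prod>j\<in>I. prob (Y (\<pi> j) -` A (?q (\<pi> j)) \<inter> space M))"
        by (rule sum.reindex_bij_betw[OF \<pi>, symmetric] prod.reindex_bij_betw[OF \<pi>, symmetric])
      also have "\<dots> = (\<Prod>j\<in>I. prob (Y (\<pi> j) -` A j \<inter> space M))"
        by (intro prod.cong refl) (simp add: q)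
      finally show "prob (\<Inter>j\<in>I. Y (\<pi> j) -` A j \<inter> space M) = (\<Prod>j\<in>I. prob (Y (\<pi> j) -` A j \<inter> space M))" .
    qed
    show "Y (\<pi> i) \<in> M \<rightarrow>\<^sub>M N" if "i \<in> I" for i using Ym \<pi>I that by blast
    show "sets N = sigma_sets (space N) (sets N)" by (simp add: sets.sigma_sets_eq)
    show "Int_stable (sets N)" by (rule sets.Int_stable)
    show "sets N \<subseteq> Pow (space N)" by (rule sets.space_closed)
  qed auto
qed

locale brownian = prob_space M for M :: "'w measure" +
  fixes T :: real and X :: "real \<Rightarrow> 'w \<Rightarrow> 'a::euclidean_space"
  assumes T_pos: "0 < T" and bm: "brownian_motion M T X"
begin

lemma X_measurable: "t \<in> {0..T} \<Longrightarrow> X t \<in> borel_measurable M"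
proof -
  assume t: "t \<in> {0..T}"
  obtain W where W: "standard_brownian_motion M T W" "\<And>t \<omega>. t \<in> {0..T} \<Longrightarrow> \<omega> \<in> space M \<Longrightarrow> X t \<omega> = X 0 \<omega> + W t \<omega>"
    and X0[measurable]: "X 0 \<in> borel_measurable M"
    using bm unfolding brownian_motion_def by blast
  have [measurable]: "W t \<in> borel_measurable M" using W(1) t by (simp add: standard_brownian_motion_def)
  have "(\<lambda>\<omega>. X 0 \<omega> + W t \<omega>) \<in> borel_measurable M" by measurable
  then show ?thesis using measurable_cong[of M "X t" "\<lambda>\<omega>. X 0 \<omega> + W t \<omega>" borel] W(2)[OF t] by simp
qed

lemma X_continuous: "\<omega> \<in> space M \<Longrightarrow> continuous_on {0..T} (\<lambda>t. X t \<omega>)"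
proof -
  assume \<omega>: "\<omega> \<in> space M"
  obtain W where W: "standard_brownian_motion M T W" "\<And>t \<omega>. t \<in> {0..T} \<Longrightarrow> \<omega> \<in> space M \<Longrightarrow> X t \<omega> = X 0 \<omega> + W t \<omega>"
    using bm unfolding brownian_motion_def by blast
  have "continuous_on {0..T} (\<lambda>t. X 0 \<omega> + W t \<omega>)"
    using W(1) \<omega> by (intro continuous_intros) (simp add: standard_brownian_motion_def)
  then show ?thesis by (rule continuous_on_eq) (rule W(2)[OF _ \<omega>, symmetric])
qed

lemma increment_distributed:
  assumes "0 \<le> s" "s < t" "t \<le> T"
  shows "distributed M lborel (\<lambda>\<omega>. X t \<omega> - X s \<omega>) (\<lambda>x. ennreal (gauss (sqrt (t - s)) x))"
proof -
  obtain W where W: "standard_brownian_motion M T W" "\<And>t \<omega>. t \<in> {0..T} \<Longrightarrow> \<omega> \<in> space M \<Longrightarrow> X t \<omega> = X 0 \<omega> + W t \<omega>"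
    using bm unfolding brownian_motion_def by blast
  have d: "distributed M lborel (\<lambda>\<omega>. W t \<omega> - W s \<omega>) (\<lambda>x. ennreal (gauss (sqrt (t - s)) x))"
    using W(1) assms unfolding standard_brownian_motion_def gauss_def by blast
  have e: "X t \<omega> - X s \<omega> = W t \<omega> - W s \<omega>" if "\<omega> \<in> space M" for \<omega>
    using assms W(2)[of t \<omega>] W(2)[of s \<omega>] that by simp
  have "distr M lborel (\<lambda>\<omega>. X t \<omega> - X s \<omega>) = distr M lborel (\<lambda>\<omega>. W t \<omega> - W s \<omega>)"
    by (rule distr_cong) (use e in auto)
  moreover have "(\<lambda>\<omega>. X t \<omega> - X s \<omega>) \<in> borel_measurable M"
    using X_measurable[of t] X_measurable[of s] assms by auto
  ultimately show ?thesis using d by (simp add: distributed_def)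
qed

lemma increment_distr:
  assumes "0 \<le> s" "s \<le> t" "t \<le> T"
  shows "distr M borel (\<lambda>\<omega>. X t \<omega> - X s \<omega>) = (if t = s then return borel 0 else density lborel (\<lambda>x. ennreal (gauss (sqrt (t - s)) x)))"
proof (cases "t = s")
  case True
  have "distr M borel (\<lambda>\<omega>. X t \<omega> - X s \<omega>) = distr M borel (\<lambda>_. 0)" using True by simp
  also have "\<dots> = return borel 0" by (rule distr_const) simp
  finally show ?thesis using True by simp
next
  case False
  then have "distr M lborel (\<lambda>\<omega>. X t \<omega> - X s \<omega>) = density lborel (\<lambda>x. ennreal (gauss (sqrt (t - s)) x))"
    using increment_distributed[of s t] assms by (auto simp: distributed_def)
  moreover have "distr M lborel (\<lambda>\<omega>. X t \<omega> - X s \<omega>) = distr M borel (\<lambda>\<omega>. X t \<omega> - X s \<omega>)"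
    by (rule distr_cong) auto
  ultimately show ?thesis using False by simp
qed

text \<open>The initial value is counted as increment number \<open>0\<close>, so that the state at a time of the
  partition is the sum of the increments up to it.\<close>

definition incr :: "(nat \<Rightarrow> real) \<Rightarrow> nat \<Rightarrow> 'w \<Rightarrow> 'a" where
  "incr \<tau> i \<omega> = (case i of 0 \<Rightarrow> X 0 \<omega> | Suc j \<Rightarrow> X (\<tau> (Suc j)) \<omega> - X (\<tau> j) \<omega>)"

lemma incr_simps: "incr \<tau> 0 = X 0" "incr \<tau> (Suc j) = (\<lambda>\<omega>. X (\<tau> (Suc j)) \<omega> - X (\<tau> j) \<omega>)"
  by (simp_all add: incr_def fun_eq_iff)

lemma incr_sum: "\<tau> 0 = 0 \<Longrightarrow> (\<Sum>j\<le>i. incr \<tau> j \<omega>) = X (\<tau> i) \<omega>"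
  by (induction i) (auto simp: incr_simps)

lemma incr_measurable:
  assumes "\<And>i. i \<le> m \<Longrightarrow> \<tau> i \<in> {0..T}" "i \<le> m"
  shows "incr \<tau> i \<in> borel_measurable M"
proof (cases i)
  case 0
  then show ?thesis using X_measurable[of 0] T_pos by (simp add: incr_simps)
next
  case (Suc j)
  have "X (\<tau> j) \<in> borel_measurable M" "X (\<tau> (Suc j)) \<in> borel_measurable M"
    using assms Suc by (auto intro!: X_measurable)
  then show ?thesis by (simp add: Suc incr_simps)
qed

text \<open>The initial value is independent of the path of the driving motion, and the increments are
  measurable functions of that path; so the initial value joins the independent increments.\<close>

lemma indep_incr:
  assumes \<tau>: "\<And>i. i \<le> m \<Longrightarrow> \<tau> i \<in> {0..T}" "\<And>i. i < m \<Longrightarrow> \<tau> i \<le> \<tau> (Suc i)"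
  shows "indep_vars (\<lambda>_. borel) (incr \<tau>) {..m}"
proof -
  obtain W where W: "standard_brownian_motion M T W" "\<And>t \<omega>. t \<in> {0..T} \<Longrightarrow> \<omega> \<in> space M \<Longrightarrow> X t \<omega> = X 0 \<omega> + W t \<omega>"
    and ind: "indep_set (sets (vimage_algebra (space M) (X 0) borel))
          (sets (vimage_algebra (space M) (\<lambda>\<omega>. \<lambda>t\<in>{0..T}. W t \<omega>) (\<Pi>\<^sub>M t\<in>{0..T}. borel)))"
    using bm unfolding brownian_motion_def by blast
  let ?D = "\<lambda>i \<omega>. W (\<tau> (Suc i)) \<omega> - W (\<tau> i) \<omega>"
  have indW: "indep_vars (\<lambda>_. borel) ?D {..<m}"
    using W(1) \<tau> unfolding standard_brownian_motion_def by blast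
  have De: "incr \<tau> (Suc j) \<omega> = ?D j \<omega>" if "j < m" "\<omega> \<in> space M" for j \<omega>
    using W(2)[OF \<tau>(1) that(2), of j] W(2)[OF \<tau>(1) that(2), of "Suc j"] that by (simp add: incr_simps)
  let ?I = "\<lambda>A j. incr \<tau> j -` A j \<inter> space M"
  have prodf: "prob (\<Inter>j\<in>{..m}. ?I A j) = (\<Prod>j\<in>{..m}. prob (?I A j))" if A: "\<And>j. j \<le> m \<Longrightarrow> A j \<in> sets borel" for A
  proof (cases "m = 0")
    case False
    let ?E = "\<Inter>j\<in>{..<m}. ?D j -` A (Suc j) \<inter> space M"
    have Dev: "?D j -` A (Suc j) \<inter> space M \<in> sets (vimage_algebra (space M) (\<lambda>\<omega>. \<lambda>t\<in>{0..T}. W t \<omega>) (\<Pi>\<^sub>M t\<in>{0..T}. borel))" if j: "j < m" for j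
    proof -
      let ?C = "{w \<in> space (\<Pi>\<^sub>M t\<in>{0..T}. (borel :: 'a measure)). w (\<tau> (Suc j)) - w (\<tau> j) \<in> A (Suc j)}"
      have [measurable]: "\<tau> j \<in> {0..T}" "\<tau> (Suc j) \<in> {0..T}" "A (Suc j) \<in> sets borel" using \<tau>(1) A j by auto
      have C: "?C \<in> sets (\<Pi>\<^sub>M t\<in>{0..T}. borel)" by measurable
      have eq: "?D j -` A (Suc j) \<inter> space M = (\<lambda>\<omega>. \<lambda>t\<in>{0..T}. W t \<omega>) -` ?C \<inter> space M"
        using \<open>\<tau> j \<in> {0..T}\<close> \<open>\<tau> (Suc j) \<in> {0..T}\<close> by (auto simp: space_PiM)
      show ?thesis unfolding eq by (rule in_vimage_algebra[OF C])
    qed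
    have E: "?E \<in> sets (vimage_algebra (space M) (\<lambda>\<omega>. \<lambda>t\<in>{0..T}. W t \<omega>) (\<Pi>\<^sub>M t\<in>{0..T}. borel))"
      using False Dev by (intro sets.finite_INT) auto
    have "(\<Inter>j\<in>{..m}. ?I A j) = ?I A 0 \<inter> (\<Inter>j\<in>{..<m}. ?I A (Suc j))"
    proof -
      have "{..m} = insert 0 (Suc ` {..<m})"
        using False atMost_Suc_eq_insert_0[of "m - 1"] lessThan_Suc_atMost[of "m - 1"] by simp
      then show ?thesis by (simp only: INT_insert image_image)
    qed
    also have "(\<Inter>j\<in>{..<m}. ?I A (Suc j)) = ?E"
      using De by (intro INF_cong refl) auto
    finally have eq: "(\<Inter>j\<in>{..m}. ?I A j) = ?I A 0 \<inter> ?E" .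
    have "prob (?I A 0 \<inter> ?E) = prob (?I A 0) * prob ?E"
    proof (rule indep_setD[OF ind _ E])
      show "?I A 0 \<in> sets (vimage_algebra (space M) (X 0) borel)"
        unfolding incr_simps using A[of 0] by (intro in_vimage_algebra) simp
    qed
    also have "prob ?E = (\<Prod>j\<in>{..<m}. prob (?D j -` A (Suc j) \<inter> space M))"
      using False A by (intro indep_varsD_finite[OF indW]) auto
    also have "\<dots> = (\<Prod>j\<in>{..<m}. prob (?I A (Suc j)))"
      using De by (intro prod.cong refl arg_cong[where f=prob]) auto
    also have "prob (?I A 0) * (\<Prod>j\<in>{..<m}. prob (?I A (Suc j))) = (\<Prod>j\<in>{..m}. prob (?I A j))"
      by (simp only: prod.atMost_shift)
    finally show ?thesis unfolding eq .
  next
    case True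
    then have "{..m} = {0}" by (simp only: atMost_0)
    then show ?thesis
      by (simp only: INT_insert INT_empty Int_UNIV_right prod.insert finite.emptyI empty_iff not_False_eq_True prod.empty mult_1_right)
  qed
  show ?thesis
  proof (subst indep_vars_finite[where E="\<lambda>_. sets borel"])
    show "\<forall>A\<in>(\<Pi> i\<in>{..m}. sets borel). prob (\<Inter>j\<in>{..m}. incr \<tau> j -` A j \<inter> space M) = (\<Prod>j\<in>{..m}. prob (incr \<tau> j -` A j \<inter> space M))"
      using prodf by (auto simp: Pi_iff)
    show "random_variable borel (incr \<tau> i)" if "i \<in> {..m}" for i
      using incr_measurable[of m \<tau> i] \<tau> that by auto
    show "sets borel = sigma_sets (space borel) (sets (borel :: 'a measure))"
      by (rule sets.sigma_sets_eq[symmetric])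
    show "Int_stable (sets (borel :: 'a measure))" by (rule sets.Int_stable)
    show "sets borel \<subseteq> Pow (space (borel :: 'a measure))" by (rule sets.space_closed)
    show "space (borel :: 'a measure) \<in> sets borel" by (rule sets.top)
    show "{..m} \<noteq> {}" "finite {..m}" by blast simp
  qed
qed

text \<open>States along a partition are partial sums of increments, hence a function of increments
  that are independent of the next one. The statement is in terms of a product law because
  the two sides have different types.\<close>

lemma indep_past_increment:
  assumes \<tau>: "\<And>i. i \<le> m \<Longrightarrow> \<tau> i \<in> {0..T}" "\<And>i. i < m \<Longrightarrow> \<tau> i \<le> \<tau> (Suc i)" "\<tau> 0 = 0"
    and t: "\<tau> m \<le> t" "t \<le> T"
  defines "V \<equiv> \<lambda>\<omega>. \<lambda>i\<in>{..m}. X (\<tau> i) \<omega>" and "Y \<equiv> \<lambda>\<omega>. X t \<omega> - X (\<tau> m) \<omega>"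
  shows "distr M ((\<Pi>\<^sub>M i\<in>{..m}. borel) \<Otimes>\<^sub>M borel) (\<lambda>\<omega>. (V \<omega>, Y \<omega>))
      = distr M (\<Pi>\<^sub>M i\<in>{..m}. borel) V \<Otimes>\<^sub>M distr M borel Y"
proof -
  define \<tau>' where "\<tau>' = \<tau>(Suc m := t)"
  have t0: "0 \<le> t" using order_trans[OF _ t(1), of 0] \<tau>(1)[of m] by simp
  let ?A = "\<lambda>\<omega>. restrict (\<lambda>i. incr \<tau>' i \<omega>) {..m}" and ?B = "\<lambda>\<omega>. restrict (\<lambda>i. incr \<tau>' i \<omega>) {Suc m}"
  let ?PA = "\<Pi>\<^sub>M i\<in>{..m}. (borel :: 'a measure)" and ?PB = "\<Pi>\<^sub>M i\<in>{Suc m}. (borel :: 'a measure)"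
  let ?f = "\<lambda>z::nat \<Rightarrow> 'a. \<lambda>i\<in>{..m}. \<Sum>j\<le>i. z j" and ?g = "\<lambda>z::nat \<Rightarrow> 'a. z (Suc m)"
  have "indep_vars (\<lambda>_. borel) (incr \<tau>') {..Suc m}"
  proof (rule indep_incr)
    show "\<tau>' i \<in> {0..T}" if "i \<le> Suc m" for i
      using \<tau>(1)[of i] that t(2) t0 by (cases "i = Suc m") (simp_all add: \<tau>'_def)
    show "\<tau>' i \<le> \<tau>' (Suc i)" if "i < Suc m" for i
      using \<tau>(2)[of i] that t(1) by (cases "i = m") (simp_all add: \<tau>'_def)
  qed
  then have "indep_var ?PA ?A ?PB ?B"
    by (rule indep_var_restrict) auto
  then have AB: "?A \<in> M \<rightarrow>\<^sub>M ?PA" "?B \<in> M \<rightarrow>\<^sub>M ?PB" "distr M ?PA ?A \<Otimes>\<^sub>M distr M ?PB ?B = distr M (?PA \<Otimes>\<^sub>M ?PB) (\<lambda>\<omega>. (?A \<omega>, ?B \<omega>))"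
    by (auto simp: indep_var_distribution_eq)
  have f: "?f \<in> ?PA \<rightarrow>\<^sub>M ?PA"
    by (intro measurable_restrict borel_measurable_sum measurable_component_singleton) auto
  have g: "?g \<in> ?PB \<rightarrow>\<^sub>M borel"
    by (intro measurable_component_singleton) auto
  have fA: "?f (?A \<omega>) = V \<omega>" for \<omega>
  proof
    fix i
    have "(\<Sum>j\<le>i. ?A \<omega> j) = X (\<tau> i) \<omega>" if "i \<le> m"
    proof -
      have "(\<Sum>j\<le>i. ?A \<omega> j) = (\<Sum>j\<le>i. incr \<tau>' j \<omega>)"
        using that by (intro sum.cong) auto
      also have "\<dots> = X (\<tau>' i) \<omega>" using \<tau>(3) by (intro incr_sum) (simp add: \<tau>'_def)
      finally show ?thesis using that by (simp add: \<tau>'_def)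
    qed
    then show "?f (?A \<omega>) i = V \<omega> i" by (cases "i \<le> m") (simp_all add: V_def)
  qed
  have gB: "?g (?B \<omega>) = Y \<omega>" for \<omega> by (simp add: incr_simps \<tau>'_def Y_def)
  interpret SB: prob_space "distr M ?PB ?B" by (rule prob_space_distr[OF AB(2)])
  have V: "distr M ?PA V = distr (distr M ?PA ?A) ?PA ?f"
    by (subst distr_distr[OF f AB(1)]) (simp only: comp_def fA)
  have Y: "distr M borel Y = distr (distr M ?PB ?B) borel ?g"
    by (subst distr_distr[OF g AB(2)]) (simp only: comp_def gB)
  interpret SY: prob_space "distr (distr M ?PB ?B) borel ?g" by (rule SB.prob_space_distr) (use g in simp)
  have "distr M ?PA V \<Otimes>\<^sub>M distr M borel Y = distr (distr M ?PA ?A \<Otimes>\<^sub>M distr M ?PB ?B) (?PA \<Otimes>\<^sub>M borel) (\<lambda>(x, y). (?f x, ?g y))"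
    unfolding V Y
  proof (rule pair_measure_distr)
    show "?f \<in> distr M ?PA ?A \<rightarrow>\<^sub>M ?PA" using f by simp
    show "?g \<in> distr M ?PB ?B \<rightarrow>\<^sub>M borel" using g by simp
    show "sigma_finite_measure (distr (distr M ?PB ?B) borel ?g)" by (rule SY.sigma_finite_measure_axioms)
  qed
  also have "\<dots> = distr M (?PA \<Otimes>\<^sub>M borel) (\<lambda>\<omega>. (V \<omega>, Y \<omega>))"
    unfolding AB(3)
  proof (subst distr_distr)
    show "(\<lambda>(x, y). (?f x, ?g y)) \<in> ?PA \<Otimes>\<^sub>M ?PB \<rightarrow>\<^sub>M ?PA \<Otimes>\<^sub>M borel"
      using f g by measurable
    show "(\<lambda>\<omega>. (?A \<omega>, ?B \<omega>)) \<in> M \<rightarrow>\<^sub>M ?PA \<Otimes>\<^sub>M ?PB" using AB(1,2) by (rule measurable_Pair)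
  qed (simp only: comp_def case_prod_conv fA gB)
  finally show ?thesis by simp
qed

text \<open>The symmetry behind the factor \<open>1/12\<close>. Splitting the \<open>k\<close>-th interval into pieces of lengths \<open>\<rho>\<close>
  and \<open>\<Delta> - \<rho>\<close>, in either order, gives the same joint law of the two increments and of all the
  others; the states at the partition points only involve the sum of the two.\<close>

lemma increment_reversal:
  fixes n :: nat
  assumes t: "\<And>i. i \<le> n \<Longrightarrow> t i \<in> {0..T}" "\<And>i. i < n \<Longrightarrow> t i \<le> t (Suc i)" "t 0 = 0" and k: "k < n"
    and \<rho>: "0 \<le> \<rho>" "\<rho> \<le> t (Suc k) - t k"
    and H[measurable]: "H \<in> borel_measurable ((\<Pi>\<^sub>M i\<in>{..n}. borel) \<Otimes>\<^sub>M (borel :: 'a measure))"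
  shows "(\<integral>\<omega>. H (\<lambda>i\<in>{..n}. X (t i) \<omega>, X (t k + \<rho>) \<omega> - X (t k) \<omega>) \<partial>M)
       = (\<integral>\<omega>. H (\<lambda>i\<in>{..n}. X (t i) \<omega>, X (t (Suc k)) \<omega> - X (t (Suc k) - \<rho>) \<omega>) \<partial>M :: real)"
proof -
  \<comment> \<open>The partition refined by one point \<open>r\<close> in the \<open>k\<close>-th interval.\<close>
  define \<tau> where "\<tau> r i = (if i \<le> k then t i else if i = Suc k then r else t (i - 1))" for r i
  define r1 where "r1 = t k + \<rho>"
  define r2 where "r2 = t (Suc k) - \<rho>"
  have kk: "t k \<in> {0..T}" "t (Suc k) \<in> {0..T}" using t(1) k by auto
  have r: "t k \<le> r1" "r1 \<le> t (Suc k)" "t k \<le> r2" "r2 \<le> t (Suc k)" "r1 \<in> {0..T}" "r2 \<in> {0..T}"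
    using \<rho> kk by (auto simp: r1_def r2_def)
  have ind: "indep_vars (\<lambda>_. borel) (incr (\<tau> r)) {..Suc n}" if "t k \<le> r" "r \<le> t (Suc k)" "r \<in> {0..T}" for r
  proof (rule indep_incr)
    show "\<tau> r i \<in> {0..T}" if "i \<le> Suc n" for i
      using t(1)[of i] t(1)[of "i - 1"] that \<open>r \<in> {0..T}\<close> k by (auto simp: \<tau>_def)
    show "\<tau> r i \<le> \<tau> r (Suc i)" if "i < Suc n" for i
    proof -
      consider "Suc i \<le> k" | "i = k" | "i = Suc k" | "i > Suc k" by linarith
      then show ?thesis
      proof cases
        case 1
        then show ?thesis using t(2)[of i] k by (simp add: \<tau>_def)
      next
        case 2
        then show ?thesis using \<open>t k \<le> r\<close> by (simp add: \<tau>_def)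
      next
        case 3
        then show ?thesis using \<open>r \<le> t (Suc k)\<close> by (simp add: \<tau>_def)
      next
        case 4
        then obtain j where "i = Suc j" by (cases i) auto
        then show ?thesis using 4 t(2)[of j] that by (simp add: \<tau>_def)
      qed
    qed
  qed
  \<comment> \<open>Exchanges the two increments of the split interval.\<close>
  define \<pi> where "\<pi> i = (if i = Suc k then Suc (Suc k) else if i = Suc (Suc k) then Suc k else i)" for i
  have inv: "\<pi> (\<pi> i) = i" for i by (auto simp: \<pi>_def)
  have \<pi>_bij: "bij_betw \<pi> {..i} {..i}" if "i \<le> k \<or> Suc (Suc k) \<le> i" for i
  proof (rule bij_betwI[where g=\<pi>])
    have le: "\<pi> j \<le> i" if "j \<le> i" for j
      using that \<open>i \<le> k \<or> Suc (Suc k) \<le> i\<close> unfolding \<pi>_def by presburger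
    show "\<pi> \<in> {..i} \<rightarrow> {..i}" "\<pi> \<in> {..i} \<rightarrow> {..i}" using le by (simp_all add: Pi_iff)
  qed (rule inv)+
  let ?P = "\<Pi>\<^sub>M i\<in>{..Suc n}. (borel :: 'a measure)"
  let ?Z1 = "\<lambda>\<omega>. \<lambda>j\<in>{..Suc n}. incr (\<tau> r1) j \<omega>" and ?Z2 = "\<lambda>\<omega>. \<lambda>j\<in>{..Suc n}. incr (\<tau> r2) (\<pi> j) \<omega>"
  have \<pi>n: "bij_betw \<pi> {..Suc n} {..Suc n}" using k by (intro \<pi>_bij) simp
  have i1: "indep_vars (\<lambda>_. borel) (incr (\<tau> r1)) {..Suc n}" using ind[of r1] r by blast
  have i2: "indep_vars (\<lambda>_. borel) (\<lambda>j. incr (\<tau> r2) (\<pi> j)) {..Suc n}"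
    by (rule indep_vars_permute[OF ind[OF r(3,4,6)] _ _ \<pi>n]) auto
  have m1: "incr (\<tau> r1) j \<in> borel_measurable M" if "j \<le> Suc n" for j
    using i1 that unfolding indep_vars_def2 by blast
  have m2: "incr (\<tau> r2) (\<pi> j) \<in> borel_measurable M" if "j \<le> Suc n" for j
    using i2 that unfolding indep_vars_def2 by blast
  have law: "distr M borel (incr (\<tau> r1) j) = distr M borel (incr (\<tau> r2) (\<pi> j))" if "j \<le> Suc n" for j
  proof -
    consider "j \<le> k" | "j = Suc k" | "j = Suc (Suc k)" | "j > Suc (Suc k)" by linarith
    then show ?thesis
    proof cases
      case 1
      then show ?thesis by (cases j) (simp_all add: \<pi>_def incr_simps \<tau>_def)
    next
      case 2
      then show ?thesis
        unfolding 2 using r kk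
        by (simp add: \<pi>_def incr_simps \<tau>_def increment_distr) (auto simp: r1_def r2_def)
    next
      case 3
      then show ?thesis
        unfolding 3 using r kk
        by (simp add: \<pi>_def incr_simps \<tau>_def increment_distr) (auto simp: r1_def r2_def algebra_simps)
    next
      case 4
      then show ?thesis by (cases j) (simp_all add: \<pi>_def incr_simps \<tau>_def)
    qed
  qed
  have "distr M ?P ?Z1 = (\<Pi>\<^sub>M j\<in>{..Suc n}. distr M borel (incr (\<tau> r1) j))"
    using i1 m1 by (subst (asm) indep_vars_iff_distr_eq_PiM') auto
  also have "\<dots> = (\<Pi>\<^sub>M j\<in>{..Suc n}. distr M borel (incr (\<tau> r2) (\<pi> j)))"
    by (intro PiM_cong refl law) simp
  also have "\<dots> = distr M ?P ?Z2"
    using i2 m2 by (subst (asm) indep_vars_iff_distr_eq_PiM') auto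
  finally have Z: "distr M ?P ?Z1 = distr M ?P ?Z2" .
  \<comment> \<open>The increments of the refined partition that sum up to the \<open>i\<close>-th observation; these index sets are invariant under the exchange.\<close>
  define J where "J i = (if i \<le> k then {..i} else {..Suc i})" for i
  let ?F = "\<lambda>z::nat \<Rightarrow> 'a. H (\<lambda>i\<in>{..n}. \<Sum>j\<in>J i. z j, z (Suc k))"
  have F: "?F \<in> borel_measurable ?P"
  proof -
    have "(\<lambda>z::nat \<Rightarrow> 'a. (\<lambda>i\<in>{..n}. \<Sum>j\<in>J i. z j, z (Suc k))) \<in> ?P \<rightarrow>\<^sub>M (\<Pi>\<^sub>M i\<in>{..n}. borel) \<Otimes>\<^sub>M borel"
      using k by (intro measurable_Pair measurable_restrict borel_measurable_sum measurable_component_singleton) (auto simp: J_def split: if_splits)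
    from measurable_compose[OF this H] show ?thesis .
  qed
  have Z1m: "?Z1 \<in> M \<rightarrow>\<^sub>M ?P" and Z2m: "?Z2 \<in> M \<rightarrow>\<^sub>M ?P"
    using m1 m2 by (auto intro!: measurable_restrict)
  have S1: "(\<Sum>j\<in>J i. ?Z1 \<omega> j) = X (t i) \<omega>" if "i \<le> n" for i \<omega>
  proof -
    have "(\<Sum>j\<in>J i. ?Z1 \<omega> j) = (\<Sum>j\<in>J i. incr (\<tau> r1) j \<omega>)"
      using that k by (intro sum.cong refl) (auto simp: J_def split: if_splits)
    also have "\<dots> = X (t i) \<omega>"
      using incr_sum[of "\<tau> r1" \<omega> i] incr_sum[of "\<tau> r1" \<omega> "Suc i"] t(3) by (auto simp: J_def \<tau>_def simp del: sum.atMost_Suc)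
    finally show ?thesis .
  qed
  have S2: "(\<Sum>j\<in>J i. ?Z2 \<omega> j) = X (t i) \<omega>" if "i \<le> n" for i \<omega>
  proof -
    have "(\<Sum>j\<in>J i. ?Z2 \<omega> j) = (\<Sum>j\<in>J i. incr (\<tau> r2) (\<pi> j) \<omega>)"
      using that k by (intro sum.cong refl) (auto simp: J_def split: if_splits)
    also have "\<dots> = (\<Sum>j\<in>J i. incr (\<tau> r2) j \<omega>)"
      by (rule sum.reindex_bij_betw) (auto simp: J_def intro!: \<pi>_bij)
    also have "\<dots> = X (t i) \<omega>"
      using incr_sum[of "\<tau> r2" \<omega> i] incr_sum[of "\<tau> r2" \<omega> "Suc i"] t(3) by (auto simp: J_def \<tau>_def simp del: sum.atMost_Suc)
    finally show ?thesis .
  qed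
  have F1: "?F (?Z1 \<omega>) = H (\<lambda>i\<in>{..n}. X (t i) \<omega>, X (t k + \<rho>) \<omega> - X (t k) \<omega>)" for \<omega>
  proof -
    have "(\<lambda>i\<in>{..n}. \<Sum>j\<in>J i. ?Z1 \<omega> j) = (\<lambda>i\<in>{..n}. X (t i) \<omega>)"
      by (rule restrict_ext) (use S1 in blast)
    moreover have "?Z1 \<omega> (Suc k) = X (t k + \<rho>) \<omega> - X (t k) \<omega>"
      using k by (simp add: incr_simps \<tau>_def r1_def)
    ultimately show ?thesis by (simp only:)
  qed
  have F2: "?F (?Z2 \<omega>) = H (\<lambda>i\<in>{..n}. X (t i) \<omega>, X (t (Suc k)) \<omega> - X (t (Suc k) - \<rho>) \<omega>)" for \<omega>
  proof -
    have "(\<lambda>i\<in>{..n}. \<Sum>j\<in>J i. ?Z2 \<omega> j) = (\<lambda>i\<in>{..n}. X (t i) \<omega>)"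
      by (rule restrict_ext) (use S2 in blast)
    moreover have "?Z2 \<omega> (Suc k) = X (t (Suc k)) \<omega> - X (t (Suc k) - \<rho>) \<omega>"
      using k by (simp add: incr_simps \<tau>_def r2_def \<pi>_def)
    ultimately show ?thesis by (simp only:)
  qed
  have "(\<integral>\<omega>. ?F (?Z1 \<omega>) \<partial>M) = (\<integral>\<omega>. ?F (?Z2 \<omega>) \<partial>M)"
    unfolding integral_distr[OF Z1m F, symmetric] integral_distr[OF Z2m F, symmetric] by (simp only: Z)
  then show ?thesis by (simp only: F1 F2)
qed

end

section \<open>Conditioning on the past and the law at a fixed time\<close>

lemma (in prob_space) pair_sigma_finite_lborel:
  "pair_sigma_finite (lborel :: 'c::euclidean_space measure) M"
  by (intro pair_sigma_finite.intro sigma_finite_lborel sigma_finite_measure_axioms)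

lemma (in prob_space) nn_Fubini_lborel:
  fixes h :: "'c::euclidean_space \<Rightarrow> 'a \<Rightarrow> ennreal"
  assumes "(\<lambda>p. h (fst p) (snd p)) \<in> borel_measurable (lborel \<Otimes>\<^sub>M M)"
  shows "(\<integral>\<^sup>+x. (\<integral>\<^sup>+\<omega>. h x \<omega> \<partial>M) \<partial>lborel) = (\<integral>\<^sup>+\<omega>. (\<integral>\<^sup>+x. h x \<omega> \<partial>lborel) \<partial>M)"
proof -
  interpret pair_sigma_finite "lborel :: 'c measure" M by (rule pair_sigma_finite_lborel)
  show ?thesis using Fubini'[of h] assms by (simp add: case_prod_beta')
qed

lemma gauss_continuous:
  assumes "0 < t" "s \<longlonglongrightarrow> t"
  shows "(\<lambda>n. gauss (sqrt (s n)) y) \<longlonglongrightarrow> gauss (sqrt t) y"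
  unfolding gauss_def normal_density_def
  by (intro tendsto_intros assms) (use assms(1) in auto)

context brownian
begin

text \<open>Time is clipped to the interval \<open>[0, T]\<close>, so that the process is defined and jointly
  measurable on the whole real line and Fubini needs no restricted measures.\<close>

definition clipped :: "real \<Rightarrow> 'w \<Rightarrow> 'a" where
  "clipped r = X (max 0 (min T r))"

lemma clipped_eq: "r \<in> {0..T} \<Longrightarrow> clipped r = X r"
  by (simp add: clipped_def)

lemma clipped_measurable[measurable]: "clipped r \<in> borel_measurable M"
  unfolding clipped_def using T_pos by (intro X_measurable) auto

lemma clipped_continuous: "\<omega> \<in> space M \<Longrightarrow> continuous_on UNIV (\<lambda>r. clipped r \<omega>)"
proof -
  assume \<omega>: "\<omega> \<in> space M"
  have "continuous_on UNIV (\<lambda>r::real. max 0 (min T r))" by (intro continuous_intros)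
  then show ?thesis
    unfolding clipped_def
    by (rule continuous_on_compose2[OF X_continuous[OF \<omega>]]) (use T_pos in auto)
qed

text \<open>Continuous paths are limits of their values at the times \<open>\<lfloor>m r\<rfloor>/m\<close>, and these
  approximations take countably many time values.\<close>

lemma clipped_joint_measurable: "(\<lambda>p. clipped (fst p) (snd p)) \<in> borel_measurable (borel \<Otimes>\<^sub>M M)"
proof (rule borel_measurable_LIMSEQ_metric)
  let ?a = "\<lambda>n r. of_int \<lfloor>real (Suc n) * r\<rfloor> / real (Suc n)"
  show "(\<lambda>p. clipped (?a n (fst p)) (snd p)) \<in> borel_measurable (borel \<Otimes>\<^sub>M M)" for n
    by (rule measurable_compose_countable[where f="\<lambda>i p. clipped (of_int i / real (Suc n)) (snd p)" and g="\<lambda>p. \<lfloor>real (Suc n) * fst p\<rfloor>"])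
      measurable
  fix p :: "real \<times> 'w" assume "p \<in> space (borel \<Otimes>\<^sub>M M)"
  then have c: "isCont (\<lambda>r. clipped r (snd p)) (fst p)"
    using clipped_continuous[of "snd p"] by (auto simp: space_pair_measure continuous_on_eq_continuous_at)
  have "(\<lambda>n. ?a n (fst p)) \<longlonglongrightarrow> fst p"
  proof (rule tendsto_sandwich)
    have "(\<lambda>n. fst p - 1 / real (Suc n)) \<longlonglongrightarrow> fst p - 0"
      by (intro tendsto_diff tendsto_const LIMSEQ_Suc[OF lim_1_over_n])
    then show "(\<lambda>n. fst p - 1 / real (Suc n)) \<longlonglongrightarrow> fst p" by simp
    show "\<forall>\<^sub>F n in sequentially. fst p - 1 / real (Suc n) \<le> ?a n (fst p)"
    proof (intro always_eventually allI)
      fix n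
      have "real (Suc n) * fst p - 1 \<le> of_int \<lfloor>real (Suc n) * fst p\<rfloor>" by linarith
      then have "(real (Suc n) * fst p - 1) / real (Suc n) \<le> ?a n (fst p)" by (rule divide_right_mono) simp
      then show "fst p - 1 / real (Suc n) \<le> ?a n (fst p)" by (simp add: diff_divide_distrib)
    qed
    show "\<forall>\<^sub>F n in sequentially. ?a n (fst p) \<le> fst p"
    proof (intro always_eventually allI)
      fix n
      have "of_int \<lfloor>real (Suc n) * fst p\<rfloor> \<le> real (Suc n) * fst p" by linarith
      then have "?a n (fst p) \<le> real (Suc n) * fst p / real (Suc n)" by (rule divide_right_mono) simp
      then show "?a n (fst p) \<le> fst p" by simp
    qed
  qed simp
  then show "(\<lambda>n. clipped (?a n (fst p)) (snd p)) \<longlonglongrightarrow> clipped (fst p) (snd p)"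
    by (rule isCont_tendsto_compose[OF c])
qed

lemma clipped_compose_measurable[measurable (raw)]:
  assumes "g \<in> borel_measurable N" "h \<in> N \<rightarrow>\<^sub>M M"
  shows "(\<lambda>x. clipped (g x) (h x)) \<in> borel_measurable N"
  using measurable_compose[OF measurable_Pair[OF assms] clipped_joint_measurable] by simp

lemma past_increment_distr:
  assumes \<tau>: "\<And>i. i \<le> m \<Longrightarrow> \<tau> i \<in> {0..T}" "\<And>i. i < m \<Longrightarrow> \<tau> i \<le> \<tau> (Suc i)" "\<tau> 0 = 0"
    and t: "\<tau> m < t" "t \<le> T"
  defines "V \<equiv> \<lambda>\<omega>. \<lambda>i\<in>{..m}. clipped (\<tau> i) \<omega>" and "Y \<equiv> \<lambda>\<omega>. clipped t \<omega> - clipped (\<tau> m) \<omega>"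
  shows "distr M ((\<Pi>\<^sub>M i\<in>{..m}. borel) \<Otimes>\<^sub>M borel) (\<lambda>\<omega>. (V \<omega>, Y \<omega>))
      = distr M (\<Pi>\<^sub>M i\<in>{..m}. borel) V \<Otimes>\<^sub>M density lborel (\<lambda>x. ennreal (gauss (sqrt (t - \<tau> m)) x))"
    and "V \<in> M \<rightarrow>\<^sub>M (\<Pi>\<^sub>M i\<in>{..m}. borel)"
proof -
  have tm: "\<tau> m \<in> {0..T}" using \<tau>(1) by blast
  then have tt: "t \<in> {0..T}" using t by simp
  have V: "V = (\<lambda>\<omega>. \<lambda>i\<in>{..m}. X (\<tau> i) \<omega>)"
    unfolding V_def using \<tau>(1) by (intro ext restrict_ext) (simp add: clipped_eq)
  have Y: "Y = (\<lambda>\<omega>. X t \<omega> - X (\<tau> m) \<omega>)" unfolding Y_def using tm tt by (simp add: clipped_eq)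
  have d: "distr M borel Y = density lborel (\<lambda>x. ennreal (gauss (sqrt (t - \<tau> m)) x))"
    unfolding Y using increment_distr[of "\<tau> m" t] tm t by simp
  have "distr M ((\<Pi>\<^sub>M i\<in>{..m}. borel) \<Otimes>\<^sub>M borel) (\<lambda>\<omega>. (V \<omega>, Y \<omega>)) = distr M (\<Pi>\<^sub>M i\<in>{..m}. borel) V \<Otimes>\<^sub>M distr M borel Y"
    unfolding V Y using \<tau> t by (intro indep_past_increment) auto
  then show "distr M ((\<Pi>\<^sub>M i\<in>{..m}. borel) \<Otimes>\<^sub>M borel) (\<lambda>\<omega>. (V \<omega>, Y \<omega>))
      = distr M (\<Pi>\<^sub>M i\<in>{..m}. borel) V \<Otimes>\<^sub>M density lborel (\<lambda>x. ennreal (gauss (sqrt (t - \<tau> m)) x))"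
    by (simp only: d)
  show "V \<in> M \<rightarrow>\<^sub>M (\<Pi>\<^sub>M i\<in>{..m}. borel)" unfolding V_def by (intro measurable_restrict) simp
qed

lemma prob_space_gauss: "0 < \<sigma> \<Longrightarrow> prob_space (density lborel (\<lambda>x::'a. ennreal (gauss \<sigma> x)))"
  by (rule prob_spaceI) (simp add: emeasure_density gauss_nn_integral)

text \<open>An increment can be integrated out with its Gaussian density, given the past.\<close>

lemma nn_integral_past_increment:
  assumes \<tau>: "\<And>i. i \<le> m \<Longrightarrow> \<tau> i \<in> {0..T}" "\<And>i. i < m \<Longrightarrow> \<tau> i \<le> \<tau> (Suc i)" "\<tau> 0 = 0"
    and t: "\<tau> m < t" "t \<le> T"
    and h[measurable]: "h \<in> borel_measurable ((\<Pi>\<^sub>M i\<in>{..m}. borel) \<Otimes>\<^sub>M (borel :: 'a measure))"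
  shows "(\<integral>\<^sup>+\<omega>. h (\<lambda>i\<in>{..m}. clipped (\<tau> i) \<omega>, clipped t \<omega> - clipped (\<tau> m) \<omega>) \<partial>M)
    = (\<integral>\<^sup>+\<omega>. (\<integral>\<^sup>+y. ennreal (gauss (sqrt (t - \<tau> m)) y) * h (\<lambda>i\<in>{..m}. clipped (\<tau> i) \<omega>, y) \<partial>lborel) \<partial>M)"
proof -
  let ?P = "\<Pi>\<^sub>M i\<in>{..m}. (borel :: 'a measure)" and ?V = "\<lambda>\<omega>. \<lambda>i\<in>{..m}. clipped (\<tau> i) \<omega>"
  let ?D = "density lborel (\<lambda>x::'a. ennreal (gauss (sqrt (t - \<tau> m)) x))"
  have d: "distr M (?P \<Otimes>\<^sub>M borel) (\<lambda>\<omega>. (?V \<omega>, clipped t \<omega> - clipped (\<tau> m) \<omega>)) = distr M ?P ?V \<Otimes>\<^sub>M ?D"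
    by (rule past_increment_distr(1)[OF \<tau> t])
  interpret D: prob_space ?D using t by (intro prob_space_gauss) simp
  have V: "?V \<in> M \<rightarrow>\<^sub>M ?P" by (rule past_increment_distr(2)[OF \<tau> t])
  have VY: "(\<lambda>\<omega>. (?V \<omega>, clipped t \<omega> - clipped (\<tau> m) \<omega>)) \<in> M \<rightarrow>\<^sub>M ?P \<Otimes>\<^sub>M borel"
    by (intro measurable_Pair V) measurable
  have hm: "h \<in> borel_measurable (distr M ?P ?V \<Otimes>\<^sub>M ?D)"
    by (subst measurable_cong_sets[OF sets_pair_measure_cong refl, of _ ?P _ borel]) (use h in auto)
  have "(\<integral>\<^sup>+\<omega>. h (?V \<omega>, clipped t \<omega> - clipped (\<tau> m) \<omega>) \<partial>M) = (\<integral>\<^sup>+x. h x \<partial>(distr M ?P ?V \<Otimes>\<^sub>M ?D))"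
    unfolding d[symmetric] by (subst nn_integral_distr[OF VY]) (use h in simp_all)
  also have "\<dots> = (\<integral>\<^sup>+v. (\<integral>\<^sup>+y. h (v, y) \<partial>?D) \<partial>distr M ?P ?V)"
    by (rule D.nn_integral_fst[OF hm, symmetric])
  also have "\<dots> = (\<integral>\<^sup>+v. (\<integral>\<^sup>+y. ennreal (gauss (sqrt (t - \<tau> m)) y) * h (v, y) \<partial>lborel) \<partial>distr M ?P ?V)"
  proof (rule nn_integral_cong)
    fix v assume "v \<in> space (distr M ?P ?V)"
    then have v: "v \<in> space ?P" by simp
    have "(\<lambda>y. h (v, y)) \<in> borel_measurable borel" using measurable_Pair2[OF h v] .
    then show "(\<integral>\<^sup>+y. h (v, y) \<partial>?D) = (\<integral>\<^sup>+y. ennreal (gauss (sqrt (t - \<tau> m)) y) * h (v, y) \<partial>lborel)"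
      by (intro nn_integral_density) auto
  qed
  also have "\<dots> = (\<integral>\<^sup>+\<omega>. (\<integral>\<^sup>+y. ennreal (gauss (sqrt (t - \<tau> m)) y) * h (?V \<omega>, y) \<partial>lborel) \<partial>M)"
    by (rule nn_integral_distr[OF V]) measurable
  finally show ?thesis .
qed

lemma nn_integral_state_increment:
  assumes s: "0 \<le> s" "s < t" "t \<le> T"
    and h[measurable]: "(\<lambda>p. h (fst p) (snd p)) \<in> borel_measurable (borel \<Otimes>\<^sub>M (borel :: 'a measure))"
  shows "(\<integral>\<^sup>+\<omega>. h (clipped s \<omega>) (clipped t \<omega> - clipped s \<omega>) \<partial>M)
    = (\<integral>\<^sup>+\<omega>. (\<integral>\<^sup>+y. ennreal (gauss (sqrt (t - s)) y) * h (clipped s \<omega>) y \<partial>lborel) \<partial>M)"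
proof -
  let ?\<tau> = "\<lambda>i::nat. if i = 0 then 0 else s"
  have "(\<lambda>p. (fst p (1::nat), snd p)) \<in> (\<Pi>\<^sub>M i\<in>{..1}. borel) \<Otimes>\<^sub>M borel \<rightarrow>\<^sub>M borel \<Otimes>\<^sub>M (borel :: 'a measure)"
    by (intro measurable_Pair measurable_compose[OF measurable_fst] measurable_component_singleton measurable_snd) simp
  from measurable_compose[OF this h]
  have m: "(\<lambda>p. h (fst p (1::nat)) (snd p)) \<in> borel_measurable ((\<Pi>\<^sub>M i\<in>{..1}. borel) \<Otimes>\<^sub>M (borel :: 'a measure))" by simp
  have "(\<integral>\<^sup>+\<omega>. (\<lambda>p. h (fst p (1::nat)) (snd p)) (\<lambda>i\<in>{..1}. clipped (?\<tau> i) \<omega>, clipped t \<omega> - clipped (?\<tau> 1) \<omega>) \<partial>M)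
    = (\<integral>\<^sup>+\<omega>. (\<integral>\<^sup>+y. ennreal (gauss (sqrt (t - ?\<tau> 1)) y) * (\<lambda>p. h (fst p (1::nat)) (snd p)) (\<lambda>i\<in>{..1}. clipped (?\<tau> i) \<omega>, y) \<partial>lborel) \<partial>M)"
    by (rule nn_integral_past_increment[OF _ _ _ _ _ m]) (use s in auto)
  then show ?thesis by simp
qed

lemma nn_integral_increment_square:
  fixes G :: "'a \<Rightarrow> 'a"
  assumes s: "0 \<le> s" "s \<le> q" "q \<le> p" "p \<le> T" and [measurable]: "G \<in> borel_measurable borel"
  shows "(\<integral>\<^sup>+\<omega>. ennreal ((G (clipped s \<omega>) \<bullet> (clipped p \<omega> - clipped q \<omega>))\<^sup>2) \<partial>M) = ennreal (p - q) * (\<integral>\<^sup>+\<omega>. ennreal ((norm (G (clipped s \<omega>)))\<^sup>2) \<partial>M)"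
proof (cases "q = p")
  case False
  let ?\<tau> = "\<lambda>i::nat. if i = 0 then 0 else if i = 1 then s else q"
  let ?h = "\<lambda>p::(nat \<Rightarrow> 'a) \<times> 'a. ennreal ((G (fst p 1) \<bullet> snd p)\<^sup>2)"
  have m: "?h \<in> borel_measurable ((\<Pi>\<^sub>M i\<in>{..2}. borel) \<Otimes>\<^sub>M (borel :: 'a measure))"
  proof -
    have [measurable]: "(\<lambda>p. fst p (1::nat)) \<in> (\<Pi>\<^sub>M i\<in>{..2}. borel) \<Otimes>\<^sub>M borel \<rightarrow>\<^sub>M (borel :: 'a measure)"
      by (intro measurable_compose[OF measurable_fst] measurable_component_singleton) simp
    show ?thesis by measurable
  qed
  have "(\<integral>\<^sup>+\<omega>. ?h (\<lambda>i\<in>{..2}. clipped (?\<tau> i) \<omega>, clipped p \<omega> - clipped (?\<tau> 2) \<omega>) \<partial>M)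
    = (\<integral>\<^sup>+\<omega>. (\<integral>\<^sup>+y. ennreal (gauss (sqrt (p - ?\<tau> 2)) y) * ?h (\<lambda>i\<in>{..2}. clipped (?\<tau> i) \<omega>, y) \<partial>lborel) \<partial>M)"
    by (rule nn_integral_past_increment[OF _ _ _ _ _ m]) (use s False in auto)
  also have "\<dots> = (\<integral>\<^sup>+\<omega>. ennreal (p - q) * ennreal ((norm (G (clipped s \<omega>)))\<^sup>2) \<partial>M)"
  proof (rule nn_integral_cong)
    fix \<omega>
    let ?v = "G (clipped s \<omega>)"
    have \<sigma>: "0 < sqrt (p - q)" using s False by simp
    have "(\<integral>\<^sup>+y. ennreal (gauss (sqrt (p - q)) y) * ennreal ((?v \<bullet> y)\<^sup>2) \<partial>lborel) = (\<integral>\<^sup>+y. ennreal (gauss (sqrt (p - q)) y * (?v \<bullet> y)\<^sup>2) \<partial>lborel)"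
      by (simp add: ennreal_mult gauss_nonneg)
    also have "\<dots> = ennreal ((sqrt (p - q))\<^sup>2 * (norm ?v)\<^sup>2)"
      using gauss_second_moment[OF \<sigma>, of ?v] by (subst nn_integral_eq_integral) (auto simp: gauss_nonneg)
    also have "\<dots> = ennreal (p - q) * ennreal ((norm ?v)\<^sup>2)"
      using s by (simp add: ennreal_mult)
    finally show "(\<integral>\<^sup>+y. ennreal (gauss (sqrt (p - ?\<tau> 2)) y) * ?h (\<lambda>i\<in>{..2}. clipped (?\<tau> i) \<omega>, y) \<partial>lborel) = ennreal (p - q) * ennreal ((norm ?v)\<^sup>2)"
      by simp
  qed
  also have "\<dots> = ennreal (p - q) * (\<integral>\<^sup>+\<omega>. ennreal ((norm (G (clipped s \<omega>)))\<^sup>2) \<partial>M)"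
    by (rule nn_integral_cmult) measurable
  finally show ?thesis by simp
qed simp

text \<open>The martingale difference property in the only form needed: three past states and a
  function of an increment that is centred given the present state.\<close>

lemma orthogonal_to_past:
  fixes u :: "'a \<times> 'a \<times> 'a \<Rightarrow> real" and q :: "'a \<Rightarrow> 'a \<Rightarrow> real"
  assumes r: "0 \<le> r0" "r0 \<le> r1" "r1 \<le> r2" "r2 \<le> s" "s < t" "t \<le> T"
    and u[measurable]: "u \<in> borel_measurable borel" and q[measurable]: "(\<lambda>p. q (fst p) (snd p)) \<in> borel_measurable (borel \<Otimes>\<^sub>M borel)"
    and u2: "integrable M (\<lambda>\<omega>. (u (clipped r0 \<omega>, clipped r1 \<omega>, clipped r2 \<omega>))\<^sup>2)"
    and q2: "integrable M (\<lambda>\<omega>. (q (clipped s \<omega>) (clipped t \<omega> - clipped s \<omega>))\<^sup>2)"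
    and q0: "\<And>x. (\<integral>y. gauss (sqrt (t - s)) y * q x y \<partial>lborel) = 0"
  shows "(\<integral>\<omega>. u (clipped r0 \<omega>, clipped r1 \<omega>, clipped r2 \<omega>) * q (clipped s \<omega>) (clipped t \<omega> - clipped s \<omega>) \<partial>M) = 0"
proof -
  define \<tau> where "\<tau> i = (if i = 0 then 0 else if i = 1 then r0 else if i = 2 then r1 else if i = 3 then r2 else s)" for i :: nat
  have \<tau>v: "\<tau> 0 = 0" "\<tau> 1 = r0" "\<tau> 2 = r1" "\<tau> 3 = r2" "\<tau> 4 = s" by (simp_all add: \<tau>_def)
  let ?P = "\<Pi>\<^sub>M i\<in>{..4::nat}. (borel :: 'a measure)" and ?V = "\<lambda>\<omega>. \<lambda>i\<in>{..4}. clipped (\<tau> i) \<omega>"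
  let ?D = "density lborel (\<lambda>x::'a. ennreal (gauss (sqrt (t - s)) x))"
  have d: "distr M (?P \<Otimes>\<^sub>M borel) (\<lambda>\<omega>. (?V \<omega>, clipped t \<omega> - clipped s \<omega>)) = distr M ?P ?V \<Otimes>\<^sub>M ?D"
    and V: "?V \<in> M \<rightarrow>\<^sub>M ?P"
  proof -
    have 1: "\<tau> i \<in> {0..T}" for i using r by (auto simp: \<tau>_def)
    have 2: "\<tau> i \<le> \<tau> (Suc i)" for i using r by (auto simp: \<tau>_def)
    show "distr M (?P \<Otimes>\<^sub>M borel) (\<lambda>\<omega>. (?V \<omega>, clipped t \<omega> - clipped s \<omega>)) = distr M ?P ?V \<Otimes>\<^sub>M ?D" "?V \<in> M \<rightarrow>\<^sub>M ?P"
      using past_increment_distr[of 4 \<tau> t, OF 1 2] r unfolding \<tau>v by auto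
  qed
  interpret D: prob_space ?D using r by (intro prob_space_gauss) simp
  interpret V: prob_space "distr M ?P ?V" by (rule prob_space_distr[OF V])
  interpret VD: pair_sigma_finite "distr M ?P ?V" ?D ..
  let ?F = "\<lambda>p::(nat \<Rightarrow> 'a) \<times> 'a. u (fst p 1, fst p 2, fst p 3) * q (fst p 4) (snd p)"
  have [measurable]: "(\<lambda>p. fst p i) \<in> ?P \<Otimes>\<^sub>M borel \<rightarrow>\<^sub>M (borel :: 'a measure)" if "i \<le> 4" for i
    using that by (intro measurable_compose[OF measurable_fst] measurable_component_singleton) simp
  have F: "?F \<in> borel_measurable (?P \<Otimes>\<^sub>M borel)"
  proof (rule borel_measurable_times)
    have "(\<lambda>p. (fst p 1, fst p 2, fst p 3)) \<in> ?P \<Otimes>\<^sub>M borel \<rightarrow>\<^sub>M (borel :: ('a \<times> 'a \<times> 'a) measure)"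
      unfolding borel_prod[symmetric] by measurable
    from measurable_compose[OF this u] show "(\<lambda>p. u (fst p 1, fst p 2, fst p 3)) \<in> borel_measurable (?P \<Otimes>\<^sub>M borel)" .
    have "(\<lambda>p. (fst p 4, snd p)) \<in> ?P \<Otimes>\<^sub>M borel \<rightarrow>\<^sub>M (borel \<Otimes>\<^sub>M borel :: ('a \<times> 'a) measure)"
      by measurable
    from measurable_compose[OF this q] show "(\<lambda>p. q (fst p 4) (snd p)) \<in> borel_measurable (?P \<Otimes>\<^sub>M borel)" by simp
  qed
  have VY: "(\<lambda>\<omega>. (?V \<omega>, clipped t \<omega> - clipped s \<omega>)) \<in> M \<rightarrow>\<^sub>M ?P \<Otimes>\<^sub>M borel"
    by (intro measurable_Pair V) measurable
  have e: "?F (?V \<omega>, clipped t \<omega> - clipped s \<omega>) = u (clipped r0 \<omega>, clipped r1 \<omega>, clipped r2 \<omega>) * q (clipped s \<omega>) (clipped t \<omega> - clipped s \<omega>)" for \<omega>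
    by (simp add: \<tau>_def)
  have i: "integrable M (\<lambda>\<omega>. u (clipped r0 \<omega>, clipped r1 \<omega>, clipped r2 \<omega>) * q (clipped s \<omega>) (clipped t \<omega> - clipped s \<omega>))"
  proof (rule L2_Cauchy_Schwarz(1)[OF _ _ u2 q2])
    have "(\<lambda>\<omega>. (clipped r0 \<omega>, clipped r1 \<omega>, clipped r2 \<omega>)) \<in> M \<rightarrow>\<^sub>M (borel :: ('a \<times> 'a \<times> 'a) measure)"
      unfolding borel_prod[symmetric] by measurable
    from measurable_compose[OF this u] show "(\<lambda>\<omega>. u (clipped r0 \<omega>, clipped r1 \<omega>, clipped r2 \<omega>)) \<in> borel_measurable M" .
    have "(\<lambda>\<omega>. (clipped s \<omega>, clipped t \<omega> - clipped s \<omega>)) \<in> M \<rightarrow>\<^sub>M borel \<Otimes>\<^sub>M borel" by measurable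
    from measurable_compose[OF this q] show "(\<lambda>\<omega>. q (clipped s \<omega>) (clipped t \<omega> - clipped s \<omega>)) \<in> borel_measurable M" by simp
  qed
  then have iF: "integrable (distr M ?P ?V \<Otimes>\<^sub>M ?D) ?F"
    unfolding d[symmetric] by (subst integrable_distr_eq[OF VY F]) (simp only: e)
  have "(\<integral>\<omega>. u (clipped r0 \<omega>, clipped r1 \<omega>, clipped r2 \<omega>) * q (clipped s \<omega>) (clipped t \<omega> - clipped s \<omega>) \<partial>M) = (\<integral>p. ?F p \<partial>(distr M ?P ?V \<Otimes>\<^sub>M ?D))"
    unfolding d[symmetric] by (subst integral_distr[OF VY F]) (simp only: e)
  also have "\<dots> = (\<integral>v. (\<integral>y. ?F (v, y) \<partial>?D) \<partial>distr M ?P ?V)"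
    by (rule VD.integral_fst'[OF iF, symmetric])
  also have "\<dots> = (\<integral>v. 0 \<partial>distr M ?P ?V)"
  proof (rule Bochner_Integration.integral_cong[OF refl])
    fix v :: "nat \<Rightarrow> 'a"
    have [measurable]: "(\<lambda>y. q (v 4) y) \<in> borel_measurable borel"
      using measurable_compose[OF measurable_Pair[OF measurable_const[of "v 4" borel borel] measurable_ident] q] by simp
    have "(\<integral>y. ?F (v, y) \<partial>?D) = u (v 1, v 2, v 3) * (\<integral>y. q (v 4) y \<partial>?D)" by simp
    also have "(\<integral>y. q (v 4) y \<partial>?D) = (\<integral>y. gauss (sqrt (t - s)) y * q (v 4) y \<partial>lborel)"
      by (subst integral_density) (auto simp: gauss_nonneg)
    finally show "(\<integral>y. ?F (v, y) \<partial>?D) = 0" by (simp add: q0)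
  qed
  finally show ?thesis by simp
qed

text \<open>At positive times the law is a mixture of Gaussians centred at the initial value. These
  densities depend continuously on time and are bounded locally uniformly, so dominated
  convergence applies even to discontinuous \<open>g\<close>.\<close>

lemma expectation_continuous:
  fixes g :: "'a \<Rightarrow> ennreal"
  assumes [measurable]: "g \<in> borel_measurable borel" and g: "(\<integral>\<^sup>+x. g x \<partial>lborel) < \<infinity>"
    and s: "\<And>n. 0 < s n" "\<And>n. s n \<le> T" "s \<longlonglongrightarrow> t" and t: "0 < t" "t \<le> T"
  shows "(\<lambda>n. \<integral>\<^sup>+\<omega>. g (clipped (s n) \<omega>) \<partial>M) \<longlonglongrightarrow> (\<integral>\<^sup>+\<omega>. g (clipped t \<omega>) \<partial>M)"
proof -
  have e: "(\<integral>\<^sup>+\<omega>. g (clipped a \<omega>) \<partial>M) = (\<integral>\<^sup>+\<omega>. (\<integral>\<^sup>+z. ennreal (gauss (sqrt a) (z - clipped 0 \<omega>)) * g z \<partial>lborel) \<partial>M)" if a: "0 < a" "a \<le> T" for a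
  proof -
    have "(\<integral>\<^sup>+\<omega>. g (clipped a \<omega>) \<partial>M) = (\<integral>\<^sup>+\<omega>. g (clipped 0 \<omega> + (clipped a \<omega> - clipped 0 \<omega>)) \<partial>M)" by simp
    also have "\<dots> = (\<integral>\<^sup>+\<omega>. (\<integral>\<^sup>+y. ennreal (gauss (sqrt (a - 0)) y) * g (clipped 0 \<omega> + y) \<partial>lborel) \<partial>M)"
      by (rule nn_integral_state_increment[of 0 a "\<lambda>x y. g (x + y)"]) (use a in auto)
    also have "\<dots> = (\<integral>\<^sup>+\<omega>. (\<integral>\<^sup>+z. ennreal (gauss (sqrt a) (z - clipped 0 \<omega>)) * g z \<partial>lborel) \<partial>M)"
    proof (rule nn_integral_cong)
      fix \<omega>
      show "(\<integral>\<^sup>+y. ennreal (gauss (sqrt (a - 0)) y) * g (clipped 0 \<omega> + y) \<partial>lborel) = (\<integral>\<^sup>+z. ennreal (gauss (sqrt a) (z - clipped 0 \<omega>)) * g z \<partial>lborel)"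
        using nn_integral_translate[of "\<lambda>z. ennreal (gauss (sqrt a) (z - clipped 0 \<omega>)) * g z" "clipped 0 \<omega>"] by (simp add: add.commute)
    qed
    finally show ?thesis .
  qed
  have "\<forall>\<^sub>F n in sequentially. t / 2 < s n"
    using order_tendstoD(1)[OF s(3), of "t / 2"] t by simp
  then obtain n0 where n0: "\<And>n. n \<ge> n0 \<Longrightarrow> t / 2 < s n" by (auto simp: eventually_sequentially)
  define B where "B = (1 / sqrt (2 * pi * (t / 2))) ^ DIM('a)"
  have B0: "0 \<le> B" using t by (simp add: B_def)
  have gb: "gauss (sqrt a) y \<le> B" if a: "t / 2 < a" for a and y :: 'a
  proof -
    have "gauss (sqrt a) y \<le> (1 / sqrt (2 * pi * (sqrt a)\<^sup>2)) ^ DIM('a)" by (rule gauss_le)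
    also have "\<dots> \<le> B"
      unfolding B_def using a t by (intro power_mono divide_left_mono real_sqrt_le_mono) auto
    finally show ?thesis .
  qed
  let ?\<psi> = "\<lambda>a \<omega>. \<integral>\<^sup>+z. ennreal (gauss (sqrt a) (z - clipped 0 \<omega>)) * g z \<partial>lborel"
  have fin: "ennreal B * (\<integral>\<^sup>+x. g x \<partial>lborel) < \<infinity>" using g by (simp add: ennreal_mult_less_top)
  have inner: "(\<lambda>n. ?\<psi> (s (n + n0)) \<omega>) \<longlonglongrightarrow> ?\<psi> t \<omega>" for \<omega>
  proof (rule nn_integral_dominated_convergence[where w="\<lambda>z. ennreal B * g z"])
    show "(\<integral>\<^sup>+z. ennreal B * g z \<partial>lborel) < \<infinity>" using fin by (simp add: nn_integral_cmult)
    show "AE z in lborel. ennreal (gauss (sqrt (s (n + n0))) (z - clipped 0 \<omega>)) * g z \<le> ennreal B * g z" for n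
      by (intro AE_I2 mult_right_mono ennreal_leI gb n0) auto
    have "AE z in lborel. g z \<noteq> \<infinity>" using g by (intro nn_integral_PInf_AE) auto
    then show "AE z in lborel. (\<lambda>n. ennreal (gauss (sqrt (s (n + n0))) (z - clipped 0 \<omega>)) * g z) \<longlonglongrightarrow> ennreal (gauss (sqrt t) (z - clipped 0 \<omega>)) * g z"
    proof eventually_elim
      case (elim z)
      have "(\<lambda>n. ennreal (gauss (sqrt (s (n + n0))) (z - clipped 0 \<omega>))) \<longlonglongrightarrow> ennreal (gauss (sqrt t) (z - clipped 0 \<omega>))"
        by (intro tendsto_ennrealI gauss_continuous t LIMSEQ_ignore_initial_segment s)
      then have "(\<lambda>n. g z * ennreal (gauss (sqrt (s (n + n0))) (z - clipped 0 \<omega>))) \<longlonglongrightarrow> g z * ennreal (gauss (sqrt t) (z - clipped 0 \<omega>))"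
        using elim by (intro ennreal_tendsto_cmult) (auto simp: less_top)
      then show ?case by (simp only: mult.commute)
    qed
  qed measurable
  have "(\<lambda>n. \<integral>\<^sup>+\<omega>. ?\<psi> (s (n + n0)) \<omega> \<partial>M) \<longlonglongrightarrow> (\<integral>\<^sup>+\<omega>. ?\<psi> t \<omega> \<partial>M)"
  proof (rule nn_integral_dominated_convergence[where w="\<lambda>_. ennreal B * (\<integral>\<^sup>+x. g x \<partial>lborel)"])
    show "(\<integral>\<^sup>+\<omega>. ennreal B * (\<integral>\<^sup>+x. g x \<partial>lborel) \<partial>M) < \<infinity>" using fin by (simp add: emeasure_space_1)
    show "AE \<omega> in M. ?\<psi> (s (n + n0)) \<omega> \<le> ennreal B * (\<integral>\<^sup>+x. g x \<partial>lborel)" for n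
      by (subst nn_integral_cmult[symmetric]) (auto intro!: AE_I2 nn_integral_mono mult_right_mono ennreal_leI gb n0)
    show "AE \<omega> in M. (\<lambda>n. ?\<psi> (s (n + n0)) \<omega>) \<longlonglongrightarrow> ?\<psi> t \<omega>" using inner by simp
  qed measurable
  then have "(\<lambda>n. \<integral>\<^sup>+\<omega>. g (clipped (s (n + n0)) \<omega>) \<partial>M) \<longlonglongrightarrow> (\<integral>\<^sup>+\<omega>. g (clipped t \<omega>) \<partial>M)"
    using s t by (simp add: e)
  then show ?thesis by (rule LIMSEQ_offset)
qed

text \<open>The one place where the two alternative hypotheses enter. In dimension one the Gaussian
  density with variance \<open>t\<close> is itself at most \<open>t\<^sup>-\<^sup>1\<^sup>/\<^sup>2\<close>. A bounded initial density stays bounded under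
  convolution, and \<open>1 \<le> \<surd>T t\<^sup>-\<^sup>1\<^sup>/\<^sup>2\<close> brings both cases to the same form.\<close>

lemma density_bound:
  assumes "has_bounded_density M (X 0) \<or> DIM('a) = 1"
  shows "\<exists>C\<ge>0. \<forall>t h. 0 < t \<longrightarrow> t \<le> T \<longrightarrow> h \<in> borel_measurable borel \<longrightarrow>
    (\<integral>\<^sup>+\<omega>. h (clipped t \<omega>) \<partial>M) \<le> ennreal (C * t powr (-1/2)) * (\<integral>\<^sup>+x. h x \<partial>(lborel :: 'a measure))"
proof -
  have e: "(\<integral>\<^sup>+\<omega>. h (clipped t \<omega>) \<partial>M) = (\<integral>\<^sup>+\<omega>. (\<integral>\<^sup>+y. ennreal (gauss (sqrt t) y) * h (clipped 0 \<omega> + y) \<partial>lborel) \<partial>M)"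
    if t: "0 < t" "t \<le> T" and [measurable]: "h \<in> borel_measurable borel" for t and h :: "'a \<Rightarrow> ennreal"
  proof -
    have "(\<integral>\<^sup>+\<omega>. h (clipped t \<omega>) \<partial>M) = (\<integral>\<^sup>+\<omega>. h (clipped 0 \<omega> + (clipped t \<omega> - clipped 0 \<omega>)) \<partial>M)" by simp
    also have "\<dots> = (\<integral>\<^sup>+\<omega>. (\<integral>\<^sup>+y. ennreal (gauss (sqrt (t - 0)) y) * h (clipped 0 \<omega> + y) \<partial>lborel) \<partial>M)"
      by (rule nn_integral_state_increment[of 0 t "\<lambda>x y. h (x + y)"]) (use t in auto)
    finally show ?thesis by simp
  qed
  from assms show ?thesis
  proof
    assume d1: "DIM('a) = 1"
    show ?thesis
    proof (intro exI[of _ 1] conjI allI impI)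
      fix t and h :: "'a \<Rightarrow> ennreal" assume t: "0 < t" "t \<le> T" and [measurable]: "h \<in> borel_measurable borel"
      have g: "gauss (sqrt t) y \<le> 1 * t powr (-1/2)" for y :: 'a
      proof -
        have "gauss (sqrt t) y \<le> 1 / sqrt (2 * pi * t)" using gauss_le[of "sqrt t" y] t d1 by simp
        also have "\<dots> \<le> 1 / sqrt t"
          using t pi_ge_two by (intro divide_left_mono real_sqrt_le_mono) auto
        also have "\<dots> = t powr (-1/2)" using t by (simp add: powr_minus powr_half_sqrt field_simps)
        finally show ?thesis by simp
      qed
      have "(\<integral>\<^sup>+\<omega>. h (clipped t \<omega>) \<partial>M) \<le> (\<integral>\<^sup>+\<omega>. ennreal (1 * t powr (-1/2)) * (\<integral>\<^sup>+x. h x \<partial>lborel) \<partial>M)"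
        unfolding e[OF t \<open>h \<in> borel_measurable borel\<close>]
      proof (rule nn_integral_mono)
        fix \<omega>
        have "(\<integral>\<^sup>+y. ennreal (gauss (sqrt t) y) * h (clipped 0 \<omega> + y) \<partial>lborel) \<le> (\<integral>\<^sup>+y. ennreal (1 * t powr (-1/2)) * h (y + clipped 0 \<omega>) \<partial>lborel)"
        proof (rule nn_integral_mono)
          fix y
          show "ennreal (gauss (sqrt t) y) * h (clipped 0 \<omega> + y) \<le> ennreal (1 * t powr (-1/2)) * h (y + clipped 0 \<omega>)"
            unfolding add.commute[of y] by (intro mult_right_mono ennreal_leI g) simp
        qed
        also have "\<dots> = ennreal (1 * t powr (-1/2)) * (\<integral>\<^sup>+y. h (y + clipped 0 \<omega>) \<partial>lborel)" by (rule nn_integral_cmult) measurable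
        also have "(\<integral>\<^sup>+y. h (y + clipped 0 \<omega>) \<partial>lborel) = (\<integral>\<^sup>+y. h y \<partial>lborel)" by (rule nn_integral_translate) measurable
        finally show "(\<integral>\<^sup>+y. ennreal (gauss (sqrt t) y) * h (clipped 0 \<omega> + y) \<partial>lborel) \<le> ennreal (1 * t powr (-1/2)) * (\<integral>\<^sup>+x. h x \<partial>lborel)" .
      qed
      then show "(\<integral>\<^sup>+\<omega>. h (clipped t \<omega>) \<partial>M) \<le> ennreal (1 * t powr (-1/2)) * (\<integral>\<^sup>+x. h x \<partial>lborel)"
        by (simp add: emeasure_space_1)
    qed simp
  next
    assume "has_bounded_density M (X 0)"
    then obtain p C0 where p: "distributed M lborel (X 0) p" and C0: "AE x in lborel. p x \<le> ennreal C0"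
      by (auto simp: has_bounded_density_def)
    define C where "C = max 0 C0"
    have C: "AE x in lborel. p x \<le> ennreal C" using C0 by (rule eventually_mono) (erule order_trans, simp add: C_def ennreal_leI)
    have C_nn: "0 \<le> C" by (simp add: C_def)
    have [measurable]: "p \<in> borel_measurable borel" using p by (simp add: distributed_def)
    have X0: "clipped 0 = X 0" using T_pos by (intro clipped_eq) simp
    show ?thesis
    proof (intro exI[of _ "C * sqrt T"] conjI allI impI)
      show "0 \<le> C * sqrt T" using C_nn T_pos by simp
      fix t and h :: "'a \<Rightarrow> ennreal" assume t: "0 < t" "t \<le> T" and [measurable]: "h \<in> borel_measurable borel"
      have "(\<integral>\<^sup>+\<omega>. h (clipped t \<omega>) \<partial>M) = (\<integral>\<^sup>+y. (\<integral>\<^sup>+\<omega>. ennreal (gauss (sqrt t) y) * h (clipped 0 \<omega> + y) \<partial>M) \<partial>lborel)"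
        unfolding e[OF t \<open>h \<in> borel_measurable borel\<close>] by (rule nn_Fubini_lborel[symmetric]) measurable
      also have "\<dots> \<le> (\<integral>\<^sup>+y. ennreal (gauss (sqrt t) y) * (ennreal C * (\<integral>\<^sup>+x. h x \<partial>lborel)) \<partial>(lborel :: 'a measure))"
      proof (rule nn_integral_mono)
        fix y :: 'a
        have "(\<integral>\<^sup>+\<omega>. ennreal (gauss (sqrt t) y) * h (clipped 0 \<omega> + y) \<partial>M) = ennreal (gauss (sqrt t) y) * (\<integral>\<^sup>+\<omega>. h (X 0 \<omega> + y) \<partial>M)"
          unfolding X0[symmetric] by (rule nn_integral_cmult) measurable
        also have "(\<integral>\<^sup>+\<omega>. h (X 0 \<omega> + y) \<partial>M) = (\<integral>\<^sup>+x. p x * h (x + y) \<partial>lborel)"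
          by (rule distributed_nn_integral[OF p, symmetric]) measurable
        also have "\<dots> \<le> (\<integral>\<^sup>+x. ennreal C * h (x + y) \<partial>lborel)"
          using C by (intro nn_integral_mono_AE) (auto elim!: eventually_mono intro!: mult_right_mono)
        also have "\<dots> = ennreal C * (\<integral>\<^sup>+x. h (x + y) \<partial>lborel)" by (rule nn_integral_cmult) measurable
        also have "(\<integral>\<^sup>+x. h (x + y) \<partial>lborel) = (\<integral>\<^sup>+x. h x \<partial>lborel)" by (rule nn_integral_translate) measurable
        finally show "(\<integral>\<^sup>+\<omega>. ennreal (gauss (sqrt t) y) * h (clipped 0 \<omega> + y) \<partial>M) \<le> ennreal (gauss (sqrt t) y) * (ennreal C * (\<integral>\<^sup>+x. h x \<partial>lborel))"
          by (simp add: mult_left_mono)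
      qed
      also have "\<dots> = ennreal C * (\<integral>\<^sup>+x. h x \<partial>lborel)"
        using gauss_nn_integral[of "sqrt t", where 'a='a] t by (subst nn_integral_multc) auto
      also have "\<dots> \<le> ennreal (C * sqrt T * t powr (-1/2)) * (\<integral>\<^sup>+x. h x \<partial>lborel)"
      proof (intro mult_right_mono ennreal_leI)
        have "1 \<le> sqrt T * t powr (-1/2)" using t by (simp add: powr_minus powr_half_sqrt field_simps)
        then show "C \<le> C * sqrt T * t powr (-1/2)" using mult_left_mono[of 1 "sqrt T * t powr (-1/2)" C] C_nn by simp
      qed simp
      finally show "(\<integral>\<^sup>+\<omega>. h (clipped t \<omega>) \<partial>M) \<le> ennreal (C * sqrt T * t powr (-1/2)) * (\<integral>\<^sup>+x. h x \<partial>lborel)" .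
    qed
  qed
qed

end

section \<open>Time integrals of square-integrable processes\<close>

lemma L2_norm_triangle:
  fixes f g :: "'b \<Rightarrow> real"
  assumes [measurable]: "f \<in> borel_measurable N" "g \<in> borel_measurable N"
    and f2: "integrable N (\<lambda>x. (f x)\<^sup>2)" and g2: "integrable N (\<lambda>x. (g x)\<^sup>2)"
  shows "integrable N (\<lambda>x. (f x + g x)\<^sup>2)" "L2_norm N (\<lambda>x. f x + g x) \<le> L2_norm N f + L2_norm N g"
proof -
  note fg = L2_Cauchy_Schwarz[OF assms]
  have e: "(f x + g x)\<^sup>2 = (f x)\<^sup>2 + 2 * (f x * g x) + (g x)\<^sup>2" for x by (simp add: power2_eq_square algebra_simps)
  show "integrable N (\<lambda>x. (f x + g x)\<^sup>2)" unfolding e using f2 g2 fg(1) by simp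
  have "(\<integral>x. (f x + g x)\<^sup>2 \<partial>N) = (\<integral>x. (f x)\<^sup>2 \<partial>N) + 2 * (\<integral>x. f x * g x \<partial>N) + (\<integral>x. (g x)\<^sup>2 \<partial>N)"
    unfolding e using f2 g2 fg(1) by simp
  also have "\<dots> \<le> (\<integral>x. (f x)\<^sup>2 \<partial>N) + 2 * (sqrt (\<integral>x. (f x)\<^sup>2 \<partial>N) * sqrt (\<integral>x. (g x)\<^sup>2 \<partial>N)) + (\<integral>x. (g x)\<^sup>2 \<partial>N)"
    using fg(2) by linarith
  also have "\<dots> = (sqrt (\<integral>x. (f x)\<^sup>2 \<partial>N) + sqrt (\<integral>x. (g x)\<^sup>2 \<partial>N))\<^sup>2"
    by (simp add: power2_sum)
  finally show "L2_norm N (\<lambda>x. f x + g x) \<le> L2_norm N f + L2_norm N g"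
    unfolding L2_norm_def by (intro real_le_lsqrt) auto
qed

lemma L2_norm_minus: "L2_norm N (\<lambda>x. - f x) = L2_norm N f"
  by (simp add: L2_norm_def)

lemma L2_norm_cong_AE:
  assumes "AE x in N. f x = g x" "f \<in> borel_measurable N" "g \<in> borel_measurable N"
  shows "L2_norm N f = L2_norm N g"
proof -
  have "(\<integral>x. (f x)\<^sup>2 \<partial>N) = (\<integral>x. (g x)\<^sup>2 \<partial>N)"
    by (rule integral_cong_AE) (use assms in \<open>auto elim: eventually_mono\<close>)
  then show ?thesis by (simp add: L2_norm_def)
qed

context prob_space
begin

lemma square_integrable_product:
  assumes [measurable]: "(\<lambda>p. \<beta> (fst p) (snd p)) \<in> borel_measurable (lborel \<Otimes>\<^sub>M M)"
    and fin: "(\<integral>\<^sup>+r. (\<integral>\<^sup>+\<omega>. ennreal ((\<beta> r \<omega>)\<^sup>2) \<partial>M) \<partial>lborel) < \<infinity>"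
  shows "integrable (lborel \<Otimes>\<^sub>M M) (\<lambda>p. (\<beta> (fst p :: real) (snd p) :: real)\<^sup>2)"
proof (rule integrableI_bounded)
  show "(\<lambda>p. (\<beta> (fst p) (snd p))\<^sup>2) \<in> borel_measurable (lborel \<Otimes>\<^sub>M M)" by measurable
  have "(\<integral>\<^sup>+p. ennreal (norm ((\<beta> (fst p) (snd p))\<^sup>2)) \<partial>(lborel \<Otimes>\<^sub>M M)) = (\<integral>\<^sup>+r. (\<integral>\<^sup>+\<omega>. ennreal ((\<beta> r \<omega>)\<^sup>2) \<partial>M) \<partial>lborel)"
    by (subst nn_integral_fst[symmetric]) simp_all
  then show "(\<integral>\<^sup>+p. ennreal (norm ((\<beta> (fst p) (snd p))\<^sup>2)) \<partial>(lborel \<Otimes>\<^sub>M M)) < \<infinity>" using fin by simp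
qed

text \<open>The Cauchy--Schwarz inequality in time on an interval of length \<open>q - p\<close> outside which the
  process vanishes.\<close>

lemma time_integral:
  fixes \<beta> :: "real \<Rightarrow> 'a \<Rightarrow> real"
  assumes m[measurable]: "(\<lambda>p. \<beta> (fst p) (snd p)) \<in> borel_measurable (lborel \<Otimes>\<^sub>M M)"
    and supp: "\<And>r \<omega>. r \<notin> {p<..q} \<Longrightarrow> \<beta> r \<omega> = 0" and pq: "p \<le> q"
    and fin: "(\<integral>\<^sup>+r. (\<integral>\<^sup>+\<omega>. ennreal ((\<beta> r \<omega>)\<^sup>2) \<partial>M) \<partial>lborel) < \<infinity>"
  shows time_integral_measurable: "(\<lambda>\<omega>. \<integral>r. \<beta> r \<omega> \<partial>lborel) \<in> borel_measurable M"
    and time_integral_AE_integrable: "AE \<omega> in M. integrable lborel (\<lambda>r. \<beta> r \<omega>)"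
    and time_integral_nn_square: "(\<integral>\<^sup>+\<omega>. ennreal ((\<integral>r. \<beta> r \<omega> \<partial>lborel)\<^sup>2) \<partial>M) \<le> ennreal (q - p) * (\<integral>\<^sup>+r. (\<integral>\<^sup>+\<omega>. ennreal ((\<beta> r \<omega>)\<^sup>2) \<partial>M) \<partial>lborel)"
    and time_integral_square: "integrable M (\<lambda>\<omega>. (\<integral>r. \<beta> r \<omega> \<partial>lborel)\<^sup>2)"
proof -
  interpret LM: pair_sigma_finite "lborel :: real measure" M
    by (intro pair_sigma_finite.intro sigma_finite_lborel sigma_finite_measure_axioms)
  have sw: "(\<lambda>p. \<beta> (snd p) (fst p)) \<in> borel_measurable (M \<Otimes>\<^sub>M lborel)"
    using measurable_compose[OF measurable_Pair[OF measurable_snd measurable_fst] m] by simp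
  have mr[measurable]: "(\<lambda>r. \<beta> r \<omega>) \<in> borel_measurable lborel" if "\<omega> \<in> space M" for \<omega>
    using measurable_compose[OF measurable_Pair1'[OF that] sw] by simp
  show Bm: "(\<lambda>\<omega>. \<integral>r. \<beta> r \<omega> \<partial>lborel) \<in> borel_measurable M"
    by (rule lborel.borel_measurable_lebesgue_integral) (use sw in \<open>simp add: case_prod_beta'\<close>)
  have mn: "(\<lambda>p. ennreal ((\<beta> (fst p) (snd p))\<^sup>2)) \<in> borel_measurable (lborel \<Otimes>\<^sub>M M)" by measurable
  have F: "(\<integral>\<^sup>+r. (\<integral>\<^sup>+\<omega>. ennreal ((\<beta> r \<omega>)\<^sup>2) \<partial>M) \<partial>lborel) = (\<integral>\<^sup>+\<omega>. (\<integral>\<^sup>+r. ennreal ((\<beta> r \<omega>)\<^sup>2) \<partial>lborel) \<partial>M)"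
    using LM.Fubini'[of "\<lambda>r \<omega>. ennreal ((\<beta> r \<omega>)\<^sup>2)"] mn by (simp add: case_prod_beta')
  have nm: "(\<lambda>\<omega>. \<integral>\<^sup>+r. ennreal ((\<beta> r \<omega>)\<^sup>2) \<partial>lborel) \<in> borel_measurable M"
    by (rule lborel.borel_measurable_nn_integral) (use sw in \<open>simp add: case_prod_beta'\<close>)
  have ae: "AE \<omega> in M. (\<integral>\<^sup>+r. ennreal ((\<beta> r \<omega>)\<^sup>2) \<partial>lborel) \<noteq> \<infinity>"
    using fin unfolding F by (intro nn_integral_PInf_AE nm) auto
  have key: "AE \<omega> in M. integrable lborel (\<lambda>r. \<beta> r \<omega>) \<and>
      ennreal ((\<integral>r. \<beta> r \<omega> \<partial>lborel)\<^sup>2) \<le> ennreal (q - p) * (\<integral>\<^sup>+r. ennreal ((\<beta> r \<omega>)\<^sup>2) \<partial>lborel)"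
    using ae AE_space
  proof eventually_elim
    case (elim \<omega>)
    have i2: "integrable lborel (\<lambda>r. (\<beta> r \<omega>)\<^sup>2)"
      using elim mr[OF elim(2)] by (intro integrableI_bounded) (auto simp: less_top)
    have ii: "integrable lborel (\<lambda>r. (indicator {p<..q} r :: real)\<^sup>2)"
    proof -
      have "(indicator {p<..q} r :: real)\<^sup>2 = indicator {p<..q} r" for r by (simp add: indicator_def)
      then show ?thesis using pq by (simp add: integrable_real_indicator)
    qed
    have I: "(\<integral>r. (indicator {p<..q} r :: real)\<^sup>2 \<partial>lborel) = q - p"
    proof -
      have "(indicator {p<..q} r :: real)\<^sup>2 = indicator {p<..q} r" for r by (simp add: indicator_def)
      then show ?thesis using pq by simp
    qed
    have e: "\<beta> r \<omega> * indicator {p<..q} r = \<beta> r \<omega>" for r by (cases "r \<in> {p<..q}") (simp_all add: supp)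
    note CS = L2_Cauchy_Schwarz[OF mr[OF elim(2)] _ i2 ii, unfolded e I]
    have "(\<integral>r. \<beta> r \<omega> \<partial>lborel)\<^sup>2 = \<bar>\<integral>r. \<beta> r \<omega> \<partial>lborel\<bar>\<^sup>2" by simp
    also have "\<dots> \<le> (sqrt (\<integral>r. (\<beta> r \<omega>)\<^sup>2 \<partial>lborel) * sqrt (q - p))\<^sup>2"
      by (intro power_mono CS(2)) auto
    also have "\<dots> = (q - p) * (\<integral>r. (\<beta> r \<omega>)\<^sup>2 \<partial>lborel)" using pq by (simp add: power_mult_distrib)
    finally have "ennreal ((\<integral>r. \<beta> r \<omega> \<partial>lborel)\<^sup>2) \<le> ennreal ((q - p) * (\<integral>r. (\<beta> r \<omega>)\<^sup>2 \<partial>lborel))" by (rule ennreal_leI)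
    also have "\<dots> = ennreal (q - p) * (\<integral>\<^sup>+r. ennreal ((\<beta> r \<omega>)\<^sup>2) \<partial>lborel)"
      using pq nn_integral_eq_integral[OF i2] by (simp add: ennreal_mult)
    finally show ?case using CS(1) by simp
  qed
  show "AE \<omega> in M. integrable lborel (\<lambda>r. \<beta> r \<omega>)" using key by eventually_elim simp
  have "(\<integral>\<^sup>+\<omega>. ennreal ((\<integral>r. \<beta> r \<omega> \<partial>lborel)\<^sup>2) \<partial>M) \<le> (\<integral>\<^sup>+\<omega>. ennreal (q - p) * (\<integral>\<^sup>+r. ennreal ((\<beta> r \<omega>)\<^sup>2) \<partial>lborel) \<partial>M)"
    using key by (intro nn_integral_mono_AE) (auto elim: eventually_mono)
  also have "\<dots> = ennreal (q - p) * (\<integral>\<^sup>+r. (\<integral>\<^sup>+\<omega>. ennreal ((\<beta> r \<omega>)\<^sup>2) \<partial>M) \<partial>lborel)"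
    unfolding F by (rule nn_integral_cmult[OF nm])
  finally show sq: "(\<integral>\<^sup>+\<omega>. ennreal ((\<integral>r. \<beta> r \<omega> \<partial>lborel)\<^sup>2) \<partial>M) \<le> ennreal (q - p) * (\<integral>\<^sup>+r. (\<integral>\<^sup>+\<omega>. ennreal ((\<beta> r \<omega>)\<^sup>2) \<partial>M) \<partial>lborel)" .
  show "integrable M (\<lambda>\<omega>. (\<integral>r. \<beta> r \<omega> \<partial>lborel)\<^sup>2)"
  proof (rule integrableI_bounded)
    have "(\<integral>\<^sup>+\<omega>. ennreal ((\<integral>r. \<beta> r \<omega> \<partial>lborel)\<^sup>2) \<partial>M) < \<infinity>"
      using fin by (intro le_less_trans[OF sq]) (simp add: ennreal_mult_less_top)
    then show "(\<integral>\<^sup>+\<omega>. ennreal (norm ((\<integral>r. \<beta> r \<omega> \<partial>lborel)\<^sup>2)) \<partial>M) < \<infinity>" by simp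
  qed (use Bm in measurable)
qed

lemma time_integral_inner:
  fixes \<beta> :: "real \<Rightarrow> 'a \<Rightarrow> real"
  assumes m[measurable]: "(\<lambda>p. \<beta> (fst p) (snd p)) \<in> borel_measurable (lborel \<Otimes>\<^sub>M M)"
    and supp: "\<And>r \<omega>. r \<notin> {p<..q} \<Longrightarrow> \<beta> r \<omega> = 0" and pq: "p \<le> q"
    and fin: "(\<integral>\<^sup>+r. (\<integral>\<^sup>+\<omega>. ennreal ((\<beta> r \<omega>)\<^sup>2) \<partial>M) \<partial>lborel) < \<infinity>"
    and C[measurable]: "C \<in> borel_measurable M" and C2: "integrable M (\<lambda>\<omega>. (C \<omega>)\<^sup>2)"
  shows "(\<integral>\<omega>. C \<omega> * (\<integral>r. \<beta> r \<omega> \<partial>lborel) \<partial>M) = (\<integral>r. (\<integral>\<omega>. C \<omega> * \<beta> r \<omega> \<partial>M) \<partial>lborel)"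
    and "integrable lborel (\<lambda>r. \<integral>\<omega>. C \<omega> * \<beta> r \<omega> \<partial>M)"
proof -
  interpret LM: pair_sigma_finite "lborel :: real measure" M
    by (intro pair_sigma_finite.intro sigma_finite_lborel sigma_finite_measure_axioms)
  have C2': "(\<integral>\<^sup>+\<omega>. ennreal ((C \<omega>)\<^sup>2) \<partial>M) < \<infinity>" using C2 by (simp add: integrable_iff_bounded)
  have fC: "(\<integral>\<^sup>+r. (\<integral>\<^sup>+\<omega>. ennreal ((indicator {p<..q} r * C \<omega>)\<^sup>2) \<partial>M) \<partial>lborel) < \<infinity>"
  proof -
    have "(\<integral>\<^sup>+\<omega>. ennreal ((indicator {p<..q} r * C \<omega>)\<^sup>2) \<partial>M) = (\<integral>\<^sup>+\<omega>. ennreal ((C \<omega>)\<^sup>2) \<partial>M) * indicator {p<..q} r" for r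
      by (simp add: indicator_def)
    then show ?thesis using C2' pq by (simp add: nn_integral_cmult_indicator ennreal_mult_less_top)
  qed
  have i1: "integrable (lborel \<Otimes>\<^sub>M M) (\<lambda>x. (indicator {p<..q} (fst x) * C (snd x))\<^sup>2)"
    by (rule square_integrable_product[OF _ fC]) measurable
  have i: "integrable (lborel \<Otimes>\<^sub>M M) (\<lambda>x. (indicator {p<..q} (fst x) * C (snd x)) * \<beta> (fst x) (snd x))"
    by (rule L2_Cauchy_Schwarz(1)[OF _ m i1 square_integrable_product[OF m fin]]) measurable
  have e: "indicator {p<..q} r * C \<omega> * \<beta> r \<omega> = C \<omega> * \<beta> r \<omega>" for r \<omega>
    by (cases "r \<in> {p<..q}") (simp_all add: supp)
  have i': "integrable (lborel \<Otimes>\<^sub>M M) (\<lambda>(r, \<omega>). C \<omega> * \<beta> r \<omega>)"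
    using i unfolding e by (simp add: case_prod_beta')
  show "integrable lborel (\<lambda>r. \<integral>\<omega>. C \<omega> * \<beta> r \<omega> \<partial>M)"
    by (rule LM.integrable_fst[OF i'])
  show "(\<integral>\<omega>. C \<omega> * (\<integral>r. \<beta> r \<omega> \<partial>lborel) \<partial>M) = (\<integral>r. (\<integral>\<omega>. C \<omega> * \<beta> r \<omega> \<partial>M) \<partial>lborel)"
    using LM.Fubini_integral[OF i'] by simp
qed

text \<open>Second moments of time integrals are double time integrals of covariances, which reduces
  orthogonality and variances to statements at two fixed times.\<close>

lemma time_integral_cross:
  fixes \<alpha> \<beta> :: "real \<Rightarrow> 'a \<Rightarrow> real"
  assumes "(\<lambda>p. \<beta> (fst p) (snd p)) \<in> borel_measurable (lborel \<Otimes>\<^sub>M M)"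
    and "\<And>r \<omega>. r \<notin> {p<..q} \<Longrightarrow> \<beta> r \<omega> = 0" "p \<le> q"
    and "(\<integral>\<^sup>+r. (\<integral>\<^sup>+\<omega>. ennreal ((\<beta> r \<omega>)\<^sup>2) \<partial>M) \<partial>lborel) < \<infinity>"
    and "(\<lambda>p. \<alpha> (fst p) (snd p)) \<in> borel_measurable (lborel \<Otimes>\<^sub>M M)"
    and "\<And>r \<omega>. r \<notin> {p'<..q'} \<Longrightarrow> \<alpha> r \<omega> = 0" "p' \<le> q'"
    and "(\<integral>\<^sup>+r. (\<integral>\<^sup>+\<omega>. ennreal ((\<alpha> r \<omega>)\<^sup>2) \<partial>M) \<partial>lborel) < \<infinity>"
    and "\<And>r. \<alpha> r \<in> borel_measurable M" "\<And>r. integrable M (\<lambda>\<omega>. (\<alpha> r \<omega>)\<^sup>2)"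
  shows "(\<integral>\<omega>. (\<integral>r. \<alpha> r \<omega> \<partial>lborel) * (\<integral>r. \<beta> r \<omega> \<partial>lborel) \<partial>M) = (\<integral>r. (\<integral>r'. (\<integral>\<omega>. \<alpha> r \<omega> * \<beta> r' \<omega> \<partial>M) \<partial>lborel) \<partial>lborel)"
proof -
  have "(\<integral>\<omega>. (\<integral>r. \<beta> r \<omega> \<partial>lborel) * (\<integral>r. \<alpha> r \<omega> \<partial>lborel) \<partial>M) = (\<integral>r. (\<integral>\<omega>. (\<integral>r. \<beta> r \<omega> \<partial>lborel) * \<alpha> r \<omega> \<partial>M) \<partial>lborel)"
    by (rule time_integral_inner(1)[OF assms(5-8) time_integral_measurable[OF assms(1-4)] time_integral_square[OF assms(1-4)]])
  also have "\<dots> = (\<integral>r. (\<integral>r'. (\<integral>\<omega>. \<alpha> r \<omega> * \<beta> r' \<omega> \<partial>M) \<partial>lborel) \<partial>lborel)"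
    using time_integral_inner(1)[OF assms(1-4) assms(9,10)] by (simp add: mult.commute)
  finally show ?thesis by (simp add: mult.commute)
qed

end

section \<open>Second moments on one observation interval\<close>

lemma gauss_measurable2[measurable (raw)]:
  assumes [measurable]: "\<sigma> \<in> borel_measurable N" "y \<in> borel_measurable N"
  shows "(\<lambda>x. gauss (\<sigma> x) (y x :: 'a::euclidean_space)) \<in> borel_measurable N"
  unfolding gauss_def normal_density_def by measurable

lemma gauss_square_integrable:
  assumes "0 < \<sigma>"
  shows "integrable lborel (\<lambda>y::'a::euclidean_space. (gauss \<sigma> y)\<^sup>2)"
proof (rule Bochner_Integration.integrable_bound)
  show "integrable lborel (\<lambda>y::'a. (1 / sqrt (2 * pi * \<sigma>\<^sup>2)) ^ DIM('a) * gauss \<sigma> y)"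
    using gauss_integral[OF assms, where 'a='a] by (intro integrable_mult_right)
  show "AE y::'a in lborel. norm ((gauss \<sigma> y)\<^sup>2) \<le> norm ((1 / sqrt (2 * pi * \<sigma>\<^sup>2)) ^ DIM('a) * gauss \<sigma> y)"
  proof (rule AE_I2)
    fix y :: 'a
    show "norm ((gauss \<sigma> y)\<^sup>2) \<le> norm ((1 / sqrt (2 * pi * \<sigma>\<^sup>2)) ^ DIM('a) * gauss \<sigma> y)"
      using mult_right_mono[OF gauss_le[of \<sigma> y] gauss_nonneg[of \<sigma> y]]
      by (simp add: power2_eq_square gauss_nonneg abs_mult)
  qed
qed measurable

text \<open>The interface between analysis and probability: \<open>G\<close> stands for the weak gradient, \<open>C\<close> for the
  constant in the density bound and \<open>\<theta>\<close> for the modulus of the mean Taylor defect.\<close>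

locale brownian_sobolev = brownian M T X for M :: "'w measure" and T and X :: "real \<Rightarrow> 'w \<Rightarrow> 'a::euclidean_space" +
  fixes f :: "'a \<Rightarrow> real" and G :: "'a \<Rightarrow> 'a" and C :: real and \<theta> :: "real \<Rightarrow> real"
  assumes C_nonneg: "0 \<le> C"
    and density: "\<And>t h. 0 < t \<Longrightarrow> t \<le> T \<Longrightarrow> h \<in> borel_measurable borel \<Longrightarrow>
      (\<integral>\<^sup>+\<omega>. h (clipped t \<omega>) \<partial>M) \<le> ennreal (C * t powr (-1/2)) * (\<integral>\<^sup>+x. h x \<partial>lborel)"
    and f_sq: "square_integrable f"
    and G_meas[measurable]: "G \<in> borel_measurable borel" and G_sq: "sq_mass lborel G < \<infinity>"
    and \<theta>_nonneg: "\<And>\<delta>. 0 \<le> \<theta> \<delta>" and \<theta>_lim: "(\<theta> \<longlongrightarrow> 0) (at_right 0)"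
    and taylor: "\<And>\<sigma> \<delta>. 0 < \<sigma> \<Longrightarrow> \<sigma>\<^sup>2 \<le> \<delta> \<Longrightarrow>
      (\<integral>\<^sup>+y. ennreal (gauss \<sigma> y) * taylor_defect f G y \<partial>lborel) \<le> ennreal (\<sigma>\<^sup>2 * \<theta> \<delta>)"
begin

lemma f_meas[measurable]: "f \<in> borel_measurable borel"
  using f_sq by (simp add: square_integrable_def)

definition grad_mass where "grad_mass = enn2real (sq_mass lborel G)"
definition fun_mass where "fun_mass = enn2real (sq_mass lborel f)"
text \<open>The integrand of the squared limit, up to the factor \<open>1/12\<close>.\<close>

definition energy where "energy t = (\<integral>\<omega>. (norm (G (clipped t \<omega>)))\<^sup>2 \<partial>M)"

lemma grad_mass: "0 \<le> grad_mass" "sq_mass lborel G = ennreal grad_mass"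
  using G_sq by (auto simp: grad_mass_def less_top)

lemma fun_mass: "0 \<le> fun_mass" "sq_mass lborel f = ennreal fun_mass"
  using f_sq by (auto simp: fun_mass_def square_integrable_iff_sq_mass less_top)

lemma decay_nonneg: "0 \<le> C * t powr (-1/2)" using C_nonneg by simp

lemma G_bound:
  assumes "0 < t" "t \<le> T"
  shows "(\<integral>\<^sup>+\<omega>. ennreal ((norm (G (clipped t \<omega>)))\<^sup>2) \<partial>M) \<le> ennreal (C * t powr (-1/2) * grad_mass)"
  using density[OF assms, of "\<lambda>x. ennreal ((norm (G x))\<^sup>2)"] grad_mass decay_nonneg[of t]
  by (simp add: sq_mass_def ennreal_mult)

lemma G_integrable:
  assumes "0 < t" "t \<le> T"
  shows "integrable M (\<lambda>\<omega>. (norm (G (clipped t \<omega>)))\<^sup>2)"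
proof (rule integrableI_bounded)
  show "(\<integral>\<^sup>+\<omega>. ennreal (norm ((norm (G (clipped t \<omega>)))\<^sup>2)) \<partial>M) < \<infinity>"
    using le_less_trans[OF G_bound[OF assms] ennreal_less_top] by simp
qed measurable

lemma energy_nn: "0 < t \<Longrightarrow> t \<le> T \<Longrightarrow> (\<integral>\<^sup>+\<omega>. ennreal ((norm (G (clipped t \<omega>)))\<^sup>2) \<partial>M) = ennreal (energy t)"
  unfolding energy_def by (rule nn_integral_eq_integral[OF G_integrable]) auto

lemma energy_nonneg: "0 \<le> energy t"
  by (simp add: energy_def)

lemma energy_le: "0 < t \<Longrightarrow> t \<le> T \<Longrightarrow> energy t \<le> C * t powr (-1/2) * grad_mass"
  using G_bound[of t] energy_nn[of t] C_nonneg grad_mass(1) by (simp add: ennreal_le_iff)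

lemma f_bound:
  assumes "0 < t" "t \<le> T"
  shows "(\<integral>\<^sup>+\<omega>. ennreal ((f (clipped t \<omega>))\<^sup>2) \<partial>M) \<le> ennreal (C * t powr (-1/2) * fun_mass)"
  using density[OF assms, of "\<lambda>x. ennreal ((f x)\<^sup>2)"] fun_mass decay_nonneg[of t]
  by (simp add: sq_mass_real ennreal_mult)

definition taylor_rem :: "'a \<Rightarrow> 'a \<Rightarrow> real" where "taylor_rem x y = f (x + y) - f x - G x \<bullet> y"
text \<open>The conditional mean, given the state \<open>x\<close>, of the Taylor remainder over an increment with
  standard deviation \<open>\<sigma>\<close>.\<close>

definition mean_rem :: "real \<Rightarrow> 'a \<Rightarrow> real" where "mean_rem \<sigma> x = (\<integral>y. gauss \<sigma> y * taylor_rem x y \<partial>lborel)"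

lemma taylor_rem_measurable[measurable (raw)]:
  assumes [measurable]: "x \<in> borel_measurable N" "y \<in> borel_measurable N"
  shows "(\<lambda>w. taylor_rem (x w) (y w)) \<in> borel_measurable N"
  unfolding taylor_rem_def by measurable

lemma mean_rem_measurable[measurable (raw)]:
  assumes \<sigma>[measurable]: "\<sigma> \<in> borel_measurable N" and x[measurable]: "x \<in> borel_measurable N"
  shows "(\<lambda>w. mean_rem (\<sigma> w) (x w)) \<in> borel_measurable N"
  unfolding mean_rem_def
  by (rule sigma_finite_measure.borel_measurable_lebesgue_integral[OF sigma_finite_lborel]) measurable

lemma taylor_rem_gauss_integrable:
  assumes "0 < \<sigma>"
  shows "integrable lborel (\<lambda>y. gauss \<sigma> y * taylor_rem x y)"
proof -
  have "square_integrable (\<lambda>y. f (y + x))" by (rule square_integrable_translate[OF f_sq])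
  then have f2: "integrable lborel (\<lambda>y. (f (x + y))\<^sup>2)" by (simp add: square_integrable_def add.commute)
  have "integrable lborel (\<lambda>y. gauss \<sigma> y * f (x + y))"
    by (rule L2_Cauchy_Schwarz(1)[OF _ _ gauss_square_integrable[OF assms] f2]) measurable
  then have "integrable lborel (\<lambda>y. gauss \<sigma> y * f (x + y) - f x * gauss \<sigma> y - gauss \<sigma> y * (G x \<bullet> y))"
    using gauss_integral(1)[OF assms, where 'a='a] gauss_first_moment(2)[OF assms, of "G x"] by simp
  then show ?thesis by (simp add: taylor_rem_def algebra_simps)
qed

lemma taylor_rem_centered:
  assumes "0 < \<sigma>"
  shows "(\<integral>y. gauss \<sigma> y * (taylor_rem x y - mean_rem \<sigma> x) \<partial>lborel) = 0"
  using taylor_rem_gauss_integrable[OF assms, of x] gauss_integral[OF assms, where 'a='a]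
  by (simp add: right_diff_distrib mean_rem_def)

lemma taylor_rem_variance:
  assumes \<sigma>: "0 < \<sigma>"
  shows "(\<integral>\<^sup>+y. ennreal (gauss \<sigma> y) * ennreal ((taylor_rem x y - mean_rem \<sigma> x)\<^sup>2) \<partial>lborel) \<le> (\<integral>\<^sup>+y. ennreal (gauss \<sigma> y) * ennreal ((taylor_rem x y)\<^sup>2) \<partial>lborel)"
proof (cases "(\<integral>\<^sup>+y. ennreal (gauss \<sigma> y) * ennreal ((taylor_rem x y)\<^sup>2) \<partial>lborel) = \<infinity>")
  case False
  have e: "ennreal (gauss \<sigma> y) * ennreal a = ennreal (gauss \<sigma> y * a)" if "0 \<le> a" for y :: 'a and a
    using that by (simp add: ennreal_mult gauss_nonneg)
  have i2: "integrable lborel (\<lambda>y. gauss \<sigma> y * (taylor_rem x y)\<^sup>2)"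
    using False by (intro integrableI_bounded) (auto simp: e gauss_nonneg less_top)
  note i1 = taylor_rem_gauss_integrable[OF \<sigma>, of x] and i0 = gauss_integral[OF \<sigma>, where 'a='a]
  have q: "gauss \<sigma> y * (taylor_rem x y - mean_rem \<sigma> x)\<^sup>2 = gauss \<sigma> y * (taylor_rem x y)\<^sup>2 - 2 * mean_rem \<sigma> x * (gauss \<sigma> y * taylor_rem x y) + (mean_rem \<sigma> x)\<^sup>2 * gauss \<sigma> y" for y
    by (simp add: power2_eq_square algebra_simps)
  have iq: "integrable lborel (\<lambda>y. gauss \<sigma> y * (taylor_rem x y - mean_rem \<sigma> x)\<^sup>2)"
    unfolding q using i0 i1 i2 by simp
  have "(\<integral>y. gauss \<sigma> y * (taylor_rem x y - mean_rem \<sigma> x)\<^sup>2 \<partial>lborel) = (\<integral>y. gauss \<sigma> y * (taylor_rem x y)\<^sup>2 \<partial>lborel) - 2 * mean_rem \<sigma> x * mean_rem \<sigma> x + (mean_rem \<sigma> x)\<^sup>2"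
    unfolding q using i0 i1 i2 by (simp add: mean_rem_def)
  also have "\<dots> \<le> (\<integral>y. gauss \<sigma> y * (taylor_rem x y)\<^sup>2 \<partial>lborel)" by (simp add: power2_eq_square)
  finally show ?thesis
    using iq i2 by (simp add: e nn_integral_eq_integral gauss_nonneg ennreal_leI)
qed simp

text \<open>Given \<open>X\<^sub>s\<close> the increment is Gaussian with variance \<open>t - s\<close>, and the density bound replaces the
  law of \<open>X\<^sub>s\<close> by Lebesgue measure; what is left is the mean Taylor defect. Subtracting the
  conditional mean can only decrease the second moment.\<close>

lemma taylor_rem_second_moment:
  assumes st: "0 < s" "s < t" "t \<le> T" "t - s \<le> \<delta>"
  shows "(\<integral>\<^sup>+\<omega>. ennreal ((taylor_rem (clipped s \<omega>) (clipped t \<omega> - clipped s \<omega>))\<^sup>2) \<partial>M) \<le> ennreal (C * s powr (-1/2) * (t - s) * \<theta> \<delta>)"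
    and "(\<integral>\<^sup>+\<omega>. ennreal ((taylor_rem (clipped s \<omega>) (clipped t \<omega> - clipped s \<omega>) - mean_rem (sqrt (t - s)) (clipped s \<omega>))\<^sup>2) \<partial>M) \<le> ennreal (C * s powr (-1/2) * (t - s) * \<theta> \<delta>)"
proof -
  let ?\<sigma> = "sqrt (t - s)"
  have \<sigma>: "0 < ?\<sigma>" "?\<sigma>\<^sup>2 = t - s" using st by auto
  have sT: "s \<le> T" using st by simp
  let ?I = "\<integral>\<^sup>+\<omega>. (\<integral>\<^sup>+y. ennreal (gauss ?\<sigma> y) * ennreal ((taylor_rem (clipped s \<omega>) y)\<^sup>2) \<partial>lborel) \<partial>M"
  have "?I = (\<integral>\<^sup>+y. (\<integral>\<^sup>+\<omega>. ennreal (gauss ?\<sigma> y) * ennreal ((taylor_rem (clipped s \<omega>) y)\<^sup>2) \<partial>M) \<partial>lborel)"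
    by (rule nn_Fubini_lborel[symmetric]) measurable
  also have "\<dots> \<le> (\<integral>\<^sup>+y. ennreal (C * s powr (-1/2)) * (ennreal (gauss ?\<sigma> y) * taylor_defect f G y) \<partial>lborel)"
  proof (rule nn_integral_mono)
    fix y
    have "(\<integral>\<^sup>+\<omega>. ennreal (gauss ?\<sigma> y) * ennreal ((taylor_rem (clipped s \<omega>) y)\<^sup>2) \<partial>M) = ennreal (gauss ?\<sigma> y) * (\<integral>\<^sup>+\<omega>. ennreal ((taylor_rem (clipped s \<omega>) y)\<^sup>2) \<partial>M)"
      by (rule nn_integral_cmult) measurable
    also have "\<dots> \<le> ennreal (gauss ?\<sigma> y) * (ennreal (C * s powr (-1/2)) * (\<integral>\<^sup>+x. ennreal ((taylor_rem x y)\<^sup>2) \<partial>lborel))"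
      by (intro mult_left_mono density[OF st(1) sT]) auto
    also have "(\<integral>\<^sup>+x. ennreal ((taylor_rem x y)\<^sup>2) \<partial>lborel) = taylor_defect f G y"
      by (simp add: taylor_defect_def sq_mass_real taylor_rem_def)
    finally show "(\<integral>\<^sup>+\<omega>. ennreal (gauss ?\<sigma> y) * ennreal ((taylor_rem (clipped s \<omega>) y)\<^sup>2) \<partial>M) \<le> ennreal (C * s powr (-1/2)) * (ennreal (gauss ?\<sigma> y) * taylor_defect f G y)"
      by (simp add: mult_ac)
  qed
  also have "\<dots> = ennreal (C * s powr (-1/2)) * (\<integral>\<^sup>+y. ennreal (gauss ?\<sigma> y) * taylor_defect f G y \<partial>lborel)"
  proof (rule nn_integral_cmult)
    have "(\<lambda>y. \<integral>\<^sup>+x. ennreal ((norm (f (x + y) - f x - G x \<bullet> y))\<^sup>2) \<partial>lborel) \<in> borel_measurable borel"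
      by (rule sigma_finite_measure.borel_measurable_nn_integral[OF sigma_finite_lborel]) measurable
    then have [measurable]: "(\<lambda>y. taylor_defect f G y) \<in> borel_measurable borel"
      by (simp add: taylor_defect_def sq_mass_def)
    show "(\<lambda>y. ennreal (gauss ?\<sigma> y) * taylor_defect f G y) \<in> borel_measurable lborel" by measurable
  qed
  also have "\<dots> \<le> ennreal (C * s powr (-1/2)) * ennreal (?\<sigma>\<^sup>2 * \<theta> \<delta>)"
    using st by (intro mult_left_mono taylor \<sigma>) (auto simp: \<sigma>)
  also have "\<dots> = ennreal (C * s powr (-1/2) * (t - s) * \<theta> \<delta>)"
    using decay_nonneg[of s] st \<theta>_nonneg[of \<delta>] unfolding \<sigma>(2) by (subst ennreal_mult[symmetric]) (auto simp: mult.assoc)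
  finally have I: "?I \<le> ennreal (C * s powr (-1/2) * (t - s) * \<theta> \<delta>)" .
  have "(\<integral>\<^sup>+\<omega>. ennreal ((taylor_rem (clipped s \<omega>) (clipped t \<omega> - clipped s \<omega>))\<^sup>2) \<partial>M) = ?I"
    by (rule nn_integral_state_increment[of s t "\<lambda>x y. ennreal ((taylor_rem x y)\<^sup>2)"]) (use st in auto)
  then show "(\<integral>\<^sup>+\<omega>. ennreal ((taylor_rem (clipped s \<omega>) (clipped t \<omega> - clipped s \<omega>))\<^sup>2) \<partial>M) \<le> ennreal (C * s powr (-1/2) * (t - s) * \<theta> \<delta>)"
    using I by simp
  have "(\<integral>\<^sup>+\<omega>. ennreal ((taylor_rem (clipped s \<omega>) (clipped t \<omega> - clipped s \<omega>) - mean_rem ?\<sigma> (clipped s \<omega>))\<^sup>2) \<partial>M)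
     = (\<integral>\<^sup>+\<omega>. (\<integral>\<^sup>+y. ennreal (gauss ?\<sigma> y) * ennreal ((taylor_rem (clipped s \<omega>) y - mean_rem ?\<sigma> (clipped s \<omega>))\<^sup>2) \<partial>lborel) \<partial>M)"
    by (rule nn_integral_state_increment[of s t "\<lambda>x y. ennreal ((taylor_rem x y - mean_rem ?\<sigma> x)\<^sup>2)"]) (use st in auto)
  also have "\<dots> \<le> ?I" by (intro nn_integral_mono taylor_rem_variance \<sigma>)
  finally show "(\<integral>\<^sup>+\<omega>. ennreal ((taylor_rem (clipped s \<omega>) (clipped t \<omega> - clipped s \<omega>) - mean_rem ?\<sigma> (clipped s \<omega>))\<^sup>2) \<partial>M) \<le> ennreal (C * s powr (-1/2) * (t - s) * \<theta> \<delta>)"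
    using I by (rule order_trans)
qed

text \<open>Both orders of \<open>p\<close> and \<open>q\<close> are covered, because the covariances of the bridge terms are obtained
  from squares of differences by polarisation.\<close>

lemma G_increment_square:
  assumes "0 < s" "s \<le> p" "s \<le> q" "p \<le> T" "q \<le> T"
  shows "integrable M (\<lambda>\<omega>. (G (clipped s \<omega>) \<bullet> (clipped p \<omega> - clipped q \<omega>))\<^sup>2)"
    and "(\<integral>\<omega>. (G (clipped s \<omega>) \<bullet> (clipped p \<omega> - clipped q \<omega>))\<^sup>2 \<partial>M) = energy s * \<bar>p - q\<bar>"
proof -
  have nn: "(\<integral>\<^sup>+\<omega>. ennreal ((G (clipped s \<omega>) \<bullet> (clipped p \<omega> - clipped q \<omega>))\<^sup>2) \<partial>M) = ennreal (energy s * \<bar>p - q\<bar>)"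
    if "s \<le> q" "q \<le> p" "p \<le> T" for p q
    using nn_integral_increment_square[of s q p G] assms that energy_nn[of s] energy_nonneg[of s]
    by (simp add: ennreal_mult mult.commute)
  have nn': "(\<integral>\<^sup>+\<omega>. ennreal ((G (clipped s \<omega>) \<bullet> (clipped p \<omega> - clipped q \<omega>))\<^sup>2) \<partial>M) = ennreal (energy s * \<bar>p - q\<bar>)"
  proof (cases "q \<le> p")
    case True
    then show ?thesis using nn assms by simp
  next
    case False
    have "(G (clipped s \<omega>) \<bullet> (clipped p \<omega> - clipped q \<omega>))\<^sup>2 = (G (clipped s \<omega>) \<bullet> (clipped q \<omega> - clipped p \<omega>))\<^sup>2" for \<omega>
      by (simp add: inner_diff_right power2_commute)
    then show ?thesis using nn[of p q] assms False by (simp add: abs_minus_commute)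
  qed
  show i: "integrable M (\<lambda>\<omega>. (G (clipped s \<omega>) \<bullet> (clipped p \<omega> - clipped q \<omega>))\<^sup>2)"
    by (rule integrableI_bounded) (use nn' in auto)
  show "(\<integral>\<omega>. (G (clipped s \<omega>) \<bullet> (clipped p \<omega> - clipped q \<omega>))\<^sup>2 \<partial>M) = energy s * \<bar>p - q\<bar>"
    using nn' nn_integral_eq_integral[OF i] energy_nonneg[of s] by simp
qed

text \<open>Controls the first observation interval: the expansion is around the earlier time \<open>r\<close>, where
  the singular factor \<open>r\<^sup>-\<^sup>1\<^sup>/\<^sup>2\<close> is integrable.\<close>

lemma f_increment:
  assumes r: "0 < r" "r < e" "e \<le> T" "e - r \<le> \<delta>"
  shows "(\<integral>\<^sup>+\<omega>. ennreal ((f (clipped r \<omega>) - f (clipped e \<omega>))\<^sup>2) \<partial>M) \<le> ennreal (C * r powr (-1/2) * \<delta> * (2 * \<theta> \<delta> + 2 * grad_mass))"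
proof -
  let ?c = "\<lambda>\<omega>. taylor_rem (clipped r \<omega>) (clipped e \<omega> - clipped r \<omega>)" and ?g = "\<lambda>\<omega>. G (clipped r \<omega>) \<bullet> (clipped e \<omega> - clipped r \<omega>)"
  have rT: "r \<le> T" using r by simp
  have "(\<integral>\<^sup>+\<omega>. ennreal ((f (clipped r \<omega>) - f (clipped e \<omega>))\<^sup>2) \<partial>M) \<le> (\<integral>\<^sup>+\<omega>. 2 * ennreal ((?c \<omega>)\<^sup>2) + 2 * ennreal ((?g \<omega>)\<^sup>2) \<partial>M)"
  proof (rule nn_integral_mono)
    fix \<omega>
    have "f (clipped r \<omega>) - f (clipped e \<omega>) = - (?c \<omega> + ?g \<omega>)" by (simp add: taylor_rem_def)
    then have "(f (clipped r \<omega>) - f (clipped e \<omega>))\<^sup>2 = (?c \<omega> + ?g \<omega>)\<^sup>2" by (simp only: power2_minus)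
    then have "(f (clipped r \<omega>) - f (clipped e \<omega>))\<^sup>2 \<le> 2 * (?c \<omega>)\<^sup>2 + 2 * (?g \<omega>)\<^sup>2"
      using norm_add_square_le[of "?c \<omega>" "?g \<omega>"] by simp
    from ennreal_leI[OF this] show "ennreal ((f (clipped r \<omega>) - f (clipped e \<omega>))\<^sup>2) \<le> 2 * ennreal ((?c \<omega>)\<^sup>2) + 2 * ennreal ((?g \<omega>)\<^sup>2)"
      by (simp add: ennreal_mult')
  qed
  also have "\<dots> = 2 * (\<integral>\<^sup>+\<omega>. ennreal ((?c \<omega>)\<^sup>2) \<partial>M) + 2 * (\<integral>\<^sup>+\<omega>. ennreal ((?g \<omega>)\<^sup>2) \<partial>M)"
    by (simp add: nn_integral_add nn_integral_cmult)
  also have "(\<integral>\<^sup>+\<omega>. ennreal ((?g \<omega>)\<^sup>2) \<partial>M) = ennreal (energy r * (e - r))"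
    using G_increment_square[of r e r] r rT by (simp add: nn_integral_eq_integral)
  also have "2 * (\<integral>\<^sup>+\<omega>. ennreal ((?c \<omega>)\<^sup>2) \<partial>M) + 2 * ennreal (energy r * (e - r))
      \<le> 2 * ennreal (C * r powr (-1/2) * \<delta> * \<theta> \<delta>) + 2 * ennreal (C * r powr (-1/2) * \<delta> * grad_mass)"
  proof (intro add_mono mult_left_mono)
    have "C * r powr (-1/2) * (e - r) * \<theta> \<delta> \<le> C * r powr (-1/2) * \<delta> * \<theta> \<delta>"
      using r by (intro mult_right_mono mult_left_mono decay_nonneg \<theta>_nonneg) auto
    then show "(\<integral>\<^sup>+\<omega>. ennreal ((?c \<omega>)\<^sup>2) \<partial>M) \<le> ennreal (C * r powr (-1/2) * \<delta> * \<theta> \<delta>)"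
      using taylor_rem_second_moment(1)[OF r] by (meson ennreal_leI order_trans)
    have "energy r * (e - r) \<le> (C * r powr (-1/2) * grad_mass) * \<delta>"
      using r energy_le[of r] C_nonneg grad_mass(1) rT by (intro mult_mono) auto
    then show "ennreal (energy r * (e - r)) \<le> ennreal (C * r powr (-1/2) * \<delta> * grad_mass)"
      by (intro ennreal_leI) (simp add: mult_ac)
  qed auto
  also have "\<dots> = ennreal (2 * (C * r powr (-1/2) * \<delta> * \<theta> \<delta>) + 2 * (C * r powr (-1/2) * \<delta> * grad_mass))"
    using r C_nonneg grad_mass(1) \<theta>_nonneg[of \<delta>] by (subst ennreal_plus) (auto simp: ennreal_mult')
  also have "2 * (C * r powr (-1/2) * \<delta> * \<theta> \<delta>) + 2 * (C * r powr (-1/2) * \<delta> * grad_mass) = C * r powr (-1/2) * \<delta> * (2 * \<theta> \<delta> + 2 * grad_mass)"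
    by (simp add: algebra_simps)
  finally show ?thesis .
qed

text \<open>The Taylor remainder on the interval from \<open>s\<close> to \<open>e\<close>, minus its conditional mean given \<open>X\<^sub>s\<close>.\<close>

definition centred_rem :: "real \<Rightarrow> real \<Rightarrow> real \<Rightarrow> 'w \<Rightarrow> real" where
  "centred_rem s e r \<omega> = indicator {s<..e} r * (taylor_rem (clipped s \<omega>) (clipped r \<omega> - clipped s \<omega>) - mean_rem (sqrt (r - s)) (clipped s \<omega>))"

lemma centred_rem_joint: "(\<lambda>p. centred_rem s e (fst p) (snd p)) \<in> borel_measurable (lborel \<Otimes>\<^sub>M M)"
  unfolding centred_rem_def by measurable

lemma centred_rem_meas[measurable]: "centred_rem s e r \<in> borel_measurable M"
  unfolding centred_rem_def[abs_def] by measurable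

lemma centred_rem_supp: "r \<notin> {s<..e} \<Longrightarrow> centred_rem s e r \<omega> = 0"
  by (simp add: centred_rem_def)

lemma centred_rem_bound:
  assumes "0 < s" "s < e" "e \<le> T"
  shows "(\<integral>\<^sup>+\<omega>. ennreal ((centred_rem s e r \<omega>)\<^sup>2) \<partial>M) \<le> ennreal (C * s powr (-1/2) * (e - s) * \<theta> (e - s)) * indicator {s<..e} r"
proof (cases "r \<in> {s<..e}")
  case True
  have "(\<integral>\<^sup>+\<omega>. ennreal ((centred_rem s e r \<omega>)\<^sup>2) \<partial>M) \<le> ennreal (C * s powr (-1/2) * (r - s) * \<theta> (e - s))"
    using taylor_rem_second_moment(2)[of s r "e - s"] assms True by (simp add: centred_rem_def)
  also have "\<dots> \<le> ennreal (C * s powr (-1/2) * (e - s) * \<theta> (e - s))"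
    using True by (intro ennreal_leI mult_right_mono mult_left_mono decay_nonneg \<theta>_nonneg) auto
  finally show ?thesis using True by simp
qed (simp add: centred_rem_supp)

lemma centred_rem_fin:
  assumes "0 < s" "s < e" "e \<le> T"
  shows "(\<integral>\<^sup>+r. (\<integral>\<^sup>+\<omega>. ennreal ((centred_rem s e r \<omega>)\<^sup>2) \<partial>M) \<partial>lborel) \<le> ennreal (C * s powr (-1/2) * (e - s)^2 * \<theta> (e - s))"
    and "integrable M (\<lambda>\<omega>. (centred_rem s e r \<omega>)\<^sup>2)"
proof -
  let ?B = "C * s powr (-1/2) * (e - s) * \<theta> (e - s)"
  have "(\<integral>\<^sup>+r. (\<integral>\<^sup>+\<omega>. ennreal ((centred_rem s e r \<omega>)\<^sup>2) \<partial>M) \<partial>lborel) \<le> (\<integral>\<^sup>+r. ennreal ?B * indicator {s<..e} r \<partial>lborel)"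
    by (intro nn_integral_mono centred_rem_bound assms)
  also have "\<dots> = ennreal ?B * ennreal (e - s)" using assms by (subst nn_integral_cmult_indicator) auto
  also have "\<dots> = ennreal (?B * (e - s))" using assms C_nonneg \<theta>_nonneg[of "e - s"] by (subst ennreal_mult) auto
  also have "?B * (e - s) = C * s powr (-1/2) * (e - s)^2 * \<theta> (e - s)" by (simp add: power2_eq_square mult_ac)
  finally show "(\<integral>\<^sup>+r. (\<integral>\<^sup>+\<omega>. ennreal ((centred_rem s e r \<omega>)\<^sup>2) \<partial>M) \<partial>lborel) \<le> ennreal (C * s powr (-1/2) * (e - s)^2 * \<theta> (e - s))" .
  show "integrable M (\<lambda>\<omega>. (centred_rem s e r \<omega>)\<^sup>2)"
  proof (rule integrableI_bounded)
    have "(\<integral>\<^sup>+\<omega>. ennreal ((centred_rem s e r \<omega>)\<^sup>2) \<partial>M) < \<infinity>"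
      by (rule le_less_trans[OF centred_rem_bound[OF assms]]) (simp add: ennreal_mult_less_top indicator_def)
    then show "(\<integral>\<^sup>+\<omega>. ennreal (norm ((centred_rem s e r \<omega>)\<^sup>2)) \<partial>M) < \<infinity>" by simp
  qed measurable
qed

definition centred_rem_integral where "centred_rem_integral s e \<omega> = (\<integral>r. centred_rem s e r \<omega> \<partial>lborel)"

text \<open>The hypotheses of the lemmas on time integrals, bundled for this process.\<close>

lemma centred_rem_time:
  assumes "0 < s" "s < e" "e \<le> T"
  shows "(\<lambda>p. centred_rem s e (fst p) (snd p)) \<in> borel_measurable (lborel \<Otimes>\<^sub>M M)"
    "\<And>r \<omega>. r \<notin> {s<..e} \<Longrightarrow> centred_rem s e r \<omega> = 0" "s \<le> e"
    "(\<integral>\<^sup>+r. (\<integral>\<^sup>+\<omega>. ennreal ((centred_rem s e r \<omega>)\<^sup>2) \<partial>M) \<partial>lborel) < \<infinity>"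
  using centred_rem_joint centred_rem_supp assms le_less_trans[OF centred_rem_fin(1)[OF assms] ennreal_less_top] by auto

lemma centred_rem_integral_properties:
  assumes "0 < s" "s < e" "e \<le> T"
  shows "centred_rem_integral s e \<in> borel_measurable M" "integrable M (\<lambda>\<omega>. (centred_rem_integral s e \<omega>)\<^sup>2)"
    "(\<integral>\<omega>. (centred_rem_integral s e \<omega>)\<^sup>2 \<partial>M) \<le> C * s powr (-1/2) * (e - s)^3 * \<theta> (e - s)"
    "AE \<omega> in M. integrable lborel (\<lambda>r. centred_rem s e r \<omega>)"
proof -
  note t = centred_rem_time[OF assms]
  show "centred_rem_integral s e \<in> borel_measurable M" using time_integral_measurable[OF t] by (simp add: centred_rem_integral_def[abs_def])
  show i: "integrable M (\<lambda>\<omega>. (centred_rem_integral s e \<omega>)\<^sup>2)" using time_integral_square[OF t] by (simp add: centred_rem_integral_def)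
  show "AE \<omega> in M. integrable lborel (\<lambda>r. centred_rem s e r \<omega>)" by (rule time_integral_AE_integrable[OF t])
  have "ennreal (\<integral>\<omega>. (centred_rem_integral s e \<omega>)\<^sup>2 \<partial>M) = (\<integral>\<^sup>+\<omega>. ennreal ((centred_rem_integral s e \<omega>)\<^sup>2) \<partial>M)"
    by (rule nn_integral_eq_integral[OF i, symmetric]) simp
  also have "\<dots> \<le> ennreal (e - s) * ennreal (C * s powr (-1/2) * (e - s)^2 * \<theta> (e - s))"
    unfolding centred_rem_integral_def by (rule order_trans[OF time_integral_nn_square[OF t] mult_left_mono[OF centred_rem_fin(1)[OF assms]]]) auto
  also have "\<dots> = ennreal (C * s powr (-1/2) * (e - s)^3 * \<theta> (e - s))"
    using assms C_nonneg \<theta>_nonneg[of "e - s"] by (subst ennreal_mult[symmetric]) (auto simp: power3_eq_cube power2_eq_square mult_ac)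
  finally show "(\<integral>\<omega>. (centred_rem_integral s e \<omega>)\<^sup>2 \<partial>M) \<le> C * s powr (-1/2) * (e - s)^3 * \<theta> (e - s)"
    using assms C_nonneg \<theta>_nonneg[of "e - s"] by (subst (asm) ennreal_le_iff) auto
qed

text \<open>A term of an earlier interval belongs to the past of a later one, whose remainder is centred
  given the state at its left endpoint.\<close>

lemma centred_rem_integral_orthogonal:
  assumes a: "0 < s" "s < e" "e \<le> s'" "s' < e'" "e' \<le> T"
  shows "(\<integral>\<omega>. centred_rem_integral s e \<omega> * centred_rem_integral s' e' \<omega> \<partial>M) = 0"
proof -
  have 1: "0 < s" "s < e" "e \<le> T" and 2: "0 < s'" "s' < e'" "e' \<le> T" using a by auto
  have z: "(\<integral>\<omega>. centred_rem s e r \<omega> * centred_rem s' e' r' \<omega> \<partial>M) = 0" for r r'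
  proof (cases "r \<in> {s<..e} \<and> r' \<in> {s'<..e'}")
    case True
    let ?u = "\<lambda>p::'a \<times> 'a \<times> 'a. taylor_rem (fst p) (fst (snd p) - fst p) - mean_rem (sqrt (r - s)) (fst p)"
    let ?q = "\<lambda>x y. taylor_rem x y - mean_rem (sqrt (r' - s')) x"
    have "(\<integral>\<omega>. ?u (clipped s \<omega>, clipped r \<omega>, clipped r \<omega>) * ?q (clipped s' \<omega>) (clipped r' \<omega> - clipped s' \<omega>) \<partial>M) = 0"
    proof (rule orthogonal_to_past)
      show "?u \<in> borel_measurable borel" unfolding borel_prod[symmetric] by measurable
      show "integrable M (\<lambda>\<omega>. (?u (clipped s \<omega>, clipped r \<omega>, clipped r \<omega>))\<^sup>2)"
        using centred_rem_fin(2)[OF 1, of r] True by (simp add: centred_rem_def)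
      show "integrable M (\<lambda>\<omega>. (?q (clipped s' \<omega>) (clipped r' \<omega> - clipped s' \<omega>))\<^sup>2)"
        using centred_rem_fin(2)[OF 2, of r'] True by (simp add: centred_rem_def)
      show "(\<integral>y. gauss (sqrt (r' - s')) y * ?q x y \<partial>lborel) = 0" for x
        using True by (intro taylor_rem_centered) simp
    qed (use a True in \<open>auto\<close>)
    then show ?thesis using True by (simp add: centred_rem_def)
  qed (auto simp: centred_rem_supp)
  have "(\<integral>\<omega>. centred_rem_integral s e \<omega> * centred_rem_integral s' e' \<omega> \<partial>M) = (\<integral>r. (\<integral>r'. (\<integral>\<omega>. centred_rem s e r \<omega> * centred_rem s' e' r' \<omega> \<partial>M) \<partial>lborel) \<partial>lborel)"
    unfolding centred_rem_integral_def by (rule time_integral_cross[OF centred_rem_time[OF 2] centred_rem_time[OF 1] centred_rem_meas centred_rem_fin(2)[OF 1]])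
  then show ?thesis by (simp add: z)
qed

text \<open>The linear term on the interval from \<open>s\<close> to \<open>e\<close>, minus its conditional mean given both endpoints
  averaged over time: \<open>1/2\<close> is the mean of \<open>(r - s)/(e - s)\<close>.\<close>

definition bridge :: "real \<Rightarrow> real \<Rightarrow> real \<Rightarrow> 'w \<Rightarrow> real" where
  "bridge s e r \<omega> = indicator {s<..e} r * (G (clipped s \<omega>) \<bullet> (clipped r \<omega> - clipped s \<omega>) - (1/2) * (G (clipped s \<omega>) \<bullet> (clipped e \<omega> - clipped s \<omega>)))"

definition bridge_integral where "bridge_integral s e \<omega> = (\<integral>r. bridge s e r \<omega> \<partial>lborel)"

lemma bridge_joint: "(\<lambda>p. bridge s e (fst p) (snd p)) \<in> borel_measurable (lborel \<Otimes>\<^sub>M M)"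
  unfolding bridge_def by measurable

lemma bridge_meas[measurable]: "bridge s e r \<in> borel_measurable M"
  unfolding bridge_def[abs_def] by measurable

lemma bridge_supp: "r \<notin> {s<..e} \<Longrightarrow> bridge s e r \<omega> = 0"
  by (simp add: bridge_def)

text \<open>With \<open>U\<^sub>r\<close> the bridge term at time \<open>r\<close>, \<open>U\<^sub>r - U\<^sub>r\<^sub>'\<close> is an increment of the linear term and
  \<open>E U\<^sub>r\<^sup>2\<close> does not depend on \<open>r\<close>. Polarisation gives the covariance.\<close>

lemma bridge_covariance:
  assumes "0 < s" "s < e" "e \<le> T"
  shows bridge_square_integrable: "integrable M (\<lambda>\<omega>. (bridge s e r \<omega>)\<^sup>2)"
    and bridge_covariance_eq: "r \<in> {s<..e} \<Longrightarrow> r' \<in> {s<..e} \<Longrightarrow> (\<integral>\<omega>. bridge s e r \<omega> * bridge s e r' \<omega> \<partial>M) = energy s * ((e - s) / 4 - \<bar>r - r'\<bar> / 2)"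
proof -
  define D where "D p q \<omega> = G (clipped s \<omega>) \<bullet> (clipped p \<omega> - clipped q \<omega>)" for p q \<omega>
  have D: "integrable M (\<lambda>\<omega>. (D p q \<omega>)\<^sup>2)" "(\<integral>\<omega>. (D p q \<omega>)\<^sup>2 \<partial>M) = energy s * \<bar>p - q\<bar>"
    if "p \<in> {s..e}" "q \<in> {s..e}" for p q
    using G_increment_square[of s p q] assms that by (auto simp: D_def)
  define U where "U r \<omega> = D r s \<omega> - (1/2) * D e s \<omega>" for r \<omega>
  have ssU: "bridge s e r \<omega> = indicator {s<..e} r * U r \<omega>" for r \<omega> by (simp add: bridge_def U_def D_def)
  have U2: "(U r \<omega>)\<^sup>2 = (1/2) * (D r s \<omega>)\<^sup>2 + (1/2) * (D e r \<omega>)\<^sup>2 - (1/4) * (D e s \<omega>)\<^sup>2" for r \<omega>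
  proof -
    have "D e s \<omega> = D r s \<omega> + D e r \<omega>" by (simp add: D_def inner_diff_right)
    then show ?thesis by (simp add: U_def power2_eq_square field_simps)
  qed
  have Ui: "integrable M (\<lambda>\<omega>. (U r \<omega>)\<^sup>2)" "(\<integral>\<omega>. (U r \<omega>)\<^sup>2 \<partial>M) = energy s * (e - s) / 4" if r: "r \<in> {s..e}" for r
  proof -
    have i: "integrable M (\<lambda>\<omega>. (D r s \<omega>)\<^sup>2)" "integrable M (\<lambda>\<omega>. (D e r \<omega>)\<^sup>2)" "integrable M (\<lambda>\<omega>. (D e s \<omega>)\<^sup>2)"
      using r assms by (auto intro!: D(1))
    show "integrable M (\<lambda>\<omega>. (U r \<omega>)\<^sup>2)" unfolding U2 using i by simp
    have "(\<integral>\<omega>. (U r \<omega>)\<^sup>2 \<partial>M) = (1/2) * (energy s * \<bar>r - s\<bar>) + (1/2) * (energy s * \<bar>e - r\<bar>) - (1/4) * (energy s * \<bar>e - s\<bar>)"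
      unfolding U2 using i r assms by (simp add: D(2))
    also have "\<dots> = energy s * (e - s) / 4" using r assms by (simp add: field_simps)
    finally show "(\<integral>\<omega>. (U r \<omega>)\<^sup>2 \<partial>M) = energy s * (e - s) / 4" .
  qed
  show "integrable M (\<lambda>\<omega>. (bridge s e r \<omega>)\<^sup>2)"
    using Ui(1)[of r] by (cases "r \<in> {s<..e}") (simp_all add: ssU)
  assume r: "r \<in> {s<..e}" "r' \<in> {s<..e}"
  have UU: "U r \<omega> * U r' \<omega> = (1/2) * (U r \<omega>)\<^sup>2 + (1/2) * (U r' \<omega>)\<^sup>2 - (1/2) * (D r r' \<omega>)\<^sup>2" for \<omega>
  proof -
    have e: "D r r' \<omega> = U r \<omega> - U r' \<omega>" by (simp add: U_def D_def inner_diff_right)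
    show ?thesis unfolding e by (simp add: power2_eq_square field_simps)
  qed
  have i: "integrable M (\<lambda>\<omega>. (U r \<omega>)\<^sup>2)" "integrable M (\<lambda>\<omega>. (U r' \<omega>)\<^sup>2)" "integrable M (\<lambda>\<omega>. (D r r' \<omega>)\<^sup>2)"
    using r by (auto intro!: Ui(1) D(1))
  have "(\<integral>\<omega>. bridge s e r \<omega> * bridge s e r' \<omega> \<partial>M) = (\<integral>\<omega>. U r \<omega> * U r' \<omega> \<partial>M)" using r by (simp add: ssU)
  also have "\<dots> = (1/2) * (energy s * (e - s) / 4) + (1/2) * (energy s * (e - s) / 4) - (1/2) * (energy s * \<bar>r - r'\<bar>)"
    unfolding UU using i r by (simp add: D(2) Ui(2))
  also have "\<dots> = energy s * ((e - s) / 4 - \<bar>r - r'\<bar> / 2)" by (simp add: field_simps)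
  finally show "(\<integral>\<omega>. bridge s e r \<omega> * bridge s e r' \<omega> \<partial>M) = energy s * ((e - s) / 4 - \<bar>r - r'\<bar> / 2)" .
qed

lemma bridge_time:
  assumes "0 < s" "s < e" "e \<le> T"
  shows "(\<lambda>p. bridge s e (fst p) (snd p)) \<in> borel_measurable (lborel \<Otimes>\<^sub>M M)"
    "\<And>r \<omega>. r \<notin> {s<..e} \<Longrightarrow> bridge s e r \<omega> = 0" "s \<le> e"
    "(\<integral>\<^sup>+r. (\<integral>\<^sup>+\<omega>. ennreal ((bridge s e r \<omega>)\<^sup>2) \<partial>M) \<partial>lborel) < \<infinity>"
proof -
  have "(\<integral>\<^sup>+\<omega>. ennreal ((bridge s e r \<omega>)\<^sup>2) \<partial>M) = ennreal (energy s * (e - s) / 4) * indicator {s<..e} r" for r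
  proof (cases "r \<in> {s<..e}")
    case True
    then show ?thesis
      using nn_integral_eq_integral[OF bridge_square_integrable[OF assms, of r]] bridge_covariance_eq[OF assms True True]
      by (simp add: power2_eq_square)
  qed (simp add: bridge_supp)
  then have "(\<integral>\<^sup>+r. (\<integral>\<^sup>+\<omega>. ennreal ((bridge s e r \<omega>)\<^sup>2) \<partial>M) \<partial>lborel) = ennreal (energy s * (e - s) / 4) * ennreal (e - s)"
    using assms by (simp add: nn_integral_cmult_indicator)
  also have "\<dots> < \<infinity>" by (simp add: ennreal_mult_less_top)
  finally show "(\<integral>\<^sup>+r. (\<integral>\<^sup>+\<omega>. ennreal ((bridge s e r \<omega>)\<^sup>2) \<partial>M) \<partial>lborel) < \<infinity>" .
qed (use bridge_joint bridge_supp assms in auto)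

text \<open>For the integral of \<open>|r - r'|\<close> by the fundamental theorem of calculus, without splitting it at
  the kink.\<close>

lemma abs_antiderivative: "((\<lambda>x::real. x * \<bar>x\<bar> / 2) has_real_derivative \<bar>x\<bar>) (at x)"
proof -
  consider "x > 0" | "x < 0" | "x = 0" by linarith
  then show ?thesis
  proof cases
    case 1
    have "((\<lambda>x::real. x * x / 2) has_real_derivative \<bar>x\<bar>) (at x)" using 1 by (auto intro!: derivative_eq_intros)
    then show ?thesis
      by (rule DERIV_cong_ev[THEN iffD1, rotated -1])
        (use 1 in \<open>auto simp: eventually_nhds_metric dist_real_def intro!: exI[of _ x]\<close>)
  next
    case 2
    have "((\<lambda>x::real. - (x * x / 2)) has_real_derivative \<bar>x\<bar>) (at x)" using 2 by (auto intro!: derivative_eq_intros)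
    then show ?thesis
      by (rule DERIV_cong_ev[THEN iffD1, rotated -1])
        (use 2 in \<open>auto simp: eventually_nhds_metric dist_real_def intro!: exI[of _ "- x"]\<close>)
  next
    case 3
    have "((\<lambda>h::real. \<bar>h\<bar> / 2) \<longlongrightarrow> \<bar>0\<bar> / 2) (at 0)" by (intro tendsto_intros) auto
    then have "((\<lambda>h::real. \<bar>h\<bar> / 2) \<longlongrightarrow> 0) (at 0)" by simp
    then have "((\<lambda>h::real. (h * \<bar>h\<bar> / 2) / h) \<longlongrightarrow> 0) (at 0)"
      by (rule Lim_transform_eventually) (auto simp: eventually_at_filter)
    then show ?thesis using 3 by (simp add: DERIV_def)
  qed
qed

text \<open>The double integral of \<open>(e - s)/4 - |r - r'|/2\<close> over a square of side \<open>\<Delta> = e - s\<close> is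
  \<open>\<Delta>\<^sup>3/4 - \<Delta>\<^sup>3/6 = \<Delta>\<^sup>3/12\<close>.\<close>

lemma bridge_integral_properties:
  assumes "0 < s" "s < e" "e \<le> T"
  shows "bridge_integral s e \<in> borel_measurable M" "integrable M (\<lambda>\<omega>. (bridge_integral s e \<omega>)\<^sup>2)"
    "(\<integral>\<omega>. (bridge_integral s e \<omega>)\<^sup>2 \<partial>M) = energy s * (e - s)^3 / 12"
    "AE \<omega> in M. integrable lborel (\<lambda>r. bridge s e r \<omega>)"
proof -
  note t = bridge_time[OF assms]
  show "bridge_integral s e \<in> borel_measurable M" using time_integral_measurable[OF t] by (simp add: bridge_integral_def[abs_def])
  show i: "integrable M (\<lambda>\<omega>. (bridge_integral s e \<omega>)\<^sup>2)" using time_integral_square[OF t] by (simp add: bridge_integral_def)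
  show "AE \<omega> in M. integrable lborel (\<lambda>r. bridge s e r \<omega>)" by (rule time_integral_AE_integrable[OF t])
  have se: "s \<le> e" using assms by simp
  have "(\<integral>\<omega>. (bridge_integral s e \<omega>)\<^sup>2 \<partial>M) = (\<integral>\<omega>. (\<integral>r. bridge s e r \<omega> \<partial>lborel) * (\<integral>r. bridge s e r \<omega> \<partial>lborel) \<partial>M)"
    by (simp add: bridge_integral_def power2_eq_square)
  also have "\<dots> = (\<integral>r. (\<integral>r'. (\<integral>\<omega>. bridge s e r \<omega> * bridge s e r' \<omega> \<partial>M) \<partial>lborel) \<partial>lborel)"
    by (rule time_integral_cross[OF t t bridge_meas bridge_square_integrable[OF assms]])
  also have "\<dots> = (\<integral>r. (energy s * ((e - s)\<^sup>2 / 4 - ((r - s)\<^sup>2 + (e - r)\<^sup>2) / 4)) * indicator {s..e} r \<partial>lborel)"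
  proof (rule integral_cong_AE)
    have inner: "(\<integral>r'. (\<integral>\<omega>. bridge s e r \<omega> * bridge s e r' \<omega> \<partial>M) \<partial>lborel) = energy s * ((e - s)\<^sup>2 / 4 - ((r - s)\<^sup>2 + (e - r)\<^sup>2) / 4)" if r: "r \<in> {s<..e}" for r
    proof -
      have ae: "AE r' in lborel. r' \<noteq> s" by (rule AE_lborel_singleton)
      have "(\<integral>r'. (\<integral>\<omega>. bridge s e r \<omega> * bridge s e r' \<omega> \<partial>M) \<partial>lborel) = (\<integral>r'. (energy s * ((e - s) / 4 - \<bar>r' - r\<bar> / 2)) * indicator {s..e} r' \<partial>lborel)"
      proof (rule integral_cong_AE)
        show "(\<lambda>r'. \<integral>\<omega>. bridge s e r \<omega> * bridge s e r' \<omega> \<partial>M) \<in> borel_measurable lborel"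
          using time_integral_inner(2)[OF t bridge_meas bridge_square_integrable[OF assms]] by auto
        show "AE r' in lborel. (\<integral>\<omega>. bridge s e r \<omega> * bridge s e r' \<omega> \<partial>M) = (energy s * ((e - s) / 4 - \<bar>r' - r\<bar> / 2)) * indicator {s..e} r'"
          using ae
        proof eventually_elim
          case (elim r')
          show ?case
          proof (cases "r' \<in> {s<..e}")
            case True
            then show ?thesis using bridge_covariance_eq[OF assms r True] by (simp add: abs_minus_commute)
          qed (use elim in \<open>auto simp: bridge_supp\<close>)
        qed
      qed measurable
      also have "\<dots> = energy s * ((e - s) / 4 * e - (e - r) * \<bar>e - r\<bar> / 2 / 2) - energy s * ((e - s) / 4 * s - (s - r) * \<bar>s - r\<bar> / 2 / 2)"
      proof (rule integral_FTC_Icc_real)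
        show "s \<le> e" by (rule se)
        show "DERIV (\<lambda>x. energy s * ((e - s) / 4 * x - (x - r) * \<bar>x - r\<bar> / 2 / 2)) x :> energy s * ((e - s) / 4 - \<bar>x - r\<bar> / 2)" for x
        proof -
          have "((\<lambda>x. (x - r) * \<bar>x - r\<bar> / 2) has_real_derivative \<bar>x - r\<bar> * 1) (at x)"
            by (rule DERIV_chain2[OF abs_antiderivative]) (auto intro!: derivative_eq_intros)
          moreover have "((\<lambda>x. energy s * ((e - s) / 4 * x - A x / 2)) has_real_derivative energy s * ((e - s) / 4 - \<bar>x - r\<bar> / 2)) (at x)"
            if "(A has_real_derivative \<bar>x - r\<bar> * 1) (at x)" for A
            using that by (auto intro!: derivative_eq_intros)
          ultimately show ?thesis by blast
        qed
        show "isCont (\<lambda>x. energy s * ((e - s) / 4 - \<bar>x - r\<bar> / 2)) x" for x by (intro continuous_intros) auto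
      qed
      also have "\<dots> = energy s * ((e - s)\<^sup>2 / 4 - ((r - s)\<^sup>2 + (e - r)\<^sup>2) / 4)"
        using r by (simp add: power2_eq_square field_simps)
      finally show ?thesis .
    qed
    have zero: "(\<integral>r'. (\<integral>\<omega>. bridge s e r \<omega> * bridge s e r' \<omega> \<partial>M) \<partial>lborel) = 0" if "r \<notin> {s<..e}" for r
      using that by (simp add: bridge_supp)
    have form: "(\<integral>r'. (\<integral>\<omega>. bridge s e r \<omega> * bridge s e r' \<omega> \<partial>M) \<partial>lborel) = indicator {s<..e} r * (energy s * ((e - s)\<^sup>2 / 4 - ((r - s)\<^sup>2 + (e - r)\<^sup>2) / 4))" for r
      using inner[of r] zero[of r] by (simp add: indicator_def)
    show "(\<lambda>r. \<integral>r'. (\<integral>\<omega>. bridge s e r \<omega> * bridge s e r' \<omega> \<partial>M) \<partial>lborel) \<in> borel_measurable lborel"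
      unfolding form by measurable
    have ae: "AE r in lborel. r \<noteq> s" by (rule AE_lborel_singleton)
    then show "AE r in lborel. (\<integral>r'. (\<integral>\<omega>. bridge s e r \<omega> * bridge s e r' \<omega> \<partial>M) \<partial>lborel) = (energy s * ((e - s)\<^sup>2 / 4 - ((r - s)\<^sup>2 + (e - r)\<^sup>2) / 4)) * indicator {s..e} r"
      unfolding form by eventually_elim (auto simp: indicator_def)
  qed measurable
  also have "\<dots> = energy s * ((e - s)\<^sup>2 / 4 * e - ((e - s)^3 - (e - e)^3) / 12) - energy s * ((e - s)\<^sup>2 / 4 * s - ((s - s)^3 - (e - s)^3) / 12)"
  proof (rule integral_FTC_Icc_real)
    show "s \<le> e" by (rule se)
    show "DERIV (\<lambda>x. energy s * ((e - s)\<^sup>2 / 4 * x - ((x - s)^3 - (e - x)^3) / 12)) x :> energy s * ((e - s)\<^sup>2 / 4 - ((x - s)\<^sup>2 + (e - x)\<^sup>2) / 4)" for x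
      by (auto intro!: derivative_eq_intros simp: field_simps)
    show "isCont (\<lambda>x. energy s * ((e - s)\<^sup>2 / 4 - ((x - s)\<^sup>2 + (e - x)\<^sup>2) / 4)) x" for x by (intro continuous_intros) auto
  qed
  also have "\<dots> = energy s * (e - s)^3 / 12" by (simp add: power2_eq_square power3_eq_cube field_simps)
  finally show "(\<integral>\<omega>. (bridge_integral s e \<omega>)\<^sup>2 \<partial>M) = energy s * (e - s)^3 / 12" .
qed

text \<open>As for the remainders: an increment of a later interval is centred given the past.\<close>

lemma bridge_integral_orthogonal:
  assumes a: "0 < s" "s < e" "e \<le> s'" "s' < e'" "e' \<le> T"
  shows "(\<integral>\<omega>. bridge_integral s e \<omega> * bridge_integral s' e' \<omega> \<partial>M) = 0"
proof -
  have 1: "0 < s" "s < e" "e \<le> T" and 2: "0 < s'" "s' < e'" "e' \<le> T" using a by auto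
  have z: "(\<integral>\<omega>. bridge s e r \<omega> * bridge s' e' r' \<omega> \<partial>M) = 0" for r r'
  proof (cases "r \<in> {s<..e} \<and> r' \<in> {s'<..e'}")
    case True
    let ?u = "\<lambda>p::'a \<times> 'a \<times> 'a. G (fst p) \<bullet> (fst (snd p) - fst p) - (1/2) * (G (fst p) \<bullet> (snd (snd p) - fst p))"
    let ?U = "\<lambda>\<omega>. ?u (clipped s \<omega>, clipped r \<omega>, clipped e \<omega>)"
    let ?g = "\<lambda>t \<omega>. G (clipped s' \<omega>) \<bullet> (clipped t \<omega> - clipped s' \<omega>)"
    have u2: "integrable M (\<lambda>\<omega>. (?U \<omega>)\<^sup>2)"
      using bridge_square_integrable[OF 1, of r] True by (simp add: bridge_def)
    have g2: "integrable M (\<lambda>\<omega>. (?g t \<omega>)\<^sup>2)" if "s' < t" "t \<le> e'" for t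
      using G_increment_square(1)[of s' t s'] 2 that by simp
    have orth: "(\<integral>\<omega>. ?U \<omega> * ?g t \<omega> \<partial>M) = 0" if t: "s' < t" "t \<le> e'" for t
    proof (rule orthogonal_to_past[where q="\<lambda>x y. G x \<bullet> y"])
      show "?u \<in> borel_measurable borel" unfolding borel_prod[symmetric] by measurable
      show "integrable M (\<lambda>\<omega>. (?u (clipped s \<omega>, clipped r \<omega>, clipped e \<omega>))\<^sup>2)" by (rule u2)
      show "integrable M (\<lambda>\<omega>. (?g t \<omega>)\<^sup>2)" by (rule g2[OF t])
      show "(\<integral>y. gauss (sqrt (t - s')) y * (G x \<bullet> y) \<partial>lborel) = 0" for x
        using t by (intro gauss_first_moment) simp
    qed (use a True t in \<open>auto\<close>)
    have i: "integrable M (\<lambda>\<omega>. ?U \<omega> * ?g t \<omega>)" if t: "s' < t" "t \<le> e'" for t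
      by (rule L2_Cauchy_Schwarz(1)[OF _ _ u2 g2[OF t]]) measurable
    have "(\<integral>\<omega>. bridge s e r \<omega> * bridge s' e' r' \<omega> \<partial>M) = (\<integral>\<omega>. ?U \<omega> * ?g r' \<omega> - (1/2) * (?U \<omega> * ?g e' \<omega>) \<partial>M)"
      using True by (intro Bochner_Integration.integral_cong refl) (simp add: bridge_def algebra_simps)
    also have "\<dots> = (\<integral>\<omega>. ?U \<omega> * ?g r' \<omega> \<partial>M) - (1/2) * (\<integral>\<omega>. ?U \<omega> * ?g e' \<omega> \<partial>M)"
      using i[of r'] i[of e'] True 2 by (subst Bochner_Integration.integral_diff) auto
    also have "\<dots> = 0" using orth[of r'] orth[of e'] True 2 by simp
    finally show ?thesis .
  qed (auto simp: bridge_supp)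
  have "(\<integral>\<omega>. bridge_integral s e \<omega> * bridge_integral s' e' \<omega> \<partial>M) = (\<integral>r. (\<integral>r'. (\<integral>\<omega>. bridge s e r \<omega> * bridge s' e' r' \<omega> \<partial>M) \<partial>lborel) \<partial>lborel)"
    unfolding bridge_integral_def by (rule time_integral_cross[OF bridge_time[OF 2] bridge_time[OF 1] bridge_meas bridge_square_integrable[OF 1]])
  then show ?thesis by (simp add: z)
qed

end

section \<open>Conditional expectation given the observations\<close>

lemma orthogonal_sum_square:
  fixes Z :: "'i \<Rightarrow> 'b \<Rightarrow> real"
  assumes Z[measurable]: "\<And>i. i \<in> I \<Longrightarrow> Z i \<in> borel_measurable N"
    and Z2: "\<And>i. i \<in> I \<Longrightarrow> integrable N (\<lambda>x. (Z i x)\<^sup>2)"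
    and orth: "\<And>i j. i \<in> I \<Longrightarrow> j \<in> I \<Longrightarrow> i \<noteq> j \<Longrightarrow> (\<integral>x. Z i x * Z j x \<partial>N) = 0"
    and I: "finite I"
  shows "integrable N (\<lambda>x. (\<Sum>i\<in>I. Z i x)\<^sup>2)"
    and "(\<integral>x. (\<Sum>i\<in>I. Z i x)\<^sup>2 \<partial>N) = (\<Sum>i\<in>I. \<integral>x. (Z i x)\<^sup>2 \<partial>N)"
proof -
  have p: "integrable N (\<lambda>x. Z i x * Z j x)" if "i \<in> I" "j \<in> I" for i j
    by (rule L2_Cauchy_Schwarz(1)[OF Z[OF that(1)] Z[OF that(2)] Z2[OF that(1)] Z2[OF that(2)]])
  have e: "(\<Sum>i\<in>I. Z i x)\<^sup>2 = (\<Sum>i\<in>I. \<Sum>j\<in>I. Z i x * Z j x)" for x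
    by (simp add: power2_eq_square sum_product)
  show "integrable N (\<lambda>x. (\<Sum>i\<in>I. Z i x)\<^sup>2)"
    unfolding e by (intro Bochner_Integration.integrable_sum p)
  have "(\<integral>x. (\<Sum>i\<in>I. Z i x)\<^sup>2 \<partial>N) = (\<Sum>i\<in>I. \<Sum>j\<in>I. \<integral>x. Z i x * Z j x \<partial>N)"
    unfolding e using p by (simp add: Bochner_Integration.integral_sum)
  also have "\<dots> = (\<Sum>i\<in>I. \<Sum>j\<in>I. if j = i then \<integral>x. (Z i x)\<^sup>2 \<partial>N else 0)"
    using orth by (intro sum.cong refl) (auto simp: power2_eq_square)
  also have "\<dots> = (\<Sum>i\<in>I. \<integral>x. (Z i x)\<^sup>2 \<partial>N)" using I by simp
  finally show "(\<integral>x. (\<Sum>i\<in>I. Z i x)\<^sup>2 \<partial>N) = (\<Sum>i\<in>I. \<integral>x. (Z i x)\<^sup>2 \<partial>N)" .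
qed

context finite_measure_subalgebra
begin

text \<open>The conditional Jensen inequality for the square.\<close>

lemma cond_exp_L2_contraction:
  assumes [measurable]: "R \<in> borel_measurable M" and R2: "integrable M (\<lambda>x. (R x)\<^sup>2)"
  shows "integrable M (\<lambda>x. (real_cond_exp M F R x)\<^sup>2)"
    and "L2_norm M (real_cond_exp M F R) \<le> L2_norm M R"
proof -
  have R1: "integrable M R" by (rule square_integrable_imp_integrable[OF assms])
  have [measurable]: "real_cond_exp M F R \<in> borel_measurable M"
    using real_cond_exp_int(1)[OF R1] by auto
  have J: "AE x in M. (real_cond_exp M F R x)\<^sup>2 \<le> real_cond_exp M F (\<lambda>x. (R x)\<^sup>2) x"
    by (rule real_cond_exp_jensens_inequality(2)[OF R1, where I=UNIV and q="\<lambda>x. x\<^sup>2"])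
      (use R2 convex_power2 in auto)
  note i = real_cond_exp_int[OF R2]
  show i2: "integrable M (\<lambda>x. (real_cond_exp M F R x)\<^sup>2)"
    by (rule Bochner_Integration.integrable_bound[OF i(1)]) (use J in \<open>auto elim: eventually_mono\<close>)
  have "(\<integral>x. (real_cond_exp M F R x)\<^sup>2 \<partial>M) \<le> (\<integral>x. (R x)\<^sup>2 \<partial>M)"
    unfolding i(2)[symmetric] by (rule integral_mono_AE[OF i2 i(1) J])
  then show "L2_norm M (real_cond_exp M F R) \<le> L2_norm M R" by (simp add: L2_norm_def)
qed

text \<open>Subtracting the conditional expectation removes \<open>Y\<close>, keeps \<open>S\<close> and turns \<open>R\<close> into
  \<open>R - E[R|F]\<close>, whose norm is at most \<open>2\<parallel>R\<parallel>\<close>.\<close>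

lemma cond_exp_error_near:
  fixes \<Gamma> Y S R :: "'a \<Rightarrow> real"
  assumes \<Gamma>: "integrable M \<Gamma>" and dec: "AE x in M. \<Gamma> x = Y x + S x + R x"
    and Y[measurable]: "Y \<in> borel_measurable F"
    and S[measurable]: "S \<in> borel_measurable M" and S2: "integrable M (\<lambda>x. (S x)\<^sup>2)"
    and S0: "\<And>A. A \<in> sets F \<Longrightarrow> (\<integral>x. indicator A x * S x \<partial>M) = 0"
    and R[measurable]: "R \<in> borel_measurable M" and R2: "integrable M (\<lambda>x. (R x)\<^sup>2)"
  shows "\<bar>L2_norm M (\<lambda>x. \<Gamma> x - real_cond_exp M F \<Gamma> x) - L2_norm M S\<bar> \<le> 2 * L2_norm M R"
proof -
  let ?R = "real_cond_exp M F R"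
  note [measurable] = borel_measurable_integrable[OF \<Gamma>]
  have YM[measurable]: "Y \<in> borel_measurable M" by (rule measurable_from_subalg[OF subalg Y])
  have Si: "integrable M S" by (rule square_integrable_imp_integrable[OF S S2])
  have Ri: "integrable M R" by (rule square_integrable_imp_integrable[OF R R2])
  have "integrable M (\<lambda>x. \<Gamma> x - S x - R x)" using \<Gamma> Si Ri by simp
  then have Yi: "integrable M Y"
    by (rule integrable_cong_AE_imp) (use dec in \<open>auto elim: eventually_mono\<close>)
  have ER[measurable]: "?R \<in> borel_measurable M" and ERi: "integrable M ?R"
    using real_cond_exp_int(1)[OF Ri] by auto
  have E: "AE x in M. real_cond_exp M F \<Gamma> x = Y x + ?R x"
  proof (rule real_cond_exp_charact)
    fix A assume A: "A \<in> sets F"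
    then have AM[measurable]: "A \<in> sets M" using subalg by (auto simp: subalgebra_def)
    have i: "integrable M (\<lambda>x. indicator A x * Z x)" if "integrable M Z" for Z :: "'a \<Rightarrow> real"
      using integrable_mult_indicator[OF AM that] by simp
    have "(\<integral>x\<in>A. \<Gamma> x \<partial>M) = (\<integral>x. indicator A x * Y x + indicator A x * S x + indicator A x * R x \<partial>M)"
      unfolding set_lebesgue_integral_def
      by (rule integral_cong_AE) (use dec in \<open>auto elim!: eventually_mono simp: algebra_simps\<close>)
    also have "\<dots> = (\<integral>x. indicator A x * Y x \<partial>M) + (\<integral>x. indicator A x * R x \<partial>M)"
      using i[OF Yi] i[OF Si] i[OF Ri] S0[OF A] by simp
    also have "(\<integral>x. indicator A x * R x \<partial>M) = (\<integral>x. indicator A x * ?R x \<partial>M)"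
      using real_cond_exp_intA[OF Ri A] by (simp add: set_lebesgue_integral_def)
    also have "(\<integral>x. indicator A x * Y x \<partial>M) + (\<integral>x. indicator A x * ?R x \<partial>M) = (\<integral>x\<in>A. Y x + ?R x \<partial>M)"
      unfolding set_lebesgue_integral_def using i[OF Yi] i[OF ERi] by (simp add: distrib_left)
    finally show "(\<integral>x\<in>A. \<Gamma> x \<partial>M) = (\<integral>x\<in>A. Y x + ?R x \<partial>M)" .
  qed (use \<Gamma> Yi ERi in auto)
  let ?D = "\<lambda>x. R x + - ?R x"
  note c = cond_exp_L2_contraction[OF R R2]
  have D2: "integrable M (\<lambda>x. (?D x)\<^sup>2)" "L2_norm M ?D \<le> L2_norm M R + L2_norm M (\<lambda>x. - ?R x)"
    by (rule L2_norm_triangle; use R2 c in simp)+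
  have D: "L2_norm M ?D \<le> 2 * L2_norm M R" using D2(2) c(2) by (simp add: L2_norm_minus)
  have err: "L2_norm M (\<lambda>x. \<Gamma> x - real_cond_exp M F \<Gamma> x) = L2_norm M (\<lambda>x. S x + ?D x)"
    by (rule L2_norm_cong_AE) (use E dec in \<open>auto elim!: eventually_elim2\<close>)
  have "L2_norm M (\<lambda>x. S x + ?D x) \<le> L2_norm M S + L2_norm M ?D"
    by (rule L2_norm_triangle(2)) (use S2 D2(1) in auto)
  moreover have "L2_norm M (\<lambda>x. (S x + ?D x) + - ?D x) \<le> L2_norm M (\<lambda>x. S x + ?D x) + L2_norm M (\<lambda>x. - ?D x)"
  proof (rule L2_norm_triangle(2))
    show "integrable M (\<lambda>x. (S x + ?D x)\<^sup>2)" by (rule L2_norm_triangle(1)) (use S2 D2(1) in auto)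
    show "integrable M (\<lambda>x. (- ?D x)\<^sup>2)" using D2(1) by (simp only: power2_minus)
  qed measurable
  then have "L2_norm M S \<le> L2_norm M (\<lambda>x. S x + ?D x) + L2_norm M ?D"
    unfolding L2_norm_minus by simp
  ultimately show ?thesis using D unfolding err by linarith
qed

end

definition (in brownian) grid :: "nat \<Rightarrow> nat \<Rightarrow> real" where
  "grid n k = real k * (T / real n)"

context brownian
begin

lemma grid:
  assumes "0 < n"
  shows "grid n 0 = 0" "grid n n = T" "grid n (Suc k) = grid n k + T / real n"
    "k \<le> n \<Longrightarrow> grid n k \<in> {0..T}" "j \<le> k \<Longrightarrow> grid n j \<le> grid n k" "0 < k \<Longrightarrow> 0 < grid n k"
proof -
  show m: "grid n j \<le> grid n k" if "j \<le> k" for j k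
    unfolding grid_def using that T_pos by (intro mult_right_mono) auto
  show "grid n 0 = 0" "grid n (Suc k) = grid n k + T / real n" "0 < k \<Longrightarrow> 0 < grid n k"
    using assms T_pos by (simp_all add: grid_def algebra_simps add_divide_distrib)
  show n: "grid n n = T" using assms by (simp add: grid_def)
  show "grid n k \<in> {0..T}" if "k \<le> n" for k
    using m[OF that] n T_pos by (auto simp: grid_def)
qed

lemma grid_less: "0 < n \<Longrightarrow> grid n k < grid n (Suc k)"
  using grid(3)[of n k] T_pos by simp

lemma observation_subalgebra:
  assumes n: "0 < n"
  shows "subalgebra M (observation_algebra M T n X)"
    and "k \<le> n \<Longrightarrow> clipped (grid n k) \<in> borel_measurable (observation_algebra M T n X)"
proof -
  let ?E = "\<Union>k\<le>n. {X (grid n k) -` A \<inter> space M |A. A \<in> sets borel}"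
  have F: "observation_algebra M T n X = sigma (space M) ?E" by (simp add: observation_algebra_def grid_def)
  have E: "?E \<subseteq> sets M"
  proof safe
    fix k A assume k: "k \<le> n" and A: "A \<in> sets (borel :: 'a measure)"
    show "X (grid n k) -` A \<inter> space M \<in> sets M"
      by (rule measurable_sets[OF X_measurable[OF grid(4)[OF n k]] A])
  qed
  then have P: "?E \<subseteq> Pow (space M)" using sets.space_closed by blast
  show "subalgebra M (observation_algebra M T n X)"
    unfolding subalgebra_def F sets_measure_of[OF P] space_measure_of[OF P]
    using sets.sigma_sets_subset[OF E] by simp
  show "clipped (grid n k) \<in> borel_measurable (observation_algebra M T n X)" if k: "k \<le> n"
    unfolding F clipped_eq[OF grid(4)[OF n k]]
  proof (rule measurableI)
    fix A assume A: "A \<in> sets (borel :: 'a measure)"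
    show "X (grid n k) -` A \<inter> space (sigma (space M) ?E) \<in> sets (sigma (space M) ?E)"
      unfolding sets_measure_of[OF P] space_measure_of[OF P]
      by (rule sigma_sets.Basic) (use k A in blast)
  qed simp
qed

lemma observation_finite_measure_subalgebra:
  "0 < n \<Longrightarrow> finite_measure_subalgebra M (observation_algebra M T n X)"
  using observation_subalgebra(1)
  by (simp add: finite_measure_subalgebra_def finite_measure_subalgebra_axioms_def finite_measure_axioms)

text \<open>Events of the observation algebra are events for the vector of observations; this is the
  form in which the increment reversal applies to them.\<close>

lemma observation_sets:
  assumes n: "0 < n" and B: "B \<in> sets (observation_algebra M T n X)"
  obtains D where "D \<in> sets (\<Pi>\<^sub>M i\<in>{..n}. (borel :: 'a measure))"
    "B = {\<omega>\<in>space M. (\<lambda>i\<in>{..n}. X (grid n i) \<omega>) \<in> D}"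
proof -
  let ?V = "\<lambda>\<omega>. \<lambda>i\<in>{..n}. X (grid n i) \<omega>" and ?P = "\<Pi>\<^sub>M i\<in>{..n}. (borel :: 'a measure)"
  let ?E = "\<Union>k\<le>n. {X (grid n k) -` A \<inter> space M |A. A \<in> sets borel}"
  let ?A = "vimage_algebra (space M) ?V ?P"
  have V: "?V \<in> space M \<rightarrow> space ?P" by (auto simp: space_PiM)
  have F: "observation_algebra M T n X = sigma (space M) ?E" by (simp add: observation_algebra_def grid_def)
  have "?E \<subseteq> Pow (space M)" by blast
  then have B': "B \<in> sigma_sets (space M) ?E" using B unfolding F by simp
  have "?E \<subseteq> sets ?A"
  proof safe
    fix k A assume k: "k \<le> n" and A: "A \<in> sets (borel :: 'a measure)"
    have "(\<lambda>x. x k) -` A \<inter> space ?P \<in> sets ?P"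
      by (rule measurable_sets[OF _ A, where M="?P"], rule measurable_component_singleton) (use k in simp)
    then have "?V -` ((\<lambda>x. x k) -` A \<inter> space ?P) \<inter> space M \<in> sets ?A" by (rule in_vimage_algebra)
    also have "?V -` ((\<lambda>x. x k) -` A \<inter> space ?P) \<inter> space M = X (grid n k) -` A \<inter> space M"
      using k by (auto simp: space_PiM)
    finally show "X (grid n k) -` A \<inter> space M \<in> sets ?A" .
  qed
  then have "sigma_sets (space ?A) ?E \<subseteq> sets ?A" by (rule sets.sigma_sets_subset)
  then have "B \<in> sets ?A" using B' by auto
  then obtain D where "D \<in> sets ?P" "B = ?V -` D \<inter> space M"
    unfolding sets_vimage_algebra2[OF V] by blast
  then show ?thesis by (intro that[of D]) auto
qed

end

context brownian_sobolev
begin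

text \<open>Let \<open>\<epsilon>(r)\<close> be the expectation of the bridge term at time \<open>r\<close> on an observable event. Reversal of
  increments shows that \<open>\<epsilon>\<close> is odd about the midpoint of the interval, so its integral
  vanishes.\<close>

lemma bridge_integral_cond_zero:
  assumes n: "0 < n" and k: "0 < k" "k < n" and B: "B \<in> sets (observation_algebra M T n X)"
  shows "(\<integral>\<omega>. indicator B \<omega> * bridge_integral (grid n k) (grid n (Suc k)) \<omega> \<partial>M) = 0"
proof -
  let ?P = "\<Pi>\<^sub>M i\<in>{..n}. (borel :: 'a measure)" and ?V = "\<lambda>\<omega>. \<lambda>i\<in>{..n}. X (grid n i) \<omega>"
  define s where "s = grid n k"
  define e where "e = grid n (Suc k)"
  have se: "0 < s" "s < e" "e \<le> T"
    using grid(6)[OF n k(1)] grid_less[OF n, of k] grid(4)[OF n, of "Suc k"] k by (auto simp: s_def e_def)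
  obtain D where D[measurable]: "D \<in> sets ?P" and BD: "B = {\<omega>\<in>space M. ?V \<omega> \<in> D}"
    by (rule observation_sets[OF n B])
  have BM[measurable]: "B \<in> sets M" using B observation_subalgebra(1)[OF n] by (auto simp: subalgebra_def)
  define g where "g p q \<omega> = indicator B \<omega> * (G (clipped s \<omega>) \<bullet> (clipped p \<omega> - clipped q \<omega>))" for p q \<omega>
  have sq: "integrable M (\<lambda>\<omega>. (indicator B \<omega> :: real)\<^sup>2)"
  proof -
    have "(indicator B \<omega> :: real)\<^sup>2 = indicator B \<omega>" for \<omega> by (simp add: indicator_def)
    then show ?thesis by (simp add: emeasure_eq_measure)
  qed
  have gi: "integrable M (g p q)" if "p \<in> {s..e}" "q \<in> {s..e}" for p q
    unfolding g_def[abs_def]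
    by (rule L2_Cauchy_Schwarz(1)[OF _ _ sq G_increment_square(1)]) (use that se in auto)
  define \<epsilon> where "\<epsilon> r = (\<integral>\<omega>. indicator B \<omega> * bridge s e r \<omega> \<partial>M)" for r
  have \<epsilon>_eq: "\<epsilon> r = (\<integral>\<omega>. g r s \<omega> \<partial>M) - (1/2) * (\<integral>\<omega>. g e s \<omega> \<partial>M)" if r: "r \<in> {s<..e}" for r
  proof -
    have "\<epsilon> r = (\<integral>\<omega>. g r s \<omega> - (1/2) * g e s \<omega> \<partial>M)"
      unfolding \<epsilon>_def using r by (intro Bochner_Integration.integral_cong refl) (simp add: bridge_def g_def algebra_simps)
    then show ?thesis using gi[of r s] gi[of e s] r se by simp
  qed
  have rev: "(\<integral>\<omega>. g (s + \<rho>) s \<omega> \<partial>M) = (\<integral>\<omega>. g e (e - \<rho>) \<omega> \<partial>M)" if \<rho>: "0 \<le> \<rho>" "\<rho> \<le> e - s" for \<rho>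
  proof -
    let ?H = "\<lambda>(A, d). indicator D A * (G (A k) \<bullet> d) :: real"
    have kn: "k \<in> {..n}" using k by simp
    have "(\<lambda>A. A k) \<in> ?P \<rightarrow>\<^sub>M borel" by (rule measurable_component_singleton[OF kn])
    then have H: "?H \<in> borel_measurable (?P \<Otimes>\<^sub>M borel)" by measurable
    have "(\<integral>\<omega>. ?H (?V \<omega>, X (grid n k + \<rho>) \<omega> - X (grid n k) \<omega>) \<partial>M)
        = (\<integral>\<omega>. ?H (?V \<omega>, X (grid n (Suc k)) \<omega> - X (grid n (Suc k) - \<rho>) \<omega>) \<partial>M)"
      by (rule increment_reversal[OF _ _ _ k(2) \<rho>[unfolded s_def e_def] H])
        (use grid(1,4)[OF n] grid(5)[OF n le_SucI[OF order_refl]] in auto)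
    moreover have "?H (?V \<omega>, X p \<omega> - X q \<omega>) = g p q \<omega>" if "\<omega> \<in> space M" "p \<in> {0..T}" "q \<in> {0..T}" for \<omega> p q
    proof -
      have "indicator D (?V \<omega>) = (indicator B \<omega> :: real)" using that by (simp add: BD indicator_def)
      then show ?thesis using k that grid(4)[OF n, of k] clipped_eq[of s] by (simp add: g_def clipped_eq s_def)
    qed
    moreover have "s + \<rho> \<in> {0..T}" "s \<in> {0..T}" "e \<in> {0..T}" "e - \<rho> \<in> {0..T}" using se \<rho> by auto
    ultimately show ?thesis unfolding s_def[symmetric] e_def[symmetric]
      by (simp cong: Bochner_Integration.integral_cong)
  qed
  \<comment> \<open>The increment over \<open>[s, s + e - r]\<close> may be replaced by the one over \<open>[r, e]\<close>.\<close>
  have odd: "\<epsilon> (s + e - r) = - \<epsilon> r" if r: "r \<in> {s<..<e}" for r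
  proof -
    have "(\<integral>\<omega>. g (s + e - r) s \<omega> \<partial>M) = (\<integral>\<omega>. g e r \<omega> \<partial>M)" using rev[of "e - r"] r by (simp add: algebra_simps)
    also have "\<dots> = (\<integral>\<omega>. g e s \<omega> - g r s \<omega> \<partial>M)"
      by (intro Bochner_Integration.integral_cong refl) (simp add: g_def algebra_simps)
    also have "\<dots> = (\<integral>\<omega>. g e s \<omega> \<partial>M) - (\<integral>\<omega>. g r s \<omega> \<partial>M)"
      using gi[of e s] gi[of r s] r by simp
    finally show ?thesis using \<epsilon>_eq[of r] \<epsilon>_eq[of "s + e - r"] r by simp
  qed
  have zero: "\<epsilon> r = 0" if "r \<notin> {s<..e}" for r using that by (simp add: \<epsilon>_def bridge_supp)
  note ti = time_integral_inner[OF bridge_time[OF se] borel_measurable_indicator[OF BM] sq]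
  have \<epsilon>i: "integrable lborel \<epsilon>" using ti(2) by (simp add: \<epsilon>_def[abs_def])
  have \<epsilon>m[measurable]: "\<epsilon> \<in> borel_measurable borel" using borel_measurable_integrable[OF \<epsilon>i] by simp
  have "(\<integral>r. \<epsilon> r \<partial>lborel) = (\<integral>r. \<epsilon> (s + e - r) \<partial>lborel)"
    using lborel_integral_real_affine[of "-1" \<epsilon> "s + e"] by simp
  also have "\<dots> = (\<integral>r. - \<epsilon> r \<partial>lborel)"
  proof (rule integral_cong_AE)
    show "AE r in lborel. \<epsilon> (s + e - r) = - \<epsilon> r"
      using AE_lborel_singleton[of s] AE_lborel_singleton[of e]
    proof eventually_elim
      case (elim r)
      then show ?case using odd[of r] zero[of r] zero[of "s + e - r"] by (cases "r \<in> {s<..<e}") auto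
    qed
  qed measurable
  finally have "(\<integral>r. \<epsilon> r \<partial>lborel) = 0" by simp
  then show ?thesis using ti(1) by (simp add: bridge_integral_def \<epsilon>_def s_def[symmetric] e_def[symmetric])
qed

end

section \<open>The observation grid and Riemann sums\<close>

lemma nn_integral_inverse_sqrt:
  assumes "0 \<le> (a::real)"
  shows "(\<integral>\<^sup>+r. ennreal (r powr (-1/2)) * indicator {0<..a} r \<partial>lborel) = ennreal (2 * sqrt a)"
proof -
  have "(\<integral>\<^sup>+r. ennreal (r powr (-1/2)) * indicator {0<..a} r \<partial>lborel) = (\<integral>\<^sup>+r. ennreal (r powr (-1/2)) * indicator {0..a} r \<partial>lborel)"
    by (intro nn_integral_cong) (auto simp: indicator_def)
  also have "\<dots> = ennreal (a powr (-1/2 + 1) / (-1/2 + 1))"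
    by (rule nn_integral_has_integral_lebesgue'[OF _ has_integral_powr_from_0]) (use assms in auto)
  also have "a powr (-1/2 + 1) / (-1/2 + 1) = 2 * sqrt a" using assms by (simp add: powr_half_sqrt)
  finally show ?thesis .
qed

text \<open>The discrete counterpart of \<open>\<integral> x\<^sup>-\<^sup>1\<^sup>/\<^sup>2 dx\<close>; it sums the singular factors of the density bound over
  the observation times.\<close>

lemma sum_inverse_sqrt_le: "(\<Sum>k\<in>{1..<n}. 1 / sqrt (real k)) \<le> 2 * sqrt (real n)"
proof -
  have S: "(\<Sum>k\<in>{1..<Suc m}. 1 / sqrt (real k)) \<le> 2 * sqrt (real m)" for m
  proof (induction m)
    case (Suc m)
    let ?a = "sqrt (real m)" and ?b = "sqrt (real (Suc m))"
    have ab: "?b * ?b = ?a * ?a + 1" "0 < ?b" by simp_all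
    have "0 \<le> (?b - ?a) * (?b - ?a)" by (rule zero_le_square)
    then have "1 \<le> 2 * (?b - ?a) * ?b" using ab(1) by (simp add: algebra_simps)
    then have "1 / ?b \<le> 2 * (?b - ?a)" using ab(2) by (simp add: pos_divide_le_eq)
    then have "(\<Sum>k\<in>{1..<Suc m}. 1 / sqrt (real k)) + 1 / ?b \<le> 2 * ?a + 2 * (?b - ?a)"
      by (intro add_mono Suc.IH)
    then show ?case by simp
  qed simp
  show ?thesis
  proof (cases n)
    case (Suc m)
    have "2 * sqrt (real m) \<le> 2 * sqrt (real (Suc m))" by simp
    from order_trans[OF S[of m] this] show ?thesis by (simp only: Suc)
  qed simp
qed

context brownian
begin

lemma grid_cell:
  assumes n: "0 < n" and r: "0 < r" "r \<le> T"
  obtains k where "k < n" "r \<in> {grid n k<..grid n (Suc k)}"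
proof -
  define d where "d = T / real n"
  have d: "0 < d" "real n * d = T" using n T_pos by (auto simp: d_def)
  define k where "k = nat (\<lceil>r / d\<rceil> - 1)"
  have "0 < r / d" using r d by simp
  then have "1 \<le> \<lceil>r / d\<rceil>" by linarith
  then have k: "real k = of_int \<lceil>r / d\<rceil> - 1" by (simp add: k_def)
  have "real k < r / d" "r / d \<le> real k + 1" unfolding k by linarith+
  then have 1: "real k * d < r" "r \<le> (real k + 1) * d" using d by (simp_all add: field_simps)
  have "real k * d < real n * d" using 1(1) r(2) d(2) by linarith
  then have kn: "k < n" using d(1) by simp
  show ?thesis
    by (rule that[OF kn]) (use 1 in \<open>simp add: grid_def d_def add.commute\<close>)
qed

lemma grid_cell_unique:
  assumes n: "0 < n" and r: "r \<in> {grid n k<..grid n (Suc k)}"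
  shows "r \<in> {grid n j<..grid n (Suc j)} \<longleftrightarrow> j = k"
proof -
  have "grid n (Suc j) \<le> grid n k" if "j < k" using grid(5)[OF n, of "Suc j" k] that by simp
  moreover have "grid n (Suc k) \<le> grid n j" if "k < j" using grid(5)[OF n, of "Suc k" j] that by simp
  ultimately show ?thesis using r by (cases j k rule: linorder_cases) force+
qed

lemma grid_cell_sum:
  assumes n: "0 < n" and r: "r \<in> {grid n k<..grid n (Suc k)}" and J: "finite J"
  shows "(\<Sum>j\<in>J. indicator {grid n j<..grid n (Suc j)} r * a j) = (if k \<in> J then a k else (0::real))"
proof -
  have "(\<Sum>j\<in>J. indicator {grid n j<..grid n (Suc j)} r * a j) = (\<Sum>j\<in>J. if j = k then a j else 0)"
    using grid_cell_unique[OF n r] by (intro sum.cong refl) (auto simp: indicator_def)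
  then show ?thesis using J by (simp add: sum.delta')
qed

lemma grid_cells_outside:
  assumes n: "0 < n" and r: "r \<notin> {0<..T}" and J: "J \<subseteq> {..<n}"
  shows "(\<Sum>j\<in>J. indicator {grid n j<..grid n (Suc j)} r * a j) = (0::real)"
proof (intro sum.neutral ballI)
  fix j assume "j \<in> J"
  then have "j < n" using J by auto
  then have "grid n j \<in> {0..T}" "grid n (Suc j) \<in> {0..T}" by (simp_all only: grid(4)[OF n] less_imp_le Suc_leI)
  then show "indicator {grid n j<..grid n (Suc j)} r * a j = 0" using r by (auto simp: indicator_def)
qed

end

context brownian_sobolev
begin

lemma energy_meas[measurable]: "energy \<in> borel_measurable borel"
  unfolding energy_def[abs_def] by measurable

lemma energy_continuous:
  assumes "\<And>n. 0 < s n" "\<And>n. s n \<le> T" "s \<longlonglongrightarrow> t" "0 < t" "t \<le> T"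
  shows "(\<lambda>n. energy (s n)) \<longlonglongrightarrow> energy t"
proof -
  have "(\<integral>\<^sup>+x. ennreal ((norm (G x))\<^sup>2) \<partial>lborel) < \<infinity>" using G_sq by (simp add: sq_mass_def)
  from expectation_continuous[OF _ this assms] have "(\<lambda>n. ennreal (energy (s n))) \<longlonglongrightarrow> ennreal (energy t)"
    using assms by (simp add: energy_nn)
  then show ?thesis by (rule tendsto_ennrealD) (auto simp: energy_nonneg)
qed

lemma energy_integrable_majorant: "integrable lborel (\<lambda>r. indicator {0<..T} r * (C * (r / 2) powr (-1/2) * grad_mass))"
proof -
  have "integrable lborel (\<lambda>r. r powr (-1/2) * indicator {0<..T} r)"
  proof (rule integrableI_bounded)
    have "(\<integral>\<^sup>+r. ennreal (norm (r powr (-1/2) * indicator {0<..T} r)) \<partial>lborel) = (\<integral>\<^sup>+r. ennreal (r powr (-1/2)) * indicator {0<..T} r \<partial>lborel)"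
      by (intro nn_integral_cong) (simp add: indicator_def)
    also have "\<dots> < \<infinity>" using nn_integral_inverse_sqrt[of T] T_pos by (simp only: less_imp_le ennreal_less_top infinity_ennreal_def)
    finally show "(\<integral>\<^sup>+r. ennreal (norm (r powr (-1/2) * indicator {0<..T} r)) \<partial>lborel) < \<infinity>" .
  qed measurable
  then have "integrable lborel (\<lambda>r. (C * (1/2) powr (-1/2) * grad_mass) * (r powr (-1/2) * indicator {0<..T} r))" by simp
  then show ?thesis
    by (rule Bochner_Integration.integrable_cong[THEN iffD1, OF refl, rotated])
      (auto simp: indicator_def powr_mult powr_divide)
qed

text \<open>The energy is continuous on \<open>(0, T]\<close> but may blow up at \<open>0\<close> like \<open>r\<^sup>-\<^sup>1\<^sup>/\<^sup>2\<close>. Left endpoints \<open>t\<^sub>k\<close> with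
  \<open>k \<ge> 1\<close> satisfy \<open>t\<^sub>k \<ge> r/2\<close> on their interval, so the step functions have an integrable
  majorant.\<close>

lemma riemann_sum:
  "(\<lambda>n. \<Sum>k\<in>{1..<n}. T / real n * energy (grid n k)) \<longlonglongrightarrow> (\<integral>r. indicator {0<..T} r * energy r \<partial>lborel)"
proof -
  define \<phi> where "\<phi> n r = (\<Sum>k\<in>{1..<n}. indicator {grid n k<..grid n (Suc k)} r * energy (grid n k))" for n r
  have I: "(\<integral>r. \<phi> n r \<partial>lborel) = (\<Sum>k\<in>{1..<n}. T / real n * energy (grid n k))" if n: "0 < n" for n
  proof -
    have "(\<integral>r. indicator {grid n k<..grid n (Suc k)} r \<partial>lborel) = T / real n" for k
      using grid(3)[OF n, of k] grid_less[OF n, of k] by simp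
    then show ?thesis
      unfolding \<phi>_def using grid_less[OF n, THEN less_imp_le]
      by (subst Bochner_Integration.integral_sum) (auto simp: integrable_real_indicator)
  qed
  \<comment> \<open>The left endpoint of the cell of \<open>r\<close>; on the first cell, where the step function vanishes, \<open>r\<close> itself keeps the sequence inside \<open>(0, T]\<close>.\<close>
  define s where "s r n = (if \<exists>k\<in>{1..<n}. r \<in> {grid n k<..grid n (Suc k)} then grid n (SOME k. k \<in> {1..<n} \<and> r \<in> {grid n k<..grid n (Suc k)}) else r)" for r n
  have cell: "(r \<le> T / real n \<and> \<phi> n r = 0 \<and> s r n = r) \<or> (r / 2 \<le> s r n \<and> s r n \<le> r \<and> r \<le> s r n + T / real n \<and> \<phi> n r = energy (s r n))"
    if n: "0 < n" and r: "r \<in> {0<..T}" for n r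
  proof -
    obtain k where k: "k < n" "r \<in> {grid n k<..grid n (Suc k)}" using grid_cell[OF n, of r] r by auto
    note S = grid_cell_sum[OF n k(2), of "{1..<n}" "\<lambda>k. energy (grid n k)"]
    show ?thesis
    proof (cases "k = 0")
      case True
      then have "r \<le> T / real n" using k(2) grid(3)[OF n, of 0] grid(1)[OF n] by simp
      moreover have "s r n = r" unfolding s_def using grid_cell_unique[OF n k(2)] True by auto
      ultimately show ?thesis using S True by (simp add: \<phi>_def)
    next
      case False
      have "(SOME k. k \<in> {1..<n} \<and> r \<in> {grid n k<..grid n (Suc k)}) = k"
        using False k grid_cell_unique[OF n k(2)] by (intro some_equality) auto
      then have s: "s r n = grid n k" unfolding s_def using False k by auto
      have "grid n (Suc 0) \<le> grid n k" using False by (intro grid(5)[OF n]) simp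
      then have "T / real n \<le> grid n k" using grid(3)[OF n, of 0] grid(1)[OF n] by simp
      then show ?thesis using S False k grid(3)[OF n, of k] by (auto simp: \<phi>_def s)
    qed
  qed
  have zero: "\<phi> n r = 0" if "0 < n" "r \<notin> {0<..T}" for n r
    unfolding \<phi>_def by (rule grid_cells_outside) (use that in auto)
  have lim0: "(\<lambda>n. T / real (Suc n)) \<longlonglongrightarrow> 0"
    using tendsto_mult_right_zero[OF LIMSEQ_Suc[OF lim_1_over_n], of T] by simp
  have "(\<lambda>n. \<integral>r. \<phi> (Suc n) r \<partial>lborel) \<longlonglongrightarrow> (\<integral>r. indicator {0<..T} r * energy r \<partial>lborel)"
  proof (rule integral_dominated_convergence[OF _ _ energy_integrable_majorant])
    show "\<phi> (Suc n) \<in> borel_measurable lborel" for n unfolding \<phi>_def[abs_def] by measurable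
    show "AE r in lborel. norm (\<phi> (Suc n) r) \<le> indicator {0<..T} r * (C * (r / 2) powr (-1/2) * grad_mass)" for n
    proof (rule AE_I2)
      fix r
      have CL: "0 \<le> C * x powr (-1/2) * grad_mass" for x using C_nonneg grad_mass(1) by simp
      show "norm (\<phi> (Suc n) r) \<le> indicator {0<..T} r * (C * (r / 2) powr (-1/2) * grad_mass)"
      proof (cases "r \<in> {0<..T}")
        case True
        show ?thesis
        proof (cases "\<phi> (Suc n) r = 0")
          case False
          then have a: "r / 2 \<le> s r (Suc n)" "s r (Suc n) \<le> r" "\<phi> (Suc n) r = energy (s r (Suc n))"
            using cell[of "Suc n" r] True by auto
          have "energy (s r (Suc n)) \<le> C * s r (Suc n) powr (-1/2) * grad_mass" using a True by (intro energy_le) auto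
          also have "\<dots> \<le> C * (r / 2) powr (-1/2) * grad_mass"
            using a True C_nonneg grad_mass(1) by (intro mult_right_mono mult_left_mono powr_mono2') auto
          finally show ?thesis using True energy_nonneg by (simp add: a)
        qed (use True CL in simp)
      qed (use zero in simp)
    qed
    show "AE r in lborel. (\<lambda>n. \<phi> (Suc n) r) \<longlonglongrightarrow> indicator {0<..T} r * energy r"
    proof (rule AE_I2)
      fix r
      show "(\<lambda>n. \<phi> (Suc n) r) \<longlonglongrightarrow> indicator {0<..T} r * energy r"
      proof (cases "r \<in> {0<..T}")
        case True
        have b: "0 < s r (Suc n)" "s r (Suc n) \<le> r" "r - T / real (Suc n) \<le> s r (Suc n)" for n
          using cell[of "Suc n" r] True T_pos by (auto simp: divide_nonneg_pos)
        have "(\<lambda>n. r - T / real (Suc n)) \<longlonglongrightarrow> r - 0" by (intro tendsto_diff tendsto_const lim0)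
        then have "(\<lambda>n. r - T / real (Suc n)) \<longlonglongrightarrow> r" by simp
        then have "(\<lambda>n. s r (Suc n)) \<longlonglongrightarrow> r"
          by (rule tendsto_sandwich[rotated 2, OF _ tendsto_const]) (use b in auto)
        then have h: "(\<lambda>n. energy (s r (Suc n))) \<longlonglongrightarrow> energy r"
          by (rule energy_continuous[rotated 2]) (use b True order_trans[OF b(2), of T] in auto)
        have "\<forall>\<^sub>F n in sequentially. T / real (Suc n) < r"
          using order_tendstoD(2)[OF lim0, of r] True by simp
        then have "\<forall>\<^sub>F n in sequentially. energy (s r (Suc n)) = \<phi> (Suc n) r"
        proof eventually_elim
          case (elim n)
          then show ?case using cell[of "Suc n" r] True by auto
        qed
        then show ?thesis using Lim_transform_eventually[OF h] True by simp
      qed (use zero in simp)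
    qed
  qed measurable
  then have "(\<lambda>n. \<integral>r. \<phi> n r \<partial>lborel) \<longlonglongrightarrow> (\<integral>r. indicator {0<..T} r * energy r \<partial>lborel)"
    by (rule LIMSEQ_imp_Suc)
  then show ?thesis
    by (rule Lim_transform_eventually) (use I in \<open>auto simp: eventually_sequentially intro!: exI[of _ 1]\<close>)
qed

lemma occupation_gradient:
  "(\<integral>\<omega>. (\<integral>r. indicator {0<..T} r * (norm (G (clipped r \<omega>)))\<^sup>2 \<partial>lborel) \<partial>M) = (\<integral>r. indicator {0<..T} r * energy r \<partial>lborel)"
proof -
  interpret LM: pair_sigma_finite "lborel :: real measure" M by (rule pair_sigma_finite_lborel)
  let ?v = "\<lambda>r \<omega>. indicator {0<..T} r * (norm (G (clipped r \<omega>)))\<^sup>2"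
  have v[measurable]: "(\<lambda>p. ?v (fst p) (snd p)) \<in> borel_measurable (lborel \<Otimes>\<^sub>M M)" by measurable
  have i: "integrable (lborel \<Otimes>\<^sub>M M) (\<lambda>(r, \<omega>). ?v r \<omega>)"
  proof (rule integrableI_bounded)
    show "(\<lambda>(r, \<omega>). ?v r \<omega>) \<in> borel_measurable (lborel \<Otimes>\<^sub>M M)" using v by (simp add: case_prod_beta')
    have "(\<integral>\<^sup>+p. ennreal (norm (case p of (r, \<omega>) \<Rightarrow> ?v r \<omega>)) \<partial>(lborel \<Otimes>\<^sub>M M)) = (\<integral>\<^sup>+r. (\<integral>\<^sup>+\<omega>. ennreal (?v r \<omega>) \<partial>M) \<partial>lborel)"
      by (subst nn_integral_fst[symmetric]) (simp_all add: case_prod_beta' abs_mult)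
    also have "\<dots> \<le> (\<integral>\<^sup>+r. ennreal (C * grad_mass) * (ennreal (r powr (-1/2)) * indicator {0<..T} r) \<partial>lborel)"
    proof (rule nn_integral_mono)
      fix r
      show "(\<integral>\<^sup>+\<omega>. ennreal (?v r \<omega>) \<partial>M) \<le> ennreal (C * grad_mass) * (ennreal (r powr (-1/2)) * indicator {0<..T} r)"
        using G_bound[of r] C_nonneg grad_mass(1) by (cases "r \<in> {0<..T}") (auto simp: ennreal_mult[symmetric] mult_ac)
    qed
    also have "\<dots> = ennreal (C * grad_mass) * ennreal (2 * sqrt T)"
      using T_pos by (subst nn_integral_cmult, measurable) (simp only: nn_integral_inverse_sqrt less_imp_le)
    also have "\<dots> < \<infinity>" by (simp add: ennreal_mult_less_top)
    finally show "(\<integral>\<^sup>+p. ennreal (norm (case p of (r, \<omega>) \<Rightarrow> ?v r \<omega>)) \<partial>(lborel \<Otimes>\<^sub>M M)) < \<infinity>" .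
  qed
  have "(\<integral>\<omega>. (\<integral>r. ?v r \<omega> \<partial>lborel) \<partial>M) = (\<integral>r. (\<integral>\<omega>. ?v r \<omega> \<partial>M) \<partial>lborel)"
    by (rule LM.Fubini_integral[OF i])
  then show ?thesis by (simp add: energy_def)
qed

end

section \<open>Decomposition of the occupation time and the limit\<close>

context brownian_sobolev
begin

lemma time_integral_clip:
  fixes g :: "'a \<Rightarrow> real"
  assumes [measurable]: "g \<in> borel_measurable borel" and \<omega>: "\<omega> \<in> space M"
  shows "(LINT r:{0..T}|lborel. g (X r \<omega>)) = (\<integral>r. indicator {0<..T} r * g (clipped r \<omega>) \<partial>lborel)"
proof -
  have [measurable]: "(\<lambda>r. clipped r \<omega>) \<in> borel_measurable borel"
    using clipped_compose_measurable[OF measurable_ident measurable_const[OF \<omega>]] by simp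
  have "(LINT r:{0..T}|lborel. g (X r \<omega>)) = (\<integral>r. indicator {0..T} r * g (clipped r \<omega>) \<partial>lborel)"
    unfolding set_lebesgue_integral_def
    by (intro Bochner_Integration.integral_cong refl) (auto simp: indicator_def clipped_eq)
  also have "\<dots> = (\<integral>r. indicator {0<..T} r * g (clipped r \<omega>) \<partial>lborel)"
  proof (rule integral_cong_AE)
    show "AE r in lborel. indicator {0..T} r * g (clipped r \<omega>) = indicator {0<..T} r * g (clipped r \<omega>)"
      using AE_lborel_singleton[of 0] by eventually_elim (simp add: indicator_def)
  qed measurable
  finally show ?thesis .
qed

lemma f_time:
  shows "(\<lambda>p. indicator {0<..T} (fst p) * f (clipped (fst p) (snd p))) \<in> borel_measurable (lborel \<Otimes>\<^sub>M M)"
    "\<And>r \<omega>. r \<notin> {0<..T} \<Longrightarrow> indicator {0<..T} r * f (clipped r \<omega>) = 0" "0 \<le> T"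
    "(\<integral>\<^sup>+r. (\<integral>\<^sup>+\<omega>. ennreal ((indicator {0<..T} r * f (clipped r \<omega>))\<^sup>2) \<partial>M) \<partial>lborel) < \<infinity>"
proof -
  have "(\<integral>\<^sup>+r. (\<integral>\<^sup>+\<omega>. ennreal ((indicator {0<..T} r * f (clipped r \<omega>))\<^sup>2) \<partial>M) \<partial>lborel)
      \<le> (\<integral>\<^sup>+r. ennreal (C * fun_mass) * (ennreal (r powr (-1/2)) * indicator {0<..T} r) \<partial>lborel)"
  proof (rule nn_integral_mono)
    fix r
    show "(\<integral>\<^sup>+\<omega>. ennreal ((indicator {0<..T} r * f (clipped r \<omega>))\<^sup>2) \<partial>M) \<le> ennreal (C * fun_mass) * (ennreal (r powr (-1/2)) * indicator {0<..T} r)"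
      using f_bound[of r] C_nonneg fun_mass(1) by (cases "r \<in> {0<..T}") (auto simp: ennreal_mult[symmetric] mult_ac)
  qed
  also have "\<dots> = ennreal (C * fun_mass) * ennreal (2 * sqrt T)"
    using T_pos by (subst nn_integral_cmult, measurable) (simp only: nn_integral_inverse_sqrt less_imp_le)
  also have "\<dots> < \<infinity>" by (simp add: ennreal_mult_less_top)
  finally show "(\<integral>\<^sup>+r. (\<integral>\<^sup>+\<omega>. ennreal ((indicator {0<..T} r * f (clipped r \<omega>))\<^sup>2) \<partial>M) \<partial>lborel) < \<infinity>" .
qed (use T_pos in auto)

text \<open>The error of replacing \<open>f(X\<^sub>r)\<close> by \<open>f(X\<^sub>d)\<close> on the first interval. The right endpoint is used,
  because at time \<open>0\<close> the law of the process may be singular.\<close>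

definition first_step :: "real \<Rightarrow> real \<Rightarrow> 'w \<Rightarrow> real" where
  "first_step d r \<omega> = indicator {0<..d} r * (f (clipped r \<omega>) - f (clipped d \<omega>))"

definition first_step_integral where "first_step_integral d \<omega> = (\<integral>r. first_step d r \<omega> \<partial>lborel)"

lemma first_step_fin:
  assumes d: "0 < d" "d \<le> T"
  shows "(\<integral>\<^sup>+r. (\<integral>\<^sup>+\<omega>. ennreal ((first_step d r \<omega>)\<^sup>2) \<partial>M) \<partial>lborel) \<le> ennreal (C * d * (2 * \<theta> d + 2 * grad_mass) * (2 * sqrt d))"
proof -
  let ?B = "C * d * (2 * \<theta> d + 2 * grad_mass)"
  have B: "0 \<le> ?B" using C_nonneg grad_mass(1) \<theta>_nonneg[of d] d by simp
  have "(\<integral>\<^sup>+r. (\<integral>\<^sup>+\<omega>. ennreal ((first_step d r \<omega>)\<^sup>2) \<partial>M) \<partial>lborel)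
      \<le> (\<integral>\<^sup>+r. ennreal ?B * (ennreal (r powr (-1/2)) * indicator {0<..d} r) \<partial>lborel)"
  proof (rule nn_integral_mono)
    fix r
    consider "r \<in> {0<..<d}" | "r = d" | "r \<notin> {0<..d}" by fastforce
    then show "(\<integral>\<^sup>+\<omega>. ennreal ((first_step d r \<omega>)\<^sup>2) \<partial>M) \<le> ennreal ?B * (ennreal (r powr (-1/2)) * indicator {0<..d} r)"
    proof cases
      case 1
      then have "(\<integral>\<^sup>+\<omega>. ennreal ((first_step d r \<omega>)\<^sup>2) \<partial>M) \<le> ennreal (C * r powr (-1/2) * d * (2 * \<theta> d + 2 * grad_mass))"
        using f_increment[of r d d] d by (simp add: first_step_def)
      also have "C * r powr (-1/2) * d * (2 * \<theta> d + 2 * grad_mass) = ?B * r powr (-1/2)" by simp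
      also have "ennreal (?B * r powr (-1/2)) = ennreal ?B * ennreal (r powr (-1/2))"
        by (rule ennreal_mult[OF B]) simp
      finally show ?thesis using 1 by simp
    qed (simp_all add: first_step_def)
  qed
  also have "\<dots> = ennreal ?B * ennreal (2 * sqrt d)"
    using d by (subst nn_integral_cmult, measurable) (simp only: nn_integral_inverse_sqrt less_imp_le)
  also have "\<dots> = ennreal (?B * (2 * sqrt d))" using d by (intro ennreal_mult[OF B, symmetric]) simp
  finally show ?thesis .
qed

lemma first_step_time:
  assumes d: "0 < d" "d \<le> T"
  shows "(\<lambda>p. first_step d (fst p) (snd p)) \<in> borel_measurable (lborel \<Otimes>\<^sub>M M)"
    "\<And>r \<omega>. r \<notin> {0<..d} \<Longrightarrow> first_step d r \<omega> = 0" "0 \<le> d"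
    "(\<integral>\<^sup>+r. (\<integral>\<^sup>+\<omega>. ennreal ((first_step d r \<omega>)\<^sup>2) \<partial>M) \<partial>lborel) < \<infinity>"
proof -
  show "(\<lambda>p. first_step d (fst p) (snd p)) \<in> borel_measurable (lborel \<Otimes>\<^sub>M M)" unfolding first_step_def by measurable
  show "(\<integral>\<^sup>+r. (\<integral>\<^sup>+\<omega>. ennreal ((first_step d r \<omega>)\<^sup>2) \<partial>M) \<partial>lborel) < \<infinity>"
    by (rule le_less_trans[OF first_step_fin[OF d] ennreal_less_top[folded infinity_ennreal_def]])
qed (use d in \<open>auto simp: first_step_def\<close>)

text \<open>The bound is \<open>d\<close> times a factor of order \<open>d\<^sup>1\<^sup>/\<^sup>4\<close>, hence negligible after division by \<open>d\<close>.\<close>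

lemma first_step_integral_properties:
  assumes d: "0 < d" "d \<le> T"
  shows "first_step_integral d \<in> borel_measurable M" "integrable M (\<lambda>\<omega>. (first_step_integral d \<omega>)\<^sup>2)"
    "L2_norm M (first_step_integral d) \<le> d * sqrt (C * (2 * \<theta> d + 2 * grad_mass) * (2 * sqrt d))"
    "AE \<omega> in M. integrable lborel (\<lambda>r. first_step d r \<omega>)"
proof -
  note t = first_step_time[OF d]
  show "first_step_integral d \<in> borel_measurable M" using time_integral_measurable[OF t] by (simp add: first_step_integral_def[abs_def])
  show i: "integrable M (\<lambda>\<omega>. (first_step_integral d \<omega>)\<^sup>2)" using time_integral_square[OF t] by (simp add: first_step_integral_def)
  show "AE \<omega> in M. integrable lborel (\<lambda>r. first_step d r \<omega>)" by (rule time_integral_AE_integrable[OF t])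
  let ?K = "C * d * (2 * \<theta> d + 2 * grad_mass) * (2 * sqrt d)"
  have K: "0 \<le> ?K" using C_nonneg grad_mass(1) \<theta>_nonneg[of d] d by simp
  have "ennreal (\<integral>\<omega>. (first_step_integral d \<omega>)\<^sup>2 \<partial>M) = (\<integral>\<^sup>+\<omega>. ennreal ((first_step_integral d \<omega>)\<^sup>2) \<partial>M)"
    by (rule nn_integral_eq_integral[OF i, symmetric]) simp
  also have "\<dots> \<le> ennreal d * ennreal ?K"
    unfolding first_step_integral_def using order_trans[OF time_integral_nn_square[OF t] mult_left_mono[OF first_step_fin[OF d]]] by simp
  also have "\<dots> = ennreal (d * ?K)" using d K by (intro ennreal_mult[symmetric]) auto
  finally have "(\<integral>\<omega>. (first_step_integral d \<omega>)\<^sup>2 \<partial>M) \<le> d * ?K"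
    using d K by (subst (asm) ennreal_le_iff) auto
  also have "d * ?K = d\<^sup>2 * (C * (2 * \<theta> d + 2 * grad_mass) * (2 * sqrt d))" by (simp add: power2_eq_square mult_ac)
  finally have "L2_norm M (first_step_integral d) \<le> sqrt (d\<^sup>2 * (C * (2 * \<theta> d + 2 * grad_mass) * (2 * sqrt d)))"
    by (simp only: L2_norm_def real_sqrt_le_mono)
  also have "\<dots> = d * sqrt (C * (2 * \<theta> d + 2 * grad_mass) * (2 * sqrt d))" using d by (simp add: real_sqrt_mult)
  finally show "L2_norm M (first_step_integral d) \<le> d * sqrt (C * (2 * \<theta> d + 2 * grad_mass) * (2 * sqrt d))" .
qed

lemma grid_interval:
  assumes "0 < n" "k \<in> {1..<n}"
  shows "0 < grid n k" "grid n k < grid n (Suc k)" "grid n (Suc k) \<le> T"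
  using grid(6)[OF assms(1), of k] grid_less[OF assms(1), of k] grid(4)[OF assms(1), of "Suc k"] assms(2) by auto

text \<open>On each interval after the first, \<open>f(X\<^sub>r)\<close> is the sum of the centred remainder, the bridge term
  and a function of the two adjacent observations; \<open>Y\<close> collects the time integrals of the
  latter.\<close>

lemma decomposition:
  assumes n: "0 < n"
  obtains Y where "Y \<in> borel_measurable (observation_algebra M T n X)"
    "AE \<omega> in M. occupation_time T X f \<omega> = Y \<omega> + (\<Sum>k\<in>{1..<n}. bridge_integral (grid n k) (grid n (Suc k)) \<omega>)
      + (first_step_integral (T / real n) \<omega> + (\<Sum>k\<in>{1..<n}. centred_rem_integral (grid n k) (grid n (Suc k)) \<omega>))"
proof -
  define d where "d = T / real n"
  let ?F = "observation_algebra M T n X" and ?cell = "\<lambda>k. {grid n k<..grid n (Suc k)}"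
  have d: "0 < d" "d \<le> T" using n T_pos by (auto simp: d_def field_simps)
  have g1: "grid n (Suc 0) = d" using grid(1)[OF n] grid(3)[OF n, of 0] by (simp add: d_def)
  \<comment> \<open>The part of \<open>f(X\<^sub>r)\<close> determined by the observations \<open>a\<close> at the left and \<open>b\<close> at the right end of a cell.\<close>
  define \<kappa> where "\<kappa> s a b r = f a + mean_rem (sqrt (r - s)) a + (1/2) * (G a \<bullet> (b - a))" for s a b r
  define observed where "observed k r \<omega> = indicator (?cell k) r * \<kappa> (grid n k) (clipped (grid n k) \<omega>) (clipped (grid n (Suc k)) \<omega>) r" for k r \<omega>
  have observed_meas: "(\<lambda>\<omega>. \<integral>r. observed k r \<omega> \<partial>lborel) \<in> borel_measurable ?F" if k: "k \<in> {1..<n}" for k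
  proof -
    have key: "(\<lambda>\<omega>. \<integral>r. indicator (?cell k) r * \<kappa> (grid n k) (a \<omega>) (b \<omega>) r \<partial>lborel) \<in> borel_measurable ?F"
      if [measurable]: "a \<in> borel_measurable ?F" "b \<in> borel_measurable ?F" for a b :: "'w \<Rightarrow> 'a"
      unfolding \<kappa>_def by (rule lborel.borel_measurable_lebesgue_integral) measurable
    show ?thesis unfolding observed_def
      by (rule key[OF observation_subalgebra(2)[OF n] observation_subalgebra(2)[OF n]]) (use k in auto)
  qed
  define Y where "Y \<omega> = d * f (clipped d \<omega>) + (\<Sum>k\<in>{1..<n}. \<integral>r. observed k r \<omega> \<partial>lborel)" for \<omega>
  have split: "indicator {0<..T} r * v = indicator {0<..d} r * v + (\<Sum>k\<in>{1..<n}. indicator (?cell k) r * v)" for r v :: real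
  proof -
    have "indicator {0<..T} r * v = (\<Sum>k\<in>{..<n}. indicator (?cell k) r * v)"
    proof (cases "r \<in> {0<..T}")
      case True
      then obtain k where k: "k < n" "r \<in> ?cell k" using grid_cell[OF n, of r] by auto
      show ?thesis using grid_cell_sum[OF n k(2), of "{..<n}" "\<lambda>_. v"] k(1) True by simp
    next
      case False
      show ?thesis using grid_cells_outside[OF n False, of "{..<n}" "\<lambda>_. v"] False by simp
    qed
    also have "{..<n} = insert 0 {1..<n}" using n by auto
    also have "(\<Sum>k\<in>insert 0 {1..<n}. indicator (?cell k) r * v) = indicator (?cell 0) r * v + (\<Sum>k\<in>{1..<n}. indicator (?cell k) r * v)"
      by (subst sum.insert) auto
    finally show ?thesis by (simp only: g1 grid(1)[OF n])
  qed
  have cell_eq: "indicator (?cell k) r * f (clipped r \<omega>) = centred_rem (grid n k) (grid n (Suc k)) r \<omega> + bridge (grid n k) (grid n (Suc k)) r \<omega> + observed k r \<omega>" for k r \<omega>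
    by (simp add: centred_rem_def bridge_def observed_def \<kappa>_def taylor_rem_def indicator_def algebra_simps)
  have "AE \<omega> in M. \<forall>k\<in>{1..<n}. integrable lborel (\<lambda>r. centred_rem (grid n k) (grid n (Suc k)) r \<omega>)"
    by (rule AE_finite_allI) (auto intro!: centred_rem_integral_properties(4) grid_interval[OF n])
  moreover have "AE \<omega> in M. \<forall>k\<in>{1..<n}. integrable lborel (\<lambda>r. bridge (grid n k) (grid n (Suc k)) r \<omega>)"
    by (rule AE_finite_allI) (auto intro!: bridge_integral_properties(4) grid_interval[OF n])
  moreover note first_step_integral_properties(4)[OF d]
  moreover have "AE \<omega> in M. integrable lborel (\<lambda>r. indicator {0<..T} r * f (clipped r \<omega>))"
    by (rule time_integral_AE_integrable[where \<beta>="\<lambda>r \<omega>. indicator {0<..T} r * f (clipped r \<omega>)", OF f_time])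
  moreover note AE_space
  ultimately have dec: "AE \<omega> in M. occupation_time T X f \<omega> = Y \<omega> + (\<Sum>k\<in>{1..<n}. bridge_integral (grid n k) (grid n (Suc k)) \<omega>)
      + (first_step_integral d \<omega> + (\<Sum>k\<in>{1..<n}. centred_rem_integral (grid n k) (grid n (Suc k)) \<omega>))"
  proof eventually_elim
    case (elim \<omega>)
    have gi: "integrable lborel (\<lambda>r. observed k r \<omega>)" if k: "k \<in> {1..<n}" for k
    proof -
      have "integrable lborel (\<lambda>r. indicator {0<..T} r * f (clipped r \<omega>) * indicator (?cell k) r)"
        using elim(4) by (intro integrable_real_mult_indicator) auto
      also have "(\<lambda>r. indicator {0<..T} r * f (clipped r \<omega>) * indicator (?cell k) r) = (\<lambda>r. indicator (?cell k) r * f (clipped r \<omega>))"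
        using grid_interval[OF n k] by (intro ext) (auto simp: indicator_def)
      finally have "integrable lborel (\<lambda>r. indicator (?cell k) r * f (clipped r \<omega>) - centred_rem (grid n k) (grid n (Suc k)) r \<omega> - bridge (grid n k) (grid n (Suc k)) r \<omega>)"
        using elim(1,2) k by (intro Bochner_Integration.integrable_diff) auto
      then show ?thesis unfolding cell_eq by simp
    qed
    have ci: "has_bochner_integral lborel (\<lambda>r. indicator {0<..d} r * f (clipped d \<omega>)) (d * f (clipped d \<omega>))"
    proof -
      have "integrable lborel (indicator {0<..d} :: real \<Rightarrow> real)" by (rule integrable_real_indicator) (use d in auto)
      from has_bochner_integral_mult_left[OF has_bochner_integral_integrable[OF this], of "f (clipped d \<omega>)"]
      show ?thesis using d by simp
    qed
    have pt: "indicator {0<..T} r * f (clipped r \<omega>) = indicator {0<..d} r * f (clipped d \<omega>) + first_step d r \<omega>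
        + (\<Sum>k\<in>{1..<n}. centred_rem (grid n k) (grid n (Suc k)) r \<omega> + bridge (grid n k) (grid n (Suc k)) r \<omega> + observed k r \<omega>)" for r
      unfolding split[of r] cell_eq by (simp add: first_step_def algebra_simps)
    have "occupation_time T X f \<omega> = (\<integral>r. indicator {0<..T} r * f (clipped r \<omega>) \<partial>lborel)"
      unfolding occupation_time_def by (rule time_integral_clip[OF f_meas elim(5)])
    also have "\<dots> = d * f (clipped d \<omega>) + first_step_integral d \<omega>
        + (\<Sum>k\<in>{1..<n}. centred_rem_integral (grid n k) (grid n (Suc k)) \<omega> + bridge_integral (grid n k) (grid n (Suc k)) \<omega> + (\<integral>r. observed k r \<omega> \<partial>lborel))"
      unfolding pt first_step_integral_def centred_rem_integral_def bridge_integral_def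
      by (intro has_bochner_integral_integral_eq has_bochner_integral_add has_bochner_integral_sum has_bochner_integral_integrable ci)
        (use elim(1-3) gi in auto)
    also have "\<dots> = Y \<omega> + (\<Sum>k\<in>{1..<n}. bridge_integral (grid n k) (grid n (Suc k)) \<omega>)
      + (first_step_integral d \<omega> + (\<Sum>k\<in>{1..<n}. centred_rem_integral (grid n k) (grid n (Suc k)) \<omega>))"
      unfolding Y_def sum.distrib by simp
    finally show ?case .
  qed
  have fd: "(\<lambda>\<omega>. f (clipped d \<omega>)) \<in> borel_measurable ?F"
    using measurable_compose[OF observation_subalgebra(2)[OF n, of "Suc 0"] f_meas] n by (simp add: g1)
  have "Y \<in> borel_measurable ?F"
    unfolding Y_def[abs_def] using fd observed_meas by (intro borel_measurable_add borel_measurable_times borel_measurable_sum) auto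
  then show ?thesis using dec unfolding d_def by (rule that)
qed

lemma bridge_integral_sum:
  assumes n: "0 < n"
  defines "S \<equiv> \<lambda>\<omega>. \<Sum>k\<in>{1..<n}. bridge_integral (grid n k) (grid n (Suc k)) \<omega>"
  shows "S \<in> borel_measurable M" "integrable M (\<lambda>\<omega>. (S \<omega>)\<^sup>2)"
    "L2_norm M S = T / real n * sqrt (1 / 12 * (\<Sum>k\<in>{1..<n}. T / real n * energy (grid n k)))"
    "B \<in> sets (observation_algebra M T n X) \<Longrightarrow> (\<integral>\<omega>. indicator B \<omega> * S \<omega> \<partial>M) = 0"
proof -
  note g = grid_interval[OF n]
  let ?Z = "\<lambda>k. bridge_integral (grid n k) (grid n (Suc k))"
  have orth: "(\<integral>\<omega>. ?Z i \<omega> * ?Z j \<omega> \<partial>M) = 0" if ij: "i \<in> {1..<n}" "j \<in> {1..<n}" "i \<noteq> j" for i j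
  proof -
    have o: "(\<integral>\<omega>. ?Z i \<omega> * ?Z j \<omega> \<partial>M) = 0" if ij: "i \<in> {1..<n}" "j \<in> {1..<n}" "i < j" for i j
      by (rule bridge_integral_orthogonal) (use g[OF ij(1)] g[OF ij(2)] grid(5)[OF n, of "Suc i" j] ij in auto)
    show ?thesis using o[of i j] o[of j i] ij by (cases i j rule: linorder_cases) (auto simp: mult.commute)
  qed
  have m: "?Z i \<in> borel_measurable M" "integrable M (\<lambda>\<omega>. (?Z i \<omega>)\<^sup>2)" if "i \<in> {1..<n}" for i
    using bridge_integral_properties(1,2)[OF g[OF that]] by auto
  note os = orthogonal_sum_square[of "{1..<n}" ?Z M, OF m(1) m(2) orth finite_atLeastLessThan]
  show "S \<in> borel_measurable M" unfolding S_def using m(1) by (intro borel_measurable_sum)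
  show "integrable M (\<lambda>\<omega>. (S \<omega>)\<^sup>2)" unfolding S_def by (rule os(1))
  have "(\<integral>\<omega>. (S \<omega>)\<^sup>2 \<partial>M) = (\<Sum>k\<in>{1..<n}. \<integral>\<omega>. (?Z k \<omega>)\<^sup>2 \<partial>M)"
    unfolding S_def by (rule os(2))
  also have "\<dots> = (\<Sum>k\<in>{1..<n}. energy (grid n k) * (T / real n) ^ 3 / 12)"
    using bridge_integral_properties(3)[OF g] grid(3)[OF n] by (intro sum.cong refl) auto
  also have "\<dots> = (T / real n)\<^sup>2 * (1 / 12 * (\<Sum>k\<in>{1..<n}. T / real n * energy (grid n k)))"
    unfolding sum_distrib_left by (intro sum.cong refl) (simp add: power2_eq_square power3_eq_cube mult_ac)
  finally show "L2_norm M S = T / real n * sqrt (1 / 12 * (\<Sum>k\<in>{1..<n}. T / real n * energy (grid n k)))"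
    unfolding L2_norm_def using T_pos by (simp only: real_sqrt_mult real_sqrt_abs) simp
  assume B: "B \<in> sets (observation_algebra M T n X)"
  have BM: "B \<in> sets M" using B observation_subalgebra(1)[OF n] by (auto simp: subalgebra_def)
  have i: "integrable M (\<lambda>\<omega>. indicator B \<omega> * ?Z k \<omega>)" if "k \<in> {1..<n}" for k
    using integrable_mult_indicator[OF BM square_integrable_imp_integrable[OF m[OF that]]] by simp
  have "(\<integral>\<omega>. indicator B \<omega> * S \<omega> \<partial>M) = (\<Sum>k\<in>{1..<n}. \<integral>\<omega>. indicator B \<omega> * ?Z k \<omega> \<partial>M)"
    unfolding S_def sum_distrib_left using i by (rule Bochner_Integration.integral_sum)
  also have "\<dots> = 0" using bridge_integral_cond_zero[OF n _ _ B] by (intro sum.neutral) auto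
  finally show "(\<integral>\<omega>. indicator B \<omega> * S \<omega> \<partial>M) = 0" .
qed

text \<open>By orthogonality the second moments add up: \<open>\<Delta>\<^sup>3 \<theta>(\<Delta>) \<Sum> t\<^sub>k\<^sup>-\<^sup>1\<^sup>/\<^sup>2\<close> is of order \<open>\<Delta>\<^sup>2 \<theta>(\<Delta>)\<close>.\<close>

lemma centred_rem_integral_sum:
  assumes n: "0 < n"
  defines "R \<equiv> \<lambda>\<omega>. \<Sum>k\<in>{1..<n}. centred_rem_integral (grid n k) (grid n (Suc k)) \<omega>"
  shows "R \<in> borel_measurable M" "integrable M (\<lambda>\<omega>. (R \<omega>)\<^sup>2)"
    "L2_norm M R \<le> T / real n * sqrt (2 * C * sqrt T * \<theta> (T / real n))"
proof -
  note g = grid_interval[OF n]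
  let ?Z = "\<lambda>k. centred_rem_integral (grid n k) (grid n (Suc k))"
  define d where "d = T / real n"
  have d: "0 < d" "d * real n = T" using n T_pos by (auto simp: d_def)
  have orth: "(\<integral>\<omega>. ?Z i \<omega> * ?Z j \<omega> \<partial>M) = 0" if ij: "i \<in> {1..<n}" "j \<in> {1..<n}" "i \<noteq> j" for i j
  proof -
    have o: "(\<integral>\<omega>. ?Z i \<omega> * ?Z j \<omega> \<partial>M) = 0" if ij: "i \<in> {1..<n}" "j \<in> {1..<n}" "i < j" for i j
      by (rule centred_rem_integral_orthogonal) (use g[OF ij(1)] g[OF ij(2)] grid(5)[OF n, of "Suc i" j] ij in auto)
    show ?thesis using o[of i j] o[of j i] ij by (cases i j rule: linorder_cases) (auto simp: mult.commute)
  qed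
  have m: "?Z i \<in> borel_measurable M" "integrable M (\<lambda>\<omega>. (?Z i \<omega>)\<^sup>2)" if "i \<in> {1..<n}" for i
    using centred_rem_integral_properties(1,2)[OF g[OF that]] by auto
  note os = orthogonal_sum_square[of "{1..<n}" ?Z M, OF m(1) m(2) orth finite_atLeastLessThan]
  show "R \<in> borel_measurable M" unfolding R_def using m(1) by (intro borel_measurable_sum)
  show "integrable M (\<lambda>\<omega>. (R \<omega>)\<^sup>2)" unfolding R_def by (rule os(1))
  let ?K = "C * d\<^sup>2 * sqrt d * \<theta> d"
  have K: "0 \<le> ?K" using C_nonneg \<theta>_nonneg[of d] d by simp
  have "(\<integral>\<omega>. (R \<omega>)\<^sup>2 \<partial>M) = (\<Sum>k\<in>{1..<n}. \<integral>\<omega>. (?Z k \<omega>)\<^sup>2 \<partial>M)"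
    unfolding R_def by (rule os(2))
  also have "\<dots> \<le> (\<Sum>k\<in>{1..<n}. ?K * (1 / sqrt (real k)))"
  proof (rule sum_mono)
    fix k assume k: "k \<in> {1..<n}"
    have st: "grid n (Suc k) - grid n k = d" using grid(3)[OF n, of k] by (simp add: d_def)
    have "grid n k powr (-1/2) = 1 / sqrt (real k * d)"
      using k d by (simp add: grid_def d_def[symmetric] powr_minus_divide powr_half_sqrt)
    then have p: "grid n k powr (-1/2) = 1 / (sqrt (real k) * sqrt d)" by (simp add: real_sqrt_mult)
    have cube: "d ^ 3 = d\<^sup>2 * (sqrt d * sqrt d)" using d by (simp add: power2_eq_square power3_eq_cube)
    have "C * (1 / (s * q)) * (d\<^sup>2 * (q * q)) * \<theta> d = C * d\<^sup>2 * q * \<theta> d * (1 / s)" if "0 < q" for s q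
      using that by simp
    from this[of "sqrt d" "sqrt (real k)"] have "C * grid n k powr (-1/2) * d ^ 3 * \<theta> d = ?K * (1 / sqrt (real k))"
      unfolding p cube using d by (simp only: real_sqrt_gt_zero)
    then show "(\<integral>\<omega>. (?Z k \<omega>)\<^sup>2 \<partial>M) \<le> ?K * (1 / sqrt (real k))"
      using centred_rem_integral_properties(3)[OF g[OF k]] unfolding st by simp
  qed
  also have "\<dots> \<le> ?K * (2 * sqrt (real n))"
    unfolding sum_distrib_left[symmetric] by (intro mult_left_mono sum_inverse_sqrt_le K)
  also have "\<dots> = d\<^sup>2 * (2 * C * (sqrt d * sqrt (real n)) * \<theta> d)" by simp
  also have "sqrt d * sqrt (real n) = sqrt T" unfolding real_sqrt_mult[symmetric] d(2) ..
  finally have "L2_norm M R \<le> sqrt (d\<^sup>2 * (2 * C * sqrt T * \<theta> d))"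
    by (simp only: L2_norm_def real_sqrt_le_mono)
  also have "\<dots> = d * sqrt (2 * C * sqrt T * \<theta> d)" using d by (simp add: real_sqrt_mult)
  finally show "L2_norm M R \<le> T / real n * sqrt (2 * C * sqrt T * \<theta> (T / real n))" by (simp add: d_def)
qed

lemma occupation_time_integrable: "integrable M (occupation_time T X f)"
proof -
  have "integrable M (\<lambda>\<omega>. \<integral>r. indicator {0<..T} r * f (clipped r \<omega>) \<partial>lborel)"
    by (rule square_integrable_imp_integrable[OF time_integral_measurable[OF f_time] time_integral_square[OF f_time]])
  then show ?thesis
    by (rule Bochner_Integration.integrable_cong[THEN iffD1, OF refl, rotated])
      (simp add: occupation_time_def time_integral_clip[OF f_meas])
qed

lemma error_near:
  assumes n: "0 < n"
  defines "d \<equiv> T / real n"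
  shows "\<bar>inverse d * L2_norm M (\<lambda>\<omega>. occupation_time T X f \<omega> - real_cond_exp M (observation_algebra M T n X) (occupation_time T X f) \<omega>)
      - sqrt (1 / 12 * (\<Sum>k\<in>{1..<n}. d * energy (grid n k)))\<bar>
    \<le> 2 * (sqrt (C * (2 * \<theta> d + 2 * grad_mass) * (2 * sqrt d)) + sqrt (2 * C * sqrt T * \<theta> d))"
proof -
  interpret F: finite_measure_subalgebra M "observation_algebra M T n X"
    by (rule observation_finite_measure_subalgebra[OF n])
  have d: "0 < d" "d \<le> T" using n T_pos by (auto simp: d_def field_simps)
  let ?S = "\<lambda>\<omega>. \<Sum>k\<in>{1..<n}. bridge_integral (grid n k) (grid n (Suc k)) \<omega>"
  let ?Q = "\<lambda>\<omega>. \<Sum>k\<in>{1..<n}. centred_rem_integral (grid n k) (grid n (Suc k)) \<omega>"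
  let ?R = "\<lambda>\<omega>. first_step_integral d \<omega> + ?Q \<omega>"
  let ?E = "L2_norm M (\<lambda>\<omega>. occupation_time T X f \<omega> - real_cond_exp M (observation_algebra M T n X) (occupation_time T X f) \<omega>)"
  obtain Y where Y: "Y \<in> borel_measurable (observation_algebra M T n X)"
    "AE \<omega> in M. occupation_time T X f \<omega> = Y \<omega> + ?S \<omega> + ?R \<omega>"
    by (rule decomposition[OF n, folded d_def])
  note S = bridge_integral_sum[OF n, folded d_def] and Q = centred_rem_integral_sum[OF n, folded d_def] and R1 = first_step_integral_properties[OF d]
  have Rm: "?R \<in> borel_measurable M" using R1(1) Q(1) by measurable
  note R = L2_norm_triangle[OF R1(1) Q(1) R1(2) Q(2)]
  have "\<bar>?E - L2_norm M ?S\<bar> \<le> 2 * L2_norm M ?R"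
    by (rule F.cond_exp_error_near[OF occupation_time_integrable Y(2) Y(1) S(1,2) S(4) Rm R(1)])
  also have "\<dots> \<le> 2 * (d * sqrt (C * (2 * \<theta> d + 2 * grad_mass) * (2 * sqrt d)) + d * sqrt (2 * C * sqrt T * \<theta> d))"
    by (rule mult_left_mono[OF order_trans[OF R(2) add_mono[OF R1(3) Q(3)]]]) simp
  finally have "inverse d * \<bar>?E - L2_norm M ?S\<bar> \<le> inverse d * (2 * (d * sqrt (C * (2 * \<theta> d + 2 * grad_mass) * (2 * sqrt d)) + d * sqrt (2 * C * sqrt T * \<theta> d)))"
    using d by (intro mult_left_mono) auto
  moreover have "inverse d * \<bar>?E - L2_norm M ?S\<bar> = \<bar>inverse d * ?E - sqrt (1 / 12 * (\<Sum>k\<in>{1..<n}. d * energy (grid n k)))\<bar>"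
  proof -
    have "inverse d * \<bar>?E - L2_norm M ?S\<bar> = \<bar>inverse d * (?E - L2_norm M ?S)\<bar>" using d by (simp only: abs_mult) simp
    also have "inverse d * (?E - L2_norm M ?S) = inverse d * ?E - sqrt (1 / 12 * (\<Sum>k\<in>{1..<n}. d * energy (grid n k)))"
      unfolding S(3) right_diff_distrib using d by simp
    finally show ?thesis .
  qed
  moreover have "inverse d * (2 * (d * sqrt (C * (2 * \<theta> d + 2 * grad_mass) * (2 * sqrt d)) + d * sqrt (2 * C * sqrt T * \<theta> d)))
      = 2 * (sqrt (C * (2 * \<theta> d + 2 * grad_mass) * (2 * sqrt d)) + sqrt (2 * C * sqrt T * \<theta> d))"
  proof -
    have "inverse d * (2 * (d * a + d * b)) = 2 * (a + b)" for a b using d by (simp add: field_simps)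
    then show ?thesis .
  qed
  ultimately show ?thesis by simp
qed

text \<open>The leading term converges by the Riemann sum, and the perturbation bound tends to \<open>0\<close> with the
  step.\<close>

lemma error_limit:
  "(\<lambda>n. inverse (T / real n) * L2_norm M (\<lambda>\<omega>. occupation_time T X f \<omega> - real_cond_exp M (observation_algebra M T n X) (occupation_time T X f) \<omega>))
    \<longlonglongrightarrow> sqrt (1 / 12 * (\<integral>r. indicator {0<..T} r * energy r \<partial>lborel))"
proof -
  let ?e = "\<lambda>n. inverse (T / real n) * L2_norm M (\<lambda>\<omega>. occupation_time T X f \<omega> - real_cond_exp M (observation_algebra M T n X) (occupation_time T X f) \<omega>)"
  let ?q = "\<lambda>n. sqrt (1 / 12 * (\<Sum>k\<in>{1..<n}. T / real n * energy (grid n k)))"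
  let ?b = "\<lambda>\<delta>. 2 * (sqrt (C * (2 * \<theta> \<delta> + 2 * grad_mass) * (2 * sqrt \<delta>)) + sqrt (2 * C * sqrt T * \<theta> \<delta>))"
  have q: "?q \<longlonglongrightarrow> sqrt (1 / 12 * (\<integral>r. indicator {0<..T} r * energy r \<partial>lborel))"
    by (intro tendsto_intros riemann_sum)
  have d0: "(\<lambda>n. T / real n) \<longlonglongrightarrow> 0"
    using tendsto_mult_right_zero[OF lim_1_over_n, of T] by simp
  have dr: "filterlim (\<lambda>n. T / real n) (at_right 0) sequentially"
    unfolding filterlim_at using d0 T_pos by (auto simp: eventually_sequentially intro!: exI[of _ 1])
  have \<theta>0: "(\<lambda>n. \<theta> (T / real n)) \<longlonglongrightarrow> 0" by (rule filterlim_compose[OF \<theta>_lim dr])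
  have "(\<lambda>n. ?b (T / real n)) \<longlonglongrightarrow> 2 * (sqrt (C * (2 * 0 + 2 * grad_mass) * (2 * sqrt 0)) + sqrt (2 * C * sqrt T * 0))"
    by (intro tendsto_intros \<theta>0 d0)
  then have b: "(\<lambda>n. ?b (T / real n)) \<longlonglongrightarrow> 0" by simp
  have "(\<lambda>n. ?e n - ?q n) \<longlonglongrightarrow> 0"
    by (rule Lim_null_comparison[OF _ b]) (use error_near in \<open>auto simp: eventually_sequentially intro!: exI[of _ 1]\<close>)
  from tendsto_add[OF this q] show ?thesis by simp
qed

end

theorem theorem11:
  fixes M :: "'w measure" and T :: real
    and X :: "real \<Rightarrow> 'w \<Rightarrow> 'a::euclidean_space" and f :: "'a \<Rightarrow> real"
  assumes "0 < T"
    and "prob_space M"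
    and "brownian_motion M T X"
    and "f \<in> sobolev_H1"
    and "has_bounded_density M (X 0) \<or> DIM('a) = 1"
  shows "(\<lambda>n. inverse (T / real n) *
            L2_norm M (\<lambda>\<omega>. occupation_time T X f \<omega> -
              real_cond_exp M (observation_algebra M T n X) (occupation_time T X f) \<omega>))
         \<longlonglongrightarrow>
         sqrt (LINT \<omega>|M. 1 / 12 * (LINT t:{0..T}|lborel. (norm (weak_gradient f (X t \<omega>)))\<^sup>2))"
proof -
  interpret brownian M T X
    by (intro brownian.intro brownian_axioms.intro assms)
  obtain C where C: "0 \<le> C" "\<And>t h. 0 < t \<Longrightarrow> t \<le> T \<Longrightarrow> h \<in> borel_measurable borel \<Longrightarrow>
      (\<integral>\<^sup>+\<omega>. h (clipped t \<omega>) \<partial>M) \<le> ennreal (C * t powr (-1/2)) * (\<integral>\<^sup>+x. h x \<partial>lborel)"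
    using density_bound[OF assms(5)] by blast
  note G = sobolev_weak_gradient[OF assms(4)]
  obtain \<theta> where \<theta>: "(\<theta> \<longlongrightarrow> (0::real)) (at_right 0)" "\<And>\<sigma> \<delta>. 0 < \<sigma> \<Longrightarrow> \<sigma>\<^sup>2 \<le> \<delta> \<Longrightarrow>
      (\<integral>\<^sup>+y. ennreal (gauss \<sigma> y) * taylor_defect f (weak_gradient f) y \<partial>lborel) \<le> ennreal (\<sigma>\<^sup>2 * \<theta> \<delta>)"
    using G(3) by blast
  \<comment> \<open>The absolute value only serves to make the modulus nonnegative.\<close>
  interpret brownian_sobolev M T X f "weak_gradient f" C "\<lambda>\<delta>. \<bar>\<theta> \<delta>\<bar>"
  proof unfold_locales
    show "square_integrable f" using assms(4) by (simp add: sobolev_H1_def)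
    show "((\<lambda>\<delta>. \<bar>\<theta> \<delta>\<bar>) \<longlongrightarrow> 0) (at_right 0)" using \<theta>(1) by (rule tendsto_rabs_zero)
    show "(\<integral>\<^sup>+y. ennreal (gauss \<sigma> y) * taylor_defect f (weak_gradient f) y \<partial>lborel) \<le> ennreal (\<sigma>\<^sup>2 * \<bar>\<theta> \<delta>\<bar>)"
      if "0 < \<sigma>" "\<sigma>\<^sup>2 \<le> \<delta>" for \<sigma> \<delta>
      by (rule order_trans[OF \<theta>(2)[OF that]]) (intro ennreal_leI mult_left_mono; simp)
  qed (use C G in auto)
  have "(\<lambda>x. (norm (weak_gradient f x))\<^sup>2) \<in> borel_measurable borel" using G(1) by measurable
  note clip = time_integral_clip[OF this]
  have "(LINT \<omega>|M. 1 / 12 * (LINT t:{0..T}|lborel. (norm (weak_gradient f (X t \<omega>)))\<^sup>2))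
      = (\<integral>\<omega>. 1 / 12 * (\<integral>r. indicator {0<..T} r * (norm (weak_gradient f (clipped r \<omega>)))\<^sup>2 \<partial>lborel) \<partial>M)"
    by (intro Bochner_Integration.integral_cong refl) (simp add: clip)
  also have "\<dots> = 1 / 12 * (\<integral>r. indicator {0<..T} r * energy r \<partial>lborel)"
    by (simp add: occupation_gradient)
  finally show ?thesis using error_limit by simp
qed

end
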